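(* Let $\mathcal{X}$ be a finite linear category over an algebraically closed field $\mathbb{k}$. If $F, G: \mathcal{X} \to \mathcal{X}$ are left exact ($\mathbb{k}$-linear) functors, then $$\Gamma^{\mathrm{rl}}(F) \circ \Gamma^{\mathrm{rl}}(G) \cong \Gamma^{\mathrm{rl}}(\Gamma^{\mathrm{rl}}(F) \circ G).$$ If $F, G: \mathcal{X} \to \mathcal{X}$ are right exact ($\mathbb{k}$-linear) functors, then $$\Gamma^{\mathrm{lr}}(F) \circ \Gamma^{\mathrm{lr}}(G) \cong \Gamma^{\mathrm{lr}}(\Gamma^{\mathrm{lr}}(F) \circ G).$$
   Context: A $\mathbb{k}$-linear abelian category is finite (linear) if all morphism spaces are finite-dimensional, every object has finite length, every simple object has a projective cover, and there are finitely many isomorphism classes of simple objects; equivalently, it is linearly equivalent to the category of finite-dimensional modules over a finite-dimensional $\mathbb{k}$-algebra. For a finite-dimensional vector space $v$ and $c \in \mathcal{X}$, the object $v \otimes c \in \mathcal{X}$ is defined by $\mathrm{Hom}_{\mathcal{X}}(c', v \otimes c) \cong v \otimes_{\mathbb{k}} \mathrm{Hom}_{\mathcal{X}}(c', c)$, equivalently $\mathrm{Hom}_{\mathcal{X}}(v \otimes c, c') \cong v^{\star} \otimes_{\mathbb{k}} \mathrm{Hom}_{\mathcal{X}}(c, c')$; $(-)^\star$ denotes the linear dual. For a $\mathbb{k}$-linear endofunctor $H$ of $\mathcal{X}$, define endofunctors by the coend and end $$\Gamma^{\mathrm{rl}}(H) = \int^{x \in \mathcal{X}} \mathrm{Hom}_{\mathcal{X}}(-,x)^{\star}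 \otimes H(x), \qquad \Gamma^{\mathrm{lr}}(H) = \int_{x \in \mathcal{X}} \mathrm{Hom}_{\mathcal{X}}(x,-) \otimes H(x).$$ Restricted to left exact, respectively right exact, functors they give quasi-inverse equivalences between the category of left exact and the category of right exact endofunctors of $\mathcal{X}$. As in the paper, $\Gamma^{\mathrm{rl}}$ and $\Gamma^{\mathrm{lr}}$ are understood on all linear endofunctors by the same formulas, which is needed since $\Gamma^{\mathrm{rl}}(F) \circ G$ (resp. $\Gamma^{\mathrm{lr}}(F) \circ G$) need not be left (resp. right) exact. *)

theory Defs
  imports "Jordan_Normal_Form.VS_Connect" "HOL-Algebra.AbelCoset"
begin

section \<open>Vector spaces\<close>

text \<open>
  The ground field is a type \<open>'k\<close> of class \<open>field\<close>, regarded as the ring \<^term>\<open>class_ring\<close>.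
  A vector space is a record \<open>V\<close> with \<open>vectorspace class_ring V\<close>; the multiplicative
  fields that this record inherits from rings carry no meaning and are left undefined.
\<close>

abbreviation linear_maps :: "('k::field, 'v) module \<Rightarrow> ('k, 'w) module \<Rightarrow> ('v \<Rightarrow> 'w) set" where
  "linear_maps V W \<equiv> LinearCombinations.module_hom class_ring V W"

definition dual_space :: "('k::field, 'v) module \<Rightarrow> ('k, 'v \<Rightarrow> 'k) module" where
  "dual_space V = \<lparr>
     carrier = {\<phi> \<in> extensional (carrier V).
        (\<forall>v\<in>carrier V. \<forall>w\<in>carrier V. \<phi> (v \<oplus>\<^bsub>V\<^esub> w) = \<phi> v + \<phi> w) \<and>
        (\<forall>a. \<forall>v\<in>carrier V. \<phi> (a \<odot>\<^bsub>V\<^esub> v) = a * \<phi> v)},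
     mult = undefined, one = undefined,
     zero = restrict (\<lambda>v. 0) (carrier V),
     add = (\<lambda>\<phi> \<psi>. restrict (\<lambda>v. \<phi> v + \<psi> v) (carrier V)),
     smult = (\<lambda>a \<phi>. restrict (\<lambda>v. a * \<phi> v) (carrier V)) \<rparr>"

definition transpose_map :: "('k::field, 'v) module \<Rightarrow> ('v \<Rightarrow> 'w) \<Rightarrow> ('w \<Rightarrow> 'k) \<Rightarrow> 'v \<Rightarrow> 'k" where
  "transpose_map V t \<phi> = restrict (\<lambda>v. \<phi> (t v)) (carrier V)"

definition free_space :: "'s set \<Rightarrow> ('k::field, 's \<Rightarrow> 'k) module" where
  "free_space S = \<lparr>
     carrier = {c. finite {s. c s \<noteq> 0} \<and> {s. c s \<noteq> 0} \<subseteq> S},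
     mult = undefined, one = undefined,
     zero = (\<lambda>s. 0),
     add = (\<lambda>c d s. c s + d s),
     smult = (\<lambda>a c s. a * c s) \<rparr>"

definition single :: "'s \<Rightarrow> 's \<Rightarrow> 'k::field" where
  "single s = (\<lambda>x. if x = s then 1 else 0)"

text \<open>
  In the quotient by a subspace \<open>U\<close>, the multiple of a coset \<open>A\<close> by \<open>a\<close> is the coset of
  \<open>a \<odot> x\<close> for any \<open>x \<in> A\<close>; the pointwise set of multiples would be wrong for \<open>a = 0\<close>.
\<close>

definition quotient_space :: "('k::field, 'v) module \<Rightarrow> 'v set \<Rightarrow> ('k, 'v set) module" where
  "quotient_space V U = \<lparr>
     carrier = a_rcosets\<^bsub>V\<^esub> U,
     mult = undefined, one = undefined,
     zero = U,
     add = (\<lambda>A B. A <+>\<^bsub>V\<^esub> B),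
     smult = (\<lambda>a A. \<Union>x\<in>A. U +>\<^bsub>V\<^esub> (a \<odot>\<^bsub>V\<^esub> x)) \<rparr>"

definition tensor_relations ::
    "('k::field, 'v) module \<Rightarrow> ('k, 'w) module \<Rightarrow> ('v \<times> 'w \<Rightarrow> 'k) set" where
  "tensor_relations V W =
     {(\<lambda>x. single (v \<oplus>\<^bsub>V\<^esub> v', w) x - single (v, w) x - single (v', w) x) | v v' w.
        v \<in> carrier V \<and> v' \<in> carrier V \<and> w \<in> carrier W} \<union>
     {(\<lambda>x. single (v, w \<oplus>\<^bsub>W\<^esub> w') x - single (v, w) x - single (v, w') x) | v w w'.
        v \<in> carrier V \<and> w \<in> carrier W \<and> w' \<in> carrier W} \<union>
     {(\<lambda>x. single (a \<odot>\<^bsub>V\<^esub> v, w) x - a * single (v, w) x) | a v w.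
        v \<in> carrier V \<and> w \<in> carrier W} \<union>
     {(\<lambda>x. single (v, a \<odot>\<^bsub>W\<^esub> w) x - a * single (v, w) x) | a v w.
        v \<in> carrier V \<and> w \<in> carrier W}"

definition tensor_kernel ::
    "('k::field, 'v) module \<Rightarrow> ('k, 'w) module \<Rightarrow> ('v \<times> 'w \<Rightarrow> 'k) set" where
  "tensor_kernel V W =
     LinearCombinations.module.span class_ring (free_space (carrier V \<times> carrier W)) (tensor_relations V W)"

definition tensor_space ::
    "('k::field, 'v) module \<Rightarrow> ('k, 'w) module \<Rightarrow> ('k, ('v \<times> 'w \<Rightarrow> 'k) set) module" where
  "tensor_space V W = quotient_space (free_space (carrier V \<times> carrier W)) (tensor_kernel V W)"

definition pure_tensor ::
    "('k::field, 'v) module \<Rightarrow> ('k, 'w) module \<Rightarrow> 'v \<Rightarrow> 'w \<Rightarrow> ('v \<times> 'w \<Rightarrow> 'k) set" where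
  "pure_tensor V W v w =
     tensor_kernel V W +>\<^bsub>free_space (carrier V \<times> carrier W)\<^esub> single (v, w)"


section \<open>Linear categories\<close>

text \<open>
  Composition is written in the usual order: \<open>g \<cdot> f\<close> is ``\<open>g\<close> after \<open>f\<close>''.  The zero morphism
  depends on its source and target, as distinct morphism spaces are disjoint.
\<close>

record ('o, 'm, 'k) linear_cat =
  Obj :: "'o set"
  Arr :: "'m set"
  Dom :: "'m \<Rightarrow> 'o"
  Cod :: "'m \<Rightarrow> 'o"
  Idt :: "'o \<Rightarrow> 'm"
  Comp :: "'m \<Rightarrow> 'm \<Rightarrow> 'm" (infixr "\<cdot>\<index>" 75)
  ZeroArr :: "'o \<Rightarrow> 'o \<Rightarrow> 'm"
  AddArr :: "'m \<Rightarrow> 'm \<Rightarrow> 'm"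
  ScaleArr :: "'k \<Rightarrow> 'm \<Rightarrow> 'm"

definition Hom :: "('o, 'm, 'k) linear_cat \<Rightarrow> 'o \<Rightarrow> 'o \<Rightarrow> 'm set" where
  "Hom C a b = {f \<in> Arr C. Dom C f = a \<and> Cod C f = b}"

definition hom_space :: "('o, 'm, 'k) linear_cat \<Rightarrow> 'o \<Rightarrow> 'o \<Rightarrow> ('k, 'm) module" where
  "hom_space C a b = \<lparr>
     carrier = Hom C a b,
     mult = undefined, one = undefined,
     zero = ZeroArr C a b,
     add = AddArr C,
     smult = ScaleArr C \<rparr>"

locale linear_category =
  fixes C :: "('o, 'm, 'k::field) linear_cat" (structure)
  assumes Dom_in_Obj: "f \<in> Arr C \<Longrightarrow> Dom C f \<in> Obj C"
    and Cod_in_Obj: "f \<in> Arr C \<Longrightarrow> Cod C f \<in> Obj C"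
    and Idt_in_Hom: "a \<in> Obj C \<Longrightarrow> Idt C a \<in> Hom C a a"
    and Comp_in_Hom: "\<lbrakk>f \<in> Hom C a b; g \<in> Hom C b c\<rbrakk> \<Longrightarrow> g \<cdot> f \<in> Hom C a c"
    and Comp_Idt: "f \<in> Hom C a b \<Longrightarrow> f \<cdot> Idt C a = f"
    and Idt_Comp: "f \<in> Hom C a b \<Longrightarrow> Idt C b \<cdot> f = f"
    and Comp_assoc:
      "\<lbrakk>f \<in> Hom C a b; g \<in> Hom C b c; h \<in> Hom C c d\<rbrakk> \<Longrightarrow> (h \<cdot> g) \<cdot> f = h \<cdot> (g \<cdot> f)"
    and vectorspace_Hom:
      "\<lbrakk>a \<in> Obj C; b \<in> Obj C\<rbrakk> \<Longrightarrow> vectorspace class_ring (hom_space C a b)"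
    and precomp_linear: "\<lbrakk>f \<in> Hom C a b; c \<in> Obj C\<rbrakk> \<Longrightarrow>
      (\<lambda>g. g \<cdot> f) \<in> linear_maps (hom_space C b c) (hom_space C a c)"
    and postcomp_linear: "\<lbrakk>g \<in> Hom C b c; a \<in> Obj C\<rbrakk> \<Longrightarrow>
      (\<lambda>f. g \<cdot> f) \<in> linear_maps (hom_space C a b) (hom_space C a c)"

definition is_mono :: "('o, 'm, 'k) linear_cat \<Rightarrow> 'm \<Rightarrow> bool" where
  "is_mono C m \<longleftrightarrow> m \<in> Arr C \<and>
     (\<forall>a. \<forall>f\<in>Hom C a (Dom C m). \<forall>g\<in>Hom C a (Dom C m). m \<cdot>\<^bsub>C\<^esub> f = m \<cdot>\<^bsub>C\<^esub> g \<longrightarrow> f = g)"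

definition is_epi :: "('o, 'm, 'k) linear_cat \<Rightarrow> 'm \<Rightarrow> bool" where
  "is_epi C e \<longleftrightarrow> e \<in> Arr C \<and>
     (\<forall>b. \<forall>f\<in>Hom C (Cod C e) b. \<forall>g\<in>Hom C (Cod C e) b. f \<cdot>\<^bsub>C\<^esub> e = g \<cdot>\<^bsub>C\<^esub> e \<longrightarrow> f = g)"

definition is_iso :: "('o, 'm, 'k) linear_cat \<Rightarrow> 'm \<Rightarrow> bool" where
  "is_iso C f \<longleftrightarrow> f \<in> Arr C \<and> (\<exists>g\<in>Hom C (Cod C f) (Dom C f).
     g \<cdot>\<^bsub>C\<^esub> f = Idt C (Dom C f) \<and> f \<cdot>\<^bsub>C\<^esub> g = Idt C (Cod C f))"

definition isomorphic :: "('o, 'm, 'k) linear_cat \<Rightarrow> 'o \<Rightarrow> 'o \<Rightarrow> bool" where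
  "isomorphic C a b \<longleftrightarrow> (\<exists>f\<in>Hom C a b. is_iso C f)"

definition is_zero_obj :: "('o, 'm, 'k) linear_cat \<Rightarrow> 'o \<Rightarrow> bool" where
  "is_zero_obj C z \<longleftrightarrow> z \<in> Obj C \<and>
     (\<forall>a\<in>Obj C. (\<exists>!f. f \<in> Hom C a z) \<and> (\<exists>!f. f \<in> Hom C z a))"

definition is_kernel :: "('o, 'm, 'k) linear_cat \<Rightarrow> 'm \<Rightarrow> 'm \<Rightarrow> bool" where
  "is_kernel C k f \<longleftrightarrow> f \<in> Arr C \<and> k \<in> Arr C \<and> Cod C k = Dom C f \<and>
     f \<cdot>\<^bsub>C\<^esub> k = ZeroArr C (Dom C k) (Cod C f) \<and>
     (\<forall>a. \<forall>h\<in>Hom C a (Dom C f). f \<cdot>\<^bsub>C\<^esub> h = ZeroArr C a (Cod C f) \<longrightarrow>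
        (\<exists>!u. u \<in> Hom C a (Dom C k) \<and> k \<cdot>\<^bsub>C\<^esub> u = h))"

definition is_cokernel :: "('o, 'm, 'k) linear_cat \<Rightarrow> 'm \<Rightarrow> 'm \<Rightarrow> bool" where
  "is_cokernel C q f \<longleftrightarrow> f \<in> Arr C \<and> q \<in> Arr C \<and> Dom C q = Cod C f \<and>
     q \<cdot>\<^bsub>C\<^esub> f = ZeroArr C (Dom C f) (Cod C q) \<and>
     (\<forall>b. \<forall>h\<in>Hom C (Cod C f) b. h \<cdot>\<^bsub>C\<^esub> f = ZeroArr C (Dom C f) b \<longrightarrow>
        (\<exists>!u. u \<in> Hom C (Cod C q) b \<and> u \<cdot>\<^bsub>C\<^esub> q = h))"

definition is_biproduct ::
    "('o, 'm, 'k) linear_cat \<Rightarrow> 'o \<Rightarrow> 'o \<Rightarrow> 'o \<Rightarrow> 'm \<Rightarrow> 'm \<Rightarrow> 'm \<Rightarrow> 'm \<Rightarrow> bool" where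
  "is_biproduct C a b s i j p q \<longleftrightarrow>
     i \<in> Hom C a s \<and> j \<in> Hom C b s \<and> p \<in> Hom C s a \<and> q \<in> Hom C s b \<and>
     p \<cdot>\<^bsub>C\<^esub> i = Idt C a \<and> q \<cdot>\<^bsub>C\<^esub> j = Idt C b \<and>
     p \<cdot>\<^bsub>C\<^esub> j = ZeroArr C b a \<and> q \<cdot>\<^bsub>C\<^esub> i = ZeroArr C a b \<and>
     AddArr C (i \<cdot>\<^bsub>C\<^esub> p) (j \<cdot>\<^bsub>C\<^esub> q) = Idt C s"

locale abelian_linear_category = linear_category +
  assumes ex_zero_obj: "\<exists>z. is_zero_obj C z"
    and ex_biproduct: "\<lbrakk>a \<in> Obj C; b \<in> Obj C\<rbrakk> \<Longrightarrow> \<exists>s i j p q. is_biproduct C a b s i j p q"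
    and ex_kernel: "f \<in> Arr C \<Longrightarrow> \<exists>k. is_kernel C k f"
    and ex_cokernel: "f \<in> Arr C \<Longrightarrow> \<exists>q. is_cokernel C q f"
    and mono_is_kernel: "is_mono C m \<Longrightarrow> \<exists>f. is_kernel C m f"
    and epi_is_cokernel: "is_epi C e \<Longrightarrow> \<exists>f. is_cokernel C e f"

definition is_simple :: "('o, 'm, 'k) linear_cat \<Rightarrow> 'o \<Rightarrow> bool" where
  "is_simple C s \<longleftrightarrow> s \<in> Obj C \<and> \<not> is_zero_obj C s \<and>
     (\<forall>m. is_mono C m \<and> Cod C m = s \<longrightarrow> is_zero_obj C (Dom C m) \<or> is_iso C m)"

text \<open>Existence of a finite filtration from a zero object with simple successive quotients.\<close>

inductive finite_length :: "('o, 'm, 'k) linear_cat \<Rightarrow> 'o \<Rightarrow> bool" for C where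
  zero: "is_zero_obj C z \<Longrightarrow> finite_length C z"
| step: "\<lbrakk>finite_length C (Dom C m); is_mono C m; is_cokernel C q m; is_simple C (Cod C q)\<rbrakk>
           \<Longrightarrow> finite_length C (Cod C m)"

definition is_projective :: "('o, 'm, 'k) linear_cat \<Rightarrow> 'o \<Rightarrow> bool" where
  "is_projective C P \<longleftrightarrow> P \<in> Obj C \<and>
     (\<forall>e. is_epi C e \<longrightarrow> (\<forall>f\<in>Hom C P (Cod C e). \<exists>g\<in>Hom C P (Dom C e). e \<cdot>\<^bsub>C\<^esub> g = f))"

definition is_projective_cover :: "('o, 'm, 'k) linear_cat \<Rightarrow> 'm \<Rightarrow> 'o \<Rightarrow> bool" where
  "is_projective_cover C p s \<longleftrightarrow> is_projective C (Dom C p) \<and> is_epi C p \<and> Cod C p = s \<and>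
     (\<forall>a. \<forall>g\<in>Hom C a (Dom C p). is_epi C (p \<cdot>\<^bsub>C\<^esub> g) \<longrightarrow> is_epi C g)"

locale finite_linear_category = abelian_linear_category +
  assumes fin_dim_Hom:
      "\<lbrakk>a \<in> Obj C; b \<in> Obj C\<rbrakk> \<Longrightarrow> vectorspace.fin_dim class_ring (hom_space C a b)"
    and finite_length_Obj: "a \<in> Obj C \<Longrightarrow> finite_length C a"
    and ex_projective_cover: "is_simple C s \<Longrightarrow> \<exists>p. is_projective_cover C p s"
    and finite_simples: "finite ({s. is_simple C s} //
          {(s, t). is_simple C s \<and> is_simple C t \<and> isomorphic C s t})"


section \<open>Linear endofunctors\<close>

record ('o, 'm) endofunctor =
  OMap :: "'o \<Rightarrow> 'o"
  AMap :: "'m \<Rightarrow> 'm"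

definition functor_comp ::
    "('o, 'm) endofunctor \<Rightarrow> ('o, 'm) endofunctor \<Rightarrow> ('o, 'm) endofunctor" where
  "functor_comp F G = \<lparr> OMap = OMap F \<circ> OMap G, AMap = AMap F \<circ> AMap G \<rparr>"

definition linear_endofunctor ::
    "('o, 'm, 'k::field) linear_cat \<Rightarrow> ('o, 'm) endofunctor \<Rightarrow> bool" where
  "linear_endofunctor C F \<longleftrightarrow>
     (\<forall>a\<in>Obj C. OMap F a \<in> Obj C \<and> AMap F (Idt C a) = Idt C (OMap F a)) \<and>
     (\<forall>a\<in>Obj C. \<forall>b\<in>Obj C. AMap F \<in>
        linear_maps (hom_space C a b) (hom_space C (OMap F a) (OMap F b))) \<and>
     (\<forall>a b c. \<forall>f\<in>Hom C a b. \<forall>g\<in>Hom C b c.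
        AMap F (g \<cdot>\<^bsub>C\<^esub> f) = AMap F g \<cdot>\<^bsub>C\<^esub> AMap F f)"

text \<open>
  Linear functors preserve biproducts, hence for them preserving finite limits (colimits) amounts to
  preserving kernels (cokernels).
\<close>

definition left_exact ::
    "('o, 'm, 'k::field) linear_cat \<Rightarrow> ('o, 'm) endofunctor \<Rightarrow> bool" where
  "left_exact C F \<longleftrightarrow> linear_endofunctor C F \<and>
     (\<forall>k f. is_kernel C k f \<longrightarrow> is_kernel C (AMap F k) (AMap F f))"

definition right_exact ::
    "('o, 'm, 'k::field) linear_cat \<Rightarrow> ('o, 'm) endofunctor \<Rightarrow> bool" where
  "right_exact C F \<longleftrightarrow> linear_endofunctor C F \<and>
     (\<forall>q f. is_cokernel C q f \<longrightarrow> is_cokernel C (AMap F q) (AMap F f))"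

definition isomorphic_functors ::
    "('o, 'm, 'k::field) linear_cat \<Rightarrow> ('o, 'm) endofunctor \<Rightarrow> ('o, 'm) endofunctor \<Rightarrow> bool" where
  "isomorphic_functors C F G \<longleftrightarrow> linear_endofunctor C F \<and> linear_endofunctor C G \<and>
     (\<exists>\<eta>. (\<forall>a\<in>Obj C. \<eta> a \<in> Hom C (OMap F a) (OMap G a) \<and> is_iso C (\<eta> a)) \<and>
          (\<forall>a b. \<forall>f\<in>Hom C a b. \<eta> b \<cdot>\<^bsub>C\<^esub> AMap F f = AMap G f \<cdot>\<^bsub>C\<^esub> \<eta> a))"


section \<open>The object \<open>v \<otimes> c\<close>\<close>

text \<open>
  \<open>\<theta>\<close> is an isomorphism \<open>V \<otimes> Hom(b, c) \<cong> Hom(b, T)\<close>, natural in \<open>b\<close>.  As pure tensors span,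
  naturality is only required on them.
\<close>

definition is_tensor_obj ::
    "('o, 'm, 'k::field) linear_cat \<Rightarrow> ('k, 'v) module \<Rightarrow> 'o \<Rightarrow>
     'o \<Rightarrow> ('o \<Rightarrow> ('v \<times> 'm \<Rightarrow> 'k) set \<Rightarrow> 'm) \<Rightarrow> bool" where
  "is_tensor_obj C V c T \<theta> \<longleftrightarrow> T \<in> Obj C \<and>
     (\<forall>b\<in>Obj C.
        \<theta> b \<in> linear_maps (tensor_space V (hom_space C b c)) (hom_space C b T) \<and>
        bij_betw (\<theta> b) (carrier (tensor_space V (hom_space C b c))) (Hom C b T)) \<and>
     (\<forall>a b. \<forall>f\<in>Hom C a b. \<forall>g\<in>Hom C b c. \<forall>v\<in>carrier V.
        \<theta> a (pure_tensor V (hom_space C a c) v (g \<cdot>\<^bsub>C\<^esub> f)) =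
        \<theta> b (pure_tensor V (hom_space C b c) v g) \<cdot>\<^bsub>C\<^esub> f)"

definition tensor_choice ::
    "('o, 'm, 'k::field) linear_cat \<Rightarrow> ('k, 'v) module \<Rightarrow> 'o \<Rightarrow>
     'o \<times> ('o \<Rightarrow> ('v \<times> 'm \<Rightarrow> 'k) set \<Rightarrow> 'm)" where
  "tensor_choice C V c = (SOME (T, \<theta>). is_tensor_obj C V c T \<theta>)"

definition tensor_obj ::
    "('o, 'm, 'k::field) linear_cat \<Rightarrow> ('k, 'v) module \<Rightarrow> 'o \<Rightarrow> 'o" where
  "tensor_obj C V c = fst (tensor_choice C V c)"

text \<open>The morphism \<open>b \<rightarrow> V \<otimes> c\<close> corresponding to \<open>v \<otimes> f\<close> with \<open>v \<in> V\<close> and \<open>f : b \<rightarrow> c\<close>.\<close>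

definition tensor_elt ::
    "('o, 'm, 'k::field) linear_cat \<Rightarrow> ('k, 'v) module \<Rightarrow> 'o \<Rightarrow> 'v \<Rightarrow> 'm \<Rightarrow> 'm" where
  "tensor_elt C V c v f =
     snd (tensor_choice C V c) (Dom C f) (pure_tensor V (hom_space C (Dom C f) c) v f)"

text \<open>
  The morphism \<open>t \<otimes> g : V \<otimes> c \<rightarrow> V' \<otimes> c'\<close> induced by a linear map \<open>t : V \<rightarrow> V'\<close> and a morphism
  \<open>g : c \<rightarrow> c'\<close>: under the isomorphisms above, composition with it is \<open>t \<otimes> Hom(b, g)\<close>.
\<close>

definition tensor_mor ::
    "('o, 'm, 'k::field) linear_cat \<Rightarrow> ('k, 'v) module \<Rightarrow> ('k, 'w) module \<Rightarrow>
     ('v \<Rightarrow> 'w) \<Rightarrow> 'm \<Rightarrow> 'm" where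
  "tensor_mor C V V' t g = (THE h.
     h \<in> Hom C (tensor_obj C V (Dom C g)) (tensor_obj C V' (Cod C g)) \<and>
     (\<forall>b. \<forall>f\<in>Hom C b (Dom C g). \<forall>v\<in>carrier V.
        h \<cdot>\<^bsub>C\<^esub> tensor_elt C V (Dom C g) v f = tensor_elt C V' (Cod C g) (t v) (g \<cdot>\<^bsub>C\<^esub> f)))"


section \<open>Ends and coends\<close>

text \<open>
  A functor \<open>S : C\<^sup>o\<^sup>p \<times> C \<rightarrow> C\<close>: for \<open>f : a \<rightarrow> b\<close> and \<open>g : c \<rightarrow> d\<close>, the morphism \<open>BMap S f g\<close>
  goes from \<open>BObj S b c\<close> to \<open>BObj S a d\<close>.
\<close>

record ('o, 'm) bifunctor =
  BObj :: "'o \<Rightarrow> 'o \<Rightarrow> 'o"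
  BMap :: "'m \<Rightarrow> 'm \<Rightarrow> 'm"

definition is_cowedge ::
    "('o, 'm, 'k) linear_cat \<Rightarrow> ('o, 'm) bifunctor \<Rightarrow> 'o \<Rightarrow> ('o \<Rightarrow> 'm) \<Rightarrow> bool" where
  "is_cowedge C S z \<iota> \<longleftrightarrow> z \<in> Obj C \<and> (\<forall>x\<in>Obj C. \<iota> x \<in> Hom C (BObj S x x) z) \<and>
     (\<forall>a b. \<forall>f\<in>Hom C a b. \<iota> a \<cdot>\<^bsub>C\<^esub> BMap S f (Idt C a) = \<iota> b \<cdot>\<^bsub>C\<^esub> BMap S (Idt C b) f)"

definition is_coend ::
    "('o, 'm, 'k) linear_cat \<Rightarrow> ('o, 'm) bifunctor \<Rightarrow> 'o \<Rightarrow> ('o \<Rightarrow> 'm) \<Rightarrow> bool" where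
  "is_coend C S z \<iota> \<longleftrightarrow> is_cowedge C S z \<iota> \<and>
     (\<forall>w \<kappa>. is_cowedge C S w \<kappa> \<longrightarrow>
        (\<exists>!h. h \<in> Hom C z w \<and> (\<forall>x\<in>Obj C. h \<cdot>\<^bsub>C\<^esub> \<iota> x = \<kappa> x)))"

definition is_wedge ::
    "('o, 'm, 'k) linear_cat \<Rightarrow> ('o, 'm) bifunctor \<Rightarrow> 'o \<Rightarrow> ('o \<Rightarrow> 'm) \<Rightarrow> bool" where
  "is_wedge C S z \<pi> \<longleftrightarrow> z \<in> Obj C \<and> (\<forall>x\<in>Obj C. \<pi> x \<in> Hom C z (BObj S x x)) \<and>
     (\<forall>a b. \<forall>f\<in>Hom C a b. BMap S (Idt C a) f \<cdot>\<^bsub>C\<^esub> \<pi> a = BMap S f (Idt C b) \<cdot>\<^bsub>C\<^esub> \<pi> b)"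

definition is_end ::
    "('o, 'm, 'k) linear_cat \<Rightarrow> ('o, 'm) bifunctor \<Rightarrow> 'o \<Rightarrow> ('o \<Rightarrow> 'm) \<Rightarrow> bool" where
  "is_end C S z \<pi> \<longleftrightarrow> is_wedge C S z \<pi> \<and>
     (\<forall>w \<kappa>. is_wedge C S w \<kappa> \<longrightarrow>
        (\<exists>!h. h \<in> Hom C w z \<and> (\<forall>x\<in>Obj C. \<pi> x \<cdot>\<^bsub>C\<^esub> h = \<kappa> x)))"

definition coend_choice ::
    "('o, 'm, 'k) linear_cat \<Rightarrow> ('o, 'm) bifunctor \<Rightarrow> 'o \<times> ('o \<Rightarrow> 'm)" where
  "coend_choice C S = (SOME (z, \<iota>). is_coend C S z \<iota>)"

definition end_choice ::
    "('o, 'm, 'k) linear_cat \<Rightarrow> ('o, 'm) bifunctor \<Rightarrow> 'o \<times> ('o \<Rightarrow> 'm)" where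
  "end_choice C S = (SOME (z, \<pi>). is_end C S z \<pi>)"


section \<open>The endofunctors \<open>\<Gamma>\<^sup>r\<^sup>l(H)\<close> and \<open>\<Gamma>\<^sup>l\<^sup>r(H)\<close>\<close>

text \<open>\<open>(x', x) \<mapsto> Hom(y, x')\<^sup>\<star> \<otimes> H(x)\<close>\<close>

definition rl_bifunctor ::
    "('o, 'm, 'k::field) linear_cat \<Rightarrow> ('o, 'm) endofunctor \<Rightarrow> 'o \<Rightarrow> ('o, 'm) bifunctor" where
  "rl_bifunctor C H y = \<lparr>
     BObj = (\<lambda>x' x. tensor_obj C (dual_space (hom_space C y x')) (OMap H x)),
     BMap = (\<lambda>f g. tensor_mor C
        (dual_space (hom_space C y (Cod C f))) (dual_space (hom_space C y (Dom C f)))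
        (transpose_map (hom_space C y (Dom C f)) (\<lambda>h. f \<cdot>\<^bsub>C\<^esub> h)) (AMap H g)) \<rparr>"

text \<open>\<open>(x', x) \<mapsto> Hom(x', y) \<otimes> H(x)\<close>\<close>

definition lr_bifunctor ::
    "('o, 'm, 'k::field) linear_cat \<Rightarrow> ('o, 'm) endofunctor \<Rightarrow> 'o \<Rightarrow> ('o, 'm) bifunctor" where
  "lr_bifunctor C H y = \<lparr>
     BObj = (\<lambda>x' x. tensor_obj C (hom_space C x' y) (OMap H x)),
     BMap = (\<lambda>f g. tensor_mor C (hom_space C (Cod C f) y) (hom_space C (Dom C f) y)
        (\<lambda>h. h \<cdot>\<^bsub>C\<^esub> f) (AMap H g)) \<rparr>"

text \<open>
  On a morphism \<open>u : y \<rightarrow> y'\<close> both functors are induced, through the universal property, by the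
  action of \<open>u\<close> on the factors \<open>Hom(y, x)\<^sup>\<star>\<close> respectively \<open>Hom(x, y)\<close>.
\<close>

definition Gamma_rl ::
    "('o, 'm, 'k::field) linear_cat \<Rightarrow> ('o, 'm) endofunctor \<Rightarrow> ('o, 'm) endofunctor" where
  "Gamma_rl C H = (let
       obj = (\<lambda>y. fst (coend_choice C (rl_bifunctor C H y)));
       incl = (\<lambda>y. snd (coend_choice C (rl_bifunctor C H y)))
     in \<lparr>
       OMap = obj,
       AMap = (\<lambda>u. THE h. h \<in> Hom C (obj (Dom C u)) (obj (Cod C u)) \<and>
         (\<forall>x\<in>Obj C. h \<cdot>\<^bsub>C\<^esub> incl (Dom C u) x = incl (Cod C u) x \<cdot>\<^bsub>C\<^esub>
            tensor_mor C
              (dual_space (hom_space C (Dom C u) x)) (dual_space (hom_space C (Cod C u) x))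
              (transpose_map (hom_space C (Cod C u) x) (\<lambda>h. h \<cdot>\<^bsub>C\<^esub> u))
              (Idt C (OMap H x)))) \<rparr>)"

definition Gamma_lr ::
    "('o, 'm, 'k::field) linear_cat \<Rightarrow> ('o, 'm) endofunctor \<Rightarrow> ('o, 'm) endofunctor" where
  "Gamma_lr C H = (let
       obj = (\<lambda>y. fst (end_choice C (lr_bifunctor C H y)));
       proj = (\<lambda>y. snd (end_choice C (lr_bifunctor C H y)))
     in \<lparr>
       OMap = obj,
       AMap = (\<lambda>u. THE h. h \<in> Hom C (obj (Dom C u)) (obj (Cod C u)) \<and>
         (\<forall>x\<in>Obj C. proj (Cod C u) x \<cdot>\<^bsub>C\<^esub> h =
            tensor_mor C (hom_space C x (Dom C u)) (hom_space C x (Cod C u))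
              (\<lambda>h. u \<cdot>\<^bsub>C\<^esub> h) (Idt C (OMap H x)) \<cdot>\<^bsub>C\<^esub> proj (Dom C u) x)) \<rparr>)"

end

theory Submission
  imports Defs
begin

text \<open>
  A dinatural family \<open>w \<rightarrow> Hom(x, y) \<otimes> H(x)\<close> is the same as a natural family of linear maps
  \<open>Hom(x, y)\<^sup>\<star> \<rightarrow> Hom(w, H(x))\<close>, and read in the opposite category the latter notion describes the dinatural
  families \<open>Hom(y, x)\<^sup>\<star> \<otimes> H(x) \<rightarrow> w\<close>.  Hence \<open>\<Gamma>\<^sup>l\<^sup>r\<close> on a category and \<open>\<Gamma>\<^sup>r\<^sup>l\<close> on its opposite are instances of
  one construction \<open>\<Gamma>\<close>, characterized by a universal property.  Since morphism spaces are
  finite-dimensional, hence reflexive, \<open>\<Gamma>(F) \<circ> \<Gamma>(G)\<close> has the universal property of \<open>\<Gamma>(\<Gamma>(F) \<circ> G)\<close>.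

  The universal families exist because they represent presheaves: if \<open>Q\<close> is a projective generator, a
  presheaf that is separated and finitely generated with respect to \<open>Q\<close> and compatible with cokernels
  is representable.  The projective covers of the simple objects add up to such a \<open>Q\<close>; for the opposite
  category one takes the injective object that represents \<open>b \<mapsto> Hom(Q, b)\<^sup>\<star>\<close>.
\<close>


section \<open>Finite-dimensional vector spaces\<close>

text \<open>In symbols the theorem is a chain of bijections. A morphism from \<open>w\<close> to
  \<open>\<Gamma>(F)(\<Gamma>(G) y)\<close> is a family, natural in \<open>u\<close>, of linear maps
  from the dual of \<open>Hom(u, \<Gamma>(G) y)\<close> to \<open>Hom(w, F u)\<close>. Transposed,
  it maps the dual of \<open>Hom(w, F u)\<close> to \<open>Hom(u, \<Gamma>(G) y)\<close>, which the
  universal property of \<open>\<Gamma>(G) y\<close> splits into data in \<open>x\<close>.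
  Transposing back for each \<open>x\<close> leaves a datum with values in
  \<open>Hom(w, \<Gamma>(F)(G x))\<close>. Both transpositions rest on reflexivity. Most of the work
  is existence. The functors are made with \<open>SOME\<close> and \<open>THE\<close>, so nothing is
  known of them before the objects \<open>V \<otimes> c\<close>, the ends and the coends are shown
  to exist; and an end over all objects is not a finite limit, so finiteness has to enter through a
  generator. The axioms provide projective covers but no injective hulls. The argument is therefore
  run in the setting \<open>category_with_generator\<close>, which an abelian category shares with
  its opposite at the price of another generator.\<close>

lemma vectorspace_classI:
  fixes V :: "('k::field, 'v) module"
  assumes "\<zero>\<^bsub>V\<^esub> \<in> carrier V"
    and "\<And>v w. \<lbrakk>v \<in> carrier V; w \<in> carrier V\<rbrakk> \<Longrightarrow> v \<oplus>\<^bsub>V\<^esub> w \<in> carrier V"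
    and "\<And>a v. v \<in> carrier V \<Longrightarrow> a \<odot>\<^bsub>V\<^esub> v \<in> carrier V"
    and "\<And>u v w. \<lbrakk>u \<in> carrier V; v \<in> carrier V; w \<in> carrier V\<rbrakk> \<Longrightarrow> (u \<oplus>\<^bsub>V\<^esub> v) \<oplus>\<^bsub>V\<^esub> w = u \<oplus>\<^bsub>V\<^esub> (v \<oplus>\<^bsub>V\<^esub> w)"
    and "\<And>v w. \<lbrakk>v \<in> carrier V; w \<in> carrier V\<rbrakk> \<Longrightarrow> v \<oplus>\<^bsub>V\<^esub> w = w \<oplus>\<^bsub>V\<^esub> v"
    and "\<And>v. v \<in> carrier V \<Longrightarrow> v \<oplus>\<^bsub>V\<^esub> \<zero>\<^bsub>V\<^esub> = v"
    and "\<And>v. v \<in> carrier V \<Longrightarrow> v \<oplus>\<^bsub>V\<^esub> (-1) \<odot>\<^bsub>V\<^esub> v = \<zero>\<^bsub>V\<^esub>"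
    and "\<And>a v w. \<lbrakk>v \<in> carrier V; w \<in> carrier V\<rbrakk> \<Longrightarrow> a \<odot>\<^bsub>V\<^esub> (v \<oplus>\<^bsub>V\<^esub> w) = a \<odot>\<^bsub>V\<^esub> v \<oplus>\<^bsub>V\<^esub> a \<odot>\<^bsub>V\<^esub> w"
    and "\<And>a b v. v \<in> carrier V \<Longrightarrow> (a + b) \<odot>\<^bsub>V\<^esub> v = a \<odot>\<^bsub>V\<^esub> v \<oplus>\<^bsub>V\<^esub> b \<odot>\<^bsub>V\<^esub> v"
    and "\<And>a b v. v \<in> carrier V \<Longrightarrow> (a * b) \<odot>\<^bsub>V\<^esub> v = a \<odot>\<^bsub>V\<^esub> (b \<odot>\<^bsub>V\<^esub> v)"
    and "\<And>v. v \<in> carrier V \<Longrightarrow> 1 \<odot>\<^bsub>V\<^esub> v = v"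
  shows "vectorspace class_ring V"
proof -
  have "\<exists>w\<in>carrier V. v \<oplus>\<^bsub>V\<^esub> w = \<zero>\<^bsub>V\<^esub>" if "v \<in> carrier V" for v
    using assms(3,7)[OF that] by blast
  then show ?thesis
    by (intro vs_criteria class_field) (use assms in auto)
qed

section \<open>Vector space laws over the ground field\<close>

context
  fixes V :: "('k::field, 'v) module"
  assumes V: "vectorspace class_ring V"
begin

interpretation vectorspace class_ring V by (rule V)

text \<open>This group of laws uses the operations of the type \<open>'k\<close> in place of those
  of the record \<open>class_ring\<close>, so that arithmetic on scalars simplifies.\<close>

lemma vs_zero_closed: "\<zero>\<^bsub>V\<^esub> \<in> carrier V"
  by simp

lemma vs_add_closed: "v \<in> carrier V \<Longrightarrow> w \<in> carrier V \<Longrightarrow> v \<oplus>\<^bsub>V\<^esub> w \<in> carrier V"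
  by simp

lemma vs_smult_closed: "v \<in> carrier V \<Longrightarrow> a \<odot>\<^bsub>V\<^esub> v \<in> carrier V"
  using smult_closed[of a v] by simp

lemma vs_assoc: "u \<in> carrier V \<Longrightarrow> v \<in> carrier V \<Longrightarrow> w \<in> carrier V \<Longrightarrow>
    (u \<oplus>\<^bsub>V\<^esub> v) \<oplus>\<^bsub>V\<^esub> w = u \<oplus>\<^bsub>V\<^esub> (v \<oplus>\<^bsub>V\<^esub> w)"
  by (simp add: M.a_assoc)

lemma vs_comm: "v \<in> carrier V \<Longrightarrow> w \<in> carrier V \<Longrightarrow> v \<oplus>\<^bsub>V\<^esub> w = w \<oplus>\<^bsub>V\<^esub> v"
  by (simp add: M.a_comm)

lemma vs_add_zero: "v \<in> carrier V \<Longrightarrow> v \<oplus>\<^bsub>V\<^esub> \<zero>\<^bsub>V\<^esub> = v"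
  by simp

lemma vs_zero_add: "v \<in> carrier V \<Longrightarrow> \<zero>\<^bsub>V\<^esub> \<oplus>\<^bsub>V\<^esub> v = v"
  by simp

lemma vs_smult_add: "v \<in> carrier V \<Longrightarrow> w \<in> carrier V \<Longrightarrow> a \<odot>\<^bsub>V\<^esub> (v \<oplus>\<^bsub>V\<^esub> w) = a \<odot>\<^bsub>V\<^esub> v \<oplus>\<^bsub>V\<^esub> a \<odot>\<^bsub>V\<^esub> w"
  using smult_r_distr[of a v w] by simp

lemma vs_add_smult: "v \<in> carrier V \<Longrightarrow> (a + b) \<odot>\<^bsub>V\<^esub> v = a \<odot>\<^bsub>V\<^esub> v \<oplus>\<^bsub>V\<^esub> b \<odot>\<^bsub>V\<^esub> v"
  using smult_l_distr[of a b v] by simp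

lemma vs_smult_assoc: "v \<in> carrier V \<Longrightarrow> (a * b) \<odot>\<^bsub>V\<^esub> v = a \<odot>\<^bsub>V\<^esub> (b \<odot>\<^bsub>V\<^esub> v)"
  using smult_assoc1[of a b v] by simp

lemma vs_one_smult: "v \<in> carrier V \<Longrightarrow> 1 \<odot>\<^bsub>V\<^esub> v = v"
  using smult_one[of v] by simp

lemma vs_zero_smult: "v \<in> carrier V \<Longrightarrow> 0 \<odot>\<^bsub>V\<^esub> v = \<zero>\<^bsub>V\<^esub>"
  using smult_l_null[of v] by simp

lemma vs_smult_zero: "a \<odot>\<^bsub>V\<^esub> \<zero>\<^bsub>V\<^esub> = \<zero>\<^bsub>V\<^esub>"
  using smult_r_null[of a] by simp

lemma vs_neg: "v \<in> carrier V \<Longrightarrow> v \<oplus>\<^bsub>V\<^esub> (-1) \<odot>\<^bsub>V\<^esub> v = \<zero>\<^bsub>V\<^esub>"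
  using vs_add_smult[of v 1 "-1"] by (simp add: vs_one_smult vs_zero_smult)

text \<open>Spaces of morphisms come with addition and scaling but no subtraction, so differences
  are written with the factor \<open>-1\<close>. Most injectivity arguments below end with this
  rule.\<close>

lemma vs_eqI:
  assumes "v \<in> carrier V" "w \<in> carrier V" "v \<oplus>\<^bsub>V\<^esub> (-1) \<odot>\<^bsub>V\<^esub> w = \<zero>\<^bsub>V\<^esub>"
  shows "v = w"
proof -
  have "v = v \<oplus>\<^bsub>V\<^esub> ((-1) \<odot>\<^bsub>V\<^esub> w \<oplus>\<^bsub>V\<^esub> w)"
    using assms by (simp add: vs_comm[of "(-1) \<odot>\<^bsub>V\<^esub> w" w] vs_smult_closed vs_neg)
  also have "\<dots> = w"
    using assms by (simp add: vs_assoc[symmetric] vs_smult_closed)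
  finally show ?thesis .
qed

lemma vs_lcomm: "u \<in> carrier V \<Longrightarrow> v \<in> carrier V \<Longrightarrow> w \<in> carrier V \<Longrightarrow>
    u \<oplus>\<^bsub>V\<^esub> (v \<oplus>\<^bsub>V\<^esub> w) = v \<oplus>\<^bsub>V\<^esub> (u \<oplus>\<^bsub>V\<^esub> w)"
  by (simp add: M.a_lcomm)

end

lemmas vs_simps = vs_zero_closed vs_add_closed vs_smult_closed vs_add_zero vs_zero_add vs_smult_add
  vs_one_smult vs_zero_smult vs_smult_zero vs_neg

text \<open>Sums over initial segments of the naturals: the recursion turns every law into a short
  induction, and the empty sum is the zero of the space, which in a space of morphisms depends on
  source and target.\<close>

primrec vsum :: "('k::field, 'v) module \<Rightarrow> (nat \<Rightarrow> 'v) \<Rightarrow> nat \<Rightarrow> 'v" where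
  "vsum V f 0 = \<zero>\<^bsub>V\<^esub>"
| "vsum V f (Suc n) = vsum V f n \<oplus>\<^bsub>V\<^esub> f n"

lemma vsum_closed:
  assumes "vectorspace class_ring V" "\<And>i. i < n \<Longrightarrow> f i \<in> carrier V"
  shows "vsum V f n \<in> carrier V"
  using assms(2) by (induction n) (auto simp: vs_simps[OF assms(1)])

lemma vsum_cong: "(\<And>i. i < n \<Longrightarrow> f i = g i) \<Longrightarrow> vsum V f n = vsum V g n"
  by (induction n) auto

lemma vsum_add:
  assumes V: "vectorspace class_ring V" and "\<And>i. i < n \<Longrightarrow> f i \<in> carrier V" "\<And>i. i < n \<Longrightarrow> g i \<in> carrier V"
  shows "vsum V (\<lambda>i. f i \<oplus>\<^bsub>V\<^esub> g i) n = vsum V f n \<oplus>\<^bsub>V\<^esub> vsum V g n"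
  using assms(2,3)
proof (induction n)
  case (Suc n)
  then show ?case
    by (simp add: vs_simps[OF V] vs_assoc[OF V] vs_lcomm[OF V, of "f n"] vsum_closed[OF V])
qed (simp add: vs_simps[OF V])

lemma vsum_smult:
  assumes V: "vectorspace class_ring V" and "\<And>i. i < n \<Longrightarrow> f i \<in> carrier V"
  shows "vsum V (\<lambda>i. a \<odot>\<^bsub>V\<^esub> f i) n = a \<odot>\<^bsub>V\<^esub> vsum V f n"
  using assms(2) by (induction n) (auto simp: vs_simps[OF V] vsum_closed[OF V])

lemma vsum_delta:
  assumes V: "vectorspace class_ring V" and "v \<in> carrier V"
  shows "vsum V (\<lambda>i. if i = j then v else \<zero>\<^bsub>V\<^esub>) n = (if j < n then v else \<zero>\<^bsub>V\<^esub>)"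
  using assms(2) by (induction n) (auto simp: vs_simps[OF V])

subsection \<open>Linear maps and functionals\<close>

lemma linear_mapsI:
  assumes "\<And>v. v \<in> carrier V \<Longrightarrow> f v \<in> carrier W"
    and "\<And>v w. \<lbrakk>v \<in> carrier V; w \<in> carrier V\<rbrakk> \<Longrightarrow> f (v \<oplus>\<^bsub>V\<^esub> w) = f v \<oplus>\<^bsub>W\<^esub> f w"
    and "\<And>a v. v \<in> carrier V \<Longrightarrow> f (a \<odot>\<^bsub>V\<^esub> v) = a \<odot>\<^bsub>W\<^esub> f v"
  shows "f \<in> linear_maps V W"
  using assms by (auto simp: LinearCombinations.module_hom_def)

lemma linear_maps_closed: "f \<in> linear_maps V W \<Longrightarrow> v \<in> carrier V \<Longrightarrow> f v \<in> carrier W"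
  by (auto simp: LinearCombinations.module_hom_def)

lemma linear_maps_add: "f \<in> linear_maps V W \<Longrightarrow> v \<in> carrier V \<Longrightarrow> w \<in> carrier V \<Longrightarrow>
    f (v \<oplus>\<^bsub>V\<^esub> w) = f v \<oplus>\<^bsub>W\<^esub> f w"
  by (auto simp: LinearCombinations.module_hom_def)

lemma linear_maps_smult: "f \<in> linear_maps V W \<Longrightarrow> v \<in> carrier V \<Longrightarrow> f (a \<odot>\<^bsub>V\<^esub> v) = a \<odot>\<^bsub>W\<^esub> f v"
  by (auto simp: LinearCombinations.module_hom_def)

lemma linear_maps_zero:
  assumes "vectorspace class_ring V" "vectorspace class_ring W" "f \<in> linear_maps V W"
  shows "f \<zero>\<^bsub>V\<^esub> = \<zero>\<^bsub>W\<^esub>"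
  using linear_maps_smult[OF assms(3) vs_zero_closed[OF assms(1)], of 0] assms
  by (simp add: vs_simps linear_maps_closed)

lemma linear_maps_vsum:
  assumes "vectorspace class_ring V" "vectorspace class_ring W" "f \<in> linear_maps V W"
    and "\<And>i. i < n \<Longrightarrow> u i \<in> carrier V"
  shows "f (vsum V u n) = vsum W (\<lambda>i. f (u i)) n"
  using assms(4)
  by (induction n) (auto simp: linear_maps_zero[OF assms(1-3)] linear_maps_add[OF assms(3)] vsum_closed[OF assms(1)])

lemma linear_maps_comp:
  assumes "f \<in> linear_maps U V" "g \<in> linear_maps V W"
  shows "(\<lambda>u. g (f u)) \<in> linear_maps U W"
  by (rule linear_mapsI)
    (use assms in \<open>auto simp: linear_maps_closed linear_maps_add linear_maps_smult\<close>)

lemma dual_add: "\<xi> \<in> carrier (dual_space V) \<Longrightarrow> v \<in> carrier V \<Longrightarrow> w \<in> carrier V \<Longrightarrow> \<xi> (v \<oplus>\<^bsub>V\<^esub> w) = \<xi> v + \<xi> w"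
  by (simp add: dual_space_def)

lemma dual_smult: "\<xi> \<in> carrier (dual_space V) \<Longrightarrow> v \<in> carrier V \<Longrightarrow> \<xi> (a \<odot>\<^bsub>V\<^esub> v) = a * \<xi> v"
  by (simp add: dual_space_def)

lemma dual_zero:
  assumes "vectorspace class_ring V" "\<xi> \<in> carrier (dual_space V)"
  shows "\<xi> \<zero>\<^bsub>V\<^esub> = 0"
  using dual_smult[OF assms(2) vs_zero_closed[OF assms(1)], of 0] assms by (simp add: vs_simps)

lemma dual_vsum:
  assumes "vectorspace class_ring V" "\<xi> \<in> carrier (dual_space V)" "\<And>i. i < n \<Longrightarrow> u i \<in> carrier V"
  shows "\<xi> (vsum V u n) = (\<Sum>i<n. \<xi> (u i))"
  using assms(3) by (induction n) (auto simp: dual_zero[OF assms(1,2)] dual_add[OF assms(2)] vsum_closed[OF assms(1)])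

lemma dual_restrictI:
  assumes V: "vectorspace class_ring V" and "\<And>v w. \<lbrakk>v \<in> carrier V; w \<in> carrier V\<rbrakk> \<Longrightarrow> \<phi> (v \<oplus>\<^bsub>V\<^esub> w) = \<phi> v + \<phi> w"
    and "\<And>a v. v \<in> carrier V \<Longrightarrow> \<phi> (a \<odot>\<^bsub>V\<^esub> v) = a * \<phi> v"
  shows "restrict \<phi> (carrier V) \<in> carrier (dual_space V)"
  using assms by (auto simp: dual_space_def vs_simps[OF V])

lemma dual_eqI:
  assumes "\<xi> \<in> carrier (dual_space V)" "\<eta> \<in> carrier (dual_space V)" "\<And>v. v \<in> carrier V \<Longrightarrow> \<xi> v = \<eta> v"
  shows "\<xi> = \<eta>"
  using assms by (intro extensionalityI[of _ "carrier V"]) (auto simp: dual_space_def)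

lemma dual_add_apply: "v \<in> carrier V \<Longrightarrow> (\<xi> \<oplus>\<^bsub>dual_space V\<^esub> \<eta>) v = \<xi> v + \<eta> v"
  by (simp add: dual_space_def)

lemma dual_smult_apply: "v \<in> carrier V \<Longrightarrow> (a \<odot>\<^bsub>dual_space V\<^esub> \<xi>) v = a * \<xi> v"
  by (simp add: dual_space_def)

lemma dual_zero_apply: "v \<in> carrier V \<Longrightarrow> \<zero>\<^bsub>dual_space V\<^esub> v = 0"
  by (simp add: dual_space_def)

lemma dual_vsum_apply: "v \<in> carrier V \<Longrightarrow> vsum (dual_space V) \<xi> n v = (\<Sum>i<n. \<xi> i v)"
  by (induction n) (auto simp: dual_add_apply dual_zero_apply)

lemma vectorspace_dual:
  assumes "vectorspace class_ring V"
  shows "vectorspace class_ring (dual_space V)"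
  by (rule vectorspace_classI)
    (auto simp: dual_space_def fun_eq_iff algebra_simps extensional_def vs_simps[OF assms])

lemma transpose_map_dual:
  assumes "vectorspace class_ring V" "t \<in> linear_maps V W" "\<phi> \<in> carrier (dual_space W)"
  shows "transpose_map V t \<phi> \<in> carrier (dual_space V)"
  unfolding transpose_map_def
  by (rule dual_restrictI) (use assms in \<open>auto simp: linear_maps_closed linear_maps_add linear_maps_smult dual_add dual_smult\<close>)

lemma transpose_map_apply: "v \<in> carrier V \<Longrightarrow> transpose_map V t \<phi> v = \<phi> (t v)"
  by (simp add: transpose_map_def)

lemma transpose_map_linear:
  assumes "vectorspace class_ring V" "t \<in> linear_maps V W"
  shows "transpose_map V t \<in> linear_maps (dual_space W) (dual_space V)"
proof (rule linear_mapsI)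
  show "transpose_map V t \<xi> \<in> carrier (dual_space V)" if "\<xi> \<in> carrier (dual_space W)" for \<xi>
    using transpose_map_dual[OF assms that] .
qed (use assms in \<open>auto simp: fun_eq_iff transpose_map_def linear_maps_closed dual_space_def\<close>)

subsection \<open>Dual bases\<close>

text \<open>Finite dimension as explicit data, a numbered basis with its coordinate functionals.
  Later constructions are written down directly in these terms.\<close>

definition dual_basis :: "('k::field, 'v) module \<Rightarrow> nat \<Rightarrow> (nat \<Rightarrow> 'v) \<Rightarrow> (nat \<Rightarrow> 'v \<Rightarrow> 'k) \<Rightarrow> bool" where
  "dual_basis V n e \<epsilon> \<longleftrightarrow> (\<forall>i<n. e i \<in> carrier V \<and> \<epsilon> i \<in> carrier (dual_space V)) \<and>
     (\<forall>i<n. \<forall>j<n. \<epsilon> i (e j) = (if i = j then 1 else 0)) \<and>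
     (\<forall>v\<in>carrier V. vsum V (\<lambda>i. \<epsilon> i v \<odot>\<^bsub>V\<^esub> e i) n = v)"

definition fdvs :: "('k::field, 'v) module \<Rightarrow> bool" where
  "fdvs V \<longleftrightarrow> vectorspace class_ring V \<and> (\<exists>n e \<epsilon>. dual_basis V n e \<epsilon>)"

lemma fdvs_vectorspace: "fdvs V \<Longrightarrow> vectorspace class_ring V"
  by (simp add: fdvs_def)

lemma fdvsE:
  assumes "fdvs V"
  obtains n e \<epsilon> where "dual_basis V n e \<epsilon>"
  using assms by (auto simp: fdvs_def)

lemma dual_basisD:
  assumes "dual_basis V n e \<epsilon>"
  shows "i < n \<Longrightarrow> e i \<in> carrier V" "i < n \<Longrightarrow> \<epsilon> i \<in> carrier (dual_space V)"
    "i < n \<Longrightarrow> j < n \<Longrightarrow> \<epsilon> i (e j) = (if i = j then 1 else 0)"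
    "v \<in> carrier V \<Longrightarrow> vsum V (\<lambda>i. \<epsilon> i v \<odot>\<^bsub>V\<^esub> e i) n = v"
  using assms by (auto simp: dual_basis_def)

lemma dual_basis_expand:
  assumes V: "vectorspace class_ring V" and b: "dual_basis V n e \<epsilon>" and \<xi>: "\<xi> \<in> carrier (dual_space V)"
    and v: "v \<in> carrier V"
  shows "\<xi> v = (\<Sum>i<n. \<epsilon> i v * \<xi> (e i))"
  using dual_vsum[OF V \<xi>, of n "\<lambda>i. \<epsilon> i v \<odot>\<^bsub>V\<^esub> e i"] dual_basisD[OF b] v
  by (simp add: vs_smult_closed[OF V] dual_smult[OF \<xi>])


lemma finsum_vsum:
  fixes V :: "('k::field, 'v) module"
  assumes V: "vectorspace class_ring V" and "\<And>i. i < n \<Longrightarrow> f i \<in> carrier V"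
  shows "finsum V f {..<n} = vsum V f n"
proof -
  interpret vectorspace class_ring V by (rule V)
  show ?thesis
    using assms(2)
  proof (induction n)
    case (Suc n)
    then have "finsum V f {..<Suc n} = f n \<oplus>\<^bsub>V\<^esub> finsum V f {..<n}"
      by (subst lessThan_Suc, subst M.finsum_insert) auto
    with Suc show ?case
      by (simp add: vsum_closed[OF V] vs_comm[OF V])
  qed simp
qed

text \<open>The coordinate functionals read off the unique coefficients with respect to a finite
  basis; uniqueness makes them linear. This connects the notion of dimension in
  \<open>finite_linear_category\<close> with \<open>fdvs\<close>.\<close>

lemma fdvsI:
  fixes V :: "('k::field, 'v) module"
  assumes V: "vectorspace class_ring V" and fd: "vectorspace.fin_dim class_ring V"
  shows "fdvs V"
proof -
  interpret vectorspace class_ring V by (rule V)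
  obtain B where B: "finite B" "basis B"
    using finite_basis_exists[OF fd] by blast
  then have BV: "B \<subseteq> carrier V"
    by (simp add: basis_def)
  obtain n and e :: "nat \<Rightarrow> 'v" where e: "bij_betw e {..<n} B"
    using ex_bij_betw_nat_finite[OF B(1)] by (auto simp: atLeast0LessThan)
  have eB: "e i \<in> carrier V" if "i < n" for i
    using bij_betwE[OF e] that BV by auto
  have lc: "lincomb a B = vsum V (\<lambda>i. a (e i) \<odot>\<^bsub>V\<^esub> e i) n" for a
  proof -
    have "lincomb a B = (\<Oplus>\<^bsub>V\<^esub>b\<in>e ` {..<n}. a b \<odot>\<^bsub>V\<^esub> b)"
      using e by (simp add: lincomb_def bij_betw_def)
    also have "\<dots> = (\<Oplus>\<^bsub>V\<^esub>i\<in>{..<n}. a (e i) \<odot>\<^bsub>V\<^esub> e i)"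
      by (rule M.finsum_reindex) (use e eB in \<open>auto simp: bij_betw_def vs_smult_closed[OF V]\<close>)
    also have "\<dots> = vsum V (\<lambda>i. a (e i) \<odot>\<^bsub>V\<^esub> e i) n"
      by (rule finsum_vsum[OF V]) (simp add: eB vs_smult_closed[OF V])
    finally show ?thesis .
  qed
  have uniq: "\<exists>!a. a \<in> B \<rightarrow>\<^sub>E UNIV \<and> lincomb a B = v" if "v \<in> carrier V" for v
    using that B basis_criterion[OF B(1) BV] by simp
  define c where "c = (\<lambda>v. THE a. a \<in> B \<rightarrow>\<^sub>E UNIV \<and> lincomb a B = v)"
  have c: "c v \<in> B \<rightarrow>\<^sub>E UNIV" "lincomb (c v) B = v" if "v \<in> carrier V" for v
    using theI'[OF uniq[OF that]] by (auto simp: c_def)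
  have c_eq: "c v b = a b"
    if "v \<in> carrier V" "b \<in> B" "lincomb a B = v" for v a b
  proof -
    \<comment> \<open>Uniqueness of coefficients holds among the functions in
      \<open>B \<rightarrow>\<^sub>E UNIV\<close>, hence the restriction.\<close>
    have "lincomb (restrict a B) B = v"
      using that e bij_betwE[OF e] by (auto simp: lc intro!: vsum_cong)
    then have "c v = restrict a B"
      using uniq[OF that(1)] c[OF that(1)] by fastforce
    then show ?thesis
      using that by simp
  qed
  have add: "c (v \<oplus>\<^bsub>V\<^esub> w) b = c v b + c w b" if "v \<in> carrier V" "w \<in> carrier V" "b \<in> B" for v w b
  proof (rule c_eq)
    show "lincomb (\<lambda>b. c v b + c w b) B = v \<oplus>\<^bsub>V\<^esub> w"
      using c(2)[OF that(1)] c(2)[OF that(2)]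
      by (simp add: lc vs_add_smult[OF V] eB vsum_add[OF V] vs_smult_closed[OF V] cong: vsum_cong)
  qed (use that in \<open>auto simp: vs_simps[OF V]\<close>)
  have smult: "c (a \<odot>\<^bsub>V\<^esub> v) b = a * c v b" if "v \<in> carrier V" "b \<in> B" for a v b
  proof (rule c_eq)
    show "lincomb (\<lambda>b. a * c v b) B = a \<odot>\<^bsub>V\<^esub> v"
      using c(2)[OF that(1)]
      by (simp add: lc vs_smult_assoc[OF V] eB vsum_smult[OF V] vs_smult_closed[OF V] cong: vsum_cong)
  qed (use that in \<open>auto simp: vs_simps[OF V]\<close>)
  have eiB: "e i \<in> B" if "i < n" for i
    using bij_betwE[OF e] that by auto
  define \<epsilon> where "\<epsilon> i = restrict (\<lambda>v. c v (e i)) (carrier V)" for i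
  have "dual_basis V n e \<epsilon>"
    unfolding dual_basis_def
  proof (intro conjI allI ballI impI)
    fix i assume i: "i < n"
    then show "e i \<in> carrier V"
      by (rule eB)
    show "\<epsilon> i \<in> carrier (dual_space V)"
      unfolding \<epsilon>_def by (rule dual_restrictI[OF V]) (use i in \<open>simp_all add: add smult eiB\<close>)
    fix j assume j: "j < n"
    have *: "(e i' = e j') = (i' = j')" if "i' < n" "j' < n" for i' j'
      using e that by (auto simp: bij_betw_def inj_on_def)
    have "c (e j) (e i) = (if e i = e j then 1 else 0)"
    proof (rule c_eq)
      have "vsum V (\<lambda>i. (if e i = e j then 1 else 0) \<odot>\<^bsub>V\<^esub> e i) n = vsum V (\<lambda>i. if i = j then e j else \<zero>\<^bsub>V\<^esub>) n"
        by (rule vsum_cong) (use j * eB in \<open>auto simp: vs_simps[OF V]\<close>)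
      then show "lincomb (\<lambda>b. if b = e j then 1 else 0) B = e j"
        using j eB by (simp add: lc vsum_delta[OF V])
    qed (use i j eB eiB in auto)
    then show "\<epsilon> i (e j) = (if i = j then 1 else 0)"
      using i j * eB by (simp add: \<epsilon>_def)
  next
    fix v assume "v \<in> carrier V"
    then show "vsum V (\<lambda>i. \<epsilon> i v \<odot>\<^bsub>V\<^esub> e i) n = v"
      using c(2)[of v] by (simp add: lc \<epsilon>_def)
  qed
  then show ?thesis
    using V by (auto simp: fdvs_def)
qed

text \<open>The coordinates of a functional with respect to \<open>\<epsilon>\<close> are its values
  on \<open>e\<close>, so evaluation at the basis vectors is the dual basis of the dual
  space.\<close>

lemma dual_basis_dual:
  fixes V :: "('k::field, 'v) module"
  assumes V: "vectorspace class_ring V" and b: "dual_basis V n e \<epsilon>"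
  shows "dual_basis (dual_space V) n \<epsilon> (\<lambda>i. restrict (\<lambda>\<xi>. \<xi> (e i)) (carrier (dual_space V)))"
  unfolding dual_basis_def
proof (intro conjI allI ballI impI)
  fix i assume i: "i < n"
  then show "\<epsilon> i \<in> carrier (dual_space V)"
    by (rule dual_basisD[OF b])
  show "restrict (\<lambda>\<xi>. \<xi> (e i)) (carrier (dual_space V)) \<in> carrier (dual_space (dual_space V))"
    by (rule dual_restrictI[OF vectorspace_dual[OF V]])
      (use dual_basisD(1)[OF b i] in \<open>simp_all add: dual_add_apply dual_smult_apply\<close>)
  fix j assume j: "j < n"
  then show "restrict (\<lambda>\<xi>. \<xi> (e i)) (carrier (dual_space V)) (\<epsilon> j) = (if i = j then 1 else 0)"
    using i by (simp add: dual_basisD[OF b])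
next
  fix \<xi> assume \<xi>: "\<xi> \<in> carrier (dual_space V)"
  note V' = vectorspace_dual[OF V]
  have "vsum (dual_space V) (\<lambda>i. \<xi> (e i) \<odot>\<^bsub>dual_space V\<^esub> \<epsilon> i) n = \<xi>"
  proof (rule dual_eqI[OF _ \<xi>])
    show "vsum (dual_space V) (\<lambda>i. \<xi> (e i) \<odot>\<^bsub>dual_space V\<^esub> \<epsilon> i) n \<in> carrier (dual_space V)"
      by (rule vsum_closed[OF V']) (simp add: vs_smult_closed[OF V'] dual_basisD[OF b])
    show "vsum (dual_space V) (\<lambda>i. \<xi> (e i) \<odot>\<^bsub>dual_space V\<^esub> \<epsilon> i) n v = \<xi> v" if "v \<in> carrier V" for v
      using that
      by (simp add: dual_vsum_apply dual_smult_apply dual_basis_expand[OF V b \<xi>] mult.commute)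
  qed
  then show "vsum (dual_space V) (\<lambda>i. restrict (\<lambda>\<xi>. \<xi> (e i)) (carrier (dual_space V)) \<xi> \<odot>\<^bsub>dual_space V\<^esub> \<epsilon> i) n = \<xi>"
    using \<xi> by simp
qed

lemma fdvs_dual: "fdvs V \<Longrightarrow> fdvs (dual_space V)"
  using dual_basis_dual vectorspace_dual unfolding fdvs_def by blast

text \<open>The vector with coordinates \<open>\<Lambda> (\<epsilon> i)\<close> does it. This is the
  source of all morphisms that are later obtained from scalars.\<close>

lemma dual_space_reflexive:
  fixes V :: "('k::field, 'v) module"
  assumes V: "fdvs V" and \<Lambda>: "\<Lambda> \<in> carrier (dual_space (dual_space V))"
  shows "\<exists>v\<in>carrier V. \<forall>\<xi>\<in>carrier (dual_space V). \<Lambda> \<xi> = \<xi> v"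
proof -
  note V1 = fdvs_vectorspace[OF V]
  obtain n e \<epsilon> where b: "dual_basis V n e \<epsilon>"
    using V by (rule fdvsE)
  let ?v = "vsum V (\<lambda>i. \<Lambda> (\<epsilon> i) \<odot>\<^bsub>V\<^esub> e i) n"
  have "\<Lambda> \<xi> = \<xi> ?v" if \<xi>: "\<xi> \<in> carrier (dual_space V)" for \<xi>
    using dual_basis_expand[OF vectorspace_dual[OF V1] dual_basis_dual[OF V1 b] \<Lambda> \<xi>] \<xi>
      dual_vsum[OF V1 \<xi>, of n "\<lambda>i. \<Lambda> (\<epsilon> i) \<odot>\<^bsub>V\<^esub> e i"]
    by (simp add: dual_basisD[OF b] vs_smult_closed[OF V1] dual_smult[OF \<xi>] mult.commute)
  moreover have "?v \<in> carrier V"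
    by (rule vsum_closed[OF V1]) (simp add: dual_basisD[OF b] vs_smult_closed[OF V1])
  ultimately show ?thesis
    by blast
qed

lemma dual_space_separates:
  fixes V :: "('k::field, 'v) module"
  assumes V: "fdvs V" and "v \<in> carrier V" "w \<in> carrier V" "\<And>\<xi>. \<xi> \<in> carrier (dual_space V) \<Longrightarrow> \<xi> v = \<xi> w"
  shows "v = w"
proof -
  obtain n e \<epsilon> where b: "dual_basis V n e \<epsilon>"
    using V by (rule fdvsE)
  have "v = vsum V (\<lambda>i. \<epsilon> i v \<odot>\<^bsub>V\<^esub> e i) n"
    using dual_basisD(4)[OF b] assms by simp
  also have "\<dots> = vsum V (\<lambda>i. \<epsilon> i w \<odot>\<^bsub>V\<^esub> e i) n"
    by (rule vsum_cong) (simp add: assms dual_basisD[OF b])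
  also have "\<dots> = w"
    using dual_basisD(4)[OF b] assms by simp
  finally show ?thesis .
qed

subsection \<open>Subspaces\<close>

definition subsp :: "('k::field, 'v) module \<Rightarrow> 'v set \<Rightarrow> bool" where
  "subsp V U \<longleftrightarrow> U \<subseteq> carrier V \<and> \<zero>\<^bsub>V\<^esub> \<in> U \<and> (\<forall>u\<in>U. \<forall>v\<in>U. u \<oplus>\<^bsub>V\<^esub> v \<in> U) \<and>
     (\<forall>a. \<forall>u\<in>U. a \<odot>\<^bsub>V\<^esub> u \<in> U)"

lemma subspD:
  assumes "subsp V U"
  shows "u \<in> U \<Longrightarrow> u \<in> carrier V" "\<zero>\<^bsub>V\<^esub> \<in> U" "u \<in> U \<Longrightarrow> v \<in> U \<Longrightarrow> u \<oplus>\<^bsub>V\<^esub> v \<in> U" "u \<in> U \<Longrightarrow> a \<odot>\<^bsub>V\<^esub> u \<in> U"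
  using assms by (auto simp: subsp_def)

lemma subsp_vsum: "subsp V U \<Longrightarrow> (\<And>i. i < n \<Longrightarrow> f i \<in> U) \<Longrightarrow> vsum V f n \<in> U"
  by (induction n) (auto simp: subspD)

text \<open>The span of the \<open>e i\<close> with \<open>i \<in> J\<close>. Coefficients outside
  \<open>J\<close> are set to zero so that every sum keeps the index range
  \<open>{..<n}\<close>.\<close>

definition lspan :: "('k::field, 'v) module \<Rightarrow> nat \<Rightarrow> (nat \<Rightarrow> 'v) \<Rightarrow> nat set \<Rightarrow> 'v set" where
  "lspan V n e J = {vsum V (\<lambda>i. (if i \<in> J then a i else 0) \<odot>\<^bsub>V\<^esub> e i) n | a. True}"

lemma subsp_lspan:
  assumes V: "vectorspace class_ring V" and e: "\<And>i. i < n \<Longrightarrow> e i \<in> carrier V"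
  shows "subsp V (lspan V n e J)"
  unfolding subsp_def
proof (intro conjI allI ballI)
  show "lspan V n e J \<subseteq> carrier V"
    using e by (auto simp: lspan_def intro!: vsum_closed[OF V] vs_smult_closed[OF V])
  have *: "vsum V (\<lambda>i. \<zero>\<^bsub>V\<^esub>) n = \<zero>\<^bsub>V\<^esub>"
    by (induction n) (auto simp: vs_simps[OF V])
  have "vsum V (\<lambda>i. (if i \<in> J then 0 else 0) \<odot>\<^bsub>V\<^esub> e i) n = vsum V (\<lambda>i. \<zero>\<^bsub>V\<^esub>) n"
    by (rule vsum_cong) (simp add: e vs_simps[OF V])
  then show "\<zero>\<^bsub>V\<^esub> \<in> lspan V n e J"
    unfolding lspan_def * by (auto intro!: exI[of _ "\<lambda>_. 0"])
next
  fix u v assume "u \<in> lspan V n e J" "v \<in> lspan V n e J"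
  then obtain a b where u: "u = vsum V (\<lambda>i. (if i \<in> J then a i else 0) \<odot>\<^bsub>V\<^esub> e i) n"
    and v: "v = vsum V (\<lambda>i. (if i \<in> J then b i else 0) \<odot>\<^bsub>V\<^esub> e i) n"
    by (auto simp: lspan_def)
  have "u \<oplus>\<^bsub>V\<^esub> v = vsum V (\<lambda>i. (if i \<in> J then a i + b i else 0) \<odot>\<^bsub>V\<^esub> e i) n"
    unfolding u v by (subst vsum_add[OF V, symmetric])
      (auto simp: e vs_simps[OF V] vs_add_smult[OF V] intro!: vsum_cong)
  then show "u \<oplus>\<^bsub>V\<^esub> v \<in> lspan V n e J"
    by (auto simp: lspan_def intro!: exI[of _ "\<lambda>i. a i + b i"])
next
  fix c u assume "u \<in> lspan V n e J"
  then obtain a where u: "u = vsum V (\<lambda>i. (if i \<in> J then a i else 0) \<odot>\<^bsub>V\<^esub> e i) n"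
    by (auto simp: lspan_def)
  have "c \<odot>\<^bsub>V\<^esub> u = vsum V (\<lambda>i. (if i \<in> J then c * a i else 0) \<odot>\<^bsub>V\<^esub> e i) n"
    unfolding u by (subst vsum_smult[OF V, symmetric])
      (auto simp: e vs_simps[OF V] vs_smult_assoc[OF V] intro!: vsum_cong)
  then show "c \<odot>\<^bsub>V\<^esub> u \<in> lspan V n e J"
    by (auto simp: lspan_def intro!: exI[of _ "\<lambda>i. c * a i"])
qed

text \<open>The complement is the span of a maximal set of basis vectors whose span meets \<open>U\<close> trivially.\<close>

lemma subsp_complement:
  fixes V :: "('k::field, 'v) module"
  assumes V: "fdvs V" and U: "subsp V U"
  obtains S where "subsp V S" "U \<inter> S = {\<zero>\<^bsub>V\<^esub>}" "\<And>v. v \<in> carrier V \<Longrightarrow> \<exists>u\<in>U. \<exists>s\<in>S. v = u \<oplus>\<^bsub>V\<^esub> s"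
proof -
  note V1 = fdvs_vectorspace[OF V]
  obtain n e \<epsilon> where b: "dual_basis V n e \<epsilon>"
    using V by (rule fdvsE)
  note eV = dual_basisD(1)[OF b]
  let ?L = "lspan V n e"
  have L: "subsp V (?L J)" for J
    by (rule subsp_lspan[OF V1]) (rule eV)
  have L0: "?L {} = {\<zero>\<^bsub>V\<^esub>}"
  proof -
    have "vsum V (\<lambda>i. 0 \<odot>\<^bsub>V\<^esub> e i) m = \<zero>\<^bsub>V\<^esub>" if "m \<le> n" for m
      using that by (induction m) (auto simp: vs_simps[OF V1] eV)
    then show ?thesis
      by (auto simp: lspan_def)
  qed
  define P where "P J \<longleftrightarrow> J \<subseteq> {..<n} \<and> U \<inter> ?L J = {\<zero>\<^bsub>V\<^esub>}" for J
  have "P {}"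
    using subspD(2)[OF U] by (auto simp: P_def L0)
  moreover have "finite {J. P J}"
    by (rule finite_subset[of _ "Pow {..<n}"]) (auto simp: P_def)
  ultimately obtain J where J: "P J" and max: "\<And>J'. P J' \<Longrightarrow> J \<subseteq> J' \<Longrightarrow> J = J'"
    using finite_has_maximal[of "{J. P J}"] by auto
  \<comment> \<open>The sum of \<open>U\<close> and the span. Maximality of \<open>J\<close> will
    put every basis vector into it, hence every vector.\<close>
  let ?W = "{u \<oplus>\<^bsub>V\<^esub> s | u s. u \<in> U \<and> s \<in> ?L J}"
  note LV = subspD(1)[OF L] and UV = subspD(1)[OF U]
  have W: "subsp V ?W"
    unfolding subsp_def
  proof (intro conjI allI ballI)
    show "?W \<subseteq> carrier V"
      using LV UV by (auto simp: vs_simps[OF V1])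
    show "\<zero>\<^bsub>V\<^esub> \<in> ?W"
      using subspD(2)[OF L, of J] subspD(2)[OF U] vs_zero_add[OF V1 vs_zero_closed[OF V1]] by force
  next
    fix x y assume "x \<in> ?W" "y \<in> ?W"
    then obtain u s u' s' where *: "x = u \<oplus>\<^bsub>V\<^esub> s" "y = u' \<oplus>\<^bsub>V\<^esub> s'" "u \<in> U" "u' \<in> U" "s \<in> ?L J" "s' \<in> ?L J"
      by blast
    then have "x \<oplus>\<^bsub>V\<^esub> y = (u \<oplus>\<^bsub>V\<^esub> u') \<oplus>\<^bsub>V\<^esub> (s \<oplus>\<^bsub>V\<^esub> s')"
      using LV UV by (simp add: vs_simps[OF V1] vs_assoc[OF V1] vs_lcomm[OF V1, of s u'])
    moreover have "u \<oplus>\<^bsub>V\<^esub> u' \<in> U" "s \<oplus>\<^bsub>V\<^esub> s' \<in> ?L J"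
      using * subspD(3)[OF U] subspD(3)[OF L] by auto
    ultimately show "x \<oplus>\<^bsub>V\<^esub> y \<in> ?W"
      by blast
  next
    fix a x assume "x \<in> ?W"
    then obtain u s where *: "x = u \<oplus>\<^bsub>V\<^esub> s" "u \<in> U" "s \<in> ?L J"
      by blast
    then have "a \<odot>\<^bsub>V\<^esub> x = a \<odot>\<^bsub>V\<^esub> u \<oplus>\<^bsub>V\<^esub> a \<odot>\<^bsub>V\<^esub> s"
      using LV UV by (simp add: vs_simps[OF V1])
    moreover have "a \<odot>\<^bsub>V\<^esub> u \<in> U" "a \<odot>\<^bsub>V\<^esub> s \<in> ?L J"
      using * subspD(4)[OF U] subspD(4)[OF L] by auto
    ultimately show "a \<odot>\<^bsub>V\<^esub> x \<in> ?W"
      by blast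
  qed
  have split: "\<exists>c. \<exists>s\<in>?L J. x = s \<oplus>\<^bsub>V\<^esub> c \<odot>\<^bsub>V\<^esub> e i" if xi: "x \<in> ?L (insert i J)" "i < n" "i \<notin> J" for x i
  proof -
    obtain a where x: "x = vsum V (\<lambda>j. (if j \<in> insert i J then a j else 0) \<odot>\<^bsub>V\<^esub> e j) n"
      using xi(1) unfolding lspan_def by blast
    let ?s = "vsum V (\<lambda>j. (if j \<in> J then a j else 0) \<odot>\<^bsub>V\<^esub> e j) n"
    have "x = vsum V (\<lambda>j. (if j \<in> J then a j else 0) \<odot>\<^bsub>V\<^esub> e j \<oplus>\<^bsub>V\<^esub> (if j = i then a i \<odot>\<^bsub>V\<^esub> e i else \<zero>\<^bsub>V\<^esub>)) n"
      unfolding x by (rule vsum_cong) (use xi eV in \<open>auto simp: vs_simps[OF V1]\<close>)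
    also have "\<dots> = ?s \<oplus>\<^bsub>V\<^esub> vsum V (\<lambda>j. if j = i then a i \<odot>\<^bsub>V\<^esub> e i else \<zero>\<^bsub>V\<^esub>) n"
      by (rule vsum_add[OF V1]) (use xi eV in \<open>auto simp: vs_simps[OF V1]\<close>)
    also have "\<dots> = ?s \<oplus>\<^bsub>V\<^esub> a i \<odot>\<^bsub>V\<^esub> e i"
      using xi eV by (simp add: vsum_delta[OF V1] vs_simps[OF V1])
    finally show ?thesis
      by (force simp: lspan_def)
  qed
  have eW: "e i \<in> ?W" if i: "i < n" for i
  proof (cases "i \<in> J")
    case True
    have "vsum V (\<lambda>j. (if j \<in> J then (if j = i then 1 else 0) else 0) \<odot>\<^bsub>V\<^esub> e j) n
        = vsum V (\<lambda>j. if j = i then e i else \<zero>\<^bsub>V\<^esub>) n"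
      by (rule vsum_cong) (use True eV in \<open>auto simp: vs_simps[OF V1]\<close>)
    then have "e i \<in> ?L J"
      using i eV vsum_delta[OF V1, of "e i" i n]
      by (auto simp: lspan_def intro!: exI[of _ "\<lambda>j. if j = i then 1 else 0"])
    then show ?thesis
      using subspD(2)[OF U] vs_zero_add[OF V1 eV[OF i]] by force
  next
    case False
    show ?thesis
    proof (rule ccontr)
      assume not: "e i \<notin> ?W"
      have z: "x = \<zero>\<^bsub>V\<^esub>" if x: "x \<in> U" "x \<in> ?L (insert i J)" for x
      proof -
        obtain c s where s: "s \<in> ?L J" "x = s \<oplus>\<^bsub>V\<^esub> c \<odot>\<^bsub>V\<^esub> e i"
          using split[OF x(2) i False] by blast
        note [simp] = LV[OF s(1)] UV[OF x(1)] eV[OF i]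
        \<comment> \<open>If \<open>c\<close> were nonzero, dividing by it would express
          \<open>e i\<close> through \<open>x \<in> U\<close> and \<open>s \<in> ?L J\<close>,
          against \<open>not\<close>. So enlarging \<open>J\<close> by \<open>i\<close> keeps the
          intersection with \<open>U\<close> trivial.\<close>
        have "c = 0"
        proof (rule ccontr)
          assume c: "c \<noteq> 0"
          have "e i = (1/c) \<odot>\<^bsub>V\<^esub> (c \<odot>\<^bsub>V\<^esub> e i)"
            using c by (simp add: vs_smult_assoc[OF V1, symmetric] vs_simps[OF V1])
          also have "c \<odot>\<^bsub>V\<^esub> e i = x \<oplus>\<^bsub>V\<^esub> (-1) \<odot>\<^bsub>V\<^esub> s"
            unfolding s(2) by (simp add: vs_simps[OF V1] vs_assoc[OF V1] vs_comm[OF V1, of "c \<odot>\<^bsub>V\<^esub> e i"])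
              (simp add: vs_simps[OF V1] vs_assoc[OF V1, symmetric])
          finally have ei: "e i = (1/c) \<odot>\<^bsub>V\<^esub> (x \<oplus>\<^bsub>V\<^esub> (-1) \<odot>\<^bsub>V\<^esub> s)" .
          have "x \<oplus>\<^bsub>V\<^esub> (-1) \<odot>\<^bsub>V\<^esub> s \<in> ?W"
            using x(1) subspD(4)[OF L s(1)] by blast
          from subspD(4)[OF W this, of "1/c"] show False
            unfolding ei[symmetric] using not by (rule notE[rotated])
        qed
        then have "x \<in> ?L J"
          using s by (simp add: vs_simps[OF V1])
        then show ?thesis
          using J x(1) by (auto simp: P_def)
      qed
      have "U \<inter> ?L (insert i J) = {\<zero>\<^bsub>V\<^esub>}"
        using z subspD(2)[OF U] subspD(2)[OF L] by blast
      then have "P (insert i J)"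
        using J i by (simp add: P_def)
      then show False
        using max[of "insert i J"] False by auto
    qed
  qed
  show thesis
  proof (rule that[of "?L J"])
    show "subsp V (?L J)"
      by (rule L)
    show "U \<inter> ?L J = {\<zero>\<^bsub>V\<^esub>}"
      using J by (simp add: P_def)
    show "\<exists>u\<in>U. \<exists>s\<in>?L J. v = u \<oplus>\<^bsub>V\<^esub> s" if v: "v \<in> carrier V" for v
    proof -
      have "vsum V (\<lambda>i. \<epsilon> i v \<odot>\<^bsub>V\<^esub> e i) n \<in> ?W"
        by (rule subsp_vsum[OF W]) (use subspD(4)[OF W] eW in blast)
      then show ?thesis
        using dual_basisD(4)[OF b v] by auto
    qed
  qed
qed

text \<open>Projection along a complement; it is well defined and linear because the decomposition
  into the two summands is unique.\<close>

lemma subsp_projection: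
  fixes V :: "('k::field, 'v) module"
  assumes V: "fdvs V" and U: "subsp V U"
  obtains \<pi> where "\<pi> \<in> linear_maps V V" "\<And>v. v \<in> carrier V \<Longrightarrow> \<pi> v \<in> U" "\<And>u. u \<in> U \<Longrightarrow> \<pi> u = u"
proof -
  note V1 = fdvs_vectorspace[OF V]
  obtain S where S: "subsp V S" "U \<inter> S = {\<zero>\<^bsub>V\<^esub>}" and ex: "\<And>v. v \<in> carrier V \<Longrightarrow> \<exists>u\<in>U. \<exists>s\<in>S. v = u \<oplus>\<^bsub>V\<^esub> s"
    using subsp_complement[OF V U] by metis
  note SV = subspD(1)[OF S(1)] and UV = subspD(1)[OF U]
  have uniq: "u = u'" if "u \<in> U" "u' \<in> U" "s \<in> S" "s' \<in> S" "u \<oplus>\<^bsub>V\<^esub> s = u' \<oplus>\<^bsub>V\<^esub> s'" for u u' s s'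
  proof -
    note [simp] = that(1,2)[THEN UV] that(3,4)[THEN SV]
    have "u \<oplus>\<^bsub>V\<^esub> (-1) \<odot>\<^bsub>V\<^esub> u' = (u \<oplus>\<^bsub>V\<^esub> s) \<oplus>\<^bsub>V\<^esub> (-1) \<odot>\<^bsub>V\<^esub> s \<oplus>\<^bsub>V\<^esub> (-1) \<odot>\<^bsub>V\<^esub> u'"
      by (simp add: vs_simps[OF V1] vs_assoc[OF V1])
    also have "\<dots> = s' \<oplus>\<^bsub>V\<^esub> (-1) \<odot>\<^bsub>V\<^esub> s"
      unfolding that(5)
      by (simp add: vs_simps[OF V1] vs_assoc[OF V1] vs_lcomm[OF V1, of u'])
    finally have *: "u \<oplus>\<^bsub>V\<^esub> (-1) \<odot>\<^bsub>V\<^esub> u' = s' \<oplus>\<^bsub>V\<^esub> (-1) \<odot>\<^bsub>V\<^esub> s" .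
    have "u \<oplus>\<^bsub>V\<^esub> (-1) \<odot>\<^bsub>V\<^esub> u' \<in> U"
      using that subspD[OF U] by blast
    moreover have "u \<oplus>\<^bsub>V\<^esub> (-1) \<odot>\<^bsub>V\<^esub> u' \<in> S"
      unfolding * using that subspD[OF S(1)] by blast
    ultimately have "u \<oplus>\<^bsub>V\<^esub> (-1) \<odot>\<^bsub>V\<^esub> u' = \<zero>\<^bsub>V\<^esub>"
      using S(2) by blast
    then show ?thesis
      by (rule vs_eqI[OF V1, rotated 2]) simp_all
  qed
  define \<pi> where "\<pi> v = (SOME u. u \<in> U \<and> (\<exists>s\<in>S. v = u \<oplus>\<^bsub>V\<^esub> s))" for v
  have \<pi>: "\<pi> v \<in> U" "\<exists>s\<in>S. v = \<pi> v \<oplus>\<^bsub>V\<^esub> s" if "v \<in> carrier V" for v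
    using someI_ex[of "\<lambda>u. u \<in> U \<and> (\<exists>s\<in>S. v = u \<oplus>\<^bsub>V\<^esub> s)"] ex[OF that] by (auto simp: \<pi>_def)
  have \<pi>_eq: "\<pi> v = u" if "u \<in> U" "s \<in> S" "v = u \<oplus>\<^bsub>V\<^esub> s" for u s v
  proof -
    have "v \<in> carrier V"
      using that SV UV by (simp add: vs_simps[OF V1])
    then show ?thesis
      using \<pi>[of v] uniq that by metis
  qed
  show thesis
  proof
    show "\<pi> \<in> linear_maps V V"
    proof (rule linear_mapsI)
      show "\<pi> v \<in> carrier V" if "v \<in> carrier V" for v
        using \<pi>(1)[OF that] UV by simp
    next
      fix v w assume vw: "v \<in> carrier V" "w \<in> carrier V"
      obtain s t where s: "s \<in> S" "v = \<pi> v \<oplus>\<^bsub>V\<^esub> s" and t: "t \<in> S" "w = \<pi> w \<oplus>\<^bsub>V\<^esub> t"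
        using \<pi>(2)[OF vw(1)] \<pi>(2)[OF vw(2)] by blast
      note [simp] = \<pi>(1)[OF vw(1), THEN UV] \<pi>(1)[OF vw(2), THEN UV] s(1)[THEN SV] t(1)[THEN SV]
      show "\<pi> (v \<oplus>\<^bsub>V\<^esub> w) = \<pi> v \<oplus>\<^bsub>V\<^esub> \<pi> w"
      proof (rule \<pi>_eq)
        show "\<pi> v \<oplus>\<^bsub>V\<^esub> \<pi> w \<in> U" "s \<oplus>\<^bsub>V\<^esub> t \<in> S"
          using \<pi>(1) vw s(1) t(1) subspD(3)[OF U] subspD(3)[OF S(1)] by auto
        have "v \<oplus>\<^bsub>V\<^esub> w = (\<pi> v \<oplus>\<^bsub>V\<^esub> s) \<oplus>\<^bsub>V\<^esub> (\<pi> w \<oplus>\<^bsub>V\<^esub> t)"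
          using s(2) t(2) by simp
        then show "v \<oplus>\<^bsub>V\<^esub> w = \<pi> v \<oplus>\<^bsub>V\<^esub> \<pi> w \<oplus>\<^bsub>V\<^esub> (s \<oplus>\<^bsub>V\<^esub> t)"
          by (simp add: vs_simps[OF V1] vs_assoc[OF V1] vs_lcomm[OF V1, of s "\<pi> w"])
      qed
    next
      fix a v assume v: "v \<in> carrier V"
      obtain s where s: "s \<in> S" "v = \<pi> v \<oplus>\<^bsub>V\<^esub> s"
        using \<pi>(2)[OF v] by blast
      show "\<pi> (a \<odot>\<^bsub>V\<^esub> v) = a \<odot>\<^bsub>V\<^esub> \<pi> v"
      proof (rule \<pi>_eq)
        show "a \<odot>\<^bsub>V\<^esub> \<pi> v \<in> U" "a \<odot>\<^bsub>V\<^esub> s \<in> S"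
          using \<pi>(1)[OF v] s(1) subspD(4)[OF U] subspD(4)[OF S(1)] by auto
        show "a \<odot>\<^bsub>V\<^esub> v = a \<odot>\<^bsub>V\<^esub> \<pi> v \<oplus>\<^bsub>V\<^esub> a \<odot>\<^bsub>V\<^esub> s"
          using vs_smult_add[OF V1, of "\<pi> v" s a] s \<pi>(1)[OF v] UV SV by simp
      qed
    qed
    show "\<pi> v \<in> U" if "v \<in> carrier V" for v
      using \<pi>(1)[OF that] .
    show "\<pi> u = u" if "u \<in> U" for u
      using \<pi>_eq[OF that subspD(2)[OF S(1)]] that UV by (simp add: vs_simps[OF V1])
  qed
qed

text \<open>A projection onto \<open>U\<close> sends a basis of the whole space to a spanning family
  of \<open>U\<close>. It serves to replace a subspace of morphisms by finitely many of
  them.\<close>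

lemma subsp_finitely_spanned:
  fixes V :: "('k::field, 'v) module"
  assumes V: "fdvs V" and U: "subsp V U"
  obtains n u where "\<And>i. i < n \<Longrightarrow> u i \<in> U" "\<And>v. v \<in> U \<Longrightarrow> \<exists>a. v = vsum V (\<lambda>i. a i \<odot>\<^bsub>V\<^esub> u i) n"
proof -
  note V1 = fdvs_vectorspace[OF V]
  obtain \<pi> where \<pi>: "\<pi> \<in> linear_maps V V" "\<And>v. v \<in> carrier V \<Longrightarrow> \<pi> v \<in> U" "\<And>u. u \<in> U \<Longrightarrow> \<pi> u = u"
    using subsp_projection[OF V U] by metis
  obtain n e \<epsilon> where b: "dual_basis V n e \<epsilon>"
    using V by (rule fdvsE)
  show thesis
  proof
    show "\<pi> (e i) \<in> U" if "i < n" for i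
      using that by (simp add: \<pi> dual_basisD[OF b])
    show "\<exists>a. v = vsum V (\<lambda>i. a i \<odot>\<^bsub>V\<^esub> \<pi> (e i)) n" if v: "v \<in> U" for v
    proof
      have vV: "v \<in> carrier V"
        using v subspD(1)[OF U] by simp
      have "v = \<pi> (vsum V (\<lambda>i. \<epsilon> i v \<odot>\<^bsub>V\<^esub> e i) n)"
        using v vV by (simp add: dual_basisD(4)[OF b] \<pi>)
      also have "\<dots> = vsum V (\<lambda>i. \<epsilon> i v \<odot>\<^bsub>V\<^esub> \<pi> (e i)) n"
        by (subst linear_maps_vsum[OF V1 V1 \<pi>(1)])
          (auto simp: vs_smult_closed[OF V1] dual_basisD[OF b] linear_maps_smult[OF \<pi>(1)] intro!: vsum_cong)
      finally show "v = vsum V (\<lambda>i. \<epsilon> i v \<odot>\<^bsub>V\<^esub> \<pi> (e i)) n" .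
    qed
  qed
qed

text \<open>By reflexivity a functional on the dual that vanishes on \<open>U\<close> is evaluation
  at a vector killed by \<open>U\<close>, and such a vector is zero. Through this, surjectivity onto
  a dual space follows from injectivity of maps between spaces of morphisms.\<close>

lemma separating_subsp_dual:
  fixes V :: "('k::field, 'v) module"
  assumes V: "fdvs V" and U: "subsp (dual_space V) U"
    and sep: "\<And>v. \<lbrakk>v \<in> carrier V; \<And>\<xi>. \<xi> \<in> U \<Longrightarrow> \<xi> v = 0\<rbrakk> \<Longrightarrow> v = \<zero>\<^bsub>V\<^esub>"
  shows "U = carrier (dual_space V)"
proof -
  note V1 = fdvs_vectorspace[OF V] and V' = fdvs_dual[OF V] and V1' = vectorspace_dual[OF fdvs_vectorspace[OF V]]
  obtain \<pi> where \<pi>: "\<pi> \<in> linear_maps (dual_space V) (dual_space V)"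
    "\<And>\<xi>. \<xi> \<in> carrier (dual_space V) \<Longrightarrow> \<pi> \<xi> \<in> U" "\<And>\<xi>. \<xi> \<in> U \<Longrightarrow> \<pi> \<xi> = \<xi>"
    using subsp_projection[OF V' U] by metis
  have "\<pi> \<xi> = \<xi>" if \<xi>: "\<xi> \<in> carrier (dual_space V)" for \<xi>
  proof (rule dual_space_separates[OF V' _ \<xi>])
    show "\<pi> \<xi> \<in> carrier (dual_space V)"
      using \<pi>(2)[OF \<xi>] subspD(1)[OF U] by simp
    fix \<Lambda> assume \<Lambda>: "\<Lambda> \<in> carrier (dual_space (dual_space V))"
    \<comment> \<open>This is \<open>\<Lambda>\<close> composed with the difference of
      \<open>\<pi>\<close> and the identity. It vanishes on \<open>U\<close>, so it is evaluation at
      the vector zero.\<close>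
    let ?\<Lambda> = "restrict (\<lambda>\<xi>. \<Lambda> (\<pi> \<xi>) - \<Lambda> \<xi>) (carrier (dual_space V))"
    have "?\<Lambda> \<in> carrier (dual_space (dual_space V))"
      by (rule dual_restrictI[OF V1'])
        (use \<Lambda> \<pi>(1) in \<open>simp_all add: linear_maps_add linear_maps_smult linear_maps_closed dual_add dual_smult algebra_simps\<close>)
    then obtain v where v: "v \<in> carrier V" "\<And>\<xi>. \<xi> \<in> carrier (dual_space V) \<Longrightarrow> ?\<Lambda> \<xi> = \<xi> v"
      using dual_space_reflexive[OF V] by blast
    have "v = \<zero>\<^bsub>V\<^esub>"
    proof (rule sep[OF v(1)])
      show "\<xi> v = 0" if "\<xi> \<in> U" for \<xi>
        using v(2)[of \<xi>] that subspD(1)[OF U that] \<pi>(3) by simp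
    qed
    then show "\<Lambda> (\<pi> \<xi>) = \<Lambda> \<xi>"
      using v(2)[OF \<xi>] \<xi> dual_zero[OF V1 \<xi>] by simp
  qed
  then show ?thesis
    using \<pi>(2) subspD(1)[OF U] by (metis subsetI subset_antisym)
qed


subsection \<open>Quotients and tensor products\<close>

definition coset :: "('k::field, 'v) module \<Rightarrow> 'v set \<Rightarrow> 'v \<Rightarrow> 'v set" where
  "coset V U v = U +>\<^bsub>V\<^esub> v"

lemma coset_explicit: "coset V U v = {u \<oplus>\<^bsub>V\<^esub> v | u. u \<in> U}"
  by (auto simp: coset_def a_r_coset_def')

context
  fixes V :: "('k::field, 'v) module" and U
  assumes V: "vectorspace class_ring V" and U: "subsp V U"
begin

lemma coset_eq_iff:
  assumes "v \<in> carrier V" "w \<in> carrier V"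
  shows "coset V U v = coset V U w \<longleftrightarrow> v \<oplus>\<^bsub>V\<^esub> (-1) \<odot>\<^bsub>V\<^esub> w \<in> U"
proof
  assume *: "coset V U v = coset V U w"
  have "v \<in> coset V U v"
    using subspD(2)[OF U] vs_zero_add[OF V assms(1)] by (force simp: coset_explicit)
  then obtain u where u: "u \<in> U" "v = u \<oplus>\<^bsub>V\<^esub> w"
    unfolding * by (auto simp: coset_explicit)
  then show "v \<oplus>\<^bsub>V\<^esub> (-1) \<odot>\<^bsub>V\<^esub> w \<in> U"
    using assms subspD(1)[OF U u(1)] by (simp add: vs_simps[OF V] vs_assoc[OF V])
next
  have sub: "coset V U v \<subseteq> coset V U w"
    if vw: "v \<in> carrier V" "w \<in> carrier V" "v \<oplus>\<^bsub>V\<^esub> (-1) \<odot>\<^bsub>V\<^esub> w \<in> U" for v w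
  proof
    fix x assume "x \<in> coset V U v"
    then obtain u where u: "u \<in> U" "x = u \<oplus>\<^bsub>V\<^esub> v"
      by (auto simp: coset_explicit)
    have "(-1) \<odot>\<^bsub>V\<^esub> w \<oplus>\<^bsub>V\<^esub> w = \<zero>\<^bsub>V\<^esub>"
      using vw by (simp add: vs_simps[OF V] vs_comm[OF V, of _ w])
    then have "x = (u \<oplus>\<^bsub>V\<^esub> (v \<oplus>\<^bsub>V\<^esub> (-1) \<odot>\<^bsub>V\<^esub> w)) \<oplus>\<^bsub>V\<^esub> w"
      using vw u subspD(1)[OF U u(1)] by (simp add: vs_simps[OF V] vs_assoc[OF V])
    then show "x \<in> coset V U w"
      using subspD(3)[OF U u(1) vw(3)] by (auto simp: coset_explicit)
  qed
  assume *: "v \<oplus>\<^bsub>V\<^esub> (-1) \<odot>\<^bsub>V\<^esub> w \<in> U"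
  have "w \<oplus>\<^bsub>V\<^esub> (-1) \<odot>\<^bsub>V\<^esub> v = (-1) \<odot>\<^bsub>V\<^esub> (v \<oplus>\<^bsub>V\<^esub> (-1) \<odot>\<^bsub>V\<^esub> w)"
    using assms vs_smult_assoc[OF V, of w "-1" "-1"]
    by (simp add: vs_simps[OF V] vs_comm[OF V, of w])
  also have "\<dots> \<in> U"
    using subspD(4)[OF U *] .
  finally show "coset V U v = coset V U w"
    using sub[OF assms *] sub[OF assms(2,1)] by blast
qed

lemma coset_add:
  assumes "v \<in> carrier V" "w \<in> carrier V"
  shows "coset V U v \<oplus>\<^bsub>quotient_space V U\<^esub> coset V U w = coset V U (v \<oplus>\<^bsub>V\<^esub> w)"
proof -
  have e: "coset V U v \<oplus>\<^bsub>quotient_space V U\<^esub> coset V U w = {(u \<oplus>\<^bsub>V\<^esub> v) \<oplus>\<^bsub>V\<^esub> (u' \<oplus>\<^bsub>V\<^esub> w) | u u'. u \<in> U \<and> u' \<in> U}"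
    by (auto simp: quotient_space_def set_add_def' coset_explicit)
  have *: "(u \<oplus>\<^bsub>V\<^esub> v) \<oplus>\<^bsub>V\<^esub> (u' \<oplus>\<^bsub>V\<^esub> w) = (u \<oplus>\<^bsub>V\<^esub> u') \<oplus>\<^bsub>V\<^esub> (v \<oplus>\<^bsub>V\<^esub> w)" if "u \<in> U" "u' \<in> U" for u u'
    using assms subspD(1)[OF U] that by (simp add: vs_simps[OF V] vs_assoc[OF V] vs_lcomm[OF V, of v u'])
  show ?thesis
  proof
    show "coset V U v \<oplus>\<^bsub>quotient_space V U\<^esub> coset V U w \<subseteq> coset V U (v \<oplus>\<^bsub>V\<^esub> w)"
    proof
      fix x assume "x \<in> coset V U v \<oplus>\<^bsub>quotient_space V U\<^esub> coset V U w"
      then obtain u u' where u: "u \<in> U" "u' \<in> U" "x = (u \<oplus>\<^bsub>V\<^esub> v) \<oplus>\<^bsub>V\<^esub> (u' \<oplus>\<^bsub>V\<^esub> w)"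
        unfolding e by blast
      then show "x \<in> coset V U (v \<oplus>\<^bsub>V\<^esub> w)"
        unfolding coset_explicit u(3) *[OF u(1,2)] using subspD(3)[OF U u(1,2)] by blast
    qed
    show "coset V U (v \<oplus>\<^bsub>V\<^esub> w) \<subseteq> coset V U v \<oplus>\<^bsub>quotient_space V U\<^esub> coset V U w"
    proof
      fix x assume "x \<in> coset V U (v \<oplus>\<^bsub>V\<^esub> w)"
      then obtain u where u: "u \<in> U" "x = u \<oplus>\<^bsub>V\<^esub> (v \<oplus>\<^bsub>V\<^esub> w)"
        by (auto simp: coset_explicit)
      then have "x = (u \<oplus>\<^bsub>V\<^esub> v) \<oplus>\<^bsub>V\<^esub> (\<zero>\<^bsub>V\<^esub> \<oplus>\<^bsub>V\<^esub> w)"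
        using assms subspD(1)[OF U u(1)] by (simp add: vs_simps[OF V] vs_assoc[OF V])
      then show "x \<in> coset V U v \<oplus>\<^bsub>quotient_space V U\<^esub> coset V U w"
        unfolding e using u(1) subspD(2)[OF U] by blast
    qed
  qed
qed

text \<open>The multiple is defined as a union over representatives; all cosets in that union
  coincide, also for \<open>a = 0\<close>.\<close>

lemma coset_smult:
  assumes "v \<in> carrier V"
  shows "a \<odot>\<^bsub>quotient_space V U\<^esub> coset V U v = coset V U (a \<odot>\<^bsub>V\<^esub> v)"
proof -
  have "coset V U (a \<odot>\<^bsub>V\<^esub> (u \<oplus>\<^bsub>V\<^esub> v)) = coset V U (a \<odot>\<^bsub>V\<^esub> v)" if u: "u \<in> U" for u
  proof -
    note [simp] = assms subspD(1)[OF U u]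
    have "a \<odot>\<^bsub>V\<^esub> (u \<oplus>\<^bsub>V\<^esub> v) \<oplus>\<^bsub>V\<^esub> (-1) \<odot>\<^bsub>V\<^esub> (a \<odot>\<^bsub>V\<^esub> v) = a \<odot>\<^bsub>V\<^esub> u"
      by (simp add: vs_simps[OF V] vs_assoc[OF V])
    then show ?thesis
      using subspD(4)[OF U u, of a] by (subst coset_eq_iff) (auto simp: vs_simps[OF V])
  qed
  moreover have "\<exists>u. u \<in> U"
    using subspD(2)[OF U] by blast
  ultimately show ?thesis
    by (auto simp: quotient_space_def coset_def[symmetric] coset_explicit[of V U v])
qed

lemma coset_closed: "v \<in> carrier V \<Longrightarrow> coset V U v \<in> carrier (quotient_space V U)"
  by (auto simp: quotient_space_def coset_def A_RCOSETS_def')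

lemma coset_cases:
  assumes "x \<in> carrier (quotient_space V U)"
  obtains v where "v \<in> carrier V" "x = coset V U v"
  using assms by (auto simp: quotient_space_def coset_def A_RCOSETS_def')

lemma coset_zero: "\<zero>\<^bsub>quotient_space V U\<^esub> = coset V U \<zero>\<^bsub>V\<^esub>"
proof -
  have "u = u \<oplus>\<^bsub>V\<^esub> \<zero>\<^bsub>V\<^esub>" if "u \<in> U" for u
    using subspD(1)[OF U] that by (simp add: vs_simps[OF V])
  then show ?thesis
    by (force simp: quotient_space_def coset_explicit)
qed

lemma vectorspace_quotient: "vectorspace class_ring (quotient_space V U)"
  by (rule vectorspace_classI; (elim coset_cases)?)
    (simp_all add: coset_zero coset_add coset_smult coset_closed vs_simps[OF V] vs_assoc[OF V]
      vs_add_smult[OF V] vs_smult_assoc[OF V], simp add: vs_comm[OF V])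

lemma quotient_lift:
  assumes Z: "vectorspace class_ring Z" and f: "f \<in> linear_maps V Z" and 0: "\<And>u. u \<in> U \<Longrightarrow> f u = \<zero>\<^bsub>Z\<^esub>"
  obtains g where "g \<in> linear_maps (quotient_space V U) Z" "\<And>v. v \<in> carrier V \<Longrightarrow> g (coset V U v) = f v"
proof -
  define g where "g x = f (SOME v. v \<in> carrier V \<and> x = coset V U v)" for x
  have g: "g (coset V U v) = f v" if v: "v \<in> carrier V" for v
  proof -
    let ?w = "SOME w. w \<in> carrier V \<and> coset V U v = coset V U w"
    have w: "?w \<in> carrier V" "coset V U v = coset V U ?w"
      using someI[of "\<lambda>w. w \<in> carrier V \<and> coset V U v = coset V U w" v] v by auto
    have "f (v \<oplus>\<^bsub>V\<^esub> (-1) \<odot>\<^bsub>V\<^esub> ?w) = \<zero>\<^bsub>Z\<^esub>"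
      using w coset_eq_iff[OF v w(1)] by (intro 0) simp
    then have "f v \<oplus>\<^bsub>Z\<^esub> (-1) \<odot>\<^bsub>Z\<^esub> f ?w = \<zero>\<^bsub>Z\<^esub>"
      using v w(1) by (simp add: linear_maps_add[OF f] linear_maps_smult[OF f] vs_simps[OF V])
    then have "f v = f ?w"
      by (rule vs_eqI[OF Z linear_maps_closed[OF f v] linear_maps_closed[OF f w(1)]])
    then show ?thesis
      by (simp add: g_def)
  qed
  show thesis
  proof (rule that)
    show "g \<in> linear_maps (quotient_space V U) Z"
      by (rule linear_mapsI; (elim coset_cases)?)
        (simp_all add: coset_add coset_smult g vs_simps[OF V] linear_maps_closed[OF f]
          linear_maps_add[OF f] linear_maps_smult[OF f])
  qed (rule g)
qed

end

section \<open>Free spaces\<close>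

lemma vectorspace_free: "vectorspace class_ring (free_space S :: ('k::field, 's \<Rightarrow> 'k) module)"
proof -
  have fin: "finite {s. c s + d s \<noteq> 0}" if "finite {s. c s \<noteq> 0}" "finite {s. d s \<noteq> 0}" for c d :: "'s \<Rightarrow> 'k"
    by (rule finite_subset[of _ "{s. c s \<noteq> 0} \<union> {s. d s \<noteq> 0}"]) (use that in auto)
  have fin': "finite {s. a \<noteq> 0 \<and> c s \<noteq> 0}" if "finite {s. c s \<noteq> 0}" for a and c :: "'s \<Rightarrow> 'k"
    by (rule finite_subset[of _ "{s. c s \<noteq> 0}"]) (use that in auto)
  show ?thesis
    by (rule vectorspace_classI)
      (auto simp: free_space_def fin fin' algebra_simps fun_eq_iff, metis (mono_tags) add_0 mem_Collect_eq subsetD)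
qed

lemma single_in_free: "s \<in> S \<Longrightarrow> single s \<in> carrier (free_space S :: ('k::field, 's \<Rightarrow> 'k) module)"
proof -
  have "{x. single s x \<noteq> (0::'k)} = {s}"
    by (auto simp: single_def)
  then show "s \<in> S \<Longrightarrow> ?thesis"
    by (simp add: free_space_def)
qed

text \<open>Induction on a finite set containing the support, splitting off one point at a
  time.\<close>

lemma free_space_induct:
  fixes N :: "('s \<Rightarrow> 'k::field) set"
  assumes N: "subsp (free_space S) N" and single: "\<And>s. s \<in> S \<Longrightarrow> single s \<in> N"
    and c: "c \<in> carrier (free_space S)"
  shows "c \<in> N"
proof -
  have "\<And>c. c \<in> carrier (free_space S) \<Longrightarrow> {s. c s \<noteq> 0} \<subseteq> A \<Longrightarrow> c \<in> N" if "finite A" for A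
    using that
  proof induction
    case empty
    then have "c = \<zero>\<^bsub>free_space S\<^esub>"
      by (auto simp: free_space_def)
    then show ?case
      using subspD(2)[OF N] by simp
  next
    case (insert s A)
    show ?case
    proof (cases "c s = 0")
      case True
      then show ?thesis
        using insert by auto
    next
      case False
      then have sS: "s \<in> S"
        using insert.prems by (auto simp: free_space_def)
      let ?d = "\<lambda>x. if x = s then 0 else c x"
      have "finite {x. ?d x \<noteq> 0}"
        by (rule finite_subset[of _ "{x. c x \<noteq> 0}"]) (use insert.prems in \<open>auto simp: free_space_def\<close>)
      then have "?d \<in> carrier (free_space S)"
        using insert.prems by (auto simp: free_space_def)
      then have "?d \<in> N"
        by (rule insert.IH) (use insert.prems in auto)
      moreover have "c s \<odot>\<^bsub>free_space S\<^esub> single s \<in> N"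
        using subspD(4)[OF N single[OF sS]] .
      moreover have "c = ?d \<oplus>\<^bsub>free_space S\<^esub> c s \<odot>\<^bsub>free_space S\<^esub> single s"
        by (auto simp: free_space_def single_def fun_eq_iff)
      ultimately show ?thesis
        using subspD(3)[OF N] by metis
    qed
  qed
  moreover have "finite {s. c s \<noteq> 0}"
    using c by (simp add: free_space_def)
  ultimately show ?thesis
    using c by blast
qed

text \<open>The extension is written coordinate by coordinate in a basis of \<open>Z\<close>. Each
  coordinate is a sum of field elements over the support, so the ordinary finite sum applies;
  \<open>vsum\<close> is left for the fixed index range of the basis.\<close>

lemma free_space_lift:
  fixes Z :: "('k::field, 'z) module"
  assumes Z: "fdvs Z" and B: "\<And>s. s \<in> S \<Longrightarrow> B s \<in> carrier Z"
  obtains f where "f \<in> linear_maps (free_space S) Z" "\<And>s. s \<in> S \<Longrightarrow> f (single s) = B s"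
proof -
  note Z1 = fdvs_vectorspace[OF Z]
  obtain n e \<epsilon> where b: "dual_basis Z n e \<epsilon>"
    using Z by (rule fdvsE)
  define l where "l k c = (\<Sum>s | c s \<noteq> 0. c s * \<epsilon> k (B s))" for k and c :: "'a \<Rightarrow> 'k"
  have l: "l k c = (\<Sum>s\<in>A. c s * \<epsilon> k (B s))" if "finite A" "{s. c s \<noteq> 0} \<subseteq> A" for k c A
    unfolding l_def by (rule sum.mono_neutral_left) (use that in auto)
  have l_add: "l k (\<lambda>s. c s + d s) = l k c + l k d" if "finite {s. c s \<noteq> 0}" "finite {s. d s \<noteq> 0}" for k c d
  proof -
    let ?A = "{s. c s \<noteq> 0} \<union> {s. d s \<noteq> 0}"
    have "l k (\<lambda>s. c s + d s) = (\<Sum>s\<in>?A. (c s + d s) * \<epsilon> k (B s))"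
      by (rule l) (use that in auto)
    moreover have "l k c = (\<Sum>s\<in>?A. c s * \<epsilon> k (B s))"
      by (rule l) (use that in auto)
    moreover have "l k d = (\<Sum>s\<in>?A. d s * \<epsilon> k (B s))"
      by (rule l) (use that in auto)
    ultimately show ?thesis
      by (simp add: algebra_simps sum.distrib)
  qed
  have l_smult: "l k (\<lambda>s. a * c s) = a * l k c" if "finite {s. c s \<noteq> 0}" for k a c
  proof -
    have "l k (\<lambda>s. a * c s) = (\<Sum>s | c s \<noteq> 0. (a * c s) * \<epsilon> k (B s))"
      by (rule l) (use that in auto)
    then show ?thesis
      by (simp add: l_def sum_distrib_left mult.assoc)
  qed
  have l_single: "l k (single s) = \<epsilon> k (B s)" for k s
    using l[of "{s}" "single s" k] by (auto simp: single_def)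
  let ?f = "\<lambda>c. vsum Z (\<lambda>k. l k c \<odot>\<^bsub>Z\<^esub> e k) n"
  note cl = dual_basisD(1)[OF b] vs_smult_closed[OF Z1]
  show thesis
  proof
    show "?f \<in> linear_maps (free_space S) Z"
    proof (rule linear_mapsI)
      show "?f c \<in> carrier Z" for c
        by (rule vsum_closed[OF Z1]) (simp add: cl)
    next
      fix c d :: "'a \<Rightarrow> 'k" assume "c \<in> carrier (free_space S)" "d \<in> carrier (free_space S)"
      then show "?f (c \<oplus>\<^bsub>free_space S\<^esub> d) = ?f c \<oplus>\<^bsub>Z\<^esub> ?f d"
        by (simp add: free_space_def l_add vsum_add[OF Z1, symmetric] cl vs_add_smult[OF Z1] cong: vsum_cong)
    next
      fix a and c :: "'a \<Rightarrow> 'k" assume "c \<in> carrier (free_space S)"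
      then show "?f (a \<odot>\<^bsub>free_space S\<^esub> c) = a \<odot>\<^bsub>Z\<^esub> ?f c"
        by (simp add: free_space_def l_smult vsum_smult[OF Z1, symmetric] cl vs_smult_assoc[OF Z1] cong: vsum_cong)
    qed
    show "?f (single s) = B s" if "s \<in> S" for s
      using dual_basisD(4)[OF b B[OF that]] by (simp add: l_single)
  qed
qed

section \<open>Tensor products of vector spaces\<close>

context
  fixes V :: "('k::field, 'v) module" and W :: "('k, 'w) module"
  assumes V: "vectorspace class_ring V" and W: "vectorspace class_ring W"
begin

abbreviation (input) "FS \<equiv> free_space (carrier V \<times> carrier W) :: ('k, 'v \<times> 'w \<Rightarrow> 'k) module"

lemma free_add_apply: "(c \<oplus>\<^bsub>free_space S\<^esub> d) = (\<lambda>s. c s + d s)"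
  and free_smult_apply: "(a \<odot>\<^bsub>free_space S\<^esub> c) = (\<lambda>s. a * c s)"
  by (simp_all add: free_space_def)

lemma tensor_relations_free: "tensor_relations V W \<subseteq> carrier FS"
proof -
  have F: "vectorspace class_ring FS"
    by (rule vectorspace_free)
  have *: "(\<lambda>x. c x - d x - d' x) \<in> carrier FS" "(\<lambda>x. c x - a * d x) \<in> carrier FS"
    if "c \<in> carrier FS" "d \<in> carrier FS" "d' \<in> carrier FS" for c d d' and a :: 'k
  proof -
    have "c \<oplus>\<^bsub>FS\<^esub> (-1) \<odot>\<^bsub>FS\<^esub> d \<oplus>\<^bsub>FS\<^esub> (-1) \<odot>\<^bsub>FS\<^esub> d' \<in> carrier FS"
      "c \<oplus>\<^bsub>FS\<^esub> (-a) \<odot>\<^bsub>FS\<^esub> d \<in> carrier FS"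
      using that by (intro vs_add_closed[OF F] vs_smult_closed[OF F]; simp)+
    then show "(\<lambda>x. c x - d x - d' x) \<in> carrier FS" "(\<lambda>x. c x - a * d x) \<in> carrier FS"
      by (simp_all add: free_add_apply free_smult_apply)
  qed
  show ?thesis
    unfolding tensor_relations_def
    by (auto intro!: * single_in_free simp: vs_simps[OF V] vs_simps[OF W])
qed

lemma tensor_kernel_least:
  assumes "subsp FS N" "tensor_relations V W \<subseteq> N"
  shows "tensor_kernel V W \<subseteq> N"
proof -
  interpret F: vectorspace class_ring FS
    by (rule vectorspace_free)
  have "submodule class_ring N FS"
    using assms(1) by (auto simp: submodule_def subsp_def F.module_axioms)
  then show ?thesis
    unfolding tensor_kernel_def by (rule F.span_is_subset[OF assms(2)])
qed

lemma tensor_kernel: "subsp FS (tensor_kernel V W)" "tensor_relations V W \<subseteq> tensor_kernel V W"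
proof -
  interpret F: vectorspace class_ring FS
    by (rule vectorspace_free)
  have s: "submodule class_ring (F.span (tensor_relations V W)) FS"
    by (rule F.span_is_submodule[OF tensor_relations_free])
  interpret s: submodule class_ring "F.span (tensor_relations V W)" FS
    by (rule s)
  obtain x where "x \<in> F.span (tensor_relations V W)"
    using s.subset s unfolding submodule_def by blast
  then show "subsp FS (tensor_kernel V W)"
    using s unfolding tensor_kernel_def subsp_def submodule_def by auto
  show "tensor_relations V W \<subseteq> tensor_kernel V W"
    unfolding tensor_kernel_def by (rule F.in_own_span[OF tensor_relations_free])
qed

lemma vectorspace_tensor: "vectorspace class_ring (tensor_space V W)"
  unfolding tensor_space_def by (rule vectorspace_quotient[OF vectorspace_free tensor_kernel(1)])

lemma pure_tensor_coset: "pure_tensor V W v w = coset FS (tensor_kernel V W) (single (v, w))"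
  by (simp add: pure_tensor_def coset_def)

lemma pure_tensor_closed:
  "v \<in> carrier V \<Longrightarrow> w \<in> carrier W \<Longrightarrow> pure_tensor V W v w \<in> carrier (tensor_space V W)"
  unfolding pure_tensor_coset tensor_space_def
  by (rule coset_closed[OF vectorspace_free tensor_kernel(1)]) (simp add: single_in_free)

lemma coset_tensor_eqI:
  assumes "c \<in> carrier FS" "d \<in> carrier FS" "(\<lambda>x. c x - d x) \<in> tensor_relations V W"
  shows "coset FS (tensor_kernel V W) c = coset FS (tensor_kernel V W) d"
  using coset_eq_iff[OF vectorspace_free tensor_kernel(1) assms(1,2)] tensor_kernel(2) assms(3)
  by (auto simp: free_add_apply free_smult_apply)

lemma pure_tensor_add_left:
  assumes "v \<in> carrier V" "v' \<in> carrier V" "w \<in> carrier W"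
  shows "pure_tensor V W (v \<oplus>\<^bsub>V\<^esub> v') w = pure_tensor V W v w \<oplus>\<^bsub>tensor_space V W\<^esub> pure_tensor V W v' w"
proof -
  have F: "vectorspace class_ring FS"
    by (rule vectorspace_free)
  have s: "single (v, w) \<in> carrier FS" "single (v', w) \<in> carrier FS" "single (v \<oplus>\<^bsub>V\<^esub> v', w) \<in> carrier FS"
    using assms by (auto intro!: single_in_free simp: vs_simps[OF V])
  show ?thesis
    unfolding pure_tensor_coset tensor_space_def coset_add[OF F tensor_kernel(1) s(1,2)]
  proof (rule coset_tensor_eqI[OF s(3) vs_add_closed[OF F s(1,2)]])
    show "(\<lambda>x. single (v \<oplus>\<^bsub>V\<^esub> v', w) x - (single (v, w) \<oplus>\<^bsub>FS\<^esub> single (v', w)) x) \<in> tensor_relations V W"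
      unfolding free_add_apply diff_diff_eq[symmetric] tensor_relations_def using assms by blast
  qed
qed

lemma pure_tensor_add_right:
  assumes "v \<in> carrier V" "w \<in> carrier W" "w' \<in> carrier W"
  shows "pure_tensor V W v (w \<oplus>\<^bsub>W\<^esub> w') = pure_tensor V W v w \<oplus>\<^bsub>tensor_space V W\<^esub> pure_tensor V W v w'"
proof -
  have F: "vectorspace class_ring FS"
    by (rule vectorspace_free)
  have s: "single (v, w) \<in> carrier FS" "single (v, w') \<in> carrier FS" "single (v, w \<oplus>\<^bsub>W\<^esub> w') \<in> carrier FS"
    using assms by (auto intro!: single_in_free simp: vs_simps[OF W])
  show ?thesis
    unfolding pure_tensor_coset tensor_space_def coset_add[OF F tensor_kernel(1) s(1,2)]
  proof (rule coset_tensor_eqI[OF s(3) vs_add_closed[OF F s(1,2)]])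
    show "(\<lambda>x. single (v, w \<oplus>\<^bsub>W\<^esub> w') x - (single (v, w) \<oplus>\<^bsub>FS\<^esub> single (v, w')) x) \<in> tensor_relations V W"
      unfolding free_add_apply diff_diff_eq[symmetric] tensor_relations_def using assms by blast
  qed
qed

lemma pure_tensor_smult_left:
  assumes "v \<in> carrier V" "w \<in> carrier W"
  shows "pure_tensor V W (a \<odot>\<^bsub>V\<^esub> v) w = a \<odot>\<^bsub>tensor_space V W\<^esub> pure_tensor V W v w"
proof -
  have F: "vectorspace class_ring FS"
    by (rule vectorspace_free)
  have s: "single (v, w) \<in> carrier FS" "single (a \<odot>\<^bsub>V\<^esub> v, w) \<in> carrier FS"
    using assms by (auto intro!: single_in_free simp: vs_simps[OF V])
  show ?thesis
    unfolding pure_tensor_coset tensor_space_def coset_smult[OF F tensor_kernel(1) s(1)]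
  proof (rule coset_tensor_eqI[OF s(2) vs_smult_closed[OF F s(1)]])
    show "(\<lambda>x. single (a \<odot>\<^bsub>V\<^esub> v, w) x - (a \<odot>\<^bsub>FS\<^esub> single (v, w)) x) \<in> tensor_relations V W"
      unfolding free_smult_apply tensor_relations_def using assms by blast
  qed
qed

lemma pure_tensor_smult_right:
  assumes "v \<in> carrier V" "w \<in> carrier W"
  shows "pure_tensor V W v (a \<odot>\<^bsub>W\<^esub> w) = a \<odot>\<^bsub>tensor_space V W\<^esub> pure_tensor V W v w"
proof -
  have F: "vectorspace class_ring FS"
    by (rule vectorspace_free)
  have s: "single (v, w) \<in> carrier FS" "single (v, a \<odot>\<^bsub>W\<^esub> w) \<in> carrier FS"
    using assms by (auto intro!: single_in_free simp: vs_simps[OF W])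
  show ?thesis
    unfolding pure_tensor_coset tensor_space_def coset_smult[OF F tensor_kernel(1) s(1)]
  proof (rule coset_tensor_eqI[OF s(2) vs_smult_closed[OF F s(1)]])
    show "(\<lambda>x. single (v, a \<odot>\<^bsub>W\<^esub> w) x - (a \<odot>\<^bsub>FS\<^esub> single (v, w)) x) \<in> tensor_relations V W"
      unfolding free_smult_apply tensor_relations_def using assms by blast
  qed
qed

text \<open>The cosets of the generators of the free space are the pure tensors, so
  \<open>free_space_induct\<close> applies to the preimage of \<open>N\<close>.\<close>

lemma tensor_space_induct:
  assumes N: "subsp (tensor_space V W) N"
    and pure: "\<And>v w. \<lbrakk>v \<in> carrier V; w \<in> carrier W\<rbrakk> \<Longrightarrow> pure_tensor V W v w \<in> N"
    and t: "t \<in> carrier (tensor_space V W)"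
  shows "t \<in> N"
proof -
  have F: "vectorspace class_ring FS"
    by (rule vectorspace_free)
  note K = tensor_kernel(1)
  let ?c = "coset FS (tensor_kernel V W)"
  obtain c where c: "c \<in> carrier FS" "t = ?c c"
    using t unfolding tensor_space_def by (rule coset_cases[OF F K])
  have "subsp FS {c \<in> carrier FS. ?c c \<in> N}"
    unfolding subsp_def
  proof (intro conjI allI ballI)
    show "\<zero>\<^bsub>FS\<^esub> \<in> {c \<in> carrier FS. ?c c \<in> N}"
      using subspD(2)[OF N] coset_zero[OF F K] vs_zero_closed[OF F] by (simp add: tensor_space_def)
  next
    fix c d assume "c \<in> {c \<in> carrier FS. ?c c \<in> N}" "d \<in> {c \<in> carrier FS. ?c c \<in> N}"
    then show "c \<oplus>\<^bsub>FS\<^esub> d \<in> {c \<in> carrier FS. ?c c \<in> N}"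
      using coset_add[OF F K, of c d] subspD(3)[OF N, of "?c c" "?c d"] vs_add_closed[OF F]
      by (simp add: tensor_space_def)
  next
    fix a c assume "c \<in> {c \<in> carrier FS. ?c c \<in> N}"
    then show "a \<odot>\<^bsub>FS\<^esub> c \<in> {c \<in> carrier FS. ?c c \<in> N}"
      using coset_smult[OF F K, of c a] subspD(4)[OF N, of "?c c" a] vs_smult_closed[OF F]
      by (simp add: tensor_space_def)
  qed auto
  then have "c \<in> {c \<in> carrier FS. ?c c \<in> N}"
    by (rule free_space_induct[OF _ _ c(1)]) (use pure in \<open>auto simp: pure_tensor_coset intro!: single_in_free\<close>)
  then show ?thesis
    using c by simp
qed

text \<open>Bilinearity of \<open>B\<close> says that its extension to the free space kills each of
  the four kinds of relations, hence the kernel, and so descends to the quotient.\<close>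

lemma tensor_space_lift:
  fixes Z :: "('k, 'z) module"
  assumes Z: "fdvs Z"
    and left: "\<And>w. w \<in> carrier W \<Longrightarrow> (\<lambda>v. B v w) \<in> linear_maps V Z"
    and right: "\<And>v. v \<in> carrier V \<Longrightarrow> (\<lambda>w. B v w) \<in> linear_maps W Z"
  obtains f where "f \<in> linear_maps (tensor_space V W) Z"
    "\<And>v w. \<lbrakk>v \<in> carrier V; w \<in> carrier W\<rbrakk> \<Longrightarrow> f (pure_tensor V W v w) = B v w"
proof -
  note Z1 = fdvs_vectorspace[OF Z]
  have F: "vectorspace class_ring FS"
    by (rule vectorspace_free)
  have BZ: "B v w \<in> carrier Z" if "v \<in> carrier V" "w \<in> carrier W" for v w
    using linear_maps_closed[OF left] that by blast
  obtain g where g: "g \<in> linear_maps FS Z" "\<And>s. s \<in> carrier V \<times> carrier W \<Longrightarrow> g (single s) = case_prod B s"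
    by (rule free_space_lift[OF Z, of "carrier V \<times> carrier W" "case_prod B"]) (auto simp: BZ)
  have gs: "g (single (v, w)) = B v w" if "v \<in> carrier V" "w \<in> carrier W" for v w
    using g(2)[of "(v, w)"] that by simp
  have sub: "subsp FS {c \<in> carrier FS. g c = \<zero>\<^bsub>Z\<^esub>}"
    using linear_maps_zero[OF F Z1 g(1)]
    by (auto simp: subsp_def vs_simps[OF F] vs_simps[OF Z1] linear_maps_add[OF g(1)] linear_maps_smult[OF g(1)])
  have 3: "g (\<lambda>x. c x - d x - d' x) = \<zero>\<^bsub>Z\<^esub>"
    if "c \<in> carrier FS" "d \<in> carrier FS" "d' \<in> carrier FS" "g c = g d \<oplus>\<^bsub>Z\<^esub> g d'" for c d d'
  proof -
    have *: "(\<lambda>x. c x - d x - d' x) = c \<oplus>\<^bsub>FS\<^esub> (-1) \<odot>\<^bsub>FS\<^esub> (d \<oplus>\<^bsub>FS\<^esub> d')"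
      by (simp add: free_add_apply free_smult_apply algebra_simps)
    show ?thesis
      unfolding * using that linear_maps_closed[OF g(1)]
      by (simp add: linear_maps_add[OF g(1)] linear_maps_smult[OF g(1)] vs_add_closed[OF F] vs_smult_closed[OF F] vs_add_closed[OF Z1] vs_neg[OF Z1])
  qed
  have 2: "g (\<lambda>x. c x - a * d x) = \<zero>\<^bsub>Z\<^esub>"
    if "c \<in> carrier FS" "d \<in> carrier FS" "g c = a \<odot>\<^bsub>Z\<^esub> g d" for a c d
  proof -
    have *: "(\<lambda>x. c x - a * d x) = c \<oplus>\<^bsub>FS\<^esub> (-1) \<odot>\<^bsub>FS\<^esub> (a \<odot>\<^bsub>FS\<^esub> d)"
      by (simp add: free_add_apply free_smult_apply algebra_simps)
    show ?thesis
      unfolding * using that linear_maps_closed[OF g(1)]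
      by (simp add: linear_maps_add[OF g(1)] linear_maps_smult[OF g(1)] vs_smult_closed[OF F] vs_smult_closed[OF Z1] vs_neg[OF Z1])
  qed
  have "tensor_relations V W \<subseteq> {c \<in> carrier FS. g c = \<zero>\<^bsub>Z\<^esub>}"
  proof
    fix c assume c: "c \<in> tensor_relations V W"
    have "g c = \<zero>\<^bsub>Z\<^esub>"
      using c unfolding tensor_relations_def
      by (auto simp: gs vs_simps[OF V] vs_simps[OF W] linear_maps_add[OF left] linear_maps_smult[OF left]
          linear_maps_add[OF right] linear_maps_smult[OF right] intro!: 3 2 single_in_free)
    then show "c \<in> {c \<in> carrier FS. g c = \<zero>\<^bsub>Z\<^esub>}"
      using c tensor_relations_free by blast
  qed
  then have "tensor_kernel V W \<subseteq> {c \<in> carrier FS. g c = \<zero>\<^bsub>Z\<^esub>}"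
    by (rule tensor_kernel_least[OF sub])
  then obtain f where f: "f \<in> linear_maps (quotient_space FS (tensor_kernel V W)) Z"
    "\<And>c. c \<in> carrier FS \<Longrightarrow> f (coset FS (tensor_kernel V W) c) = g c"
    using quotient_lift[OF F tensor_kernel(1) Z1 g(1)] by blast
  show thesis
    using that[of f] f unfolding tensor_space_def pure_tensor_coset by (simp add: single_in_free gs)
qed

text \<open>Sums of this shape form a subspace, and it contains the pure tensors, as one sees by
  expanding the left factor in the basis and moving scalars to the right. Uniqueness of
  \<open>r\<close> is recovered where it matters from the projections of a power.\<close>

lemma tensor_space_basis_expand:
  assumes b: "dual_basis V n e \<epsilon>" and t: "t \<in> carrier (tensor_space V W)"
  shows "\<exists>r. (\<forall>k<n. r k \<in> carrier W) \<and> t = vsum (tensor_space V W) (\<lambda>k. pure_tensor V W (e k) (r k)) n"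
proof -
  note T = vectorspace_tensor
  let ?s = "\<lambda>r. vsum (tensor_space V W) (\<lambda>k. pure_tensor V W (e k) (r k)) n"
  let ?N = "{?s r | r. \<forall>k<n. r k \<in> carrier W}"
  note pc = pure_tensor_closed[OF dual_basisD(1)[OF b]]
  have "subsp (tensor_space V W) ?N"
    unfolding subsp_def
  proof (intro conjI allI ballI)
    show "?N \<subseteq> carrier (tensor_space V W)"
      by (auto intro!: vsum_closed[OF T] pc)
    have "pure_tensor V W (e k) \<zero>\<^bsub>W\<^esub> = \<zero>\<^bsub>tensor_space V W\<^esub>" if "k < n" for k
      using pure_tensor_smult_right[OF dual_basisD(1)[OF b that] vs_zero_closed[OF W], of 0]
        pc[OF that vs_zero_closed[OF W]] by (simp add: vs_simps[OF W] vs_simps[OF T])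
    then have "?s (\<lambda>_. \<zero>\<^bsub>W\<^esub>) = vsum (tensor_space V W) (\<lambda>_. \<zero>\<^bsub>tensor_space V W\<^esub>) n"
      by (intro vsum_cong) simp
    also have "\<dots> = \<zero>\<^bsub>tensor_space V W\<^esub>"
      by (induction n) (simp_all add: vs_simps[OF T])
    finally show "\<zero>\<^bsub>tensor_space V W\<^esub> \<in> ?N"
      by (auto intro!: exI[of _ "\<lambda>_. \<zero>\<^bsub>W\<^esub>"] simp: vs_simps[OF W])
  next
    fix x y assume "x \<in> ?N" "y \<in> ?N"
    then obtain r r' where r: "x = ?s r" "y = ?s r'" "\<forall>k<n. r k \<in> carrier W" "\<forall>k<n. r' k \<in> carrier W"
      by blast
    have "x \<oplus>\<^bsub>tensor_space V W\<^esub> y = ?s (\<lambda>k. r k \<oplus>\<^bsub>W\<^esub> r' k)"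
      unfolding r(1,2) by (subst vsum_add[OF T, symmetric])
        (use r in \<open>auto intro!: pc vsum_cong simp: pure_tensor_add_right dual_basisD(1)[OF b]\<close>)
    then show "x \<oplus>\<^bsub>tensor_space V W\<^esub> y \<in> ?N"
      using r by (auto intro!: exI[of _ "\<lambda>k. r k \<oplus>\<^bsub>W\<^esub> r' k"] simp: vs_simps[OF W])
  next
    fix a x assume "x \<in> ?N"
    then obtain r where r: "x = ?s r" "\<forall>k<n. r k \<in> carrier W"
      by blast
    have "a \<odot>\<^bsub>tensor_space V W\<^esub> x = ?s (\<lambda>k. a \<odot>\<^bsub>W\<^esub> r k)"
      unfolding r(1) by (subst vsum_smult[OF T, symmetric])
        (use r in \<open>auto intro!: pc vsum_cong simp: pure_tensor_smult_right dual_basisD(1)[OF b]\<close>)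
    then show "a \<odot>\<^bsub>tensor_space V W\<^esub> x \<in> ?N"
      using r by (auto intro!: exI[of _ "\<lambda>k. a \<odot>\<^bsub>W\<^esub> r k"] simp: vs_simps[OF W])
  qed
  then have "t \<in> ?N"
  proof (rule tensor_space_induct[OF _ _ t])
    fix v w assume vw: "v \<in> carrier V" "w \<in> carrier W"
    have lin: "(\<lambda>v. pure_tensor V W v w) \<in> linear_maps V (tensor_space V W)"
      using vw by (intro linear_mapsI)
        (auto simp: pure_tensor_closed pure_tensor_add_left pure_tensor_smult_left)
    have "pure_tensor V W v w = pure_tensor V W (vsum V (\<lambda>k. \<epsilon> k v \<odot>\<^bsub>V\<^esub> e k) n) w"
      using vw by (simp add: dual_basisD(4)[OF b])
    also have "\<dots> = ?s (\<lambda>k. \<epsilon> k v \<odot>\<^bsub>W\<^esub> w)"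
      using vw by (subst linear_maps_vsum[OF V T lin])
        (auto simp: vs_smult_closed[OF V] dual_basisD(1)[OF b] pure_tensor_smult_left pure_tensor_smult_right intro!: vsum_cong)
    finally show "pure_tensor V W v w \<in> ?N"
      using vw by (auto intro!: exI[of _ "\<lambda>k. \<epsilon> k v \<odot>\<^bsub>W\<^esub> w"] simp: vs_simps[OF W])
  qed
  then show ?thesis
    by blast
qed

end


section \<open>Linear categories\<close>

lemma hom_space_simps [simp]:
  "carrier (hom_space C a b) = Hom C a b"
  "\<zero>\<^bsub>hom_space C a b\<^esub> = ZeroArr C a b"
  "f \<oplus>\<^bsub>hom_space C a b\<^esub> g = AddArr C f g"
  "k \<odot>\<^bsub>hom_space C a b\<^esub> f = ScaleArr C k f"
  by (simp_all add: hom_space_def)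

lemma HomD: "f \<in> Hom C a b \<Longrightarrow> f \<in> Arr C" "f \<in> Hom C a b \<Longrightarrow> Dom C f = a" "f \<in> Hom C a b \<Longrightarrow> Cod C f = b"
  by (simp_all add: Hom_def)

lemma Hom_Arr: "f \<in> Arr C \<Longrightarrow> f \<in> Hom C (Dom C f) (Cod C f)"
  by (simp add: Hom_def)

context linear_category
begin

lemma Hom_Obj: "f \<in> Hom C a b \<Longrightarrow> a \<in> Obj C" "f \<in> Hom C a b \<Longrightarrow> b \<in> Obj C"
  using Dom_in_Obj[of f] Cod_in_Obj[of f] by (auto simp: Hom_def)

context
  fixes a b
  assumes ab: "a \<in> Obj C" "b \<in> Obj C"
begin

lemmas hom_vs = vectorspace_Hom[OF ab]

lemma ZeroArr_Hom: "ZeroArr C a b \<in> Hom C a b"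
  using vs_zero_closed[OF hom_vs] by simp

end

context
  fixes f a b
  assumes f: "f \<in> Hom C a b"
begin

lemmas hom_vs' = vectorspace_Hom[OF Hom_Obj[OF f]]

lemma AddArr_Hom: "g \<in> Hom C a b \<Longrightarrow> AddArr C f g \<in> Hom C a b"
  using vs_add_closed[OF hom_vs'] f by simp

lemma ScaleArr_Hom: "ScaleArr C k f \<in> Hom C a b"
  using vs_smult_closed[OF hom_vs'] f by simp

lemma AddArr_zero: "AddArr C f (ZeroArr C a b) = f"
  using vs_add_zero[OF hom_vs'] f by simp

lemma ScaleArr_zero: "ScaleArr C 0 f = ZeroArr C a b"
  using vs_zero_smult[OF hom_vs'] f by simp

lemma ScaleArr_one: "ScaleArr C 1 f = f"
  using vs_one_smult[OF hom_vs'] f by simp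

lemma Comp_AddArr: "g \<in> Hom C b c \<Longrightarrow> f' \<in> Hom C a b \<Longrightarrow> g \<cdot> AddArr C f f' = AddArr C (g \<cdot> f) (g \<cdot> f')"
  using linear_maps_add[OF postcomp_linear[OF _ Hom_Obj(1)[OF f]]] f by simp

lemma AddArr_Comp: "g \<in> Hom C b c \<Longrightarrow> g' \<in> Hom C b c \<Longrightarrow> AddArr C g g' \<cdot> f = AddArr C (g \<cdot> f) (g' \<cdot> f)"
  using linear_maps_add[OF precomp_linear[OF f], of c g g'] by (simp add: Hom_Obj)

lemma Comp_ScaleArr: "g \<in> Hom C b c \<Longrightarrow> g \<cdot> ScaleArr C k f = ScaleArr C k (g \<cdot> f)"
  using linear_maps_smult[OF postcomp_linear[OF _ Hom_Obj(1)[OF f]]] f by simp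

lemma ScaleArr_Comp: "g \<in> Hom C b c \<Longrightarrow> ScaleArr C k g \<cdot> f = ScaleArr C k (g \<cdot> f)"
  using linear_maps_smult[OF precomp_linear[OF f], of c g] by (simp add: Hom_Obj)

lemma Comp_zero: "c \<in> Obj C \<Longrightarrow> f \<cdot> ZeroArr C c a = ZeroArr C c b"
  using linear_maps_zero[OF hom_vs hom_vs postcomp_linear[OF f]] by (simp add: Hom_Obj[OF f])

lemma zero_Comp: "c \<in> Obj C \<Longrightarrow> ZeroArr C b c \<cdot> f = ZeroArr C a c"
  using linear_maps_zero[OF hom_vs hom_vs precomp_linear[OF f]] by (simp add: Hom_Obj[OF f])

end

abbreviation hsum :: "'o \<Rightarrow> 'o \<Rightarrow> (nat \<Rightarrow> 'm) \<Rightarrow> nat \<Rightarrow> 'm" where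
  "hsum a b \<equiv> vsum (hom_space C a b)"

lemma hsum_Hom: "a \<in> Obj C \<Longrightarrow> b \<in> Obj C \<Longrightarrow> (\<And>i. i < n \<Longrightarrow> f i \<in> Hom C a b) \<Longrightarrow> hsum a b f n \<in> Hom C a b"
  using vsum_closed[OF hom_vs, of a b n f] by simp

lemma Comp_hsum:
  assumes "g \<in> Hom C b c" "a \<in> Obj C" "\<And>i. i < n \<Longrightarrow> f i \<in> Hom C a b"
  shows "g \<cdot> hsum a b f n = hsum a c (\<lambda>i. g \<cdot> f i) n"
  using linear_maps_vsum[OF hom_vs hom_vs postcomp_linear[OF assms(1,2)], of n f] assms
  by (simp add: Hom_Obj[OF assms(1)])

lemma hsum_Comp:
  assumes "f \<in> Hom C a b" "c \<in> Obj C" "\<And>i. i < n \<Longrightarrow> g i \<in> Hom C b c"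
  shows "hsum b c g n \<cdot> f = hsum a c (\<lambda>i. g i \<cdot> f) n"
  using linear_maps_vsum[OF hom_vs hom_vs precomp_linear[OF assms(1,2)], of n g] assms
  by (simp add: Hom_Obj[OF assms(1)])

lemma hsum_delta:
  "f \<in> Hom C a b \<Longrightarrow> hsum a b (\<lambda>i. if i = j then f else ZeroArr C a b) n = (if j < n then f else ZeroArr C a b)"
  using vsum_delta[OF hom_vs', of f a b f j n] by (simp cong: if_cong)

end

subsection \<open>The opposite category\<close>

text \<open>Objects, morphisms and identities are kept, so the same record \<open>F\<close> is an
  endofunctor of \<open>C\<close> and of the opposite category; no opposite functor has to be
  formed.\<close>

definition op_cat :: "('o, 'm, 'k) linear_cat \<Rightarrow> ('o, 'm, 'k) linear_cat" where
  "op_cat C = \<lparr>Obj = Obj C, Arr = Arr C, Dom = Cod C, Cod = Dom C, Idt = Idt C,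
     Comp = (\<lambda>f g. g \<cdot>\<^bsub>C\<^esub> f), ZeroArr = (\<lambda>a b. ZeroArr C b a), AddArr = AddArr C, ScaleArr = ScaleArr C\<rparr>"

lemma op_cat_simps [simp]:
  "Obj (op_cat C) = Obj C" "Arr (op_cat C) = Arr C" "Dom (op_cat C) = Cod C" "Cod (op_cat C) = Dom C"
  "Idt (op_cat C) = Idt C" "f \<cdot>\<^bsub>op_cat C\<^esub> g = g \<cdot>\<^bsub>C\<^esub> f" "ZeroArr (op_cat C) a b = ZeroArr C b a"
  "AddArr (op_cat C) = AddArr C" "ScaleArr (op_cat C) = ScaleArr C"
  by (simp_all add: op_cat_def)

lemma Hom_op [simp]: "Hom (op_cat C) a b = Hom C b a"
  by (auto simp: Hom_def)

text \<open>An equality of records: linear maps, dual spaces and tensor products over spaces of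
  morphisms are literally the same on both sides, and facts about them transfer by
  rewriting.\<close>

lemma hom_space_op [simp]: "hom_space (op_cat C) a b = hom_space C b a"
  by (simp add: hom_space_def)

lemma (in linear_category) linear_category_op: "linear_category (op_cat C)"
proof (rule linear_category.intro)
  show "h \<in> Hom (op_cat C) c d \<Longrightarrow> (h \<cdot>\<^bsub>op_cat C\<^esub> g) \<cdot>\<^bsub>op_cat C\<^esub> f = h \<cdot>\<^bsub>op_cat C\<^esub> (g \<cdot>\<^bsub>op_cat C\<^esub> f)"
    if "f \<in> Hom (op_cat C) a b" "g \<in> Hom (op_cat C) b c" for f g h a b c d
    using that by (simp add: Comp_assoc[of h d c g b f a])
qed (simp_all add: Dom_in_Obj Cod_in_Obj Idt_in_Hom Comp_in_Hom Comp_Idt Idt_Comp vectorspace_Hom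
    precomp_linear postcomp_linear)

lemma is_epi_op: "is_epi (op_cat C) f \<longleftrightarrow> is_mono C f"
  by (simp add: is_mono_def is_epi_def)

lemma is_cokernel_op: "is_cokernel (op_cat C) k f \<longleftrightarrow> is_kernel C k f"
  by (simp add: is_kernel_def is_cokernel_def)

lemma is_zero_obj_op: "is_zero_obj (op_cat C) z \<longleftrightarrow> is_zero_obj C z"
  by (auto simp: is_zero_obj_def)

lemma is_biproduct_op: "is_biproduct (op_cat C) a b s p q i j \<longleftrightarrow> is_biproduct C a b s i j p q"
  by (auto simp: is_biproduct_def)

lemma linear_endofunctor_op: "linear_endofunctor (op_cat C) F \<longleftrightarrow> linear_endofunctor C F"
  by (auto simp: linear_endofunctor_def)

subsection \<open>Finite powers of an object\<close>

text \<open>The biproduct of \<open>n\<close> copies of \<open>c\<close>, given by equations. The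
  description is symmetric under exchange of \<open>i\<close> and \<open>p\<close>, and with
  \<open>n\<close> the dimension of \<open>V\<close> the object is a model of
  \<open>V \<otimes> c\<close>.\<close>

definition is_power ::
    "('o, 'm, 'k::field) linear_cat \<Rightarrow> nat \<Rightarrow> 'o \<Rightarrow> 'o \<Rightarrow> (nat \<Rightarrow> 'm) \<Rightarrow> (nat \<Rightarrow> 'm) \<Rightarrow> bool" where
  "is_power C n c T i p \<longleftrightarrow> T \<in> Obj C \<and> (\<forall>k<n. i k \<in> Hom C c T \<and> p k \<in> Hom C T c) \<and>
     (\<forall>k<n. \<forall>l<n. p k \<cdot>\<^bsub>C\<^esub> i l = (if k = l then Idt C c else ZeroArr C c c)) \<and>
     vsum (hom_space C T T) (\<lambda>k. i k \<cdot>\<^bsub>C\<^esub> p k) n = Idt C T"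

text \<open>The setting in which powers exist, kept apart because it passes to the opposite
  category.\<close>

locale additive_category = linear_category C for C :: "('o, 'm, 'k::field) linear_cat" (structure) +
  assumes ex_zero_object: "\<exists>z. is_zero_obj C z"
    and ex_biproducts: "\<lbrakk>a \<in> Obj C; b \<in> Obj C\<rbrakk> \<Longrightarrow> \<exists>s i j p q. is_biproduct C a b s i j p q"
begin

lemma power_exists:
  assumes c: "c \<in> Obj C"
  shows "\<exists>T i p. is_power C n c T i p"
proof (induction n)
  case 0
  obtain z where z: "is_zero_obj C z"
    using ex_zero_object by blast
  then have zO: "z \<in> Obj C"
    by (simp add: is_zero_obj_def)
  \<comment> \<open>The empty sum is the zero morphism, so for \<open>n = 0\<close> the last
    condition of \<open>is_power\<close> says that the identity of \<open>z\<close> is zero.\<close>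
  then have "ZeroArr C z z = Idt C z"
    using z Idt_in_Hom[OF zO] ZeroArr_Hom[OF zO zO] unfolding is_zero_obj_def by blast
  then show ?case
    using zO by (auto simp: is_power_def)
next
  case (Suc n)
  then obtain T i p where P: "is_power C n c T i p"
    by blast
  then have T: "T \<in> Obj C" and ip: "\<And>k. k < n \<Longrightarrow> i k \<in> Hom C c T" "\<And>k. k < n \<Longrightarrow> p k \<in> Hom C T c"
    and pi: "\<And>k l. k < n \<Longrightarrow> l < n \<Longrightarrow> p k \<cdot> i l = (if k = l then Idt C c else ZeroArr C c c)"
    and sum: "hsum T T (\<lambda>k. i k \<cdot> p k) n = Idt C T"
    by (auto simp: is_power_def)
  obtain s a b x y where "is_biproduct C T c s a b x y"
    using ex_biproducts[OF T c] by blast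
  then have a: "a \<in> Hom C T s" and b: "b \<in> Hom C c s" and x: "x \<in> Hom C s T" and y: "y \<in> Hom C s c"
    and xa: "x \<cdot> a = Idt C T" and yb: "y \<cdot> b = Idt C c" and xb: "x \<cdot> b = ZeroArr C c T" and ya: "y \<cdot> a = ZeroArr C T c"
    and ab: "AddArr C (a \<cdot> x) (b \<cdot> y) = Idt C s"
    by (auto simp: is_biproduct_def)
  have s: "s \<in> Obj C"
    using Hom_Obj[OF a] by simp
  let ?i = "\<lambda>k. if k < n then a \<cdot> i k else b"
  let ?p = "\<lambda>k. if k < n then p k \<cdot> x else y"
  have pxai: "(p k \<cdot> x) \<cdot> (a \<cdot> i l) = p k \<cdot> i l" if "k < n" "l < n" for k l
    using that Comp_assoc[OF Comp_in_Hom[OF ip(1)[of l] a] x ip(2)[of k]] Comp_assoc[OF ip(1)[of l] a x] Idt_Comp[OF ip(1)[of l]]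
    by (simp add: xa)
  have pxb: "(p k \<cdot> x) \<cdot> b = ZeroArr C c c" if "k < n" for k
    using that Comp_assoc[OF b x ip(2)[of k]] Comp_zero[OF ip(2)[of k] c] by (simp add: xb)
  have yai: "y \<cdot> (a \<cdot> i l) = ZeroArr C c c" if "l < n" for l
    using that Comp_assoc[OF ip(1)[of l] a y] zero_Comp[OF ip(1)[of l] c] by (simp add: ya)
  have aipx: "(a \<cdot> i k) \<cdot> (p k \<cdot> x) = a \<cdot> ((i k \<cdot> p k) \<cdot> x)" if "k < n" for k
    using that Comp_assoc[OF Comp_in_Hom[OF x ip(2)[of k]] ip(1)[of k] a] Comp_assoc[OF x ip(2)[of k] ip(1)[of k]] by simp
  have "hsum s s (\<lambda>k. ?i k \<cdot> ?p k) n = hsum s s (\<lambda>k. a \<cdot> ((i k \<cdot> p k) \<cdot> x)) n"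
    by (rule vsum_cong) (simp add: aipx)
  also have "\<dots> = a \<cdot> hsum s T (\<lambda>k. (i k \<cdot> p k) \<cdot> x) n"
    using a s ip x by (intro Comp_hsum[symmetric]) (auto intro: Comp_in_Hom)
  also have "hsum s T (\<lambda>k. (i k \<cdot> p k) \<cdot> x) n = hsum T T (\<lambda>k. i k \<cdot> p k) n \<cdot> x"
    using T ip x by (intro hsum_Comp[symmetric]) (auto intro: Comp_in_Hom)
  also have "\<dots> = x"
    by (simp add: sum Idt_Comp[OF x])
  finally have "hsum s s (\<lambda>k. ?i k \<cdot> ?p k) (Suc n) = Idt C s"
    by (simp add: ab)
  then have "is_power C (Suc n) c s ?i ?p"
    unfolding is_power_def
    by (auto simp: s pxai pi pxb yai yb less_Suc_eq intro: Comp_in_Hom a x b y ip)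
  then show ?case
    by blast
qed

text \<open>The morphism is the sum of the \<open>g k \<cdot> p k\<close>. Pairing into a power is
  this lemma in the opposite category, where inclusions and projections change places.\<close>

lemma power_copair:
  assumes P: "is_power C n c T i p" and c: "c \<in> Obj C" and x: "x \<in> Obj C" and g: "\<And>k. k < n \<Longrightarrow> g k \<in> Hom C c x"
  obtains h where "h \<in> Hom C T x" "\<And>k. k < n \<Longrightarrow> h \<cdot> i k = g k"
proof
  have T: "T \<in> Obj C" and ip: "\<And>k. k < n \<Longrightarrow> i k \<in> Hom C c T" "\<And>k. k < n \<Longrightarrow> p k \<in> Hom C T c"
    and pi: "\<And>k l. k < n \<Longrightarrow> l < n \<Longrightarrow> p k \<cdot> i l = (if k = l then Idt C c else ZeroArr C c c)"
    using P by (auto simp: is_power_def)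
  show "hsum T x (\<lambda>k. g k \<cdot> p k) n \<in> Hom C T x"
    by (rule hsum_Hom[OF T x]) (rule Comp_in_Hom[OF ip(2) g])
  fix l assume l: "l < n"
  have "hsum T x (\<lambda>k. g k \<cdot> p k) n \<cdot> i l = hsum c x (\<lambda>k. (g k \<cdot> p k) \<cdot> i l) n"
    by (rule hsum_Comp[OF ip(1)[OF l] x]) (rule Comp_in_Hom[OF ip(2) g])
  also have "\<dots> = hsum c x (\<lambda>k. if k = l then g l else ZeroArr C c x) n"
  proof (rule vsum_cong)
    fix k assume k: "k < n"
    have "(g k \<cdot> p k) \<cdot> i l = g k \<cdot> (p k \<cdot> i l)"
      by (rule Comp_assoc[OF ip(1)[OF l] ip(2)[OF k] g[OF k]])
    then show "(g k \<cdot> p k) \<cdot> i l = (if k = l then g l else ZeroArr C c x)"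
      using Comp_Idt[OF g[OF k]] Comp_zero[OF g[OF k] c] by (cases "k = l") (simp_all add: pi k l)
  qed
  also have "\<dots> = g l"
    using hsum_delta[OF g[OF l], of l n] l by simp
  finally show "hsum T x (\<lambda>k. g k \<cdot> p k) n \<cdot> i l = g l" .
qed

end

lemma is_power_op: "is_power (op_cat C) n c T p i \<longleftrightarrow> is_power C n c T i p"
  by (auto simp: is_power_def)

lemma (in additive_category) additive_category_op: "additive_category (op_cat C)"
proof (rule additive_category.intro[OF linear_category_op additive_category_axioms.intro])
  show "\<exists>z. is_zero_obj (op_cat C) z"
    using ex_zero_object by (simp add: is_zero_obj_op)
  show "\<exists>s i j p q. is_biproduct (op_cat C) a b s i j p q" if "a \<in> Obj (op_cat C)" "b \<in> Obj (op_cat C)" for a b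
    using ex_biproducts[of a b] that by (metis is_biproduct_op op_cat_simps(1))
qed

subsection \<open>Representable presheaves\<close>

lemma (in linear_category) cokernel_epi:
  assumes q: "is_cokernel C q f"
  shows "is_epi C q"
  unfolding is_epi_def
proof (intro conjI ballI allI impI)
  show qA: "q \<in> Arr C"
    using q by (simp add: is_cokernel_def)
  fix b g h assume g: "g \<in> Hom C (Cod C q) b" and h: "h \<in> Hom C (Cod C q) b" and eq: "g \<cdot> q = h \<cdot> q"
  have f: "f \<in> Hom C (Dom C f) (Cod C f)" and q': "q \<in> Hom C (Cod C f) (Cod C q)"
    and 0: "q \<cdot> f = ZeroArr C (Dom C f) (Cod C q)"
    using q by (auto simp: is_cokernel_def Hom_def)
  have "(g \<cdot> q) \<cdot> f = ZeroArr C (Dom C f) b"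
    using Comp_assoc[OF f q' g] Comp_zero[OF g Hom_Obj(1)[OF f]] by (simp add: 0)
  then have "\<exists>!u. u \<in> Hom C (Cod C q) b \<and> u \<cdot> q = g \<cdot> q"
    using q Comp_in_Hom[OF q' g] unfolding is_cokernel_def by blast
  then show "g = h"
    using g h eq by auto
qed

lemma (in linear_category) kernel_mono: "is_kernel C k f \<Longrightarrow> is_mono C k"
  using linear_category.cokernel_epi[OF linear_category_op, of k f] by (simp add: is_cokernel_op is_epi_op)

text \<open>What the construction asks of a category, arranged so that the opposite of an abelian
  category with such a \<open>Q\<close> qualifies as well, an injective cogenerator taking the role
  of \<open>Q\<close>. The axioms speak of cokernels and epimorphisms; kernels and monomorphisms
  return as those of the opposite category.\<close>

locale category_with_generator = additive_category C for C :: "('o, 'm, 'k::field) linear_cat" (structure) +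
  fixes Q :: 'o
  assumes fdvs_Hom: "\<lbrakk>a \<in> Obj C; b \<in> Obj C\<rbrakk> \<Longrightarrow> fdvs (hom_space C a b)"
    and cokernel_exists: "f \<in> Arr C \<Longrightarrow> \<exists>q. is_cokernel C q f"
    and epi_cokernel: "is_epi C e \<Longrightarrow> \<exists>f. is_cokernel C e f"
    and Q_projective: "is_projective C Q"
    and Q_generator: "\<lbrakk>f \<in> Hom C a b; f' \<in> Hom C a b; \<And>g. g \<in> Hom C Q a \<Longrightarrow> f \<cdot> g = f' \<cdot> g\<rbrakk> \<Longrightarrow> f = f'"
begin

lemma Q_Obj: "Q \<in> Obj C"
  using Q_projective by (simp add: is_projective_def)

text \<open>Take one copy of \<open>Q\<close> for each member of a basis of
  \<open>Hom(Q, b)\<close>. Two morphisms that agree after \<open>e\<close> agree on this basis,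
  hence on all morphisms from \<open>Q\<close>, and \<open>Q\<close> is a generator.\<close>

lemma ex_epi_from_power:
  assumes b: "b \<in> Obj C"
  obtains n T i p e where "is_power C n Q T i p" "e \<in> Hom C T b" "is_epi C e"
proof -
  obtain n g \<gamma> where B: "dual_basis (hom_space C Q b) n g \<gamma>"
    using fdvs_Hom[OF Q_Obj b] by (rule fdvsE)
  have g: "g k \<in> Hom C Q b" if "k < n" for k
    using dual_basisD(1)[OF B that] by simp
  obtain T i p where P: "is_power C n Q T i p"
    using power_exists[OF Q_Obj] by blast
  then have T: "T \<in> Obj C" and i: "\<And>k. k < n \<Longrightarrow> i k \<in> Hom C Q T"
    by (auto simp: is_power_def)
  obtain e where e: "e \<in> Hom C T b" "\<And>k. k < n \<Longrightarrow> e \<cdot> i k = g k"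
    using power_copair[OF P Q_Obj b, where g = g, OF g] by blast
  have "is_epi C e"
    unfolding is_epi_def
  proof (intro conjI ballI allI impI)
    show "e \<in> Arr C"
      using HomD(1)[OF e(1)] .
    fix x h h' assume h: "h \<in> Hom C (Cod C e) x" and h': "h' \<in> Hom C (Cod C e) x" and eq: "h \<cdot> e = h' \<cdot> e"
    have hb: "h \<in> Hom C b x" "h' \<in> Hom C b x"
      using h h' HomD(3)[OF e(1)] by auto
    show "h = h'"
    proof (rule Q_generator[OF hb])
      fix t assume t: "t \<in> Hom C Q b"
      have hg: "h \<cdot> g k = h' \<cdot> g k" if "k < n" for k
        using Comp_assoc[OF i[OF that] e(1) hb(1)] Comp_assoc[OF i[OF that] e(1) hb(2)] eq by (simp add: e(2) that)
      have sg: "ScaleArr C (\<gamma> k t) (g k) \<in> Hom C Q b" if "k < n" for k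
        using ScaleArr_Hom[OF g[OF that]] .
      have t': "t = hsum Q b (\<lambda>k. ScaleArr C (\<gamma> k t) (g k)) n"
        using dual_basisD(4)[OF B, of t] t by simp
      have "u \<cdot> t = hsum Q x (\<lambda>k. ScaleArr C (\<gamma> k t) (u \<cdot> g k)) n" if u: "u \<in> Hom C b x" for u
        by (subst t', subst Comp_hsum[OF u Q_Obj]) (auto simp: sg Comp_ScaleArr[OF g u] intro!: vsum_cong)
      then show "h \<cdot> t = h' \<cdot> t"
        using hb hg by (simp cong: vsum_cong)
    qed
  qed
  then show thesis
    using that P e(1) by blast
qed

text \<open>
  A presheaf of sets \<open>\<Phi>\<close>, with \<open>act \<phi> f\<close> the restriction of \<open>\<phi>\<close> along \<open>f\<close>.  Its representing object is
  the cokernel of a morphism to \<open>c\<^sub>0\<close> whose image collects all \<open>g : Q \<rightarrow> c\<^sub>0\<close> that kill \<open>\<phi>\<^sub>0\<close>.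
\<close>

lemma representable:
  fixes \<Phi> :: "'o \<Rightarrow> 'p set" and act :: "'p \<Rightarrow> 'm \<Rightarrow> 'p"
  assumes act: "\<And>\<phi> f a b. \<lbrakk>\<phi> \<in> \<Phi> b; f \<in> Hom C a b\<rbrakk> \<Longrightarrow> act \<phi> f \<in> \<Phi> a"
    and act_Comp: "\<And>\<phi> f g a b c. \<lbrakk>\<phi> \<in> \<Phi> c; f \<in> Hom C a b; g \<in> Hom C b c\<rbrakk> \<Longrightarrow> act \<phi> (g \<cdot> f) = act (act \<phi> g) f"
    and sep: "\<And>\<phi> \<psi> b. \<lbrakk>\<phi> \<in> \<Phi> b; \<psi> \<in> \<Phi> b; b \<in> Obj C; \<And>g. g \<in> Hom C Q b \<Longrightarrow> act \<phi> g = act \<psi> g\<rbrakk> \<Longrightarrow> \<phi> = \<psi>"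
    and act_zero: "\<And>\<phi> \<psi> a c c'. \<lbrakk>\<phi> \<in> \<Phi> c; \<psi> \<in> \<Phi> c'; a \<in> Obj C; c \<in> Obj C; c' \<in> Obj C\<rbrakk>
        \<Longrightarrow> act \<phi> (ZeroArr C a c) = act \<psi> (ZeroArr C a c')"
    and act_add: "\<And>\<phi> \<psi> a c c' f f' g g'. \<lbrakk>\<phi> \<in> \<Phi> c; \<psi> \<in> \<Phi> c'; f \<in> Hom C a c; f' \<in> Hom C a c'; g \<in> Hom C a c; g' \<in> Hom C a c';
        act \<phi> f = act \<psi> f'; act \<phi> g = act \<psi> g'\<rbrakk> \<Longrightarrow> act \<phi> (AddArr C f g) = act \<psi> (AddArr C f' g')"
    and act_scale: "\<And>\<phi> a c f f' k. \<lbrakk>\<phi> \<in> \<Phi> c; f \<in> Hom C a c; f' \<in> Hom C a c; act \<phi> f = act \<phi> f'\<rbrakk>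
        \<Longrightarrow> act \<phi> (ScaleArr C k f) = act \<phi> (ScaleArr C k f')"
    and descent: "\<And>\<phi> q f. \<lbrakk>is_cokernel C q f; \<phi> \<in> \<Phi> (Cod C f); act \<phi> f = act \<phi> (ZeroArr C (Dom C f) (Cod C f))\<rbrakk>
        \<Longrightarrow> \<exists>\<phi>'\<in>\<Phi> (Cod C q). act \<phi>' q = \<phi>"
    and c0: "c0 \<in> Obj C" "\<phi>0 \<in> \<Phi> c0"
    and generated: "\<And>\<psi>. \<psi> \<in> \<Phi> Q \<Longrightarrow> \<exists>g\<in>Hom C Q c0. act \<phi>0 g = \<psi>"
  shows "\<exists>c\<in>Obj C. \<exists>\<phi>\<in>\<Phi> c. \<forall>b\<in>Obj C. \<forall>\<psi>\<in>\<Phi> b. \<exists>!h. h \<in> Hom C b c \<and> act \<phi> h = \<psi>"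
proof -
  \<comment> \<open>The sets \<open>\<Phi> b\<close> carry no addition, so linearity is assumed as a
    congruence: equal restrictions may be added and scaled. This gives the substitute for
    subtraction.\<close>
  have diff: "act \<phi> (AddArr C f (ScaleArr C (-1) f')) = act \<phi> (ZeroArr C a c)"
    if "\<phi> \<in> \<Phi> c" "f \<in> Hom C a c" "f' \<in> Hom C a c" "act \<phi> f = act \<phi> f'" for \<phi> a c f f'
  proof -
    have "act \<phi> (AddArr C f (ScaleArr C (-1) f')) = act \<phi> (AddArr C f' (ScaleArr C (-1) f'))"
      using that ScaleArr_Hom[OF that(3), of "-1"] by (intro act_add[OF that(1,1)]) auto
    then show ?thesis
      using vs_neg[OF hom_vs'[OF that(3)], of f'] that(3) by simp
  qed
  have act_sum: "act \<phi> (hsum a c f n) = act \<psi> (hsum a c' f' n)"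
    if "\<phi> \<in> \<Phi> c" "\<psi> \<in> \<Phi> c'" "a \<in> Obj C" "c \<in> Obj C" "c' \<in> Obj C"
      "\<And>k. k < n \<Longrightarrow> f k \<in> Hom C a c" "\<And>k. k < n \<Longrightarrow> f' k \<in> Hom C a c'" "\<And>k. k < n \<Longrightarrow> act \<phi> (f k) = act \<psi> (f' k)"
    for \<phi> \<psi> a c c' f f' n
    using that(6-8)
  proof (induction n)
    case 0
    then show ?case
      using act_zero[OF that(1-5)] by simp
  next
    case (Suc n)
    then have "act \<phi> (hsum a c f n) = act \<psi> (hsum a c' f' n)"
      by simp
    then have "act \<phi> (AddArr C (hsum a c f n) (f n)) = act \<psi> (AddArr C (hsum a c' f' n) (f' n))"
      using Suc.prems that(3-5) by (intro act_add[OF that(1,2)]) (auto intro!: hsum_Hom)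
    then show ?case
      by simp
  qed
  let ?K = "{g \<in> Hom C Q c0. act \<phi>0 g = act \<phi>0 (ZeroArr C Q c0)}"
  note z = ZeroArr_Hom[OF Q_Obj c0(1)]
  have K: "subsp (hom_space C Q c0) ?K"
    unfolding subsp_def
  proof (intro conjI ballI allI)
    show "f \<oplus>\<^bsub>hom_space C Q c0\<^esub> g \<in> ?K" if fg: "f \<in> ?K" "g \<in> ?K" for f g
      using fg act_add[OF c0(2,2), of f Q "ZeroArr C Q c0" g "ZeroArr C Q c0"] z AddArr_zero[OF z] AddArr_Hom[of f Q c0 g] by auto
    show "k \<odot>\<^bsub>hom_space C Q c0\<^esub> g \<in> ?K" if "g \<in> ?K" for k g
      using that act_scale[OF c0(2), of g Q "ZeroArr C Q c0" k] z
        vs_smult_zero[OF hom_vs[OF Q_Obj c0(1)], of k] ScaleArr_Hom[of g Q c0] by auto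
  qed (use z in auto)
  obtain m u where u: "\<And>k. k < m \<Longrightarrow> u k \<in> ?K"
    and u_span': "\<And>g. g \<in> ?K \<Longrightarrow> \<exists>a. g = hsum Q c0 (\<lambda>k. a k \<odot>\<^bsub>hom_space C Q c0\<^esub> u k) m"
    by (rule subsp_finitely_spanned[OF fdvs_Hom[OF Q_Obj c0(1)] K]) (rule that)
  note u_span = u_span'[unfolded hom_space_simps]
  obtain T i p where P: "is_power C m Q T i p"
    using power_exists[OF Q_Obj] by blast
  then have T: "T \<in> Obj C" and ip: "\<And>k. k < m \<Longrightarrow> i k \<in> Hom C Q T" "\<And>k. k < m \<Longrightarrow> p k \<in> Hom C T Q"
    and ip_sum: "hsum T T (\<lambda>k. i k \<cdot> p k) m = Idt C T"
    by (auto simp: is_power_def)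
  have uH: "u k \<in> Hom C Q c0" "act \<phi>0 (u k) = act \<phi>0 (ZeroArr C Q c0)" if "k < m" for k
    using u[OF that] by auto
  obtain G where G: "G \<in> Hom C T c0" "\<And>k. k < m \<Longrightarrow> G \<cdot> i k = u k"
    using power_copair[OF P Q_Obj c0(1), where g = u, OF uH(1)] by blast
  \<comment> \<open>It suffices to test on morphisms \<open>t\<close> from \<open>Q\<close>, by
    \<open>sep\<close>. There \<open>G \<cdot> t\<close> is a sum of terms
    \<open>u k \<cdot> (p k \<cdot> t)\<close>, and \<open>?K\<close> is stable under precomposition
    with endomorphisms of \<open>Q\<close>.\<close>
  have "act (act \<phi>0 G) t = act (act \<phi>0 (ZeroArr C T c0)) t" if t: "t \<in> Hom C Q T" for t
  proof -
    have Gt: "G \<cdot> t = hsum Q c0 (\<lambda>k. u k \<cdot> (p k \<cdot> t)) m"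
    proof -
      have ipT: "i k \<cdot> p k \<in> Hom C T T" if "k < m" for k
        using that ip by (blast intro: Comp_in_Hom)
      have "G \<cdot> t = G \<cdot> (Idt C T \<cdot> t)"
        by (simp add: Idt_Comp[OF t])
      also have "Idt C T \<cdot> t = hsum Q T (\<lambda>k. (i k \<cdot> p k) \<cdot> t) m"
        unfolding ip_sum[symmetric] by (rule hsum_Comp[OF t T ipT])
      also have "G \<cdot> \<dots> = hsum Q c0 (\<lambda>k. G \<cdot> ((i k \<cdot> p k) \<cdot> t)) m"
        by (rule Comp_hsum[OF G(1) Q_Obj]) (rule Comp_in_Hom[OF t ipT])
      also have "\<dots> = hsum Q c0 (\<lambda>k. u k \<cdot> (p k \<cdot> t)) m"
      proof (rule vsum_cong)
        fix k assume k: "k < m"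
        show "G \<cdot> ((i k \<cdot> p k) \<cdot> t) = u k \<cdot> (p k \<cdot> t)"
          using Comp_assoc[OF t ip(2)[OF k] ip(1)[OF k]] Comp_assoc[OF Comp_in_Hom[OF t ip(2)[OF k]] ip(1)[OF k] G(1)]
          by (simp add: G(2) k)
      qed
      finally show ?thesis .
    qed
    have up: "u k \<cdot> (p k \<cdot> t) \<in> ?K" if k: "k < m" for k
    proof -
      have pt: "p k \<cdot> t \<in> Hom C Q Q"
        by (rule Comp_in_Hom[OF t ip(2)[OF k]])
      have "act \<phi>0 (u k \<cdot> (p k \<cdot> t)) = act (act \<phi>0 (ZeroArr C Q c0)) (p k \<cdot> t)"
        using act_Comp[OF c0(2) pt uH(1)[OF k]] uH(2)[OF k] by simp
      also have "\<dots> = act \<phi>0 (ZeroArr C Q c0)"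
        using act_Comp[OF c0(2) pt z] zero_Comp[OF pt c0(1)] by simp
      finally show ?thesis
        using Comp_in_Hom[OF pt uH(1)[OF k]] by simp
    qed
    have "G \<cdot> t \<in> ?K"
      unfolding Gt by (rule subsp_vsum[OF K up])
    then have "act (act \<phi>0 G) t = act \<phi>0 (ZeroArr C Q c0)"
      using act_Comp[OF c0(2) t G(1)] by simp
    also have "\<dots> = act (act \<phi>0 (ZeroArr C T c0)) t"
      using act_Comp[OF c0(2) t ZeroArr_Hom[OF T c0(1)]] zero_Comp[OF t c0(1)] by simp
    finally show ?thesis .
  qed
  then have \<phi>G: "act \<phi>0 G = act \<phi>0 (ZeroArr C T c0)"
    using sep[OF act[OF c0(2) G(1)] act[OF c0(2) ZeroArr_Hom[OF T c0(1)]] T] by blast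
  obtain q where q: "is_cokernel C q G"
    using cokernel_exists[OF HomD(1)[OF G(1)]] by blast
  define c where "c = Cod C q"
  have qH: "q \<in> Hom C c0 c" and qG: "q \<cdot> G = ZeroArr C T c"
    using q HomD[OF G(1)] by (auto simp: is_cokernel_def Hom_def c_def)
  have cO: "c \<in> Obj C"
    using Hom_Obj[OF qH] by simp
  obtain \<phi> where \<phi>: "\<phi> \<in> \<Phi> c" "act \<phi> q = \<phi>0"
    using descent[OF q] c0(2) \<phi>G HomD[OF G(1)] by (auto simp: c_def)
  have surjQ: "\<exists>h\<in>Hom C Q c. act \<phi> h = \<psi>" if \<psi>: "\<psi> \<in> \<Phi> Q" for \<psi>
  proof -
    obtain g where g: "g \<in> Hom C Q c0" "act \<phi>0 g = \<psi>"
      using generated[OF \<psi>] by blast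
    then have "act \<phi> (q \<cdot> g) = \<psi>"
      using act_Comp[OF \<phi>(1) g(1) qH] \<phi>(2) by simp
    then show ?thesis
      using Comp_in_Hom[OF g(1) qH] by blast
  qed
  \<comment> \<open>A difference that restricts \<open>\<phi>\<close> as zero does lifts along
    \<open>q\<close> to some \<open>g : Q \<rightarrow> c0\<close> because \<open>Q\<close> is
    projective. Then \<open>g\<close> lies in \<open>?K\<close>, so it is a combination of the
    \<open>u k = G \<cdot> i k\<close>, all of which \<open>q\<close> kills.\<close>
  have injQ: "h = h'" if h: "h \<in> Hom C Q c" "h' \<in> Hom C Q c" "act \<phi> h = act \<phi> h'" for h h'
  proof -
    let ?d = "AddArr C h (ScaleArr C (-1) h')"
    have d: "?d \<in> Hom C Q c"
      using AddArr_Hom[OF h(1)] ScaleArr_Hom[OF h(2)] by blast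
    obtain g where g: "g \<in> Hom C Q c0" "q \<cdot> g = ?d"
      using Q_projective cokernel_epi[OF q] d HomD[OF qH] unfolding is_projective_def by metis
    have "act \<phi>0 g = act \<phi> ?d"
      using act_Comp[OF \<phi>(1) g(1) qH] \<phi>(2) g(2) by simp
    also have "\<dots> = act \<phi> (ZeroArr C Q c)"
      by (rule diff[OF \<phi>(1) h])
    also have "\<dots> = act \<phi>0 (ZeroArr C Q c0)"
      using act_Comp[OF \<phi>(1) z qH] \<phi>(2) Comp_zero[OF qH Q_Obj] by simp
    finally have "g \<in> ?K"
      using g(1) by simp
    then obtain a where a: "g = hsum Q c0 (\<lambda>k. ScaleArr C (a k) (u k)) m"
      using u_span by blast
    have su: "ScaleArr C (a k) (u k) \<in> Hom C Q c0" if "k < m" for k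
      using ScaleArr_Hom[OF uH(1)[OF that]] .
    have "q \<cdot> g = hsum Q c (\<lambda>k. q \<cdot> ScaleArr C (a k) (u k)) m"
      unfolding a by (rule Comp_hsum[OF qH Q_Obj su])
    also have "\<dots> = hsum Q c (\<lambda>k. ZeroArr C Q c) m"
    proof (rule vsum_cong)
      fix k assume k: "k < m"
      have "q \<cdot> u k = ZeroArr C Q c"
        using Comp_assoc[OF ip(1)[OF k] G(1) qH] zero_Comp[OF ip(1)[OF k] cO] by (simp add: qG G(2) k)
      then show "q \<cdot> ScaleArr C (a k) (u k) = ZeroArr C Q c"
        using Comp_ScaleArr[OF uH(1)[OF k] qH] vs_smult_zero[OF hom_vs[OF Q_Obj cO], of "a k"] by simp
    qed
    also have "\<dots> = ZeroArr C Q c"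
      by (induction m) (use AddArr_zero[OF ZeroArr_Hom[OF Q_Obj cO]] in auto)
    finally have "?d = ZeroArr C Q c"
      using g(2) by simp
    then show ?thesis
      using vs_eqI[OF hom_vs[OF Q_Obj cO], of h h'] h by simp
  qed
  have inj: "h = h'" if h: "h \<in> Hom C b c" "h' \<in> Hom C b c" "act \<phi> h = act \<phi> h'" for b h h'
  proof (rule Q_generator[OF h(1,2)])
    fix g assume g: "g \<in> Hom C Q b"
    show "h \<cdot> g = h' \<cdot> g"
      by (rule injQ) (use Comp_in_Hom[OF g] act_Comp[OF \<phi>(1) g] h in auto)
  qed
  \<comment> \<open>Present \<open>b\<close> as the target of an epi \<open>e\<close> from a power
    \<open>S\<close> of \<open>Q\<close>. Bijectivity at \<open>Q\<close> supplies a morphism on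
    each summand, these assemble to \<open>h : S \<rightarrow> c\<close>, and it remains to descend
    \<open>h\<close> along \<open>e\<close>.\<close>
  have surj: "\<exists>h\<in>Hom C b c. act \<phi> h = \<psi>" if b: "b \<in> Obj C" and \<psi>: "\<psi> \<in> \<Phi> b" for b \<psi>
  proof -
    obtain n S j r e where S: "is_power C n Q S j r" and e: "e \<in> Hom C S b" "is_epi C e"
      using ex_epi_from_power[OF b] by metis
    have SO: "S \<in> Obj C" and jr: "\<And>k. k < n \<Longrightarrow> j k \<in> Hom C Q S" "\<And>k. k < n \<Longrightarrow> r k \<in> Hom C S Q"
      and jr_sum: "hsum S S (\<lambda>k. j k \<cdot> r k) n = Idt C S"
      using S by (auto simp: is_power_def)
    have ej: "e \<cdot> j k \<in> Hom C Q b" if "k < n" for k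
      using Comp_in_Hom[OF jr(1)[OF that] e(1)] .
    have "\<exists>h\<in>Hom C Q c. k < n \<longrightarrow> act \<phi> h = act \<psi> (e \<cdot> j k)" for k
      using surjQ[OF act[OF \<psi> ej]] ZeroArr_Hom[OF Q_Obj cO] by blast
    then obtain hk where hk: "\<And>k. hk k \<in> Hom C Q c" "\<And>k. k < n \<Longrightarrow> act \<phi> (hk k) = act \<psi> (e \<cdot> j k)"
      by metis
    obtain h where h: "h \<in> Hom C S c" "\<And>k. k < n \<Longrightarrow> h \<cdot> j k = hk k"
      using power_copair[OF S Q_Obj cO, where g = hk, OF hk(1)] by blast
    have e\<psi>: "act \<psi> e \<in> \<Phi> S"
      using act[OF \<psi> e(1)] .
    have "act \<phi> h = act \<psi> e"
    proof (rule sep[OF act[OF \<phi>(1) h(1)] e\<psi> SO])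
      fix t assume t: "t \<in> Hom C Q S"
      have rt: "r k \<cdot> t \<in> Hom C Q Q" if "k < n" for k
        using Comp_in_Hom[OF t jr(2)[OF that]] .
      have exp: "v \<cdot> t = hsum Q x (\<lambda>k. (v \<cdot> j k) \<cdot> (r k \<cdot> t)) n" if v: "v \<in> Hom C S x" for v x
      proof -
        have jrS: "j k \<cdot> r k \<in> Hom C S S" if "k < n" for k
          using that jr by (blast intro: Comp_in_Hom)
        have "v \<cdot> t = v \<cdot> (Idt C S \<cdot> t)"
          by (simp add: Idt_Comp[OF t])
        also have "Idt C S \<cdot> t = hsum Q S (\<lambda>k. (j k \<cdot> r k) \<cdot> t) n"
          unfolding jr_sum[symmetric] by (rule hsum_Comp[OF t SO jrS])
        also have "v \<cdot> \<dots> = hsum Q x (\<lambda>k. v \<cdot> ((j k \<cdot> r k) \<cdot> t)) n"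
          by (rule Comp_hsum[OF v Q_Obj]) (rule Comp_in_Hom[OF t jrS])
        also have "\<dots> = hsum Q x (\<lambda>k. (v \<cdot> j k) \<cdot> (r k \<cdot> t)) n"
        proof (rule vsum_cong)
          fix k assume k: "k < n"
          show "v \<cdot> ((j k \<cdot> r k) \<cdot> t) = (v \<cdot> j k) \<cdot> (r k \<cdot> t)"
            using Comp_assoc[OF t jr(2)[OF k] jr(1)[OF k]] Comp_assoc[OF rt[OF k] jr(1)[OF k] v] by simp
        qed
        finally show ?thesis .
      qed
      have "act (act \<phi> h) t = act \<phi> (hsum Q c (\<lambda>k. (h \<cdot> j k) \<cdot> (r k \<cdot> t)) n)"
        using act_Comp[OF \<phi>(1) t h(1)] exp[OF h(1)] by simp
      also have "\<dots> = act \<psi> (hsum Q b (\<lambda>k. (e \<cdot> j k) \<cdot> (r k \<cdot> t)) n)"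
      proof (rule act_sum[OF \<phi>(1) \<psi> Q_Obj cO b])
        fix k assume k: "k < n"
        show "(h \<cdot> j k) \<cdot> (r k \<cdot> t) \<in> Hom C Q c" "(e \<cdot> j k) \<cdot> (r k \<cdot> t) \<in> Hom C Q b"
          using Comp_in_Hom[OF rt[OF k]] hk(1)[of k] ej[OF k] by (auto simp: h(2)[OF k])
        show "act \<phi> ((h \<cdot> j k) \<cdot> (r k \<cdot> t)) = act \<psi> ((e \<cdot> j k) \<cdot> (r k \<cdot> t))"
          using act_Comp[OF \<phi>(1) rt[OF k] hk(1)[of k]] act_Comp[OF \<psi> rt[OF k] ej[OF k]] hk(2)[OF k]
          by (simp add: h(2)[OF k])
      qed
      also have "\<dots> = act (act \<psi> e) t"
        using act_Comp[OF \<psi> t e(1)] exp[OF e(1)] by simp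
      finally show "act (act \<phi> h) t = act (act \<psi> e) t" .
    qed
    note he = this
    obtain f where f: "is_cokernel C e f"
      using epi_cokernel[OF e(2)] by blast
    have fH: "f \<in> Hom C (Dom C f) S" and ef: "e \<cdot> f = ZeroArr C (Dom C f) b"
      using f HomD[OF e(1)] by (auto simp: is_cokernel_def Hom_def)
    have D: "Dom C f \<in> Obj C"
      using Hom_Obj[OF fH] by simp
    \<comment> \<open>By \<open>inj\<close> this may be tested after restricting
      \<open>\<phi>\<close>, where \<open>h\<close> can be traded for \<open>e\<close>, and
      \<open>e \<cdot> f\<close> is zero.\<close>
    have "h \<cdot> f = ZeroArr C (Dom C f) c"
    proof (rule inj[OF Comp_in_Hom[OF fH h(1)] ZeroArr_Hom[OF D cO]])
      have "act \<phi> (h \<cdot> f) = act \<psi> (ZeroArr C (Dom C f) b)"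
        using act_Comp[OF \<phi>(1) fH h(1)] act_Comp[OF \<psi> fH e(1)] he by (simp add: ef)
      also have "\<dots> = act \<phi> (ZeroArr C (Dom C f) c)"
        by (rule act_zero[OF \<psi> \<phi>(1) D b cO])
      finally show "act \<phi> (h \<cdot> f) = act \<phi> (ZeroArr C (Dom C f) c)" .
    qed
    then obtain h' where h': "h' \<in> Hom C b c" "h' \<cdot> e = h"
      using f h(1) HomD[OF fH] HomD[OF e(1)] unfolding is_cokernel_def by metis
    have "act \<phi> h' = \<psi>"
    proof (rule sep[OF act[OF \<phi>(1) h'(1)] \<psi> b])
      fix t assume t: "t \<in> Hom C Q b"
      obtain s where s: "s \<in> Hom C Q S" "e \<cdot> s = t"
        using Q_projective e t HomD[OF e(1)] unfolding is_projective_def by metis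
      have "h' \<cdot> t = h \<cdot> s"
        using Comp_assoc[OF s(1) e(1) h'(1)] s(2) h'(2) by simp
      then have "act (act \<phi> h') t = act \<phi> (h \<cdot> s)"
        using act_Comp[OF \<phi>(1) t h'(1)] by simp
      also have "\<dots> = act \<psi> t"
        using act_Comp[OF \<phi>(1) s(1) h(1)] act_Comp[OF \<psi> s(1) e(1)] he s(2) by simp
      finally show "act (act \<phi> h') t = act \<psi> t" .
    qed
    then show ?thesis
      using h'(1) by blast
  qed
  show ?thesis
    using cO \<phi>(1) surj inj by metis
qed

end


section \<open>Universal data\<close>

abbreviation hdual :: "('o, 'm, 'k::field) linear_cat \<Rightarrow> 'o \<Rightarrow> 'o \<Rightarrow> ('m \<Rightarrow> 'k) set" where
  "hdual C a b \<equiv> carrier (dual_space (hom_space C a b))"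

text \<open>Dual of a contravariant Hom, hence covariant: for \<open>f : a \<rightarrow> b\<close>
  it goes from the dual of \<open>Hom(a, y)\<close> to that of \<open>Hom(b, y)\<close>. Its
  companion \<open>postcomp_dual\<close> is contravariant in \<open>u\<close>. Passing to the
  opposite category exchanges the two.\<close>

definition precomp_dual :: "('o, 'm, 'k::field) linear_cat \<Rightarrow> 'o \<Rightarrow> 'm \<Rightarrow> ('m \<Rightarrow> 'k) \<Rightarrow> 'm \<Rightarrow> 'k" where
  "precomp_dual C y f \<xi> = transpose_map (hom_space C (Cod C f) y) (\<lambda>g. g \<cdot>\<^bsub>C\<^esub> f) \<xi>"

definition postcomp_dual :: "('o, 'm, 'k::field) linear_cat \<Rightarrow> 'o \<Rightarrow> 'm \<Rightarrow> ('m \<Rightarrow> 'k) \<Rightarrow> 'm \<Rightarrow> 'k" where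
  "postcomp_dual C x u \<xi> = transpose_map (hom_space C x (Dom C u)) (\<lambda>g. u \<cdot>\<^bsub>C\<^esub> g) \<xi>"

text \<open>
  By the universal property of \<open>v \<otimes> c\<close>, a dinatural family \<open>w \<rightarrow> Hom(x, y) \<otimes> H(x)\<close> amounts to
  linear maps \<open>p x : Hom(x, y)\<^sup>\<star> \<rightarrow> Hom(w, H(x))\<close> with the naturality below.  In the opposite category
  the same notion describes dinatural families \<open>Hom(y, x)\<^sup>\<star> \<otimes> H(x) \<rightarrow> w\<close>, so both halves of the
  theorem become one statement.
\<close>

definition is_datum ::
    "('o, 'm, 'k::field) linear_cat \<Rightarrow> ('o, 'm) endofunctor \<Rightarrow> 'o \<Rightarrow> 'o \<Rightarrow> ('o \<Rightarrow> ('m \<Rightarrow> 'k) \<Rightarrow> 'm) \<Rightarrow> bool" where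
  "is_datum C H y w p \<longleftrightarrow> w \<in> Obj C \<and>
     (\<forall>x\<in>Obj C. p x \<in> linear_maps (dual_space (hom_space C x y)) (hom_space C w (OMap H x))) \<and>
     (\<forall>a b. \<forall>f\<in>Hom C a b. \<forall>\<xi>\<in>hdual C a y. AMap H f \<cdot>\<^bsub>C\<^esub> p a \<xi> = p b (precomp_dual C y f \<xi>))"

definition is_universal ::
    "('o, 'm, 'k::field) linear_cat \<Rightarrow> ('o, 'm) endofunctor \<Rightarrow> 'o \<Rightarrow> 'o \<Rightarrow> ('o \<Rightarrow> ('m \<Rightarrow> 'k) \<Rightarrow> 'm) \<Rightarrow> bool" where
  "is_universal C H y z p \<longleftrightarrow> is_datum C H y z p \<and>
     (\<forall>w q. is_datum C H y w q \<longrightarrow>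
        (\<exists>!h. h \<in> Hom C w z \<and> (\<forall>x\<in>Obj C. \<forall>\<xi>\<in>hdual C x y. p x \<xi> \<cdot>\<^bsub>C\<^esub> h = q x \<xi>)))"

text \<open>Only the universal families and their compatibility with morphisms are recorded;
  functoriality and linearity of \<open>E\<close> follow from uniqueness.\<close>

definition is_Gamma ::
    "('o, 'm, 'k::field) linear_cat \<Rightarrow> ('o, 'm) endofunctor \<Rightarrow> ('o, 'm) endofunctor \<Rightarrow>
     ('o \<Rightarrow> 'o \<Rightarrow> ('m \<Rightarrow> 'k) \<Rightarrow> 'm) \<Rightarrow> bool" where
  "is_Gamma C H E P \<longleftrightarrow> (\<forall>y\<in>Obj C. is_universal C H y (OMap E y) (P y)) \<and>
     (\<forall>y y'. \<forall>u\<in>Hom C y y'. AMap E u \<in> Hom C (OMap E y) (OMap E y') \<and>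
        (\<forall>x\<in>Obj C. \<forall>\<xi>\<in>hdual C x y'. P y' x \<xi> \<cdot>\<^bsub>C\<^esub> AMap E u = P y x (postcomp_dual C x u \<xi>)))"

section \<open>Consequences of the universal property\<close>

lemma linear_endofunctorD:
  assumes "linear_endofunctor C H"
  shows "a \<in> Obj C \<Longrightarrow> OMap H a \<in> Obj C"
    and "a \<in> Obj C \<Longrightarrow> AMap H (Idt C a) = Idt C (OMap H a)"
    and "\<lbrakk>a \<in> Obj C; b \<in> Obj C\<rbrakk> \<Longrightarrow> AMap H \<in> linear_maps (hom_space C a b) (hom_space C (OMap H a) (OMap H b))"
    and "\<lbrakk>f \<in> Hom C a b; g \<in> Hom C b c\<rbrakk> \<Longrightarrow> AMap H (g \<cdot>\<^bsub>C\<^esub> f) = AMap H g \<cdot>\<^bsub>C\<^esub> AMap H f"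
  using assms unfolding linear_endofunctor_def by blast+

lemma is_datumD:
  assumes "is_datum C H y w p"
  shows "w \<in> Obj C"
    and "x \<in> Obj C \<Longrightarrow> p x \<in> linear_maps (dual_space (hom_space C x y)) (hom_space C w (OMap H x))"
    and "\<lbrakk>f \<in> Hom C a b; \<xi> \<in> hdual C a y\<rbrakk> \<Longrightarrow> AMap H f \<cdot>\<^bsub>C\<^esub> p a \<xi> = p b (precomp_dual C y f \<xi>)"
  using assms by (auto simp: is_datum_def)

lemma is_datum_Hom: "is_datum C H y w p \<Longrightarrow> x \<in> Obj C \<Longrightarrow> \<xi> \<in> hdual C x y \<Longrightarrow> p x \<xi> \<in> Hom C w (OMap H x)"
  using linear_maps_closed[OF is_datumD(2)] by fastforce

lemma is_universalD: "is_universal C H y z p \<Longrightarrow> is_datum C H y z p"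
  by (simp add: is_universal_def)

lemma is_universalE:
  assumes "is_universal C H y z p" "is_datum C H y w q"
  obtains h where "h \<in> Hom C w z" "\<And>x \<xi>. \<lbrakk>x \<in> Obj C; \<xi> \<in> hdual C x y\<rbrakk> \<Longrightarrow> p x \<xi> \<cdot>\<^bsub>C\<^esub> h = q x \<xi>"
  using assms unfolding is_universal_def by blast

context linear_category
begin

lemma linear_endofunctor_Hom:
  assumes "linear_endofunctor C H" "f \<in> Hom C a b"
  shows "AMap H f \<in> Hom C (OMap H a) (OMap H b)"
  using linear_maps_closed[OF linear_endofunctorD(3)[OF assms(1) Hom_Obj[OF assms(2)]]] assms(2) by simp

lemma precomp_dual_apply: "f \<in> Hom C a b \<Longrightarrow> g \<in> Hom C b y \<Longrightarrow> precomp_dual C y f \<xi> g = \<xi> (g \<cdot> f)"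
  by (simp add: precomp_dual_def transpose_map_apply HomD)

lemma postcomp_dual_apply: "u \<in> Hom C y y' \<Longrightarrow> g \<in> Hom C x y \<Longrightarrow> postcomp_dual C x u \<xi> g = \<xi> (u \<cdot> g)"
  by (simp add: postcomp_dual_def transpose_map_apply HomD)

lemma precomp_dual_linear:
  assumes "f \<in> Hom C a b" "y \<in> Obj C"
  shows "precomp_dual C y f \<in> linear_maps (dual_space (hom_space C a y)) (dual_space (hom_space C b y))"
  using transpose_map_linear[OF vectorspace_Hom[OF Hom_Obj(2)[OF assms(1)] assms(2)] precomp_linear[OF assms]]
  by (simp add: precomp_dual_def[abs_def] HomD(3)[OF assms(1)])

lemma postcomp_dual_linear:
  assumes "u \<in> Hom C y y'" "x \<in> Obj C"
  shows "postcomp_dual C x u \<in> linear_maps (dual_space (hom_space C x y')) (dual_space (hom_space C x y))"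
  using transpose_map_linear[OF vectorspace_Hom[OF assms(2) Hom_Obj(1)[OF assms(1)]] postcomp_linear[OF assms]]
  by (simp add: postcomp_dual_def[abs_def] HomD(2)[OF assms(1)])

lemma precomp_dual_closed: "f \<in> Hom C a b \<Longrightarrow> y \<in> Obj C \<Longrightarrow> \<xi> \<in> hdual C a y \<Longrightarrow> precomp_dual C y f \<xi> \<in> hdual C b y"
  using linear_maps_closed[OF precomp_dual_linear] .

lemma postcomp_dual_closed: "u \<in> Hom C y y' \<Longrightarrow> x \<in> Obj C \<Longrightarrow> \<xi> \<in> hdual C x y' \<Longrightarrow> postcomp_dual C x u \<xi> \<in> hdual C x y"
  using linear_maps_closed[OF postcomp_dual_linear] .

lemma hdual_eqI: "\<xi> \<in> hdual C a b \<Longrightarrow> \<eta> \<in> hdual C a b \<Longrightarrow> (\<And>g. g \<in> Hom C a b \<Longrightarrow> \<xi> g = \<eta> g) \<Longrightarrow> \<xi> = \<eta>"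
  using dual_eqI[of \<xi> "hom_space C a b" \<eta>] by simp

text \<open>Data are total functions whose values matter only at objects and functionals. Hence
  \<open>q\<close> is any function that agrees with the composite there; with \<open>h\<close> an
  identity this says that being a datum depends only on the relevant values.\<close>

lemma is_datum_comp:
  assumes H: "linear_endofunctor C H" and p: "is_datum C H y z p" and h: "h \<in> Hom C w z"
    and q: "\<And>x \<xi>. x \<in> Obj C \<Longrightarrow> \<xi> \<in> hdual C x y \<Longrightarrow> q x \<xi> = p x \<xi> \<cdot> h" and y: "y \<in> Obj C"
  shows "is_datum C H y w q"
  unfolding is_datum_def
proof (intro conjI ballI allI)
  show "w \<in> Obj C"
    using Hom_Obj[OF h] by simp
next
  fix x assume x: "x \<in> Obj C"
  note V = vectorspace_dual[OF vectorspace_Hom[OF x y]]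
  have "(\<lambda>\<xi>. p x \<xi> \<cdot> h) \<in> linear_maps (dual_space (hom_space C x y)) (hom_space C w (OMap H x))"
    using linear_maps_comp[OF is_datumD(2)[OF p x] precomp_linear[OF h linear_endofunctorD(1)[OF H x]]] .
  then show "q x \<in> linear_maps (dual_space (hom_space C x y)) (hom_space C w (OMap H x))"
    by (auto intro!: linear_mapsI dest: linear_maps_closed linear_maps_add linear_maps_smult simp: q x vs_simps[OF V])
next
  fix a b f \<xi> assume f: "f \<in> Hom C a b" and \<xi>: "\<xi> \<in> hdual C a y"
  have a: "a \<in> Obj C" and b: "b \<in> Obj C"
    using Hom_Obj[OF f] by auto
  show "AMap H f \<cdot> q a \<xi> = q b (precomp_dual C y f \<xi>)"
    using Comp_assoc[OF h is_datum_Hom[OF p a \<xi>] linear_endofunctor_Hom[OF H f]]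
      is_datumD(3)[OF p f \<xi>] precomp_dual_closed[OF f y \<xi>] by (simp add: q a b \<xi>)
qed

text \<open>The members of a universal family are jointly monic. Equations between morphisms into a
  value of \<open>\<Gamma>\<close> are tested in this way throughout.\<close>

lemma is_universal_eqI:
  assumes H: "linear_endofunctor C H" and y: "y \<in> Obj C" and u: "is_universal C H y z p"
    and h: "h \<in> Hom C w z" "h' \<in> Hom C w z"
    and eq: "\<And>x \<xi>. x \<in> Obj C \<Longrightarrow> \<xi> \<in> hdual C x y \<Longrightarrow> p x \<xi> \<cdot> h = p x \<xi> \<cdot> h'"
  shows "h = h'"
proof -
  have "is_datum C H y w (\<lambda>x \<xi>. p x \<xi> \<cdot> h)"
    by (rule is_datum_comp[OF H is_universalD[OF u] h(1) _ y]) simp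
  then have "\<exists>!k. k \<in> Hom C w z \<and> (\<forall>x\<in>Obj C. \<forall>\<xi>\<in>hdual C x y. p x \<xi> \<cdot> k = p x \<xi> \<cdot> h)"
    using u unfolding is_universal_def by blast
  then show ?thesis
    using h eq by metis
qed

lemma is_GammaD:
  assumes "is_Gamma C H E P"
  shows "y \<in> Obj C \<Longrightarrow> is_universal C H y (OMap E y) (P y)"
    and "u \<in> Hom C y y' \<Longrightarrow> AMap E u \<in> Hom C (OMap E y) (OMap E y')"
    and "\<lbrakk>u \<in> Hom C y y'; x \<in> Obj C; \<xi> \<in> hdual C x y'\<rbrakk> \<Longrightarrow> P y' x \<xi> \<cdot> AMap E u = P y x (postcomp_dual C x u \<xi>)"
  using assms by (auto simp: is_Gamma_def)

lemma is_Gamma_Obj: "is_Gamma C H E P \<Longrightarrow> y \<in> Obj C \<Longrightarrow> OMap E y \<in> Obj C"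
  using is_datumD(1)[OF is_universalD[OF is_GammaD(1)]] .

text \<open>Tested on the universal family, each law for \<open>AMap E\<close> becomes the
  corresponding law for \<open>postcomp_dual\<close>, which in turn is tested on morphisms.\<close>

lemma is_Gamma_linear_endofunctor:
  assumes H: "linear_endofunctor C H" and E: "is_Gamma C H E P"
  shows "linear_endofunctor C E"
proof -
  note PH = is_datum_Hom[OF is_universalD[OF is_GammaD(1)[OF E]]]
  note PL = is_datumD(2)[OF is_universalD[OF is_GammaD(1)[OF E]]]
  note EH = is_GammaD(2)[OF E] and ES = is_GammaD(3)[OF E]
  note eqI = is_universal_eqI[OF H _ is_GammaD(1)[OF E]]
  show ?thesis
    unfolding linear_endofunctor_def
  proof (intro conjI ballI allI)
    fix a assume a: "a \<in> Obj C"
    show "OMap E a \<in> Obj C"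
      by (rule is_Gamma_Obj[OF E a])
    note I = Idt_in_Hom[OF a]
    show "AMap E (Idt C a) = Idt C (OMap E a)"
    proof (rule eqI[OF a a EH[OF I] Idt_in_Hom[OF is_Gamma_Obj[OF E a]]])
      fix x \<xi> assume x: "x \<in> Obj C" and \<xi>: "\<xi> \<in> hdual C x a"
      have "postcomp_dual C x (Idt C a) \<xi> = \<xi>"
        by (rule hdual_eqI[OF postcomp_dual_closed[OF I x \<xi>] \<xi>]) (simp add: postcomp_dual_apply[OF I] Idt_Comp)
      then show "P a x \<xi> \<cdot> AMap E (Idt C a) = P a x \<xi> \<cdot> Idt C (OMap E a)"
        using ES[OF I x \<xi>] Comp_Idt[OF PH[OF a x \<xi>]] by simp
    qed
  next
    fix a b assume a: "a \<in> Obj C" and b: "b \<in> Obj C"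
    show "AMap E \<in> linear_maps (hom_space C a b) (hom_space C (OMap E a) (OMap E b))"
    proof (rule linear_mapsI; simp only: hom_space_simps)
      show "AMap E f \<in> Hom C (OMap E a) (OMap E b)" if "f \<in> Hom C a b" for f
        by (rule EH[OF that])
    next
      fix f g assume f: "f \<in> Hom C a b" and g: "g \<in> Hom C a b"
      note fg = AddArr_Hom[OF f g]
      show "AMap E (AddArr C f g) = AddArr C (AMap E f) (AMap E g)"
      proof (rule eqI[OF b b EH[OF fg] AddArr_Hom[OF EH[OF f] EH[OF g]]])
        fix x \<xi> assume x: "x \<in> Obj C" and \<xi>: "\<xi> \<in> hdual C x b"
        note c = postcomp_dual_closed[OF f x \<xi>] postcomp_dual_closed[OF g x \<xi>]
        have "postcomp_dual C x (AddArr C f g) \<xi>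
            = postcomp_dual C x f \<xi> \<oplus>\<^bsub>dual_space (hom_space C x a)\<^esub> postcomp_dual C x g \<xi>"
        proof (rule hdual_eqI[OF postcomp_dual_closed[OF fg x \<xi>]])
          show "postcomp_dual C x f \<xi> \<oplus>\<^bsub>dual_space (hom_space C x a)\<^esub> postcomp_dual C x g \<xi> \<in> hdual C x a"
            using vs_add_closed[OF vectorspace_dual[OF vectorspace_Hom[OF x a]] c] .
          fix t assume t: "t \<in> Hom C x a"
          show "postcomp_dual C x (AddArr C f g) \<xi> t
              = (postcomp_dual C x f \<xi> \<oplus>\<^bsub>dual_space (hom_space C x a)\<^esub> postcomp_dual C x g \<xi>) t"
            using dual_add[OF \<xi>, of "f \<cdot> t" "g \<cdot> t"] Comp_in_Hom[OF t f] Comp_in_Hom[OF t g] t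
            by (simp add: postcomp_dual_apply[OF fg t] postcomp_dual_apply[OF f t] postcomp_dual_apply[OF g t]
                dual_add_apply AddArr_Comp[OF t f g])
        qed
        then have "P b x \<xi> \<cdot> AMap E (AddArr C f g) = AddArr C (P b x \<xi> \<cdot> AMap E f) (P b x \<xi> \<cdot> AMap E g)"
          using linear_maps_add[OF PL[OF a x] c] by (simp add: ES[OF fg x \<xi>] ES[OF f x \<xi>] ES[OF g x \<xi>])
        then show "P b x \<xi> \<cdot> AMap E (AddArr C f g) = P b x \<xi> \<cdot> AddArr C (AMap E f) (AMap E g)"
          using Comp_AddArr[OF EH[OF f] PH[OF b x \<xi>] EH[OF g]] by simp
      qed
    next
      fix k f assume f: "f \<in> Hom C a b"
      note fg = ScaleArr_Hom[OF f]
      show "AMap E (ScaleArr C k f) = ScaleArr C k (AMap E f)"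
      proof (rule eqI[OF b b EH[OF fg] ScaleArr_Hom[OF EH[OF f]]])
        fix x \<xi> assume x: "x \<in> Obj C" and \<xi>: "\<xi> \<in> hdual C x b"
        note c = postcomp_dual_closed[OF f x \<xi>]
        have "postcomp_dual C x (ScaleArr C k f) \<xi> = k \<odot>\<^bsub>dual_space (hom_space C x a)\<^esub> postcomp_dual C x f \<xi>"
        proof (rule hdual_eqI[OF postcomp_dual_closed[OF fg x \<xi>]])
          show "k \<odot>\<^bsub>dual_space (hom_space C x a)\<^esub> postcomp_dual C x f \<xi> \<in> hdual C x a"
            using vs_smult_closed[OF vectorspace_dual[OF vectorspace_Hom[OF x a]] c] .
          fix t assume t: "t \<in> Hom C x a"
          show "postcomp_dual C x (ScaleArr C k f) \<xi> t = (k \<odot>\<^bsub>dual_space (hom_space C x a)\<^esub> postcomp_dual C x f \<xi>) t"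
            using dual_smult[OF \<xi>, of "f \<cdot> t" k] Comp_in_Hom[OF t f] t
            by (simp add: postcomp_dual_apply[OF fg t] postcomp_dual_apply[OF f t] dual_smult_apply ScaleArr_Comp[OF t f])
        qed
        then have "P b x \<xi> \<cdot> AMap E (ScaleArr C k f) = ScaleArr C k (P b x \<xi> \<cdot> AMap E f)"
          using linear_maps_smult[OF PL[OF a x] c] by (simp add: ES[OF fg x \<xi>] ES[OF f x \<xi>])
        then show "P b x \<xi> \<cdot> AMap E (ScaleArr C k f) = P b x \<xi> \<cdot> ScaleArr C k (AMap E f)"
          using Comp_ScaleArr[OF EH[OF f] PH[OF b x \<xi>]] by simp
      qed
    qed
  next
    fix a b c f g assume f: "f \<in> Hom C a b" and g: "g \<in> Hom C b c"
    have a: "a \<in> Obj C" and b: "b \<in> Obj C" and c: "c \<in> Obj C"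
      using Hom_Obj[OF f] Hom_Obj[OF g] by auto
    note gf = Comp_in_Hom[OF f g]
    show "AMap E (g \<cdot> f) = AMap E g \<cdot> AMap E f"
    proof (rule eqI[OF c c EH[OF gf] Comp_in_Hom[OF EH[OF f] EH[OF g]]])
      fix x \<xi> assume x: "x \<in> Obj C" and \<xi>: "\<xi> \<in> hdual C x c"
      note gx = postcomp_dual_closed[OF g x \<xi>]
      have "postcomp_dual C x (g \<cdot> f) \<xi> = postcomp_dual C x f (postcomp_dual C x g \<xi>)"
      proof (rule hdual_eqI[OF postcomp_dual_closed[OF gf x \<xi>] postcomp_dual_closed[OF f x gx]])
        fix t assume t: "t \<in> Hom C x a"
        show "postcomp_dual C x (g \<cdot> f) \<xi> t = postcomp_dual C x f (postcomp_dual C x g \<xi>) t"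
          using Comp_assoc[OF t f g]
          by (simp add: postcomp_dual_apply[OF gf t] postcomp_dual_apply[OF f t] postcomp_dual_apply[OF g Comp_in_Hom[OF t f]])
      qed
      then have "P c x \<xi> \<cdot> AMap E (g \<cdot> f) = (P c x \<xi> \<cdot> AMap E g) \<cdot> AMap E f"
        by (simp add: ES[OF gf x \<xi>] ES[OF g x \<xi>] ES[OF f x gx])
      then show "P c x \<xi> \<cdot> AMap E (g \<cdot> f) = P c x \<xi> \<cdot> (AMap E g \<cdot> AMap E f)"
        using Comp_assoc[OF EH[OF f] EH[OF g] PH[OF c x \<xi>]] by simp
    qed
  qed
qed

text \<open>Each universal family is a datum for the other, which yields mutually inverse comparison
  morphisms. It reduces the theorem to finding the right universal family on the composite.\<close>

lemma is_Gamma_unique: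
  assumes H: "linear_endofunctor C H" and E: "is_Gamma C H E P" and E': "is_Gamma C H E' P'"
  shows "isomorphic_functors C E E'"
proof -
  note D = is_universalD[OF is_GammaD(1)[OF E]] and D' = is_universalD[OF is_GammaD(1)[OF E']]
  note PH = is_datum_Hom[OF D] and PH' = is_datum_Hom[OF D']
  note eqI = is_universal_eqI[OF H _ is_GammaD(1)[OF E]] and eqI' = is_universal_eqI[OF H _ is_GammaD(1)[OF E']]
  have "\<exists>h. y \<in> Obj C \<longrightarrow> h \<in> Hom C (OMap E y) (OMap E' y) \<and> (\<forall>x\<in>Obj C. \<forall>\<xi>\<in>hdual C x y. P' y x \<xi> \<cdot> h = P y x \<xi>)" for y
    using is_universalE[OF is_GammaD(1)[OF E'] D] by metis
  then obtain \<eta> where \<eta>: "\<And>y. y \<in> Obj C \<Longrightarrow> \<eta> y \<in> Hom C (OMap E y) (OMap E' y)"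
    and \<eta>P: "\<And>x y \<xi>. y \<in> Obj C \<Longrightarrow> x \<in> Obj C \<Longrightarrow> \<xi> \<in> hdual C x y \<Longrightarrow> P' y x \<xi> \<cdot> \<eta> y = P y x \<xi>"
    by metis
  have "is_iso C (\<eta> y)" if y: "y \<in> Obj C" for y
  proof -
    obtain k where k: "k \<in> Hom C (OMap E' y) (OMap E y)" "\<And>x \<xi>. x \<in> Obj C \<Longrightarrow> \<xi> \<in> hdual C x y \<Longrightarrow> P y x \<xi> \<cdot> k = P' y x \<xi>"
      using is_universalE[OF is_GammaD(1)[OF E y] D'[OF y]] by metis
    have "k \<cdot> \<eta> y = Idt C (OMap E y)"
    proof (rule eqI[OF y y Comp_in_Hom[OF \<eta>[OF y] k(1)] Idt_in_Hom[OF is_Gamma_Obj[OF E y]]])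
      fix x \<xi> assume x: "x \<in> Obj C" "\<xi> \<in> hdual C x y"
      show "P y x \<xi> \<cdot> (k \<cdot> \<eta> y) = P y x \<xi> \<cdot> Idt C (OMap E y)"
        using Comp_assoc[OF \<eta>[OF y] k(1) PH[OF y x]] Comp_Idt[OF PH[OF y x]] by (simp add: k(2)[OF x] \<eta>P[OF y x])
    qed
    moreover have "\<eta> y \<cdot> k = Idt C (OMap E' y)"
    proof (rule eqI'[OF y y Comp_in_Hom[OF k(1) \<eta>[OF y]] Idt_in_Hom[OF is_Gamma_Obj[OF E' y]]])
      fix x \<xi> assume x: "x \<in> Obj C" "\<xi> \<in> hdual C x y"
      show "P' y x \<xi> \<cdot> (\<eta> y \<cdot> k) = P' y x \<xi> \<cdot> Idt C (OMap E' y)"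
        using Comp_assoc[OF k(1) \<eta>[OF y] PH'[OF y x]] Comp_Idt[OF PH'[OF y x]] by (simp add: k(2)[OF x] \<eta>P[OF y x])
    qed
    ultimately show ?thesis
      using \<eta>[OF y] k(1) by (auto simp: is_iso_def HomD)
  qed
  moreover have "\<eta> b \<cdot> AMap E f = AMap E' f \<cdot> \<eta> a" if f: "f \<in> Hom C a b" for a b f
  proof -
    have a: "a \<in> Obj C" and b: "b \<in> Obj C"
      using Hom_Obj[OF f] by auto
    note Ef = is_GammaD(2)[OF E f] and Ef' = is_GammaD(2)[OF E' f]
    show ?thesis
    proof (rule eqI'[OF b b Comp_in_Hom[OF Ef \<eta>[OF b]] Comp_in_Hom[OF \<eta>[OF a] Ef']])
      fix x \<xi> assume x: "x \<in> Obj C" "\<xi> \<in> hdual C x b"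
      note c = postcomp_dual_closed[OF f x]
      show "P' b x \<xi> \<cdot> (\<eta> b \<cdot> AMap E f) = P' b x \<xi> \<cdot> (AMap E' f \<cdot> \<eta> a)"
        using Comp_assoc[OF Ef \<eta>[OF b] PH'[OF b x]] Comp_assoc[OF \<eta>[OF a] Ef' PH'[OF b x]]
        by (simp add: \<eta>P[OF b x] is_GammaD(3)[OF E f x] is_GammaD(3)[OF E' f x] \<eta>P[OF a x(1) c])
    qed
  qed
  ultimately show ?thesis
    unfolding isomorphic_functors_def
    using is_Gamma_linear_endofunctor[OF H E] is_Gamma_linear_endofunctor[OF H E'] \<eta> by blast
qed

end

text \<open>The same components serve on both sides, but each of them points the other way in the
  opposite category; so source and target functor are exchanged.\<close>

lemma isomorphic_functors_op: "isomorphic_functors (op_cat C) E E' \<longleftrightarrow> isomorphic_functors C E' E"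
proof -
  have "is_iso (op_cat C) f \<longleftrightarrow> is_iso C f" for f
    by (auto simp: is_iso_def)
  moreover have "(\<forall>a b. \<forall>f\<in>Hom C b a. AMap E f \<cdot>\<^bsub>C\<^esub> \<eta> b = \<eta> a \<cdot>\<^bsub>C\<^esub> AMap E' f) \<longleftrightarrow>
      (\<forall>a b. \<forall>f\<in>Hom C a b. \<eta> b \<cdot>\<^bsub>C\<^esub> AMap E' f = AMap E f \<cdot>\<^bsub>C\<^esub> \<eta> a)" for \<eta>
    by (simp only: eq_commute) blast
  ultimately show ?thesis
    by (auto simp: isomorphic_functors_def linear_endofunctor_op)
qed


section \<open>Composites of functors of the form \<Gamma>\<close>

context category_with_generator
begin

text \<open>The device that turns scalars into morphisms. Linearity of \<open>\<Lambda>\<close> is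
  asked for only on the dual space, since a functional becomes a member of the bidual after
  restriction.\<close>

lemma Hom_reflexive:
  assumes a: "a \<in> Obj C" and b: "b \<in> Obj C"
    and add: "\<And>\<xi> \<eta>. \<xi> \<in> hdual C a b \<Longrightarrow> \<eta> \<in> hdual C a b \<Longrightarrow> \<Lambda> (\<xi> \<oplus>\<^bsub>dual_space (hom_space C a b)\<^esub> \<eta>) = \<Lambda> \<xi> + \<Lambda> \<eta>"
    and smult: "\<And>k \<xi>. \<xi> \<in> hdual C a b \<Longrightarrow> \<Lambda> (k \<odot>\<^bsub>dual_space (hom_space C a b)\<^esub> \<xi>) = k * \<Lambda> \<xi>"
  shows "\<exists>g\<in>Hom C a b. \<forall>\<xi>\<in>hdual C a b. \<xi> g = \<Lambda> \<xi>"
proof -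
  note V = vectorspace_dual[OF vectorspace_Hom[OF a b]]
  have "restrict \<Lambda> (hdual C a b) \<in> carrier (dual_space (dual_space (hom_space C a b)))"
    by (rule dual_restrictI[OF V]) (simp_all only: add smult)
  from dual_space_reflexive[OF fdvs_Hom[OF a b] this] show ?thesis
    by fastforce
qed

lemma Hom_separates: "f \<in> Hom C a b \<Longrightarrow> g \<in> Hom C a b \<Longrightarrow> (\<And>\<xi>. \<xi> \<in> hdual C a b \<Longrightarrow> \<xi> f = \<xi> g) \<Longrightarrow> f = g"
  using dual_space_separates[OF fdvs_Hom, of a b f g] Hom_Obj[of f a b] by simp

text \<open>
  Let \<open>q x \<xi> : w \<rightarrow> E(G x)\<close> be a datum.  For a functional \<open>l\<close> on \<open>Hom(w, F u)\<close>, reflexivity turns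
  \<open>\<eta> \<mapsto> l (P (G x) u \<eta> \<cdot> q x \<xi>)\<close> into a datum \<open>u \<rightarrow> G x\<close>, hence into a morphism \<open>u \<rightarrow> E2 y\<close>; dualizing
  in \<open>l\<close> gives a datum \<open>w \<rightarrow> F u\<close>, hence the required morphism \<open>w \<rightarrow> E (E2 y)\<close>.
\<close>

lemma is_Gamma_comp_universal:
  assumes F: "linear_endofunctor C F" and G: "linear_endofunctor C G"
    and E: "is_Gamma C F E P" and E2: "is_Gamma C G E2 P2" and y: "y \<in> Obj C"
    and q: "is_datum C (functor_comp E G) y w q"
  shows "\<exists>!h. h \<in> Hom C w (OMap E (OMap E2 y)) \<and>
    (\<forall>x\<in>Obj C. \<forall>\<xi>\<in>hdual C x y. AMap E (P2 y x \<xi>) \<cdot> h = q x \<xi>)"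
proof -
  let ?v = "OMap E2 y"
  note lE = is_Gamma_linear_endofunctor[OF F E] and lE2 = is_Gamma_linear_endofunctor[OF G E2]
  have v: "?v \<in> Obj C"
    by (rule is_Gamma_Obj[OF E2 y])
  note FO = linear_endofunctorD(1)[OF F] and GO = linear_endofunctorD(1)[OF G]
  note FH = linear_endofunctor_Hom[OF F] and GH = linear_endofunctor_Hom[OF G] and EH = linear_endofunctor_Hom[OF lE]
  note D = is_universalD[OF is_GammaD(1)[OF E]] and D2 = is_universalD[OF is_GammaD(1)[OF E2 y]]
  note PH = is_datum_Hom[OF D] and P2H = is_datum_Hom[OF D2]
  note PL = is_datumD(2)[OF D] and P2L = is_datumD(2)[OF D2]
  have w: "w \<in> Obj C"
    using is_datumD(1)[OF q] .
  have qH: "q x \<xi> \<in> Hom C w (OMap E (OMap G x))" if "x \<in> Obj C" "\<xi> \<in> hdual C x y" for x \<xi>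
    using is_datum_Hom[OF q that] by (simp add: functor_comp_def)
  have qL: "q x \<in> linear_maps (dual_space (hom_space C x y)) (hom_space C w (OMap E (OMap G x)))" if "x \<in> Obj C" for x
    using is_datumD(2)[OF q that] by (simp add: functor_comp_def)
  have qN: "AMap E (AMap G f) \<cdot> q a \<xi> = q b (precomp_dual C y f \<xi>)" if "f \<in> Hom C a b" "\<xi> \<in> hdual C a y" for f a b \<xi>
    using is_datumD(3)[OF q that] by (simp add: functor_comp_def)
  have PqH: "P (OMap G x) u \<eta> \<cdot> q x \<xi> \<in> Hom C w (OMap F u)"
    if "u \<in> Obj C" "x \<in> Obj C" "\<xi> \<in> hdual C x y" "\<eta> \<in> hdual C u (OMap G x)" for u x \<xi> \<eta>
    using Comp_in_Hom[OF qH[OF that(2,3)] PH[OF GO[OF that(2)] that(1,4)]] .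
  have "\<exists>g\<in>Hom C u (OMap G x). \<forall>\<eta>\<in>hdual C u (OMap G x). \<eta> g = l (P (OMap G x) u \<eta> \<cdot> q x \<xi>)"
    if u: "u \<in> Obj C" and l: "l \<in> hdual C w (OMap F u)" and x: "x \<in> Obj C" "\<xi> \<in> hdual C x y" for u l x \<xi>
  proof (rule Hom_reflexive[OF u GO[OF x(1)]])
    note Gx = GO[OF x(1)]
    show "l (P (OMap G x) u (\<eta> \<oplus>\<^bsub>dual_space (hom_space C u (OMap G x))\<^esub> \<eta>') \<cdot> q x \<xi>)
      = l (P (OMap G x) u \<eta> \<cdot> q x \<xi>) + l (P (OMap G x) u \<eta>' \<cdot> q x \<xi>)"
      if "\<eta> \<in> hdual C u (OMap G x)" "\<eta>' \<in> hdual C u (OMap G x)" for \<eta> \<eta>'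
      using linear_maps_add[OF PL[OF Gx u] that] AddArr_Comp[OF qH[OF x] PH[OF Gx u that(1)] PH[OF Gx u that(2)]]
        dual_add[OF l, of "P (OMap G x) u \<eta> \<cdot> q x \<xi>" "P (OMap G x) u \<eta>' \<cdot> q x \<xi>"] PqH[OF u x that(1)] PqH[OF u x that(2)]
      by simp
    show "l (P (OMap G x) u (k \<odot>\<^bsub>dual_space (hom_space C u (OMap G x))\<^esub> \<eta>) \<cdot> q x \<xi>) = k * l (P (OMap G x) u \<eta> \<cdot> q x \<xi>)"
      if "\<eta> \<in> hdual C u (OMap G x)" for k \<eta>
      using linear_maps_smult[OF PL[OF Gx u] that] ScaleArr_Comp[OF qH[OF x] PH[OF Gx u that]]
        dual_smult[OF l, of "P (OMap G x) u \<eta> \<cdot> q x \<xi>" k] PqH[OF u x that]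
      by simp
  qed
  then obtain g where gH: "\<And>u l x \<xi>. \<lbrakk>u \<in> Obj C; l \<in> hdual C w (OMap F u); x \<in> Obj C; \<xi> \<in> hdual C x y\<rbrakk>
      \<Longrightarrow> g u l x \<xi> \<in> Hom C u (OMap G x)"
    and g: "\<And>u l x \<xi> \<eta>. \<lbrakk>u \<in> Obj C; l \<in> hdual C w (OMap F u); x \<in> Obj C; \<xi> \<in> hdual C x y; \<eta> \<in> hdual C u (OMap G x)\<rbrakk>
      \<Longrightarrow> \<eta> (g u l x \<xi>) = l (P (OMap G x) u \<eta> \<cdot> q x \<xi>)"
    by metis
  have gD: "is_datum C G y u (g u l)" if u: "u \<in> Obj C" and l: "l \<in> hdual C w (OMap F u)" for u l
    unfolding is_datum_def
  proof (intro conjI ballI allI)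
    fix x assume x: "x \<in> Obj C"
    note Gx = GO[OF x]
    note V = vectorspace_dual[OF vectorspace_Hom[OF x y]]
    show "g u l x \<in> linear_maps (dual_space (hom_space C x y)) (hom_space C u (OMap G x))"
    proof (rule linear_mapsI; simp only: hom_space_simps)
      show "g u l x \<xi> \<in> Hom C u (OMap G x)" if "\<xi> \<in> hdual C x y" for \<xi>
        by (rule gH[OF u l x that])
    next
      fix \<xi> \<xi>' assume \<xi>: "\<xi> \<in> hdual C x y" and \<xi>': "\<xi>' \<in> hdual C x y"
      note s = vs_add_closed[OF V \<xi> \<xi>']
      show "g u l x (\<xi> \<oplus>\<^bsub>dual_space (hom_space C x y)\<^esub> \<xi>') = AddArr C (g u l x \<xi>) (g u l x \<xi>')"
      proof (rule Hom_separates[OF gH[OF u l x s] AddArr_Hom[OF gH[OF u l x \<xi>] gH[OF u l x \<xi>']]])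
        fix \<eta> assume \<eta>: "\<eta> \<in> hdual C u (OMap G x)"
        note Px = PH[OF Gx u \<eta>]
        have "\<eta> (g u l x (\<xi> \<oplus>\<^bsub>dual_space (hom_space C x y)\<^esub> \<xi>')) = l (P (OMap G x) u \<eta> \<cdot> AddArr C (q x \<xi>) (q x \<xi>'))"
          using g[OF u l x s \<eta>] linear_maps_add[OF qL[OF x] \<xi> \<xi>'] by simp
        also have "\<dots> = l (P (OMap G x) u \<eta> \<cdot> q x \<xi>) + l (P (OMap G x) u \<eta> \<cdot> q x \<xi>')"
          using Comp_AddArr[OF qH[OF x \<xi>] Px qH[OF x \<xi>']] dual_add[OF l, of "P (OMap G x) u \<eta> \<cdot> q x \<xi>" "P (OMap G x) u \<eta> \<cdot> q x \<xi>'"]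
            PqH[OF u x \<xi> \<eta>] PqH[OF u x \<xi>' \<eta>] by simp
        also have "\<dots> = \<eta> (AddArr C (g u l x \<xi>) (g u l x \<xi>'))"
          using dual_add[OF \<eta>, of "g u l x \<xi>" "g u l x \<xi>'"] gH[OF u l x \<xi>] gH[OF u l x \<xi>']
          by (simp add: g[OF u l x \<xi> \<eta>] g[OF u l x \<xi>' \<eta>])
        finally show "\<eta> (g u l x (\<xi> \<oplus>\<^bsub>dual_space (hom_space C x y)\<^esub> \<xi>')) = \<eta> (AddArr C (g u l x \<xi>) (g u l x \<xi>'))" .
      qed
    next
      fix k \<xi> assume \<xi>: "\<xi> \<in> hdual C x y"
      note s = vs_smult_closed[OF V \<xi>, of k]
      show "g u l x (k \<odot>\<^bsub>dual_space (hom_space C x y)\<^esub> \<xi>) = ScaleArr C k (g u l x \<xi>)"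
      proof (rule Hom_separates[OF gH[OF u l x s] ScaleArr_Hom[OF gH[OF u l x \<xi>]]])
        fix \<eta> assume \<eta>: "\<eta> \<in> hdual C u (OMap G x)"
        note Px = PH[OF Gx u \<eta>]
        have "\<eta> (g u l x (k \<odot>\<^bsub>dual_space (hom_space C x y)\<^esub> \<xi>)) = l (P (OMap G x) u \<eta> \<cdot> ScaleArr C k (q x \<xi>))"
          using g[OF u l x s \<eta>] linear_maps_smult[OF qL[OF x] \<xi>] by simp
        also have "\<dots> = k * l (P (OMap G x) u \<eta> \<cdot> q x \<xi>)"
          using Comp_ScaleArr[OF qH[OF x \<xi>] Px] dual_smult[OF l, of "P (OMap G x) u \<eta> \<cdot> q x \<xi>" k] PqH[OF u x \<xi> \<eta>] by simp
        also have "\<dots> = \<eta> (ScaleArr C k (g u l x \<xi>))"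
          using dual_smult[OF \<eta>, of "g u l x \<xi>" k] gH[OF u l x \<xi>] by (simp add: g[OF u l x \<xi> \<eta>])
        finally show "\<eta> (g u l x (k \<odot>\<^bsub>dual_space (hom_space C x y)\<^esub> \<xi>)) = \<eta> (ScaleArr C k (g u l x \<xi>))" .
      qed
    qed
  next
    fix a b f \<xi> assume f: "f \<in> Hom C a b" and \<xi>: "\<xi> \<in> hdual C a y"
    have a: "a \<in> Obj C" and b: "b \<in> Obj C"
      using Hom_Obj[OF f] by auto
    note c = precomp_dual_closed[OF f y \<xi>]
    \<comment> \<open>Naturality in \<open>x\<close>: the effect of \<open>AMap E\<close> on the
      universal family moves \<open>G f\<close> past \<open>P\<close>, and the naturality of
      \<open>q\<close> absorbs it.\<close>
    show "AMap G f \<cdot> g u l a \<xi> = g u l b (precomp_dual C y f \<xi>)"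
    proof (rule Hom_separates[OF Comp_in_Hom[OF gH[OF u l a \<xi>] GH[OF f]] gH[OF u l b c]])
      fix \<eta> assume \<eta>: "\<eta> \<in> hdual C u (OMap G b)"
      note \<eta>f = postcomp_dual_closed[OF GH[OF f] u \<eta>]
      have "\<eta> (AMap G f \<cdot> g u l a \<xi>) = l (P (OMap G a) u (postcomp_dual C u (AMap G f) \<eta>) \<cdot> q a \<xi>)"
        using g[OF u l a \<xi> \<eta>f] postcomp_dual_apply[OF GH[OF f] gH[OF u l a \<xi>]] by simp
      also have "\<dots> = l ((P (OMap G b) u \<eta> \<cdot> AMap E (AMap G f)) \<cdot> q a \<xi>)"
        using is_GammaD(3)[OF E GH[OF f] u \<eta>] by simp
      also have "\<dots> = l (P (OMap G b) u \<eta> \<cdot> q b (precomp_dual C y f \<xi>))"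
        using Comp_assoc[OF qH[OF a \<xi>] EH[OF GH[OF f]] PH[OF GO[OF b] u \<eta>]] qN[OF f \<xi>] by simp
      finally show "\<eta> (AMap G f \<cdot> g u l a \<xi>) = \<eta> (g u l b (precomp_dual C y f \<xi>))"
        using g[OF u l b c \<eta>] by simp
    qed
  qed (rule u)
  have "\<exists>h. h \<in> Hom C u ?v \<and> (\<forall>x\<in>Obj C. \<forall>\<xi>\<in>hdual C x y. P2 y x \<xi> \<cdot> h = g u l x \<xi>)"
    if "u \<in> Obj C" "l \<in> hdual C w (OMap F u)" for u l
    using is_universalE[OF is_GammaD(1)[OF E2 y] gD[OF that]] by metis
  then obtain h where hH: "\<And>u l. \<lbrakk>u \<in> Obj C; l \<in> hdual C w (OMap F u)\<rbrakk> \<Longrightarrow> h u l \<in> Hom C u ?v"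
    and h: "\<And>u l x \<xi>. \<lbrakk>u \<in> Obj C; l \<in> hdual C w (OMap F u); x \<in> Obj C; \<xi> \<in> hdual C x y\<rbrakk> \<Longrightarrow> P2 y x \<xi> \<cdot> h u l = g u l x \<xi>"
    by metis
  \<comment> \<open>The morphism \<open>h u l\<close> is determined by the scalars it produces. Its
    additivity, homogeneity and naturality are all read off from this.\<close>
  have h_eqI: "k = h u l"
    if u: "u \<in> Obj C" and l: "l \<in> hdual C w (OMap F u)" and k: "k \<in> Hom C u ?v"
      and eq: "\<And>x \<xi> \<eta>. \<lbrakk>x \<in> Obj C; \<xi> \<in> hdual C x y; \<eta> \<in> hdual C u (OMap G x)\<rbrakk> \<Longrightarrow> \<eta> (P2 y x \<xi> \<cdot> k) = l (P (OMap G x) u \<eta> \<cdot> q x \<xi>)"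
    for u l k
  proof (rule is_universal_eqI[OF G y is_GammaD(1)[OF E2 y] k hH[OF u l]])
    fix x \<xi> assume x: "x \<in> Obj C" "\<xi> \<in> hdual C x y"
    show "P2 y x \<xi> \<cdot> k = P2 y x \<xi> \<cdot> h u l"
      by (rule Hom_separates[OF Comp_in_Hom[OF k P2H[OF x]] Comp_in_Hom[OF hH[OF u l] P2H[OF x]]])
        (simp add: eq[OF x] h[OF u l x] g[OF u l x])
  qed
  have hq: "\<eta> (P2 y x \<xi> \<cdot> h u l) = l (P (OMap G x) u \<eta> \<cdot> q x \<xi>)"
    if "u \<in> Obj C" "l \<in> hdual C w (OMap F u)" "x \<in> Obj C" "\<xi> \<in> hdual C x y" "\<eta> \<in> hdual C u (OMap G x)" for u l x \<xi> \<eta>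
    using h[OF that(1-4)] g[OF that] by simp
  have h_add: "h u (l \<oplus>\<^bsub>dual_space (hom_space C w (OMap F u))\<^esub> l') = AddArr C (h u l) (h u l')"
    if u: "u \<in> Obj C" and l: "l \<in> hdual C w (OMap F u)" and l': "l' \<in> hdual C w (OMap F u)" for u l l'
  proof (rule h_eqI[symmetric, OF u vs_add_closed[OF vectorspace_dual[OF vectorspace_Hom[OF w FO[OF u]]] l l']
        AddArr_Hom[OF hH[OF u l] hH[OF u l']]])
    fix x \<xi> \<eta> assume x: "x \<in> Obj C" "\<xi> \<in> hdual C x y" and \<eta>: "\<eta> \<in> hdual C u (OMap G x)"
    show "\<eta> (P2 y x \<xi> \<cdot> AddArr C (h u l) (h u l')) = (l \<oplus>\<^bsub>dual_space (hom_space C w (OMap F u))\<^esub> l') (P (OMap G x) u \<eta> \<cdot> q x \<xi>)"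
      using dual_add[OF \<eta>, of "P2 y x \<xi> \<cdot> h u l" "P2 y x \<xi> \<cdot> h u l'"] Comp_in_Hom[OF hH[OF u l] P2H[OF x]]
        Comp_in_Hom[OF hH[OF u l'] P2H[OF x]] PqH[OF u x \<eta>]
      by (simp add: Comp_AddArr[OF hH[OF u l] P2H[OF x] hH[OF u l']] hq[OF u l x \<eta>] hq[OF u l' x \<eta>] dual_add_apply)
  qed
  have h_smult: "h u (k \<odot>\<^bsub>dual_space (hom_space C w (OMap F u))\<^esub> l) = ScaleArr C k (h u l)"
    if u: "u \<in> Obj C" and l: "l \<in> hdual C w (OMap F u)" for u k l
  proof (rule h_eqI[symmetric, OF u vs_smult_closed[OF vectorspace_dual[OF vectorspace_Hom[OF w FO[OF u]]] l]
        ScaleArr_Hom[OF hH[OF u l]]])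
    fix x \<xi> \<eta> assume x: "x \<in> Obj C" "\<xi> \<in> hdual C x y" and \<eta>: "\<eta> \<in> hdual C u (OMap G x)"
    show "\<eta> (P2 y x \<xi> \<cdot> ScaleArr C k (h u l)) = (k \<odot>\<^bsub>dual_space (hom_space C w (OMap F u))\<^esub> l) (P (OMap G x) u \<eta> \<cdot> q x \<xi>)"
      using dual_smult[OF \<eta>, of "P2 y x \<xi> \<cdot> h u l" k] Comp_in_Hom[OF hH[OF u l] P2H[OF x]] PqH[OF u x \<eta>]
      by (simp add: Comp_ScaleArr[OF hH[OF u l] P2H[OF x]] hq[OF u l x \<eta>] dual_smult_apply)
  qed
  have "\<exists>s\<in>Hom C w (OMap F u). \<forall>l\<in>hdual C w (OMap F u). l s = \<zeta> (h u l)"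
    if u: "u \<in> Obj C" and \<zeta>: "\<zeta> \<in> hdual C u ?v" for u \<zeta>
  proof (rule Hom_reflexive[OF w FO[OF u]])
    show "\<zeta> (h u (l \<oplus>\<^bsub>dual_space (hom_space C w (OMap F u))\<^esub> l')) = \<zeta> (h u l) + \<zeta> (h u l')"
      if "l \<in> hdual C w (OMap F u)" "l' \<in> hdual C w (OMap F u)" for l l'
      using dual_add[OF \<zeta>, of "h u l" "h u l'"] hH[OF u that(1)] hH[OF u that(2)] by (simp add: h_add[OF u that])
    show "\<zeta> (h u (k \<odot>\<^bsub>dual_space (hom_space C w (OMap F u))\<^esub> l)) = k * \<zeta> (h u l)"
      if "l \<in> hdual C w (OMap F u)" for k l
      using dual_smult[OF \<zeta>, of "h u l" k] hH[OF u that] by (simp add: h_smult[OF u that])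
  qed
  then obtain s where sH: "\<And>u \<zeta>. \<lbrakk>u \<in> Obj C; \<zeta> \<in> hdual C u ?v\<rbrakk> \<Longrightarrow> s u \<zeta> \<in> Hom C w (OMap F u)"
    and s: "\<And>u \<zeta> l. \<lbrakk>u \<in> Obj C; \<zeta> \<in> hdual C u ?v; l \<in> hdual C w (OMap F u)\<rbrakk> \<Longrightarrow> l (s u \<zeta>) = \<zeta> (h u l)"
    by metis
  have sD: "is_datum C F ?v w s"
    unfolding is_datum_def
  proof (intro conjI ballI allI)
    fix u assume u: "u \<in> Obj C"
    note V = vectorspace_dual[OF vectorspace_Hom[OF u v]]
    show "s u \<in> linear_maps (dual_space (hom_space C u ?v)) (hom_space C w (OMap F u))"
    proof (rule linear_mapsI; simp only: hom_space_simps)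
      show "s u \<zeta> \<in> Hom C w (OMap F u)" if "\<zeta> \<in> hdual C u ?v" for \<zeta>
        by (rule sH[OF u that])
    next
      fix \<zeta> \<zeta>' assume z: "\<zeta> \<in> hdual C u ?v" and z': "\<zeta>' \<in> hdual C u ?v"
      note zz = vs_add_closed[OF V z z']
      show "s u (\<zeta> \<oplus>\<^bsub>dual_space (hom_space C u ?v)\<^esub> \<zeta>') = AddArr C (s u \<zeta>) (s u \<zeta>')"
      proof (rule Hom_separates[OF sH[OF u zz] AddArr_Hom[OF sH[OF u z] sH[OF u z']]])
        fix l assume l: "l \<in> hdual C w (OMap F u)"
        show "l (s u (\<zeta> \<oplus>\<^bsub>dual_space (hom_space C u ?v)\<^esub> \<zeta>')) = l (AddArr C (s u \<zeta>) (s u \<zeta>'))"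
          using dual_add[OF l, of "s u \<zeta>" "s u \<zeta>'"] sH[OF u z] sH[OF u z'] hH[OF u l]
          by (simp add: s[OF u zz l] s[OF u z l] s[OF u z' l] dual_add_apply)
      qed
    next
      fix k \<zeta> assume z: "\<zeta> \<in> hdual C u ?v"
      note zz = vs_smult_closed[OF V z, of k]
      show "s u (k \<odot>\<^bsub>dual_space (hom_space C u ?v)\<^esub> \<zeta>) = ScaleArr C k (s u \<zeta>)"
      proof (rule Hom_separates[OF sH[OF u zz] ScaleArr_Hom[OF sH[OF u z]]])
        fix l assume l: "l \<in> hdual C w (OMap F u)"
        show "l (s u (k \<odot>\<^bsub>dual_space (hom_space C u ?v)\<^esub> \<zeta>)) = l (ScaleArr C k (s u \<zeta>))"
          using dual_smult[OF l, of "s u \<zeta>" k] sH[OF u z] hH[OF u l]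
          by (simp add: s[OF u zz l] s[OF u z l] dual_smult_apply)
      qed
    qed
  next
    fix a b f \<zeta> assume f: "f \<in> Hom C a b" and z: "\<zeta> \<in> hdual C a ?v"
    have a: "a \<in> Obj C" and b: "b \<in> Obj C"
      using Hom_Obj[OF f] by auto
    note c = precomp_dual_closed[OF f v z]
    show "AMap F f \<cdot> s a \<zeta> = s b (precomp_dual C ?v f \<zeta>)"
    proof (rule Hom_separates[OF Comp_in_Hom[OF sH[OF a z] FH[OF f]] sH[OF b c]])
      fix l assume l: "l \<in> hdual C w (OMap F b)"
      note lf = postcomp_dual_closed[OF FH[OF f] w l]
      note hb = hH[OF b l]
      \<comment> \<open>Naturality of \<open>s\<close> in \<open>u\<close> is the transpose of
        naturality of \<open>h\<close>, and the latter comes from that of the family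
        \<open>P\<close>.\<close>
      have hf: "h b l \<cdot> f = h a (postcomp_dual C w (AMap F f) l)"
      proof (rule h_eqI[OF a lf Comp_in_Hom[OF f hb]])
        fix x \<xi> \<eta> assume x: "x \<in> Obj C" "\<xi> \<in> hdual C x y" and \<eta>: "\<eta> \<in> hdual C a (OMap G x)"
        note Gx = GO[OF x(1)]
        note \<eta>f = precomp_dual_closed[OF f Gx \<eta>]
        have "\<eta> (P2 y x \<xi> \<cdot> (h b l \<cdot> f)) = precomp_dual C (OMap G x) f \<eta> (P2 y x \<xi> \<cdot> h b l)"
          using precomp_dual_apply[OF f Comp_in_Hom[OF hb P2H[OF x]]] Comp_assoc[OF f hb P2H[OF x]] by simp
        also have "\<dots> = l (P (OMap G x) b (precomp_dual C (OMap G x) f \<eta>) \<cdot> q x \<xi>)"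
          by (rule hq[OF b l x \<eta>f])
        also have "\<dots> = l ((AMap F f \<cdot> P (OMap G x) a \<eta>) \<cdot> q x \<xi>)"
          using is_datumD(3)[OF D[OF Gx] f \<eta>] by simp
        also have "\<dots> = postcomp_dual C w (AMap F f) l (P (OMap G x) a \<eta> \<cdot> q x \<xi>)"
          using Comp_assoc[OF qH[OF x] PH[OF Gx a \<eta>] FH[OF f]] postcomp_dual_apply[OF FH[OF f] PqH[OF a x \<eta>]] by simp
        finally show "\<eta> (P2 y x \<xi> \<cdot> (h b l \<cdot> f)) = postcomp_dual C w (AMap F f) l (P (OMap G x) a \<eta> \<cdot> q x \<xi>)" .
      qed
      have "l (AMap F f \<cdot> s a \<zeta>) = \<zeta> (h b l \<cdot> f)"
        using postcomp_dual_apply[OF FH[OF f] sH[OF a z]] s[OF a z lf] by (simp add: hf)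
      also have "\<dots> = l (s b (precomp_dual C ?v f \<zeta>))"
        using precomp_dual_apply[OF f hb] s[OF b c l] by simp
      finally show "l (AMap F f \<cdot> s a \<zeta>) = l (s b (precomp_dual C ?v f \<zeta>))" .
    qed
  qed (rule w)
  obtain k where k: "k \<in> Hom C w (OMap E ?v)" "\<And>u \<zeta>. \<lbrakk>u \<in> Obj C; \<zeta> \<in> hdual C u ?v\<rbrakk> \<Longrightarrow> P ?v u \<zeta> \<cdot> k = s u \<zeta>"
    using is_universalE[OF is_GammaD(1)[OF E v] sD] by metis
  \<comment> \<open>Compares the family \<open>P\<close> at \<open>G x\<close> with the one at
    \<open>?v\<close>: by the definition of \<open>E\<close> on morphisms, composing with
    \<open>AMap E (P2 y x \<xi>)\<close> amounts to pulling the functional back along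
    \<open>P2 y x \<xi>\<close>.\<close>
  have EP2: "(P (OMap G x) u \<eta> \<cdot> (AMap E (P2 y x \<xi>) \<cdot> t)) = P ?v u (postcomp_dual C u (P2 y x \<xi>) \<eta>) \<cdot> t"
    if u: "u \<in> Obj C" and x: "x \<in> Obj C" "\<xi> \<in> hdual C x y" and \<eta>: "\<eta> \<in> hdual C u (OMap G x)"
      and t: "t \<in> Hom C w (OMap E ?v)" for u x \<xi> \<eta> t
    using Comp_assoc[OF t EH[OF P2H[OF x]] PH[OF GO[OF x(1)] u \<eta>]] is_GammaD(3)[OF E P2H[OF x] u \<eta>] by simp
  show ?thesis
  proof (intro ex1I conjI ballI)
    fix x \<xi> assume x: "x \<in> Obj C" "\<xi> \<in> hdual C x y"
    note Gx = GO[OF x(1)]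
    show "AMap E (P2 y x \<xi>) \<cdot> k = q x \<xi>"
    proof (rule is_universal_eqI[OF F Gx is_GammaD(1)[OF E Gx] Comp_in_Hom[OF k(1) EH[OF P2H[OF x]]] qH[OF x]])
      fix u \<eta> assume u: "u \<in> Obj C" and \<eta>: "\<eta> \<in> hdual C u (OMap G x)"
      note p = postcomp_dual_closed[OF P2H[OF x] u \<eta>]
      have "P (OMap G x) u \<eta> \<cdot> (AMap E (P2 y x \<xi>) \<cdot> k) = s u (postcomp_dual C u (P2 y x \<xi>) \<eta>)"
        by (simp add: EP2[OF u x \<eta> k(1)] k(2)[OF u p])
      also have "\<dots> = P (OMap G x) u \<eta> \<cdot> q x \<xi>"
      proof (rule Hom_separates[OF sH[OF u p] PqH[OF u x \<eta>]])
        fix l assume l: "l \<in> hdual C w (OMap F u)"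
        show "l (s u (postcomp_dual C u (P2 y x \<xi>) \<eta>)) = l (P (OMap G x) u \<eta> \<cdot> q x \<xi>)"
          using s[OF u p l] postcomp_dual_apply[OF P2H[OF x] hH[OF u l]] hq[OF u l x \<eta>] by simp
      qed
      finally show "P (OMap G x) u \<eta> \<cdot> (AMap E (P2 y x \<xi>) \<cdot> k) = P (OMap G x) u \<eta> \<cdot> q x \<xi>" .
    qed
  next
    fix t assume "t \<in> Hom C w (OMap E ?v) \<and> (\<forall>x\<in>Obj C. \<forall>\<xi>\<in>hdual C x y. AMap E (P2 y x \<xi>) \<cdot> t = q x \<xi>)"
    then have t: "t \<in> Hom C w (OMap E ?v)" and tq: "\<And>x \<xi>. \<lbrakk>x \<in> Obj C; \<xi> \<in> hdual C x y\<rbrakk> \<Longrightarrow> AMap E (P2 y x \<xi>) \<cdot> t = q x \<xi>"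
      by auto
    show "t = k"
    proof (rule is_universal_eqI[OF F v is_GammaD(1)[OF E v] t k(1)])
      fix u \<zeta> assume u: "u \<in> Obj C" and z: "\<zeta> \<in> hdual C u ?v"
      note PvH = PH[OF v u]
      note PtH = Comp_in_Hom[OF t PvH]
      have "P ?v u \<zeta> \<cdot> t = s u \<zeta>"
      proof (rule Hom_separates[OF PtH[OF z] sH[OF u z]])
        fix l assume l: "l \<in> hdual C w (OMap F u)"
        \<comment> \<open>Uniqueness runs the construction backwards: a solution \<open>t\<close>
          and a functional \<open>l\<close> define a functional on the dual of
          \<open>Hom(u, ?v)\<close>, hence a morphism \<open>m\<close>, and \<open>m\<close>
          satisfies the equations that characterize \<open>h u l\<close>.\<close>
        have "\<exists>m\<in>Hom C u ?v. \<forall>\<zeta>\<in>hdual C u ?v. \<zeta> m = l (P ?v u \<zeta> \<cdot> t)"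
        proof (rule Hom_reflexive[OF u v])
          show "l (P ?v u (\<zeta> \<oplus>\<^bsub>dual_space (hom_space C u ?v)\<^esub> \<zeta>') \<cdot> t) = l (P ?v u \<zeta> \<cdot> t) + l (P ?v u \<zeta>' \<cdot> t)"
            if "\<zeta> \<in> hdual C u ?v" "\<zeta>' \<in> hdual C u ?v" for \<zeta> \<zeta>'
            using linear_maps_add[OF PL[OF v u] that] AddArr_Comp[OF t PvH[OF that(1)] PvH[OF that(2)]]
              dual_add[OF l, of "P ?v u \<zeta> \<cdot> t" "P ?v u \<zeta>' \<cdot> t"] PtH[OF that(1)] PtH[OF that(2)] by simp
          show "l (P ?v u (c \<odot>\<^bsub>dual_space (hom_space C u ?v)\<^esub> \<zeta>) \<cdot> t) = c * l (P ?v u \<zeta> \<cdot> t)"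
            if "\<zeta> \<in> hdual C u ?v" for c \<zeta>
            using linear_maps_smult[OF PL[OF v u] that] ScaleArr_Comp[OF t PvH[OF that]]
              dual_smult[OF l, of "P ?v u \<zeta> \<cdot> t" c] PtH[OF that] by simp
        qed
        then obtain m where m: "m \<in> Hom C u ?v" "\<And>\<zeta>. \<zeta> \<in> hdual C u ?v \<Longrightarrow> \<zeta> m = l (P ?v u \<zeta> \<cdot> t)"
          by blast
        have "m = h u l"
        proof (rule h_eqI[OF u l m(1)])
          fix x \<xi> \<eta> assume x: "x \<in> Obj C" "\<xi> \<in> hdual C x y" and \<eta>: "\<eta> \<in> hdual C u (OMap G x)"
          note p = postcomp_dual_closed[OF P2H[OF x] u \<eta>]
          show "\<eta> (P2 y x \<xi> \<cdot> m) = l (P (OMap G x) u \<eta> \<cdot> q x \<xi>)"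
            using postcomp_dual_apply[OF P2H[OF x] m(1)] m(2)[OF p] EP2[OF u x \<eta> t] tq[OF x] by simp
        qed
        then show "l (P ?v u \<zeta> \<cdot> t) = l (s u \<zeta>)"
          using m(2)[OF z] s[OF u z l] by simp
      qed
      then show "P ?v u \<zeta> \<cdot> t = P ?v u \<zeta> \<cdot> k"
        by (simp add: k(2)[OF u z])
    qed
  qed (rule k(1))
qed

lemma linear_endofunctor_comp:
  assumes F: "linear_endofunctor C F" and G: "linear_endofunctor C G"
  shows "linear_endofunctor C (functor_comp F G)"
proof -
  note GH = linear_endofunctor_Hom[OF G] and FD = linear_endofunctorD[OF F] and GD = linear_endofunctorD[OF G]
  have O: "OMap (functor_comp F G) a = OMap F (OMap G a)" for a
    by (simp add: functor_comp_def)
  have A: "AMap (functor_comp F G) = (\<lambda>f. AMap F (AMap G f))"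
    by (simp add: functor_comp_def comp_def)
  show ?thesis
    unfolding linear_endofunctor_def O A
  proof (intro conjI ballI allI)
    show "(\<lambda>f. AMap F (AMap G f)) \<in> linear_maps (hom_space C a b) (hom_space C (OMap F (OMap G a)) (OMap F (OMap G b)))"
      if "a \<in> Obj C" "b \<in> Obj C" for a b
      using linear_maps_comp[OF GD(3)[OF that] FD(3)[OF GD(1)[OF that(1)] GD(1)[OF that(2)]]] .
    show "AMap F (AMap G (g \<cdot> f)) = AMap F (AMap G g) \<cdot> AMap F (AMap G f)"
      if "f \<in> Hom C a b" "g \<in> Hom C b c" for f g a b c
      using GD(4)[OF that] FD(4)[OF GH[OF that(1)] GH[OF that(2)]] by simp
  qed (simp_all add: FD GD)
qed

text \<open>The universal family of the composite is the image under \<open>E\<close> of that of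
  \<open>E2\<close>. Its universality is \<open>is_Gamma_comp_universal\<close>; what remains is
  functoriality of \<open>E\<close>.\<close>

lemma is_Gamma_comp:
  assumes F: "linear_endofunctor C F" and G: "linear_endofunctor C G"
    and E: "is_Gamma C F E P" and E2: "is_Gamma C G E2 P2"
  shows "is_Gamma C (functor_comp E G) (functor_comp E E2) (\<lambda>y x \<xi>. AMap E (P2 y x \<xi>))"
proof -
  note lE = is_Gamma_linear_endofunctor[OF F E] and lE2 = is_Gamma_linear_endofunctor[OF G E2]
  note EH = linear_endofunctor_Hom[OF lE]
  note D2 = is_universalD[OF is_GammaD(1)[OF E2]]
  note GO = linear_endofunctorD(1)[OF G]
  show ?thesis
    unfolding is_Gamma_def is_universal_def
  proof (intro conjI ballI allI impI)
    fix y assume y: "y \<in> Obj C"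
    note Ey = is_Gamma_Obj[OF E2 y]
    show "is_datum C (functor_comp E G) y (OMap (functor_comp E E2) y) (\<lambda>x \<xi>. AMap E (P2 y x \<xi>))"
      unfolding is_datum_def functor_comp_def endofunctor.simps comp_apply
    proof (intro conjI ballI allI)
      show "OMap E (OMap E2 y) \<in> Obj C"
        by (rule linear_endofunctorD(1)[OF lE Ey])
      show "(\<lambda>\<xi>. AMap E (P2 y x \<xi>)) \<in> linear_maps (dual_space (hom_space C x y)) (hom_space C (OMap E (OMap E2 y)) (OMap E (OMap G x)))"
        if x: "x \<in> Obj C" for x
        by (rule linear_maps_comp[OF is_datumD(2)[OF D2[OF y] x] linear_endofunctorD(3)[OF lE Ey GO[OF x]]])
      fix a b f \<xi> assume f: "f \<in> Hom C a b" and \<xi>: "\<xi> \<in> hdual C a y"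
      show "AMap E (AMap G f) \<cdot> AMap E (P2 y a \<xi>) = AMap E (P2 y b (precomp_dual C y f \<xi>))"
        using linear_endofunctorD(4)[OF lE is_datum_Hom[OF D2[OF y] Hom_Obj(1)[OF f] \<xi>] linear_endofunctor_Hom[OF G f]]
          is_datumD(3)[OF D2[OF y] f \<xi>] by simp
    qed
    show "\<exists>!h. h \<in> Hom C w (OMap (functor_comp E E2) y) \<and> (\<forall>x\<in>Obj C. \<forall>\<xi>\<in>hdual C x y. AMap E (P2 y x \<xi>) \<cdot> h = q x \<xi>)"
      if "is_datum C (functor_comp E G) y w q" for w q
      using is_Gamma_comp_universal[OF F G E E2 y that] by (simp add: functor_comp_def)
  next
    fix y y' u assume u: "u \<in> Hom C y y'"
    show "AMap (functor_comp E E2) u \<in> Hom C (OMap (functor_comp E E2) y) (OMap (functor_comp E E2) y')"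
      using EH[OF linear_endofunctor_Hom[OF lE2 u]] by (simp add: functor_comp_def)
    fix x \<xi> assume x: "x \<in> Obj C" "\<xi> \<in> hdual C x y'"
    have y': "y' \<in> Obj C"
      using Hom_Obj[OF u] by simp
    show "AMap E (P2 y' x \<xi>) \<cdot> AMap (functor_comp E E2) u = AMap E (P2 y x (postcomp_dual C x u \<xi>))"
      using linear_endofunctorD(4)[OF lE linear_endofunctor_Hom[OF lE2 u] is_datum_Hom[OF D2[OF y'] x]]
        is_GammaD(3)[OF E2 u x] by (simp add: functor_comp_def)
  qed
qed

end


subsection \<open>Existence of universal data\<close>

context category_with_generator
begin

lemma datum_zero:
  assumes H: "linear_endofunctor C H" and y: "y \<in> Obj C" and w: "w \<in> Obj C"
  shows "is_datum C H y w (\<lambda>x \<xi>. ZeroArr C w (OMap H x))"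
  unfolding is_datum_def
proof (intro conjI ballI allI)
  note HO = linear_endofunctorD(1)[OF H]
  show "(\<lambda>\<xi>. ZeroArr C w (OMap H x)) \<in> linear_maps (dual_space (hom_space C x y)) (hom_space C w (OMap H x))"
    if x: "x \<in> Obj C" for x
    using ZeroArr_Hom[OF w HO[OF x]] AddArr_zero[OF ZeroArr_Hom[OF w HO[OF x]]] vs_smult_zero[OF hom_vs[OF w HO[OF x]]]
    by (intro linear_mapsI) auto
  show "AMap H f \<cdot> ZeroArr C w (OMap H a) = ZeroArr C w (OMap H b)" if f: "f \<in> Hom C a b" for a b f
    using Comp_zero[OF linear_endofunctor_Hom[OF H f] w] .
qed (rule w)

lemma datum_add:
  assumes H: "linear_endofunctor C H" and y: "y \<in> Obj C" and p: "is_datum C H y w p" and q: "is_datum C H y w q"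
  shows "is_datum C H y w (\<lambda>x \<xi>. AddArr C (p x \<xi>) (q x \<xi>))"
  unfolding is_datum_def
proof (intro conjI ballI allI)
  note HO = linear_endofunctorD(1)[OF H]
  have w: "w \<in> Obj C"
    using is_datumD(1)[OF p] .
  show "(\<lambda>\<xi>. AddArr C (p x \<xi>) (q x \<xi>)) \<in> linear_maps (dual_space (hom_space C x y)) (hom_space C w (OMap H x))"
    if x: "x \<in> Obj C" for x
  proof (rule linear_mapsI; simp only: hom_space_simps)
    note pl = is_datumD(2)[OF p x] and ql = is_datumD(2)[OF q x]
    note V = hom_vs[OF w HO[OF x]]
    show "AddArr C (p x \<xi>) (q x \<xi>) \<in> Hom C w (OMap H x)" if "\<xi> \<in> hdual C x y" for \<xi>
      using AddArr_Hom[OF is_datum_Hom[OF p x that] is_datum_Hom[OF q x that]] .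
    show "AddArr C (p x (\<xi> \<oplus>\<^bsub>dual_space (hom_space C x y)\<^esub> \<eta>)) (q x (\<xi> \<oplus>\<^bsub>dual_space (hom_space C x y)\<^esub> \<eta>))
        = AddArr C (AddArr C (p x \<xi>) (q x \<xi>)) (AddArr C (p x \<eta>) (q x \<eta>))"
      if "\<xi> \<in> hdual C x y" "\<eta> \<in> hdual C x y" for \<xi> \<eta>
    proof -
      note h = is_datum_Hom[OF p x that(1)] is_datum_Hom[OF p x that(2)] is_datum_Hom[OF q x that(1)] is_datum_Hom[OF q x that(2)]
      have "AddArr C (AddArr C (p x \<xi>) (q x \<xi>)) (AddArr C (p x \<eta>) (q x \<eta>))
          = AddArr C (AddArr C (p x \<xi>) (p x \<eta>)) (AddArr C (q x \<xi>) (q x \<eta>))"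
        using vs_assoc[OF V] vs_lcomm[OF V, of "q x \<xi>" "p x \<eta>" "q x \<eta>"] h AddArr_Hom[OF h(1)] AddArr_Hom[OF h(2)] AddArr_Hom[OF h(3)]
        by (simp add: AddArr_Hom)
      then show ?thesis
        using linear_maps_add[OF pl that] linear_maps_add[OF ql that] by simp
    qed
    show "AddArr C (p x (k \<odot>\<^bsub>dual_space (hom_space C x y)\<^esub> \<xi>)) (q x (k \<odot>\<^bsub>dual_space (hom_space C x y)\<^esub> \<xi>))
        = ScaleArr C k (AddArr C (p x \<xi>) (q x \<xi>))"
      if "\<xi> \<in> hdual C x y" for k \<xi>
      using linear_maps_smult[OF pl that] linear_maps_smult[OF ql that] vs_smult_add[OF V, of "p x \<xi>" "q x \<xi>" k]
        is_datum_Hom[OF p x that] is_datum_Hom[OF q x that] by simp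
  qed
  show "AMap H f \<cdot> AddArr C (p a \<xi>) (q a \<xi>) = AddArr C (p b (precomp_dual C y f \<xi>)) (q b (precomp_dual C y f \<xi>))"
    if f: "f \<in> Hom C a b" and \<xi>: "\<xi> \<in> hdual C a y" for a b f \<xi>
    using Comp_AddArr[OF is_datum_Hom[OF p Hom_Obj(1)[OF f] \<xi>] linear_endofunctor_Hom[OF H f] is_datum_Hom[OF q Hom_Obj(1)[OF f] \<xi>]]
      is_datumD(3)[OF p f \<xi>] is_datumD(3)[OF q f \<xi>] by simp
qed (rule is_datumD(1)[OF p])

lemma datum_hsum:
  assumes H: "linear_endofunctor C H" and y: "y \<in> Obj C" and w: "w \<in> Obj C"
    and p: "\<And>k. k < n \<Longrightarrow> is_datum C H y (v k) (p k)" and s: "\<And>k. k < n \<Longrightarrow> s k \<in> Hom C w (v k)"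
  shows "is_datum C H y w (\<lambda>x \<xi>. hsum w (OMap H x) (\<lambda>k. p k x \<xi> \<cdot> s k) n)"
  using p s
proof (induction n)
  case 0
  then show ?case
    using datum_zero[OF H y w] by simp
next
  case (Suc n)
  then have "is_datum C H y w (\<lambda>x \<xi>. hsum w (OMap H x) (\<lambda>k. p k x \<xi> \<cdot> s k) n)"
    by simp
  moreover have "is_datum C H y w (\<lambda>x \<xi>. p n x \<xi> \<cdot> s n)"
    by (rule is_datum_comp[OF H Suc.prems(1) Suc.prems(2) _ y]) auto
  ultimately show ?case
    using datum_add[OF H y] by simp
qed

text \<open>The functionals on which \<open>p\<close> and \<open>q\<close> agree form a subspace. By
  naturality it contains every functional obtained from \<open>Q\<close> along some
  \<open>g : Q \<rightarrow> x\<close>; these separate \<open>Hom(x, y)\<close> because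
  \<open>Q\<close> is a generator, so the subspace is the whole dual.\<close>

lemma datum_determined:
  assumes H: "linear_endofunctor C H" and y: "y \<in> Obj C" and p: "is_datum C H y w p" and q: "is_datum C H y w q"
    and eq: "\<And>\<zeta>. \<zeta> \<in> hdual C Q y \<Longrightarrow> p Q \<zeta> = q Q \<zeta>" and x: "x \<in> Obj C" and \<xi>: "\<xi> \<in> hdual C x y"
  shows "p x \<xi> = q x \<xi>"
proof -
  note V = vectorspace_dual[OF vectorspace_Hom[OF x y]]
  note pl = is_datumD(2)[OF p x] and ql = is_datumD(2)[OF q x]
  let ?U = "{\<xi> \<in> hdual C x y. p x \<xi> = q x \<xi>}"
  have "subsp (dual_space (hom_space C x y)) ?U"
    using linear_maps_zero[OF V hom_vs[OF is_datumD(1)[OF p] linear_endofunctorD(1)[OF H x]] pl]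
      linear_maps_zero[OF V hom_vs[OF is_datumD(1)[OF p] linear_endofunctorD(1)[OF H x]] ql]
    by (auto simp: subsp_def vs_simps[OF V] linear_maps_add[OF pl] linear_maps_add[OF ql] linear_maps_smult[OF pl] linear_maps_smult[OF ql])
  then have "?U = hdual C x y"
  proof (rule separating_subsp_dual[OF fdvs_Hom[OF x y]])
    fix v assume "v \<in> carrier (hom_space C x y)" and v0: "\<And>\<xi>. \<xi> \<in> ?U \<Longrightarrow> \<xi> v = 0"
    then have v: "v \<in> Hom C x y"
      by simp
    have "v = ZeroArr C x y"
    proof (rule Q_generator[OF v ZeroArr_Hom[OF x y]])
      fix g assume g: "g \<in> Hom C Q x"
      have "v \<cdot> g = ZeroArr C Q y"
      proof (rule Hom_separates[OF Comp_in_Hom[OF g v] ZeroArr_Hom[OF Q_Obj y]])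
        fix \<zeta> assume \<zeta>: "\<zeta> \<in> hdual C Q y"
        have "precomp_dual C y g \<zeta> \<in> ?U"
          using is_datumD(3)[OF p g \<zeta>] is_datumD(3)[OF q g \<zeta>] eq[OF \<zeta>] precomp_dual_closed[OF g y \<zeta>] by simp
        then show "\<zeta> (v \<cdot> g) = \<zeta> (ZeroArr C Q y)"
          using v0 precomp_dual_apply[OF g v, of \<zeta>] dual_zero[OF vectorspace_Hom[OF Q_Obj y] \<zeta>] by force
      qed
      then show "v \<cdot> g = ZeroArr C x y \<cdot> g"
        using zero_Comp[OF g y] by simp
    qed
    then show "v = \<zero>\<^bsub>hom_space C x y\<^esub>"
      by simp
  qed
  then show ?thesis
    using \<xi> by blast
qed

text \<open>A datum at \<open>Q\<close> is fixed by finitely many morphisms from \<open>Q\<close> to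
  \<open>H Q\<close>, its values on a basis of the dual of \<open>Hom(Q, y)\<close>. Packed into one
  morphism to a power \<open>T\<close> of \<open>H Q\<close>, the data form a subspace of the
  finite-dimensional space \<open>Hom(Q, T)\<close>; finitely many of them span it and are combined
  into \<open>\<phi>\<close>.\<close>

lemma data_finitely_generated:
  assumes H: "linear_endofunctor C H" and y: "y \<in> Obj C"
  obtains c \<phi> where "is_datum C H y c \<phi>"
    "\<And>p. is_datum C H y Q p \<Longrightarrow> \<exists>g\<in>Hom C Q c. \<forall>x\<in>Obj C. \<forall>\<xi>\<in>hdual C x y. \<phi> x \<xi> \<cdot> g = p x \<xi>"
proof -
  have HQ: "OMap H Q \<in> Obj C"
    by (rule linear_endofunctorD(1)[OF H Q_Obj])
  note V = vectorspace_dual[OF vectorspace_Hom[OF Q_Obj y]]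
  obtain n \<epsilon> e where b: "dual_basis (dual_space (hom_space C Q y)) n \<epsilon> e"
    using fdvs_dual[OF fdvs_Hom[OF Q_Obj y]] by (rule fdvsE)
  note \<epsilon> = dual_basisD(1)[OF b]
  obtain T i pr where T: "is_power C n (OMap H Q) T i pr"
    using power_exists[OF HQ] by blast
  then have TO: "T \<in> Obj C" and ip: "\<And>k. k < n \<Longrightarrow> i k \<in> Hom C (OMap H Q) T" "\<And>k. k < n \<Longrightarrow> pr k \<in> Hom C T (OMap H Q)"
    and pi: "\<And>k l. k < n \<Longrightarrow> l < n \<Longrightarrow> pr k \<cdot> i l = (if k = l then Idt C (OMap H Q) else ZeroArr C (OMap H Q) (OMap H Q))"
    by (auto simp: is_power_def)
  define r where "r p = hsum Q T (\<lambda>k. i k \<cdot> p Q (\<epsilon> k)) n" for p :: "'o \<Rightarrow> ('m \<Rightarrow> 'k) \<Rightarrow> 'm"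
  note pQ = is_datum_Hom[OF _ Q_Obj \<epsilon>]
  have ipQ: "i k \<cdot> p Q (\<epsilon> k) \<in> Hom C Q T" if "is_datum C H y Q p" "k < n" for p k
    using Comp_in_Hom[OF pQ[OF that] ip(1)[OF that(2)]] .
  have rH: "r p \<in> Hom C Q T" if "is_datum C H y Q p" for p
    unfolding r_def by (rule hsum_Hom[OF Q_Obj TO ipQ[OF that]])
  have r_comp: "pr l \<cdot> r p = p Q (\<epsilon> l)" if p: "is_datum C H y Q p" and l: "l < n" for p l
  proof -
    have "pr l \<cdot> r p = hsum Q (OMap H Q) (\<lambda>k. pr l \<cdot> (i k \<cdot> p Q (\<epsilon> k))) n"
      unfolding r_def by (rule Comp_hsum[OF ip(2)[OF l] Q_Obj ipQ[OF p]])
    also have "\<dots> = hsum Q (OMap H Q) (\<lambda>k. if k = l then p Q (\<epsilon> l) else ZeroArr C Q (OMap H Q)) n"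
    proof (rule vsum_cong)
      fix k assume k: "k < n"
      show "pr l \<cdot> (i k \<cdot> p Q (\<epsilon> k)) = (if k = l then p Q (\<epsilon> l) else ZeroArr C Q (OMap H Q))"
        using Comp_assoc[OF pQ[OF p k] ip(1)[OF k] ip(2)[OF l]] Idt_Comp[OF pQ[OF p k]] zero_Comp[OF pQ[OF p k] HQ] pi[OF l k]
        by (cases "k = l") auto
    qed
    also have "\<dots> = p Q (\<epsilon> l)"
      using hsum_delta[OF pQ[OF p l], of l n] l by simp
    finally show ?thesis .
  qed
  let ?S = "{r p | p. is_datum C H y Q p}"
  have "subsp (hom_space C Q T) ?S"
    unfolding subsp_def
  proof (intro conjI ballI allI)
    show "?S \<subseteq> carrier (hom_space C Q T)"
      using rH by auto
    have "r (\<lambda>x \<xi>. ZeroArr C Q (OMap H x)) = hsum Q T (\<lambda>k. ZeroArr C Q T) n"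
      unfolding r_def by (rule vsum_cong) (simp add: Comp_zero[OF ip(1) Q_Obj])
    also have "\<dots> = ZeroArr C Q T"
      by (induction n) (use AddArr_zero[OF ZeroArr_Hom[OF Q_Obj TO]] in auto)
    finally show "\<zero>\<^bsub>hom_space C Q T\<^esub> \<in> ?S"
      using datum_zero[OF H y Q_Obj] by force
  next
    fix f g assume "f \<in> ?S" "g \<in> ?S"
    then obtain p q where p: "f = r p" "is_datum C H y Q p" and q: "g = r q" "is_datum C H y Q q"
      by blast
    have "r (\<lambda>x \<xi>. AddArr C (p x \<xi>) (q x \<xi>)) = hsum Q T (\<lambda>k. AddArr C (i k \<cdot> p Q (\<epsilon> k)) (i k \<cdot> q Q (\<epsilon> k))) n"
      unfolding r_def
      by (rule vsum_cong) (rule Comp_AddArr[OF pQ[OF p(2)] ip(1) pQ[OF q(2)]])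
    also have "\<dots> = AddArr C (r p) (r q)"
      using vsum_add[OF hom_vs[OF Q_Obj TO], of n "\<lambda>k. i k \<cdot> p Q (\<epsilon> k)" "\<lambda>k. i k \<cdot> q Q (\<epsilon> k)"] ipQ[OF p(2)] ipQ[OF q(2)]
      by (simp add: r_def)
    finally show "f \<oplus>\<^bsub>hom_space C Q T\<^esub> g \<in> ?S"
      using datum_add[OF H y p(2) q(2)] p(1) q(1) by force
  next
    fix a g assume "g \<in> ?S"
    then obtain p where p: "g = r p" "is_datum C H y Q p"
      by blast
    \<comment> \<open>A multiple of a datum is its composite with a multiple of the identity, and
      composites are data by \<open>is_datum_comp\<close>.\<close>
    let ?s = "ScaleArr C a (Idt C Q)"
    have sH: "?s \<in> Hom C Q Q"
      by (rule ScaleArr_Hom[OF Idt_in_Hom[OF Q_Obj]])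
    have "r (\<lambda>x \<xi>. p x \<xi> \<cdot> ?s) = hsum Q T (\<lambda>k. ScaleArr C a (i k \<cdot> p Q (\<epsilon> k))) n"
      unfolding r_def
    proof (rule vsum_cong)
      fix k assume k: "k < n"
      show "i k \<cdot> (p Q (\<epsilon> k) \<cdot> ?s) = ScaleArr C a (i k \<cdot> p Q (\<epsilon> k))"
        using Comp_ScaleArr[OF Idt_in_Hom[OF Q_Obj] pQ[OF p(2) k], of a] Comp_Idt[OF pQ[OF p(2) k]]
          Comp_ScaleArr[OF pQ[OF p(2) k] ip(1)[OF k], of a] by simp
    qed
    also have "\<dots> = ScaleArr C a (r p)"
      using vsum_smult[OF hom_vs[OF Q_Obj TO], of n "\<lambda>k. i k \<cdot> p Q (\<epsilon> k)" a] ipQ[OF p(2)] by (simp add: r_def)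
    finally have "ScaleArr C a g = r (\<lambda>x \<xi>. p x \<xi> \<cdot> ?s)"
      using p(1) by simp
    moreover have "is_datum C H y Q (\<lambda>x \<xi>. p x \<xi> \<cdot> ?s)"
      by (rule is_datum_comp[OF H p(2) sH _ y]) simp
    ultimately show "a \<odot>\<^bsub>hom_space C Q T\<^esub> g \<in> ?S"
      by auto
  qed
  then obtain m u where u: "\<And>k. k < m \<Longrightarrow> u k \<in> ?S"
    and u_span: "\<And>g. g \<in> ?S \<Longrightarrow> \<exists>a. g = hsum Q T (\<lambda>k. a k \<odot>\<^bsub>hom_space C Q T\<^esub> u k) m"
    by (rule subsp_finitely_spanned[OF fdvs_Hom[OF Q_Obj TO]]) (rule that)
  have "\<exists>p. k < m \<longrightarrow> u k = r p \<and> is_datum C H y Q p" for k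
    using u[of k] by auto
  then obtain p where p: "\<And>k. k < m \<Longrightarrow> u k = r (p k)" "\<And>k. k < m \<Longrightarrow> is_datum C H y Q (p k)"
    by metis
  \<comment> \<open>One copy of \<open>Q\<close> for each spanning datum, with \<open>\<phi>\<close>
    equal to \<open>p k\<close> on the copy with number \<open>k\<close>. A combination of the
    \<open>p k\<close> is then \<open>\<phi>\<close> composed with the same combination of the
    inclusions.\<close>
  obtain c j s where P: "is_power C m Q c j s"
    using power_exists[OF Q_Obj] by blast
  then have cO: "c \<in> Obj C" and js: "\<And>k. k < m \<Longrightarrow> j k \<in> Hom C Q c" "\<And>k. k < m \<Longrightarrow> s k \<in> Hom C c Q"
    and sj: "\<And>k l. k < m \<Longrightarrow> l < m \<Longrightarrow> s k \<cdot> j l = (if k = l then Idt C Q else ZeroArr C Q Q)"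
    by (auto simp: is_power_def)
  define \<phi> where "\<phi> x \<xi> = hsum c (OMap H x) (\<lambda>k. p k x \<xi> \<cdot> s k) m" for x \<xi>
  have \<phi>: "is_datum C H y c \<phi>"
    unfolding \<phi>_def using datum_hsum[OF H y cO p(2) js(2)] .
  show thesis
  proof (rule that[OF \<phi>])
    fix q assume q: "is_datum C H y Q q"
    obtain a where a: "r q = hsum Q T (\<lambda>k. ScaleArr C (a k) (u k)) m"
      using u_span[of "r q"] q by auto
    define g where "g = hsum Q c (\<lambda>k. ScaleArr C (a k) (j k)) m"
    have sjH: "ScaleArr C (a k) (j k) \<in> Hom C Q c" if "k < m" for k
      by (rule ScaleArr_Hom[OF js(1)[OF that]])
    have g: "g \<in> Hom C Q c"
      unfolding g_def by (rule hsum_Hom[OF Q_Obj cO sjH])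
    have sg: "s k \<cdot> g = ScaleArr C (a k) (Idt C Q)" if k: "k < m" for k
    proof -
      note I = ScaleArr_Hom[OF Idt_in_Hom[OF Q_Obj], of "a k"]
      have "s k \<cdot> g = hsum Q Q (\<lambda>l. s k \<cdot> ScaleArr C (a l) (j l)) m"
        unfolding g_def by (rule Comp_hsum[OF js(2)[OF k] Q_Obj sjH])
      also have "\<dots> = hsum Q Q (\<lambda>l. if l = k then ScaleArr C (a k) (Idt C Q) else ZeroArr C Q Q) m"
      proof (rule vsum_cong)
        fix l assume l: "l < m"
        show "s k \<cdot> ScaleArr C (a l) (j l) = (if l = k then ScaleArr C (a k) (Idt C Q) else ZeroArr C Q Q)"
          using Comp_ScaleArr[OF js(1)[OF l] js(2)[OF k], of "a l"] sj[OF k l] vs_smult_zero[OF hom_vs[OF Q_Obj Q_Obj], of "a l"]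
          by (cases "l = k") auto
      qed
      also have "\<dots> = ScaleArr C (a k) (Idt C Q)"
        using hsum_delta[OF I, of k m] k by simp
      finally show ?thesis .
    qed
    have \<phi>g: "\<phi> x \<xi> \<cdot> g = hsum Q (OMap H x) (\<lambda>k. ScaleArr C (a k) (p k x \<xi>)) m" if x: "x \<in> Obj C" "\<xi> \<in> hdual C x y" for x \<xi>
    proof -
      have pH: "p k x \<xi> \<in> Hom C Q (OMap H x)" if "k < m" for k
        by (rule is_datum_Hom[OF p(2)[OF that] x])
      have "\<phi> x \<xi> \<cdot> g = hsum Q (OMap H x) (\<lambda>k. (p k x \<xi> \<cdot> s k) \<cdot> g) m"
        unfolding \<phi>_def by (rule hsum_Comp[OF g linear_endofunctorD(1)[OF H x(1)]]) (rule Comp_in_Hom[OF js(2) pH])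
      also have "\<dots> = hsum Q (OMap H x) (\<lambda>k. ScaleArr C (a k) (p k x \<xi>)) m"
      proof (rule vsum_cong)
        fix k assume k: "k < m"
        show "(p k x \<xi> \<cdot> s k) \<cdot> g = ScaleArr C (a k) (p k x \<xi>)"
          using Comp_assoc[OF g js(2)[OF k] pH[OF k]] sg[OF k] Comp_ScaleArr[OF Idt_in_Hom[OF Q_Obj] pH[OF k], of "a k"]
            Comp_Idt[OF pH[OF k]] by simp
      qed
      finally show ?thesis .
    qed
    have \<phi>gD: "is_datum C H y Q (\<lambda>x \<xi>. \<phi> x \<xi> \<cdot> g)"
      by (rule is_datum_comp[OF H \<phi> g _ y]) simp
    have basis: "\<phi> Q (\<epsilon> l) \<cdot> g = q Q (\<epsilon> l)" if l: "l < n" for l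
    proof -
      have uH: "u k \<in> Hom C Q T" if "k < m" for k
        using rH[OF p(2)[OF that]] p(1)[OF that] by simp
      have "q Q (\<epsilon> l) = pr l \<cdot> r q"
        using r_comp[OF q l] by simp
      also have "\<dots> = hsum Q (OMap H Q) (\<lambda>k. pr l \<cdot> ScaleArr C (a k) (u k)) m"
        unfolding a by (rule Comp_hsum[OF ip(2)[OF l] Q_Obj ScaleArr_Hom[OF uH]])
      also have "\<dots> = hsum Q (OMap H Q) (\<lambda>k. ScaleArr C (a k) (p k Q (\<epsilon> l))) m"
      proof (rule vsum_cong)
        fix k assume k: "k < m"
        show "pr l \<cdot> ScaleArr C (a k) (u k) = ScaleArr C (a k) (p k Q (\<epsilon> l))"
          using Comp_ScaleArr[OF uH[OF k] ip(2)[OF l], of "a k"] r_comp[OF p(2)[OF k] l] p(1)[OF k] by simp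
      qed
      finally show ?thesis
        using \<phi>g[OF Q_Obj \<epsilon>[OF l]] by simp
    qed
    have exp: "q' Q \<zeta> = hsum Q (OMap H Q) (\<lambda>l. ScaleArr C (e l \<zeta>) (q' Q (\<epsilon> l))) n"
      if q': "is_datum C H y Q q'" and \<zeta>: "\<zeta> \<in> hdual C Q y" for q' \<zeta>
    proof -
      note lin = is_datumD(2)[OF q' Q_Obj]
      have "q' Q \<zeta> = q' Q (vsum (dual_space (hom_space C Q y)) (\<lambda>l. e l \<zeta> \<odot>\<^bsub>dual_space (hom_space C Q y)\<^esub> \<epsilon> l) n)"
        using dual_basisD(4)[OF b \<zeta>] by simp
      also have "\<dots> = hsum Q (OMap H Q) (\<lambda>l. q' Q (e l \<zeta> \<odot>\<^bsub>dual_space (hom_space C Q y)\<^esub> \<epsilon> l)) n"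
        by (rule linear_maps_vsum[OF V hom_vs[OF Q_Obj HQ] lin vs_smult_closed[OF V \<epsilon>]])
      also have "\<dots> = hsum Q (OMap H Q) (\<lambda>l. ScaleArr C (e l \<zeta>) (q' Q (\<epsilon> l))) n"
        by (rule vsum_cong) (simp add: linear_maps_smult[OF lin \<epsilon>])
      finally show ?thesis .
    qed
    \<comment> \<open>Linearity leads from the basis \<open>\<epsilon>\<close> to all functionals on
      \<open>Hom(Q, y)\<close>, and \<open>datum_determined\<close> from \<open>Q\<close> to all
      objects.\<close>
    have "\<phi> Q \<zeta> \<cdot> g = q Q \<zeta>" if \<zeta>: "\<zeta> \<in> hdual C Q y" for \<zeta>
      using exp[OF \<phi>gD \<zeta>] exp[OF q \<zeta>] basis by (simp cong: vsum_cong)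
    then have "\<phi> x \<xi> \<cdot> g = q x \<xi>" if "x \<in> Obj C" "\<xi> \<in> hdual C x y" for x \<xi>
      using datum_determined[OF H y \<phi>gD q _ that] by simp
    then show "\<exists>g\<in>Hom C Q c. \<forall>x\<in>Obj C. \<forall>\<xi>\<in>hdual C x y. \<phi> x \<xi> \<cdot> g = q x \<xi>"
      using g by blast
  qed
qed

text \<open>Each component factors through the cokernel, and the laws of a datum hold for the
  factors because \<open>q\<close> can be cancelled on the right.\<close>

lemma datum_descent:
  assumes H: "linear_endofunctor C H" and y: "y \<in> Obj C" and q: "is_cokernel C q f"
    and p: "is_datum C H y (Cod C f) p"
    and 0: "\<And>x \<xi>. x \<in> Obj C \<Longrightarrow> \<xi> \<in> hdual C x y \<Longrightarrow> p x \<xi> \<cdot> f = ZeroArr C (Dom C f) (OMap H x)"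
  obtains p' where "is_datum C H y (Cod C q) p'" "\<And>x \<xi>. x \<in> Obj C \<Longrightarrow> \<xi> \<in> hdual C x y \<Longrightarrow> p' x \<xi> \<cdot> q = p x \<xi>"
proof -
  have qH: "q \<in> Hom C (Cod C f) (Cod C q)"
    using q by (auto simp: is_cokernel_def Hom_def)
  have "\<exists>u. x \<in> Obj C \<longrightarrow> \<xi> \<in> hdual C x y \<longrightarrow> u \<in> Hom C (Cod C q) (OMap H x) \<and> u \<cdot> q = p x \<xi>" for x \<xi>
    using q is_datum_Hom[OF p, of x \<xi>] 0[of x \<xi>] unfolding is_cokernel_def by blast
  then obtain p' where p'H: "\<And>x \<xi>. x \<in> Obj C \<Longrightarrow> \<xi> \<in> hdual C x y \<Longrightarrow> p' x \<xi> \<in> Hom C (Cod C q) (OMap H x)"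
    and p': "\<And>x \<xi>. x \<in> Obj C \<Longrightarrow> \<xi> \<in> hdual C x y \<Longrightarrow> p' x \<xi> \<cdot> q = p x \<xi>"
    by metis
  have epi: "g = h" if "g \<in> Hom C (Cod C q) b" "h \<in> Hom C (Cod C q) b" "g \<cdot> q = h \<cdot> q" for g h b
    using cokernel_epi[OF q] that unfolding is_epi_def by blast
  have "is_datum C H y (Cod C q) p'"
    unfolding is_datum_def
  proof (intro conjI ballI allI)
    show "Cod C q \<in> Obj C"
      using Hom_Obj[OF qH] by simp
  next
    fix x assume x: "x \<in> Obj C"
    note V = vectorspace_dual[OF vectorspace_Hom[OF x y]]
    note pl = is_datumD(2)[OF p x]
    show "p' x \<in> linear_maps (dual_space (hom_space C x y)) (hom_space C (Cod C q) (OMap H x))"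
    proof (rule linear_mapsI; simp only: hom_space_simps)
      show "p' x \<xi> \<in> Hom C (Cod C q) (OMap H x)" if "\<xi> \<in> hdual C x y" for \<xi>
        by (rule p'H[OF x that])
      show "p' x (\<xi> \<oplus>\<^bsub>dual_space (hom_space C x y)\<^esub> \<eta>) = AddArr C (p' x \<xi>) (p' x \<eta>)"
        if \<xi>: "\<xi> \<in> hdual C x y" and \<eta>: "\<eta> \<in> hdual C x y" for \<xi> \<eta>
        by (rule epi[OF p'H[OF x vs_add_closed[OF V \<xi> \<eta>]] AddArr_Hom[OF p'H[OF x \<xi>] p'H[OF x \<eta>]]])
          (simp add: p'[OF x] vs_add_closed[OF V] \<xi> \<eta> AddArr_Comp[OF qH p'H[OF x \<xi>] p'H[OF x \<eta>]] linear_maps_add[OF pl])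
      show "p' x (k \<odot>\<^bsub>dual_space (hom_space C x y)\<^esub> \<xi>) = ScaleArr C k (p' x \<xi>)"
        if \<xi>: "\<xi> \<in> hdual C x y" for k \<xi>
        by (rule epi[OF p'H[OF x vs_smult_closed[OF V \<xi>]] ScaleArr_Hom[OF p'H[OF x \<xi>]]])
          (simp add: p'[OF x] vs_smult_closed[OF V] \<xi> ScaleArr_Comp[OF qH p'H[OF x \<xi>]] linear_maps_smult[OF pl])
    qed
  next
    fix a b t \<xi> assume t: "t \<in> Hom C a b" and \<xi>: "\<xi> \<in> hdual C a y"
    have a: "a \<in> Obj C" and b: "b \<in> Obj C"
      using Hom_Obj[OF t] by auto
    note Ht = linear_endofunctor_Hom[OF H t] and c = precomp_dual_closed[OF t y \<xi>]
    show "AMap H t \<cdot> p' a \<xi> = p' b (precomp_dual C y t \<xi>)"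
      by (rule epi[OF Comp_in_Hom[OF p'H[OF a \<xi>] Ht] p'H[OF b c]])
        (simp add: Comp_assoc[OF qH p'H[OF a \<xi>] Ht] p'[OF a \<xi>] p'[OF b c] is_datumD(3)[OF p t \<xi>])
  qed
  then show thesis
    using that p' by blast
qed

text \<open>Data are made extensional so that equality of data is equality of functions.\<close>

lemma universal_datum_exists:
  assumes H: "linear_endofunctor C H" and y: "y \<in> Obj C"
  shows "\<exists>z p. is_universal C H y z p"
proof -
  define cut where "cut p = (\<lambda>x \<xi>. if x \<in> Obj C \<and> \<xi> \<in> hdual C x y then p x \<xi> else undefined)"
    for p :: "'o \<Rightarrow> ('m \<Rightarrow> 'k) \<Rightarrow> 'm"
  define \<Phi> where "\<Phi> w = {p. is_datum C H y w p \<and> cut p = p}" for w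
  define act where "act p f = cut (\<lambda>x \<xi>. p x \<xi> \<cdot> f)" for p f
  note HO = linear_endofunctorD(1)[OF H]
  have cut_apply: "cut p x \<xi> = p x \<xi>" if "x \<in> Obj C" "\<xi> \<in> hdual C x y" for p x \<xi>
    using that by (simp add: cut_def)
  have cut_cong: "cut p = cut p' \<longleftrightarrow> (\<forall>x\<in>Obj C. \<forall>\<xi>\<in>hdual C x y. p x \<xi> = p' x \<xi>)" for p p'
    by (auto simp: cut_def fun_eq_iff)
  have cut_cut: "cut (cut p) = cut p" for p
    by (auto simp: cut_def fun_eq_iff)
  have cutI: "cut p \<in> \<Phi> w" if p: "is_datum C H y w p" for p w
  proof -
    \<comment> \<open>Where it matters, \<open>cut p\<close> is \<open>p\<close> composed with the
      identity, so \<open>is_datum_comp\<close> covers it.\<close>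
    have "is_datum C H y w (cut p)"
    proof (rule is_datum_comp[OF H p Idt_in_Hom[OF is_datumD(1)[OF p]] _ y])
      show "cut p x \<xi> = p x \<xi> \<cdot> Idt C w" if "x \<in> Obj C" "\<xi> \<in> hdual C x y" for x \<xi>
        using Comp_Idt[OF is_datum_Hom[OF p that]] by (simp add: cut_apply[OF that])
    qed
    then show ?thesis
      by (simp add: \<Phi>_def cut_cut)
  qed
  have D: "is_datum C H y w p" if "p \<in> \<Phi> w" for p w
    using that by (simp add: \<Phi>_def)
  have PH: "p x \<xi> \<in> Hom C w (OMap H x)" if "p \<in> \<Phi> w" "x \<in> Obj C" "\<xi> \<in> hdual C x y" for p w x \<xi>
    using is_datum_Hom[OF D that(2,3)] that(1) .
  have act_eq: "act p f = act p' f' \<longleftrightarrow> (\<forall>x\<in>Obj C. \<forall>\<xi>\<in>hdual C x y. p x \<xi> \<cdot> f = p' x \<xi> \<cdot> f')" for p p' f f'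
    by (simp add: act_def cut_cong)
  have eqI: "p = p'" if "p \<in> \<Phi> w" "p' \<in> \<Phi> w" "\<And>x \<xi>. x \<in> Obj C \<Longrightarrow> \<xi> \<in> hdual C x y \<Longrightarrow> p x \<xi> = p' x \<xi>" for p p' w
    using that cut_cong[of p p'] by (simp add: \<Phi>_def)
  obtain c0 \<phi>0 where \<phi>0: "is_datum C H y c0 \<phi>0"
    "\<And>p. is_datum C H y Q p \<Longrightarrow> \<exists>g\<in>Hom C Q c0. \<forall>x\<in>Obj C. \<forall>\<xi>\<in>hdual C x y. \<phi>0 x \<xi> \<cdot> g = p x \<xi>"
    using data_finitely_generated[OF H y] by metis
  have "\<exists>c\<in>Obj C. \<exists>\<phi>\<in>\<Phi> c. \<forall>b\<in>Obj C. \<forall>\<psi>\<in>\<Phi> b. \<exists>!h. h \<in> Hom C b c \<and> act \<phi> h = \<psi>"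
  proof (rule representable[where ?c0.0 = c0 and ?\<phi>0.0 = "cut \<phi>0"])
    show "act \<phi> f \<in> \<Phi> a" if "\<phi> \<in> \<Phi> b" "f \<in> Hom C a b" for \<phi> f a b
      unfolding act_def by (rule cutI[OF is_datum_comp[OF H D[OF that(1)] that(2) _ y]]) simp
    show "act \<phi> (g \<cdot> f) = act (act \<phi> g) f" if "\<phi> \<in> \<Phi> c" "f \<in> Hom C a b" "g \<in> Hom C b c" for \<phi> f g a b c
      unfolding act_eq using Comp_assoc[OF that(2,3) PH[OF that(1)]] by (simp add: act_def cut_apply)
    show "\<phi> = \<psi>" if "\<phi> \<in> \<Phi> b" "\<psi> \<in> \<Phi> b" "b \<in> Obj C" and eq: "\<And>g. g \<in> Hom C Q b \<Longrightarrow> act \<phi> g = act \<psi> g" for \<phi> \<psi> b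
    proof (rule eqI[OF that(1,2)])
      fix x \<xi> assume x: "x \<in> Obj C" "\<xi> \<in> hdual C x y"
      show "\<phi> x \<xi> = \<psi> x \<xi>"
        by (rule Q_generator[OF PH[OF that(1) x] PH[OF that(2) x]]) (use eq x in \<open>simp add: act_eq\<close>)
    qed
    show "act \<phi> (ZeroArr C a c) = act \<psi> (ZeroArr C a c')"
      if "\<phi> \<in> \<Phi> c" "\<psi> \<in> \<Phi> c'" "a \<in> Obj C" "c \<in> Obj C" "c' \<in> Obj C" for \<phi> \<psi> a c c'
      unfolding act_eq using Comp_zero[OF PH[OF that(1)] that(3)] Comp_zero[OF PH[OF that(2)] that(3)] by simp
    show "act \<phi> (AddArr C f g) = act \<psi> (AddArr C f' g')"
      if "\<phi> \<in> \<Phi> c" "\<psi> \<in> \<Phi> c'" "f \<in> Hom C a c" "f' \<in> Hom C a c'" "g \<in> Hom C a c" "g' \<in> Hom C a c'"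
        "act \<phi> f = act \<psi> f'" "act \<phi> g = act \<psi> g'" for \<phi> \<psi> a c c' f f' g g'
      using that(7,8) Comp_AddArr[OF that(3) PH[OF that(1)] that(5)] Comp_AddArr[OF that(4) PH[OF that(2)] that(6)]
      by (simp add: act_eq)
    show "act \<phi> (ScaleArr C k f) = act \<phi> (ScaleArr C k f')"
      if "\<phi> \<in> \<Phi> c" "f \<in> Hom C a c" "f' \<in> Hom C a c" "act \<phi> f = act \<phi> f'" for \<phi> a c f f' k
      using that(4) Comp_ScaleArr[OF that(2) PH[OF that(1)]] Comp_ScaleArr[OF that(3) PH[OF that(1)]]
      by (simp add: act_eq)
    show "\<exists>\<phi>'\<in>\<Phi> (Cod C q). act \<phi>' q = \<phi>"
      if q: "is_cokernel C q f" and \<phi>: "\<phi> \<in> \<Phi> (Cod C f)" and eq: "act \<phi> f = act \<phi> (ZeroArr C (Dom C f) (Cod C f))" for \<phi> q f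
    proof -
      have f: "Dom C f \<in> Obj C"
        using q Dom_in_Obj by (simp add: is_cokernel_def)
      obtain p' where p': "is_datum C H y (Cod C q) p'" "\<And>x \<xi>. x \<in> Obj C \<Longrightarrow> \<xi> \<in> hdual C x y \<Longrightarrow> p' x \<xi> \<cdot> q = \<phi> x \<xi>"
        by (rule datum_descent[OF H y q D[OF \<phi>]]) (use eq Comp_zero[OF PH[OF \<phi>] f] in \<open>auto simp: act_eq\<close>)
      have "act (cut p') q = cut \<phi>"
        by (simp add: act_def cut_cong cut_apply p')
      then show ?thesis
        using cutI[OF p'(1)] \<phi> by (auto simp: \<Phi>_def)
    qed
    show "c0 \<in> Obj C"
      by (rule is_datumD(1)[OF \<phi>0(1)])
    show "cut \<phi>0 \<in> \<Phi> c0"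
      by (rule cutI[OF \<phi>0(1)])
    show "\<exists>g\<in>Hom C Q c0. act (cut \<phi>0) g = \<psi>" if \<psi>: "\<psi> \<in> \<Phi> Q" for \<psi>
    proof -
      obtain g where g: "g \<in> Hom C Q c0" "\<And>x \<xi>. x \<in> Obj C \<Longrightarrow> \<xi> \<in> hdual C x y \<Longrightarrow> \<phi>0 x \<xi> \<cdot> g = \<psi> x \<xi>"
        using \<phi>0(2)[OF D[OF \<psi>]] by blast
      then have "act (cut \<phi>0) g = cut \<psi>"
        by (simp add: act_def cut_cong cut_apply)
      then show ?thesis
        using g(1) \<psi> by (auto simp: \<Phi>_def)
    qed
  qed
  then obtain c \<phi> where \<phi>: "\<phi> \<in> \<Phi> c" and univ: "\<And>b \<psi>. b \<in> Obj C \<Longrightarrow> \<psi> \<in> \<Phi> b \<Longrightarrow> \<exists>!h. h \<in> Hom C b c \<and> act \<phi> h = \<psi>"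
    by blast
  have "is_universal C H y c \<phi>"
    unfolding is_universal_def
  proof (intro conjI allI impI)
    fix w q assume q: "is_datum C H y w q"
    have "act \<phi> h = cut q \<longleftrightarrow> (\<forall>x\<in>Obj C. \<forall>\<xi>\<in>hdual C x y. \<phi> x \<xi> \<cdot> h = q x \<xi>)" for h
      by (simp add: act_def cut_cong)
    then show "\<exists>!h. h \<in> Hom C w c \<and> (\<forall>x\<in>Obj C. \<forall>\<xi>\<in>hdual C x y. \<phi> x \<xi> \<cdot> h = q x \<xi>)"
      using univ[OF is_datumD(1)[OF q] cutI[OF q]] by simp
  qed (rule D[OF \<phi>])
  then show ?thesis
    by blast
qed

end


section \<open>Generators\<close>

context abelian_linear_category
begin

lemma additive_category: "additive_category C"
  by (rule additive_category.intro[OF linear_category_axioms additive_category_axioms.intro[OF ex_zero_obj ex_biproduct]])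

text \<open>Exactness of \<open>f\<close>, \<open>q\<close> in the middle, as seen by
  \<open>Hom(Q, -)\<close>: \<open>f\<close> is an epi \<open>e\<close> followed by the kernel
  \<open>k\<close> of \<open>q\<close>, the morphism \<open>d\<close> factors through
  \<open>k\<close>, and projectivity lifts the factor along \<open>e\<close>.\<close>

lemma projective_lift_cokernel:
  assumes Q: "is_projective C Q" and q: "is_cokernel C q f" and d: "d \<in> Hom C Q (Cod C f)"
    and qd: "q \<cdot> d = ZeroArr C Q (Cod C q)"
  shows "\<exists>t\<in>Hom C Q (Dom C f). f \<cdot> t = d"
proof -
  define a b c where "a = Dom C f" and "b = Cod C f" and "c = Cod C q"
  have f: "f \<in> Hom C a b" and qH: "q \<in> Hom C b c" and qf: "q \<cdot> f = ZeroArr C a c" and d': "d \<in> Hom C Q b"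
    using q d by (auto simp: is_cokernel_def Hom_def a_def b_def c_def)
  have O: "a \<in> Obj C" "b \<in> Obj C" "c \<in> Obj C"
    using Hom_Obj[OF f] Hom_Obj[OF qH] by auto
  obtain k where k: "is_kernel C k q"
    using ex_kernel[OF HomD(1)[OF qH]] by blast
  define K where "K = Dom C k"
  have kH: "k \<in> Hom C K b" and qk: "q \<cdot> k = ZeroArr C K c"
    using k qH by (auto simp: is_kernel_def Hom_def K_def)
  have kf: "\<exists>u\<in>Hom C x K. k \<cdot> u = h" if "h \<in> Hom C x b" "q \<cdot> h = ZeroArr C x c" for h x
    using k that HomD[OF qH] unfolding is_kernel_def K_def by metis
  have kmono: "g = h" if "g \<in> Hom C x K" "h \<in> Hom C x K" "k \<cdot> g = k \<cdot> h" for g h x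
    using kernel_mono[OF k] that unfolding is_mono_def K_def by blast
  obtain e where e: "e \<in> Hom C a K" "k \<cdot> e = f"
    using kf[OF f qf] by blast
  \<comment> \<open>This makes \<open>e\<close> an epi. If \<open>h\<close> kills \<open>e\<close>,
    then \<open>f\<close> factors through \<open>k \<cdot> j\<close>, a mono and thus the kernel of
    some \<open>r\<close>. As \<open>r\<close> kills \<open>f\<close> it factors through
    \<open>q\<close>, so it kills \<open>k\<close>; hence \<open>k\<close> factors through
    \<open>k \<cdot> j\<close>, \<open>j\<close> has a right inverse, and \<open>h\<close> is
    zero.\<close>
  have zero: "h = ZeroArr C K x" if h: "h \<in> Hom C K x" and he: "h \<cdot> e = ZeroArr C a x" for h x
  proof -
    obtain j where j: "is_kernel C j h"
      using ex_kernel[OF HomD(1)[OF h]] by blast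
    define J where "J = Dom C j"
    have jH: "j \<in> Hom C J K" and hj: "h \<cdot> j = ZeroArr C J x"
      using j h by (auto simp: is_kernel_def Hom_def J_def)
    obtain e' where e': "e' \<in> Hom C a J" "j \<cdot> e' = e"
      using j e(1) he HomD[OF h] unfolding is_kernel_def J_def by metis
    note kj = Comp_in_Hom[OF jH kH]
    have "is_mono C (k \<cdot> j)"
      unfolding is_mono_def
    proof (intro conjI ballI allI impI)
      fix y g g' assume g: "g \<in> Hom C y (Dom C (k \<cdot> j))" "g' \<in> Hom C y (Dom C (k \<cdot> j))" and eq: "(k \<cdot> j) \<cdot> g = (k \<cdot> j) \<cdot> g'"
      have g': "g \<in> Hom C y J" "g' \<in> Hom C y J"
        using g HomD[OF kj] by auto
      have "j \<cdot> g = j \<cdot> g'"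
        using kmono[OF Comp_in_Hom[OF g'(1) jH] Comp_in_Hom[OF g'(2) jH]] Comp_assoc[OF g'(1) jH kH] Comp_assoc[OF g'(2) jH kH] eq by simp
      then show "g = g'"
        using kernel_mono[OF j] g' unfolding is_mono_def J_def by blast
    qed (rule HomD(1)[OF kj])
    then obtain r where r: "is_kernel C (k \<cdot> j) r"
      using mono_is_kernel by blast
    have rH: "r \<in> Hom C b (Cod C r)" and rkj: "r \<cdot> (k \<cdot> j) = ZeroArr C J (Cod C r)"
      using r HomD[OF kj] by (auto simp: is_kernel_def Hom_def)
    have rO: "Cod C r \<in> Obj C"
      using Hom_Obj[OF rH] by simp
    have "f = (k \<cdot> j) \<cdot> e'"
      using Comp_assoc[OF e'(1) jH kH] e'(2) e(2) by simp
    then have "r \<cdot> f = ZeroArr C a (Cod C r)"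
      using Comp_assoc[OF e'(1) kj rH] zero_Comp[OF e'(1) rO] rkj by simp
    then obtain r' where r': "r' \<in> Hom C c (Cod C r)" "r' \<cdot> q = r"
      using q rH unfolding is_cokernel_def a_def b_def c_def by metis
    have "r \<cdot> k = ZeroArr C K (Cod C r)"
      using Comp_assoc[OF kH qH r'(1)] r'(2) qk Comp_zero[OF r'(1) Hom_Obj(1)[OF kH]] by simp
    then obtain s where s: "s \<in> Hom C K J" "(k \<cdot> j) \<cdot> s = k"
      using r kH HomD[OF rH] HomD[OF kj] unfolding is_kernel_def by metis
    have KO: "K \<in> Obj C"
      using Hom_Obj[OF kH] by simp
    have "j \<cdot> s = Idt C K"
      using kmono[OF Comp_in_Hom[OF s(1) jH] Idt_in_Hom[OF KO]] Comp_assoc[OF s(1) jH kH] s(2) Comp_Idt[OF kH] by simp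
    then have "h = (h \<cdot> j) \<cdot> s"
      using Comp_assoc[OF s(1) jH h] Comp_Idt[OF h] by simp
    then show ?thesis
      using hj zero_Comp[OF s(1) Hom_Obj(2)[OF h]] by simp
  qed
  have "is_epi C e"
    unfolding is_epi_def
  proof (intro conjI ballI allI impI)
    fix x g h assume "g \<in> Hom C (Cod C e) x" "h \<in> Hom C (Cod C e) x" and eq: "g \<cdot> e = h \<cdot> e"
    then have g: "g \<in> Hom C K x" and h: "h \<in> Hom C K x"
      using HomD[OF e(1)] by auto
    let ?d = "AddArr C g (ScaleArr C (-1) h)"
    note h' = ScaleArr_Hom[OF h, of "-1"]
    have "?d \<cdot> e = AddArr C (h \<cdot> e) (ScaleArr C (-1) (h \<cdot> e))"
      using AddArr_Comp[OF e(1) g h'] ScaleArr_Comp[OF e(1) h, of "-1"] eq by simp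
    also have "\<dots> = ZeroArr C a x"
      using vs_neg[OF hom_vs'[OF Comp_in_Hom[OF e(1) h]], of "h \<cdot> e"] Comp_in_Hom[OF e(1) h] by simp
    finally have "?d = ZeroArr C K x"
      by (rule zero[OF AddArr_Hom[OF g h']])
    then show "g = h"
      using vs_eqI[OF hom_vs'[OF g], of g h] g h by simp
  qed (rule HomD(1)[OF e(1)])
  moreover obtain d1 where d1: "d1 \<in> Hom C Q K" "k \<cdot> d1 = d"
    using kf[OF d'] qd by (auto simp: c_def)
  ultimately obtain t where t: "t \<in> Hom C Q a" "e \<cdot> t = d1"
    using Q HomD[OF e(1)] unfolding is_projective_def by metis
  have "f \<cdot> t = d"
    using Comp_assoc[OF t(1) e(1) kH] t(2) e(2) d1(2) by simp
  then show ?thesis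
    using t(1) by (auto simp: a_def)
qed

text \<open>The representing object of \<open>b \<mapsto> Hom(Q, b)\<^sup>\<star>\<close> is an injective cogenerator.\<close>

lemma generator_op:
  assumes "category_with_generator C Q"
  shows "\<exists>I. category_with_generator (op_cat C) I"
proof -
  interpret category_with_generator C Q
    by (rule assms)
  note act_apply = postcomp_dual_apply
  have act_eq: "\<phi> (f \<cdot> t) = \<psi> (f' \<cdot> t)"
    if "postcomp_dual C Q f \<phi> = postcomp_dual C Q f' \<psi>" "f \<in> Hom C a b" "f' \<in> Hom C a b'" "t \<in> Hom C Q a" for \<phi> \<psi> f f' a b b' t
    using that(1) postcomp_dual_apply[OF that(2,4), of \<phi>] postcomp_dual_apply[OF that(3,4), of \<psi>] by simp
  have act_eqI: "postcomp_dual C Q f \<phi> = postcomp_dual C Q f' \<psi>"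
    if "f \<in> Hom C a b" "f' \<in> Hom C a b'" "\<phi> \<in> hdual C Q b" "\<psi> \<in> hdual C Q b'" "\<And>t. t \<in> Hom C Q a \<Longrightarrow> \<phi> (f \<cdot> t) = \<psi> (f' \<cdot> t)" for \<phi> \<psi> f f' a b b'
    by (rule hdual_eqI[OF postcomp_dual_closed[OF that(1) Q_Obj that(3)] postcomp_dual_closed[OF that(2) Q_Obj that(4)]])
      (simp add: postcomp_dual_apply[OF that(1)] postcomp_dual_apply[OF that(2)] that(5))
  note QV = vectorspace_Hom[OF Q_Obj]
  obtain n \<epsilon> e where b: "dual_basis (dual_space (hom_space C Q Q)) n \<epsilon> e"
    using fdvs_dual[OF fdvs_Hom[OF Q_Obj Q_Obj]] by (rule fdvsE)
  note \<epsilon> = dual_basisD(1)[OF b]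
  obtain T i p where P: "is_power C n Q T i p"
    using power_exists[OF Q_Obj] by blast
  then have T: "T \<in> Obj C" and ip: "\<And>k. k < n \<Longrightarrow> i k \<in> Hom C Q T" "\<And>k. k < n \<Longrightarrow> p k \<in> Hom C T Q"
    and pi: "\<And>k l. k < n \<Longrightarrow> l < n \<Longrightarrow> p k \<cdot> i l = (if k = l then Idt C Q else ZeroArr C Q Q)"
    by (auto simp: is_power_def)
  have pt: "p k \<cdot> t \<in> Hom C Q Q" if "k < n" "t \<in> Hom C Q T" for k t
    using Comp_in_Hom[OF that(2) ip(2)[OF that(1)]] .
  \<comment> \<open>The functional that is \<open>\<epsilon> k\<close> on the copy of
    \<open>Q\<close> with number \<open>k\<close>. Pulling it back along the morphism with
    components \<open>e k \<psi>\<close> times the identity gives the expansion of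
    \<open>\<psi>\<close> in the basis \<open>\<epsilon>\<close>.\<close>
  define \<phi>0 where "\<phi>0 = restrict (\<lambda>g. \<Sum>k<n. \<epsilon> k (p k \<cdot> g)) (Hom C Q T)"
  have \<phi>0: "\<phi>0 \<in> hdual C Q T"
  proof -
    have "restrict (\<lambda>g. \<Sum>k<n. \<epsilon> k (p k \<cdot> g)) (carrier (hom_space C Q T)) \<in> hdual C Q T"
    proof (rule dual_restrictI[OF QV[OF T]]; simp)
      fix g h assume g: "g \<in> Hom C Q T" and h: "h \<in> Hom C Q T"
      have "\<epsilon> k (p k \<cdot> AddArr C g h) = \<epsilon> k (p k \<cdot> g) + \<epsilon> k (p k \<cdot> h)" if k: "k < n" for k
        using Comp_AddArr[OF g ip(2)[OF k] h] dual_add[OF \<epsilon>[OF k], of "p k \<cdot> g" "p k \<cdot> h"] pt[OF k g] pt[OF k h] by simp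
      then show "(\<Sum>k<n. \<epsilon> k (p k \<cdot> AddArr C g h)) = (\<Sum>k<n. \<epsilon> k (p k \<cdot> g)) + (\<Sum>k<n. \<epsilon> k (p k \<cdot> h))"
        by (simp add: sum.distrib)
    next
      fix a g assume g: "g \<in> Hom C Q T"
      have "\<epsilon> k (p k \<cdot> ScaleArr C a g) = a * \<epsilon> k (p k \<cdot> g)" if k: "k < n" for k
        using Comp_ScaleArr[OF g ip(2)[OF k]] dual_smult[OF \<epsilon>[OF k], of "p k \<cdot> g" a] pt[OF k g] by simp
      then show "(\<Sum>k<n. \<epsilon> k (p k \<cdot> ScaleArr C a g)) = a * (\<Sum>k<n. \<epsilon> k (p k \<cdot> g))"
        by (simp add: sum_distrib_left)
    qed
    then show ?thesis
      by (simp add: \<phi>0_def)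
  qed
  have "\<exists>c\<in>Obj C. \<exists>\<phi>\<in>hdual C Q c. \<forall>b\<in>Obj C. \<forall>\<psi>\<in>hdual C Q b. \<exists>!h. h \<in> Hom C b c \<and> postcomp_dual C Q h \<phi> = \<psi>"
  proof (rule representable[where \<Phi> = "hdual C Q" and act = "\<lambda>\<phi> f. postcomp_dual C Q f \<phi>" and ?c0.0 = T and ?\<phi>0.0 = \<phi>0])
    show "postcomp_dual C Q f \<phi> \<in> hdual C Q a" if "\<phi> \<in> hdual C Q b" "f \<in> Hom C a b" for \<phi> f a b
      by (rule postcomp_dual_closed[OF that(2) Q_Obj that(1)])
    show "postcomp_dual C Q (g \<cdot> f) \<phi> = postcomp_dual C Q f (postcomp_dual C Q g \<phi>)"
      if "\<phi> \<in> hdual C Q c" "f \<in> Hom C a b" "g \<in> Hom C b c" for \<phi> f g a b c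
      by (rule act_eqI[OF Comp_in_Hom[OF that(2,3)] that(2) that(1) postcomp_dual_closed[OF that(3) Q_Obj that(1)]])
        (simp add: Comp_assoc[OF _ that(2,3)] postcomp_dual_apply[OF that(3) Comp_in_Hom[OF _ that(2)]])
    show "\<phi> = \<psi>" if "\<phi> \<in> hdual C Q b" "\<psi> \<in> hdual C Q b" "b \<in> Obj C"
      "\<And>g. g \<in> Hom C Q b \<Longrightarrow> postcomp_dual C Q g \<phi> = postcomp_dual C Q g \<psi>" for \<phi> \<psi> b
    proof (rule hdual_eqI[OF that(1,2)])
      fix g assume g: "g \<in> Hom C Q b"
      show "\<phi> g = \<psi> g"
        using act_eq[OF that(4)[OF g] g g Idt_in_Hom[OF Q_Obj]] Comp_Idt[OF g] by simp
    qed
    show "postcomp_dual C Q (ZeroArr C a c) \<phi> = postcomp_dual C Q (ZeroArr C a c') \<psi>"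
      if "\<phi> \<in> hdual C Q c" "\<psi> \<in> hdual C Q c'" "a \<in> Obj C" "c \<in> Obj C" "c' \<in> Obj C" for \<phi> \<psi> a c c'
      using dual_zero[OF QV[OF that(4)] that(1)] dual_zero[OF QV[OF that(5)] that(2)]
      by (intro act_eqI[OF ZeroArr_Hom[OF that(3,4)] ZeroArr_Hom[OF that(3,5)] that(1,2)])
        (simp add: zero_Comp that(4,5))
    show "postcomp_dual C Q (AddArr C f g) \<phi> = postcomp_dual C Q (AddArr C f' g') \<psi>"
      if "\<phi> \<in> hdual C Q c" "\<psi> \<in> hdual C Q c'" "f \<in> Hom C a c" "f' \<in> Hom C a c'" "g \<in> Hom C a c" "g' \<in> Hom C a c'"
        "postcomp_dual C Q f \<phi> = postcomp_dual C Q f' \<psi>" "postcomp_dual C Q g \<phi> = postcomp_dual C Q g' \<psi>" for \<phi> \<psi> a c c' f f' g g'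
    proof (rule act_eqI[OF AddArr_Hom[OF that(3,5)] AddArr_Hom[OF that(4,6)] that(1,2)])
      fix t assume t: "t \<in> Hom C Q a"
      show "\<phi> (AddArr C f g \<cdot> t) = \<psi> (AddArr C f' g' \<cdot> t)"
        using dual_add[OF that(1), of "f \<cdot> t" "g \<cdot> t"] dual_add[OF that(2), of "f' \<cdot> t" "g' \<cdot> t"]
          act_eq[OF that(7) that(3,4) t] act_eq[OF that(8) that(5,6) t]
        by (simp add: AddArr_Comp[OF t that(3,5)] AddArr_Comp[OF t that(4,6)] Comp_in_Hom[OF t that(3)] Comp_in_Hom[OF t that(4)]
            Comp_in_Hom[OF t that(5)] Comp_in_Hom[OF t that(6)])
    qed
    show "postcomp_dual C Q (ScaleArr C k f) \<phi> = postcomp_dual C Q (ScaleArr C k f') \<phi>"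
      if "\<phi> \<in> hdual C Q c" "f \<in> Hom C a c" "f' \<in> Hom C a c" "postcomp_dual C Q f \<phi> = postcomp_dual C Q f' \<phi>" for \<phi> a c f f' k
    proof (rule act_eqI[OF ScaleArr_Hom[OF that(2)] ScaleArr_Hom[OF that(3)] that(1,1)])
      fix t assume t: "t \<in> Hom C Q a"
      show "\<phi> (ScaleArr C k f \<cdot> t) = \<phi> (ScaleArr C k f' \<cdot> t)"
        using dual_smult[OF that(1), of "f \<cdot> t" k] dual_smult[OF that(1), of "f' \<cdot> t" k] act_eq[OF that(4) that(2,3) t]
        by (simp add: ScaleArr_Comp[OF t that(2)] ScaleArr_Comp[OF t that(3)] Comp_in_Hom[OF t that(2)] Comp_in_Hom[OF t that(3)])
    qed
    show "\<exists>\<phi>'\<in>hdual C Q (Cod C q). postcomp_dual C Q q \<phi>' = \<phi>"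
      if q: "is_cokernel C q f" and \<phi>: "\<phi> \<in> hdual C Q (Cod C f)"
        and eq: "postcomp_dual C Q f \<phi> = postcomp_dual C Q (ZeroArr C (Dom C f) (Cod C f)) \<phi>" for \<phi> q f
    proof -
      have fH: "f \<in> Hom C (Dom C f) (Cod C f)" and qH: "q \<in> Hom C (Cod C f) (Cod C q)"
        using q by (auto simp: is_cokernel_def Hom_def)
      note O = Hom_Obj[OF fH] Hom_Obj[OF qH]
      \<comment> \<open>The descended functional evaluates \<open>\<phi>\<close> on a lift along
        \<open>q\<close>. Two lifts differ by a morphism that factors through \<open>f\<close>, by
        \<open>projective_lift_cokernel\<close>, and there \<open>\<phi>\<close> vanishes by
        \<open>eq\<close>.\<close>
      have wd: "\<phi> g = \<phi> h" if g: "g \<in> Hom C Q (Cod C f)" and h: "h \<in> Hom C Q (Cod C f)" and gh: "q \<cdot> g = q \<cdot> h" for g h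
      proof -
        let ?d = "AddArr C g (ScaleArr C (-1) h)"
        note h' = ScaleArr_Hom[OF h, of "-1"]
        have "q \<cdot> ?d = AddArr C (q \<cdot> h) (ScaleArr C (-1) (q \<cdot> h))"
          using Comp_AddArr[OF g qH h'] Comp_ScaleArr[OF h qH, of "-1"] gh by simp
        also have "\<dots> = ZeroArr C Q (Cod C q)"
          using vs_neg[OF QV[OF O(4)], of "q \<cdot> h"] Comp_in_Hom[OF h qH] by simp
        finally obtain t where t: "t \<in> Hom C Q (Dom C f)" "f \<cdot> t = ?d"
          using projective_lift_cokernel[OF Q_projective q AddArr_Hom[OF g h']] by blast
        have "\<phi> ?d = \<phi> (ZeroArr C Q (Cod C f))"
          using act_eq[OF eq fH ZeroArr_Hom[OF O(1,2)] t(1)] t(2) zero_Comp[OF t(1) O(2)] by simp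
        then have "\<phi> g + (-1) * \<phi> h = 0"
          using dual_zero[OF QV[OF O(2)] \<phi>] dual_add[OF \<phi>, of g "ScaleArr C (-1) h"] dual_smult[OF \<phi>, of h "-1"] g h h' by simp
        then show ?thesis
          by simp
      qed
      have "\<exists>g. h \<in> Hom C Q (Cod C q) \<longrightarrow> g \<in> Hom C Q (Cod C f) \<and> q \<cdot> g = h" for h
        using Q_projective cokernel_epi[OF q] HomD[OF qH] unfolding is_projective_def by metis
      then obtain l where l: "\<And>h. h \<in> Hom C Q (Cod C q) \<Longrightarrow> l h \<in> Hom C Q (Cod C f)" "\<And>h. h \<in> Hom C Q (Cod C q) \<Longrightarrow> q \<cdot> l h = h"
        by metis
      let ?\<phi> = "restrict (\<lambda>h. \<phi> (l h)) (Hom C Q (Cod C q))"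
      have "restrict (\<lambda>h. \<phi> (l h)) (carrier (hom_space C Q (Cod C q))) \<in> hdual C Q (Cod C q)"
      proof (rule dual_restrictI[OF QV[OF O(4)]]; simp)
        fix g h assume g: "g \<in> Hom C Q (Cod C q)" and h: "h \<in> Hom C Q (Cod C q)"
        note gh = AddArr_Hom[OF g h] and lgh = AddArr_Hom[OF l(1)[OF g] l(1)[OF h]]
        have "\<phi> (l (AddArr C g h)) = \<phi> (AddArr C (l g) (l h))"
          by (rule wd[OF l(1)[OF gh] lgh]) (simp add: Comp_AddArr[OF l(1)[OF g] qH l(1)[OF h]] l(2) g h gh)
        then show "\<phi> (l (AddArr C g h)) = \<phi> (l g) + \<phi> (l h)"
          using dual_add[OF \<phi>, of "l g" "l h"] l(1)[OF g] l(1)[OF h] by simp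
      next
        fix a g assume g: "g \<in> Hom C Q (Cod C q)"
        note gh = ScaleArr_Hom[OF g, of a] and lgh = ScaleArr_Hom[OF l(1)[OF g], of a]
        have "\<phi> (l (ScaleArr C a g)) = \<phi> (ScaleArr C a (l g))"
          by (rule wd[OF l(1)[OF gh] lgh]) (simp add: Comp_ScaleArr[OF l(1)[OF g] qH] l(2) g gh)
        then show "\<phi> (l (ScaleArr C a g)) = a * \<phi> (l g)"
          using dual_smult[OF \<phi>, of "l g" a] l(1)[OF g] by simp
      qed
      then have \<phi>': "?\<phi> \<in> hdual C Q (Cod C q)"
        by simp
      have "postcomp_dual C Q q ?\<phi> = \<phi>"
      proof (rule hdual_eqI[OF postcomp_dual_closed[OF qH Q_Obj \<phi>'] \<phi>])
        fix g assume g: "g \<in> Hom C Q (Cod C f)"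
        note qg = Comp_in_Hom[OF g qH]
        show "postcomp_dual C Q q ?\<phi> g = \<phi> g"
          using wd[OF l(1)[OF qg] g] l(2)[OF qg] qg by (simp add: postcomp_dual_apply[OF qH g])
      qed
      then show ?thesis
        using \<phi>' by blast
    qed
    show "T \<in> Obj C" "\<phi>0 \<in> hdual C Q T"
      by (fact T, fact \<phi>0)
    show "\<exists>g\<in>Hom C Q T. postcomp_dual C Q g \<phi>0 = \<psi>" if \<psi>: "\<psi> \<in> hdual C Q Q" for \<psi>
    proof -
      have eI: "ScaleArr C (e k \<psi>) (Idt C Q) \<in> Hom C Q Q" for k
        by (rule ScaleArr_Hom[OF Idt_in_Hom[OF Q_Obj]])
      \<comment> \<open>A morphism into a power with prescribed components, which is copairing in
        the opposite category.\<close>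
      obtain g where g: "g \<in> Hom C Q T" "\<And>k. k < n \<Longrightarrow> p k \<cdot> g = ScaleArr C (e k \<psi>) (Idt C Q)"
      proof -
        interpret op: additive_category "op_cat C"
          by (rule additive_category.additive_category_op[OF additive_category])
        show thesis
          using op.power_copair[of n Q T p i Q "\<lambda>k. ScaleArr C (e k \<psi>) (Idt C Q)"] P Q_Obj eI that
          by (auto simp: is_power_op)
      qed
      have "postcomp_dual C Q g \<phi>0 = \<psi>"
      proof (rule hdual_eqI[OF postcomp_dual_closed[OF g(1) Q_Obj \<phi>0] \<psi>])
        fix t assume t: "t \<in> Hom C Q Q"
        have "\<epsilon> k (p k \<cdot> (g \<cdot> t)) = e k \<psi> * \<epsilon> k t" if k: "k < n" for k
        proof -
          have "p k \<cdot> (g \<cdot> t) = ScaleArr C (e k \<psi>) t"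
            using Comp_assoc[OF t g(1) ip(2)[OF k]] g(2)[OF k] ScaleArr_Comp[OF t Idt_in_Hom[OF Q_Obj], of "e k \<psi>"] Idt_Comp[OF t] by simp
          then show ?thesis
            using dual_smult[OF \<epsilon>[OF k], of t "e k \<psi>"] t by simp
        qed
        then have "postcomp_dual C Q g \<phi>0 t = (\<Sum>k<n. e k \<psi> * \<epsilon> k t)"
          using Comp_in_Hom[OF t g(1)] by (simp add: postcomp_dual_apply[OF g(1) t] \<phi>0_def)
        also have "\<dots> = vsum (dual_space (hom_space C Q Q)) (\<lambda>k. e k \<psi> \<odot>\<^bsub>dual_space (hom_space C Q Q)\<^esub> \<epsilon> k) n t"
          using t by (simp add: dual_vsum_apply dual_smult_apply)
        also have "\<dots> = \<psi> t"
          using dual_basisD(4)[OF b \<psi>] by simp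
        finally show "postcomp_dual C Q g \<phi>0 t = \<psi> t" .
      qed
      then show ?thesis
        using g(1) by blast
    qed
  qed
  then obtain I \<omega> where I: "I \<in> Obj C" and \<omega>: "\<omega> \<in> hdual C Q I"
    and rep: "\<And>b \<psi>. b \<in> Obj C \<Longrightarrow> \<psi> \<in> hdual C Q b \<Longrightarrow> \<exists>!h. h \<in> Hom C b I \<and> postcomp_dual C Q h \<omega> = \<psi>"
    by blast
  have "category_with_generator (op_cat C) I"
  proof (rule category_with_generator.intro[OF additive_category.additive_category_op[OF additive_category] category_with_generator_axioms.intro])
    show "fdvs (hom_space (op_cat C) a b)" if "a \<in> Obj (op_cat C)" "b \<in> Obj (op_cat C)" for a b
      using fdvs_Hom[of b a] that by simp
    show "\<exists>q. is_cokernel (op_cat C) q f" if "f \<in> Arr (op_cat C)" for f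
      using ex_kernel[of f] that by (simp add: is_cokernel_op)
    show "\<exists>f. is_cokernel (op_cat C) e f" if "is_epi (op_cat C) e" for e
      using mono_is_kernel[of e] that by (simp add: is_cokernel_op is_epi_op)
    show "is_projective (op_cat C) I"
      unfolding is_projective_def is_epi_op op_cat_simps Hom_op
    proof (intro conjI allI impI ballI I)
      fix m f assume m: "is_mono C m" and f: "f \<in> Hom C (Dom C m) I"
      have mH: "m \<in> Hom C (Dom C m) (Cod C m)"
        using m by (simp add: is_mono_def Hom_Arr)
      note O = Hom_Obj[OF mH]
      note lin = postcomp_dual_linear[OF mH Q_Obj]
      note V = vectorspace_dual[OF QV[OF O(1)]] and V' = vectorspace_dual[OF QV[OF O(2)]]
      \<comment> \<open>In terms of functionals, extending \<open>f\<close> along the mono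
        \<open>m\<close> means that restriction along \<open>m\<close> is surjective. Its image
        separates \<open>Hom(Q, Dom m)\<close> because \<open>m\<close> is mono.\<close>
      let ?U = "postcomp_dual C Q m ` hdual C Q (Cod C m)"
      have "?U = hdual C Q (Dom C m)"
      proof (rule separating_subsp_dual[OF fdvs_Hom[OF Q_Obj O(1)]])
        show "subsp (dual_space (hom_space C Q (Dom C m))) ?U"
          unfolding subsp_def
        proof (intro conjI ballI allI)
          show "?U \<subseteq> hdual C Q (Dom C m)"
            using linear_maps_closed[OF lin] by blast
          show "\<zero>\<^bsub>dual_space (hom_space C Q (Dom C m))\<^esub> \<in> ?U"
            using linear_maps_zero[OF V' V lin] vs_zero_closed[OF V'] by (metis imageI)
          show "u \<oplus>\<^bsub>dual_space (hom_space C Q (Dom C m))\<^esub> v \<in> ?U" if "u \<in> ?U" "v \<in> ?U" for u v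
            using that linear_maps_add[OF lin] vs_add_closed[OF V'] by (auto simp flip: linear_maps_add[OF lin])
          show "a \<odot>\<^bsub>dual_space (hom_space C Q (Dom C m))\<^esub> u \<in> ?U" if "u \<in> ?U" for a u
            using that vs_smult_closed[OF V'] by (auto simp flip: linear_maps_smult[OF lin])
        qed
        fix v assume "v \<in> carrier (hom_space C Q (Dom C m))" and 0: "\<And>\<xi>. \<xi> \<in> ?U \<Longrightarrow> \<xi> v = 0"
        then have v: "v \<in> Hom C Q (Dom C m)"
          by simp
        have "m \<cdot> v = ZeroArr C Q (Cod C m)"
        proof (rule Hom_separates[OF Comp_in_Hom[OF v mH] ZeroArr_Hom[OF Q_Obj O(2)]])
          fix \<xi> assume \<xi>: "\<xi> \<in> hdual C Q (Cod C m)"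
          show "\<xi> (m \<cdot> v) = \<xi> (ZeroArr C Q (Cod C m))"
            using 0[OF imageI[OF \<xi>]] postcomp_dual_apply[OF mH v, of \<xi>] dual_zero[OF QV[OF O(2)] \<xi>] by simp
        qed
        then have "m \<cdot> v = m \<cdot> ZeroArr C Q (Dom C m)"
          using Comp_zero[OF mH Q_Obj] by simp
        then show "v = \<zero>\<^bsub>hom_space C Q (Dom C m)\<^esub>"
          using m v ZeroArr_Hom[OF Q_Obj O(1)] unfolding is_mono_def by auto
      qed
      then obtain \<psi> where \<psi>: "\<psi> \<in> hdual C Q (Cod C m)" "postcomp_dual C Q m \<psi> = postcomp_dual C Q f \<omega>"
        using postcomp_dual_closed[OF f Q_Obj \<omega>] by (metis imageE)
      obtain g where g: "g \<in> Hom C (Cod C m) I" "postcomp_dual C Q g \<omega> = \<psi>"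
        using rep[OF O(2) \<psi>(1)] by blast
      note gm = Comp_in_Hom[OF mH g(1)]
      have "postcomp_dual C Q (g \<cdot> m) \<omega> = postcomp_dual C Q f \<omega>"
      proof (rule act_eqI[OF gm f \<omega> \<omega>])
        fix t assume t: "t \<in> Hom C Q (Dom C m)"
        show "\<omega> ((g \<cdot> m) \<cdot> t) = \<omega> (f \<cdot> t)"
          using Comp_assoc[OF t mH g(1)] postcomp_dual_apply[OF g(1) Comp_in_Hom[OF t mH], of \<omega>] g(2)
            postcomp_dual_apply[OF mH t, of \<psi>] \<psi>(2) postcomp_dual_apply[OF f t, of \<omega>] by simp
      qed
      then have "g \<cdot> m = f"
        using rep[OF O(1) postcomp_dual_closed[OF f Q_Obj \<omega>]] gm f by blast
      then show "\<exists>g\<in>Hom C (Cod C m) I. g \<cdot>\<^bsub>C\<^esub> m = f"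
        using g(1) by blast
    qed
    show "f = f'" if "f \<in> Hom (op_cat C) a b" "f' \<in> Hom (op_cat C) a b"
      and eq: "\<And>g. g \<in> Hom (op_cat C) I a \<Longrightarrow> f \<cdot>\<^bsub>op_cat C\<^esub> g = f' \<cdot>\<^bsub>op_cat C\<^esub> g" for f a b f'
    proof -
      have f: "f \<in> Hom C b a" "f' \<in> Hom C b a"
        using that by simp_all
      have a: "a \<in> Obj C"
        using Hom_Obj[OF f(1)] by simp
      show ?thesis
      proof (rule Q_generator[OF f])
        fix t assume t: "t \<in> Hom C Q b"
        show "f \<cdot> t = f' \<cdot> t"
        proof (rule Hom_separates[OF Comp_in_Hom[OF t f(1)] Comp_in_Hom[OF t f(2)]])
          fix \<psi> assume \<psi>: "\<psi> \<in> hdual C Q a"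
          \<comment> \<open>Every functional on \<open>Hom(Q, a)\<close> is \<open>\<omega>\<close>
            after some \<open>g : a \<rightarrow> I\<close>, so morphisms that agree after all such
            \<open>g\<close> agree on \<open>Q\<close>.\<close>
          obtain g where g: "g \<in> Hom C a I" "postcomp_dual C Q g \<omega> = \<psi>"
            using rep[OF a \<psi>] by blast
          have "\<psi> (h \<cdot> t) = \<omega> ((g \<cdot> h) \<cdot> t)" if h: "h \<in> Hom C b a" for h
            using postcomp_dual_apply[OF g(1) Comp_in_Hom[OF t h], of \<omega>] g(2) Comp_assoc[OF t h g(1)] by simp
          then show "\<psi> (f \<cdot> t) = \<psi> (f' \<cdot> t)"
            using f eq[of g] g(1) by simp
        qed
      qed
    qed
  qed
  then show ?thesis
    by blast
qed

section \<open>Finite sums of projective objects\<close>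

lemma projective_zero: "is_zero_obj C z \<Longrightarrow> is_projective C z"
  unfolding is_projective_def
proof (intro conjI allI impI ballI)
  assume z: "is_zero_obj C z"
  then show "z \<in> Obj C"
    by (simp add: is_zero_obj_def)
  fix e f assume e: "is_epi C e" and f: "f \<in> Hom C z (Cod C e)"
  have eH: "e \<in> Hom C (Dom C e) (Cod C e)"
    using e by (simp add: is_epi_def Hom_Arr)
  obtain g where g: "g \<in> Hom C z (Dom C e)"
    using z Hom_Obj[OF eH] unfolding is_zero_obj_def by blast
  have "e \<cdot> g = f"
    using z Comp_in_Hom[OF g eH] f Hom_Obj[OF eH] unfolding is_zero_obj_def by blast
  then show "\<exists>g\<in>Hom C z (Dom C e). e \<cdot> g = f"
    using g by blast
qed

lemma projective_biproduct:
  assumes a: "is_projective C a" and b: "is_projective C b" and s: "is_biproduct C a b s i j p q"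
  shows "is_projective C s"
  unfolding is_projective_def
proof (intro conjI allI impI ballI)
  have i: "i \<in> Hom C a s" and j: "j \<in> Hom C b s" and p: "p \<in> Hom C s a" and q: "q \<in> Hom C s b"
    and sum: "AddArr C (i \<cdot> p) (j \<cdot> q) = Idt C s"
    using s by (auto simp: is_biproduct_def)
  show sO: "s \<in> Obj C"
    using Hom_Obj[OF i] by simp
  fix e f assume e: "is_epi C e" and f: "f \<in> Hom C s (Cod C e)"
  have eH: "e \<in> Hom C (Dom C e) (Cod C e)"
    using e by (simp add: is_epi_def Hom_Arr)
  obtain g where g: "g \<in> Hom C a (Dom C e)" "e \<cdot> g = f \<cdot> i"
    using a e Comp_in_Hom[OF i f] unfolding is_projective_def by blast
  obtain h where h: "h \<in> Hom C b (Dom C e)" "e \<cdot> h = f \<cdot> j"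
    using b e Comp_in_Hom[OF j f] unfolding is_projective_def by blast
  note gp = Comp_in_Hom[OF p g(1)] and hq = Comp_in_Hom[OF q h(1)]
  have "e \<cdot> AddArr C (g \<cdot> p) (h \<cdot> q) = AddArr C (e \<cdot> (g \<cdot> p)) (e \<cdot> (h \<cdot> q))"
    by (rule Comp_AddArr[OF gp eH hq])
  also have "\<dots> = AddArr C (f \<cdot> (i \<cdot> p)) (f \<cdot> (j \<cdot> q))"
    using Comp_assoc[OF p g(1) eH] Comp_assoc[OF q h(1) eH] Comp_assoc[OF p i f] Comp_assoc[OF q j f] g(2) h(2) by simp
  also have "\<dots> = f"
    using Comp_AddArr[OF Comp_in_Hom[OF p i] f Comp_in_Hom[OF q j]] sum Comp_Idt[OF f] by simp
  finally show "\<exists>g\<in>Hom C s (Dom C e). e \<cdot> g = f"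
    using AddArr_Hom[OF gp hq] by blast
qed

text \<open>An iterated biproduct. Being a retract is what is kept of it, since a retraction onto
  \<open>P\<close> followed by an epi from \<open>P\<close> is an epi from \<open>Q\<close>.\<close>

lemma projective_common:
  assumes "finite S" "\<And>P. P \<in> S \<Longrightarrow> is_projective C P"
  shows "\<exists>Q. is_projective C Q \<and> (\<forall>P\<in>S. \<exists>i\<in>Hom C P Q. \<exists>p\<in>Hom C Q P. p \<cdot> i = Idt C P)"
  using assms
proof (induction rule: finite_induct)
  case empty
  then show ?case
    using ex_zero_obj projective_zero by blast
next
  case (insert A S)
  then obtain Q where Q: "is_projective C Q" "\<And>P. P \<in> S \<Longrightarrow> \<exists>i\<in>Hom C P Q. \<exists>p\<in>Hom C Q P. p \<cdot> i = Idt C P"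
    by (metis insertI2)
  have A: "is_projective C A"
    using insert.prems by simp
  obtain s i j p q where s: "is_biproduct C A Q s i j p q"
    using ex_biproduct[of A Q] A Q(1) unfolding is_projective_def by blast
  then have H: "i \<in> Hom C A s" "j \<in> Hom C Q s" "p \<in> Hom C s A" "q \<in> Hom C s Q" and pi: "p \<cdot> i = Idt C A" and qj: "q \<cdot> j = Idt C Q"
    by (auto simp: is_biproduct_def)
  have "\<exists>i\<in>Hom C P s. \<exists>p\<in>Hom C s P. p \<cdot> i = Idt C P" if P: "P \<in> S" for P
  proof -
    obtain k r where k: "k \<in> Hom C P Q" and r: "r \<in> Hom C Q P" and rk: "r \<cdot> k = Idt C P"
      using Q(2)[OF P] by blast
    have "(r \<cdot> q) \<cdot> (j \<cdot> k) = r \<cdot> ((q \<cdot> j) \<cdot> k)"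
      using Comp_assoc[OF Comp_in_Hom[OF k H(2)] H(4) r] Comp_assoc[OF k H(2) H(4)] by simp
    then have "(r \<cdot> q) \<cdot> (j \<cdot> k) = Idt C P"
      using Idt_Comp[OF k] rk qj by simp
    then show ?thesis
      using Comp_in_Hom[OF k H(2)] Comp_in_Hom[OF H(4) r] by blast
  qed
  then have "\<forall>P\<in>insert A S. \<exists>i\<in>Hom C P s. \<exists>p\<in>Hom C s P. p \<cdot> i = Idt C P"
    using H pi by blast
  then show ?case
    using projective_biproduct[OF A Q(1) s] by blast
qed

lemma epi_comp:
  assumes f: "f \<in> Hom C a b" "is_epi C f" and g: "g \<in> Hom C b c" "is_epi C g"
  shows "is_epi C (g \<cdot> f)"
  unfolding is_epi_def
proof (intro conjI ballI allI impI)
  note gf = Comp_in_Hom[OF f(1) g(1)]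
  show "g \<cdot> f \<in> Arr C"
    using HomD(1)[OF gf] .
  fix x h k assume "h \<in> Hom C (Cod C (g \<cdot> f)) x" "k \<in> Hom C (Cod C (g \<cdot> f)) x" and eq: "h \<cdot> (g \<cdot> f) = k \<cdot> (g \<cdot> f)"
  then have hk: "h \<in> Hom C c x" "k \<in> Hom C c x"
    using HomD[OF gf] by auto
  have "h \<cdot> g = k \<cdot> g"
    using f(2) Comp_assoc[OF f(1) g(1) hk(1)] Comp_assoc[OF f(1) g(1) hk(2)] eq Comp_in_Hom[OF g(1) hk(1)] Comp_in_Hom[OF g(1) hk(2)] HomD[OF f(1)]
    unfolding is_epi_def by metis
  then show "h = k"
    using g(2) hk HomD[OF g(1)] unfolding is_epi_def by blast
qed

lemma split_epi:
  assumes p: "p \<in> Hom C a b" and i: "i \<in> Hom C b a" and pi: "p \<cdot> i = Idt C b"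
  shows "is_epi C p"
  unfolding is_epi_def
proof (intro conjI ballI allI impI)
  show "p \<in> Arr C"
    using HomD(1)[OF p] .
  fix x h k assume "h \<in> Hom C (Cod C p) x" "k \<in> Hom C (Cod C p) x" and eq: "h \<cdot> p = k \<cdot> p"
  then have hk: "h \<in> Hom C b x" "k \<in> Hom C b x"
    using HomD[OF p] by auto
  have "(t \<cdot> p) \<cdot> i = t" if t: "t \<in> Hom C b x" for t
    using Comp_assoc[OF i p t] Comp_Idt[OF t] by (simp add: pi)
  from this[OF hk(1)] this[OF hk(2)] show "h = k"
    unfolding eq by simp
qed

end

lemma epi_cancel:
  assumes "is_epi C e" "e \<in> Hom C a b" "g \<in> Hom C b c" "h \<in> Hom C b c" "g \<cdot>\<^bsub>C\<^esub> e = h \<cdot>\<^bsub>C\<^esub> e"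
  shows "g = h"
  using assms HomD(3)[OF assms(2)] unfolding is_epi_def by blast

section \<open>The projective generator of a finite linear category\<close>

context finite_linear_category
begin

lemma isomorphic_refl:
  assumes a: "a \<in> Obj C"
  shows "isomorphic C a a"
proof -
  note I = Idt_in_Hom[OF a]
  have "is_iso C (Idt C a)"
    using I HomD[OF I] Idt_Comp[OF I] by (auto simp: is_iso_def)
  then show ?thesis
    using I by (auto simp: isomorphic_def)
qed

text \<open>One projective cover for each isomorphism class of simple objects, added up; a simple
  object is reached through the chosen member of its class.\<close>

lemma projective_covering_simples:
  obtains Q where "is_projective C Q" "\<And>s. is_simple C s \<Longrightarrow> \<exists>e\<in>Hom C Q s. is_epi C e"
proof -
  let ?r = "{(s, t). is_simple C s \<and> is_simple C t \<and> isomorphic C s t}"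
  let ?R = "(\<lambda>c. SOME t. t \<in> c) ` ({s. is_simple C s} // ?r)"
  \<comment> \<open>Reflexivity puts a simple object into its own class, so the choice made from
    that class yields a simple object isomorphic to it.\<close>
  have R: "\<exists>t\<in>?R. is_simple C t \<and> isomorphic C s t" if s: "is_simple C s" for s
  proof -
    have "s \<in> ?r `` {s}"
      using s isomorphic_refl[of s] by (auto simp: is_simple_def)
    then have "(SOME t. t \<in> ?r `` {s}) \<in> ?r `` {s}"
      by (rule someI)
    moreover have "?r `` {s} \<in> {s. is_simple C s} // ?r"
      using s by (intro quotientI) simp
    ultimately show ?thesis
      by blast
  qed
  have "\<exists>p. is_simple C t \<longrightarrow> is_projective_cover C p t" for t
    using ex_projective_cover by blast
  then obtain p where p: "\<And>t. is_simple C t \<Longrightarrow> is_projective_cover C (p t) t"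
    by metis
  define Ps where "Ps = (\<lambda>t. Dom C (p t)) ` {t \<in> ?R. is_simple C t}"
  have "finite Ps"
    using finite_simples by (simp add: Ps_def)
  moreover have "is_projective C P" if "P \<in> Ps" for P
    using that p by (auto simp: Ps_def is_projective_cover_def)
  ultimately have "\<exists>Q. is_projective C Q \<and> (\<forall>P\<in>Ps. \<exists>i\<in>Hom C P Q. \<exists>r\<in>Hom C Q P. r \<cdot> i = Idt C P)"
    by (rule projective_common)
  then obtain Q where Q: "is_projective C Q"
    "\<And>P. P \<in> Ps \<Longrightarrow> \<exists>i\<in>Hom C P Q. \<exists>r\<in>Hom C Q P. r \<cdot> i = Idt C P"
    by blast
  show thesis
  proof (rule that[OF Q(1)])
    fix s assume "is_simple C s"
    then obtain t where t: "t \<in> ?R" "is_simple C t" "isomorphic C s t"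
      using R by blast
    obtain f g where f: "f \<in> Hom C s t" and g: "g \<in> Hom C t s" "g \<cdot> f = Idt C s" "f \<cdot> g = Idt C t"
      using t(3) unfolding isomorphic_def is_iso_def Hom_def by auto
    have pt: "p t \<in> Hom C (Dom C (p t)) t" "is_epi C (p t)"
      using p[OF t(2)] by (auto simp: is_projective_cover_def is_epi_def Hom_def)
    obtain i r where r: "i \<in> Hom C (Dom C (p t)) Q" "r \<in> Hom C Q (Dom C (p t))" "r \<cdot> i = Idt C (Dom C (p t))"
      using Q(2)[of "Dom C (p t)"] t(1,2) unfolding Ps_def by blast
    note c = Comp_in_Hom[OF r(2) pt(1)]
    have "is_epi C (g \<cdot> (p t \<cdot> r))"
      by (rule epi_comp[OF c epi_comp[OF r(2) split_epi[OF r(2,1,3)] pt] g(1) split_epi[OF g(1) f g(2)]])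
    then show "\<exists>e\<in>Hom C Q s. is_epi C e"
      using Comp_in_Hom[OF c g(1)] by blast
  qed
qed

text \<open>Induction along a filtration with simple quotients. If \<open>f\<close> and
  \<open>f'\<close> agree on all morphisms from \<open>Q\<close>, their difference kills the smaller
  object by induction and factors as \<open>h \<cdot> q\<close> through the simple quotient. An epi
  from \<open>Q\<close> onto that quotient lifts along \<open>q\<close>, and on the lift the
  difference vanishes; so \<open>h\<close> is zero.\<close>

lemma generator_exists: "\<exists>Q. category_with_generator C Q"
proof -
  obtain Q where Q: "is_projective C Q" "\<And>s. is_simple C s \<Longrightarrow> \<exists>e\<in>Hom C Q s. is_epi C e"
    using projective_covering_simples by metis
  have gen: "\<And>b f f'. \<lbrakk>f \<in> Hom C a b; f' \<in> Hom C a b; \<And>g. g \<in> Hom C Q a \<Longrightarrow> f \<cdot> g = f' \<cdot> g\<rbrakk> \<Longrightarrow> f = f'"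
    if "finite_length C a" for a
    using that
  proof induction
    case (zero z)
    then show ?case
      using Hom_Obj unfolding is_zero_obj_def by blast
  next
    case (step m q)
    have qH: "q \<in> Hom C (Cod C m) (Cod C q)" and mH: "m \<in> Hom C (Dom C m) (Cod C m)"
      using step.hyps(3) by (auto simp: is_cokernel_def Hom_def)
    note f = step.prems(1) and f' = step.prems(2)
    let ?d = "AddArr C f (ScaleArr C (-1) f')"
    note s' = ScaleArr_Hom[OF f', of "-1"]
    note d = AddArr_Hom[OF f s']
    note O = Hom_Obj[OF mH] Hom_Obj[OF qH]
    have b: "b \<in> Obj C"
      using Hom_Obj[OF f] by simp
    have diff: "?d \<cdot> t = ZeroArr C x b" if t: "t \<in> Hom C x (Cod C m)" and eq: "f \<cdot> t = f' \<cdot> t" for x t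
      using AddArr_Comp[OF t f s'] ScaleArr_Comp[OF t f', of "-1"] eq vs_neg[OF hom_vs'[OF Comp_in_Hom[OF t f']], of "f' \<cdot> t"]
        Comp_in_Hom[OF t f'] by simp
    have "f \<cdot> m = f' \<cdot> m"
    proof (rule step.IH[OF Comp_in_Hom[OF mH f] Comp_in_Hom[OF mH f']])
      fix g assume g: "g \<in> Hom C Q (Dom C m)"
      show "(f \<cdot> m) \<cdot> g = (f' \<cdot> m) \<cdot> g"
        using Comp_assoc[OF g mH f] Comp_assoc[OF g mH f'] step.prems(3)[OF Comp_in_Hom[OF g mH]] by simp
    qed
    then have "?d \<cdot> m = ZeroArr C (Dom C m) b"
      by (rule diff[OF mH])
    then obtain h where h: "h \<in> Hom C (Cod C q) b" "h \<cdot> q = ?d"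
      using step.hyps(3) d unfolding is_cokernel_def by blast
    obtain e where e: "e \<in> Hom C Q (Cod C q)" "is_epi C e"
      using Q(2)[OF step.hyps(4)] by blast
    have "is_epi C q"
      by (rule cokernel_epi[OF step.hyps(3)])
    then obtain g where g: "g \<in> Hom C Q (Cod C m)" "q \<cdot> g = e"
      using Q(1) e(1) HomD[OF qH] unfolding is_projective_def by metis
    have "h \<cdot> e = ?d \<cdot> g"
      using Comp_assoc[OF g(1) qH h(1)] g(2) h(2) by simp
    also have "\<dots> = ZeroArr C (Cod C q) b \<cdot> e"
      using diff[OF g(1) step.prems(3)[OF g(1)]] zero_Comp[OF e(1) b] by simp
    finally have "h = ZeroArr C (Cod C q) b"
      by (rule epi_cancel[OF e(2,1) h(1) ZeroArr_Hom[OF O(4) b]])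
    then have "?d = ZeroArr C (Cod C m) b"
      using h(2) zero_Comp[OF qH b] by simp
    then show ?case
      using vs_eqI[OF hom_vs'[OF f], of f f'] f f' by simp
  qed
  have "category_with_generator C Q"
  proof (rule category_with_generator.intro[OF additive_category category_with_generator_axioms.intro])
    show "fdvs (hom_space C a b)" if "a \<in> Obj C" "b \<in> Obj C" for a b
      using fdvsI[OF vectorspace_Hom[OF that] fin_dim_Hom[OF that]] .
    show "f = f'" if "f \<in> Hom C a b" "f' \<in> Hom C a b" "\<And>g. g \<in> Hom C Q a \<Longrightarrow> f \<cdot> g = f' \<cdot> g" for f a b f'
      using gen[OF finite_length_Obj[OF Hom_Obj(1)[OF that(1)]] that] .
  qed (use ex_cokernel epi_is_cokernel Q(1) in auto)
  then show ?thesis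
    by blast
qed

end


section \<open>The objects \<open>V \<otimes> c\<close>\<close>

text \<open>This is \<open>\<xi> \<otimes> c\<close>, a morphism from \<open>V \<otimes> c\<close>
  to \<open>k \<otimes> c\<close>, the latter identified with \<open>c\<close>. The tensor object
  being a mere choice, the morphism is described by its composites with the inclusions.\<close>

definition tensor_proj ::
    "('o, 'm, 'k::field) linear_cat \<Rightarrow> ('k, 'v) module \<Rightarrow> 'o \<Rightarrow> ('v \<Rightarrow> 'k) \<Rightarrow> 'm" where
  "tensor_proj C V c \<xi> = (THE h. h \<in> Hom C (tensor_obj C V c) c \<and>
     (\<forall>v\<in>carrier V. h \<cdot>\<^bsub>C\<^esub> tensor_elt C V c v (Idt C c) = ScaleArr C (\<xi> v) (Idt C c)))"

context category_with_generator
begin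

abbreviation (input) tin :: "('k, 'v) module \<Rightarrow> 'o \<Rightarrow> 'v \<Rightarrow> 'm" where
  "tin V c v \<equiv> tensor_elt C V c v (Idt C c)"

text \<open>A power of \<open>c\<close> indexed by a basis of \<open>V\<close>, with
  \<open>v \<otimes> f\<close> sent to the sum of the \<open>\<epsilon> k v\<close> times
  \<open>i k \<cdot> f\<close>. A tensor is a sum of \<open>e k \<otimes> r k\<close> and goes to
  the sum of the \<open>i k \<cdot> r k\<close>, from which the projections recover the
  \<open>r k\<close>; hence injectivity, and surjectivity by decomposing a morphism into its
  components.\<close>

lemma tensor_obj_exists:
  fixes V :: "('k, 'v) module"
  assumes V: "fdvs V" and c: "c \<in> Obj C"
  shows "\<exists>T \<theta>. is_tensor_obj C V c T \<theta>"
proof -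
  note V1 = fdvs_vectorspace[OF V]
  obtain n e \<epsilon> where B: "dual_basis V n e \<epsilon>"
    using V by (rule fdvsE)
  note e = dual_basisD(1)[OF B] and \<epsilon> = dual_basisD(2)[OF B]
  obtain T i p where P: "is_power C n c T i p"
    using power_exists[OF c] by blast
  then have T: "T \<in> Obj C" and ip: "\<And>k. k < n \<Longrightarrow> i k \<in> Hom C c T" "\<And>k. k < n \<Longrightarrow> p k \<in> Hom C T c"
    and pi: "\<And>k l. k < n \<Longrightarrow> l < n \<Longrightarrow> p k \<cdot> i l = (if k = l then Idt C c else ZeroArr C c c)"
    and sum: "hsum T T (\<lambda>k. i k \<cdot> p k) n = Idt C T"
    by (auto simp: is_power_def)
  define \<beta> where "\<beta> b v f = hsum b T (\<lambda>k. ScaleArr C (\<epsilon> k v) (i k \<cdot> f)) n" for b v f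
  have iH: "i k \<cdot> f \<in> Hom C b T" if "k < n" "f \<in> Hom C b c" for k f b
    using Comp_in_Hom[OF that(2) ip(1)[OF that(1)]] .
  have sH: "ScaleArr C a (i k \<cdot> f) \<in> Hom C b T" if "k < n" "f \<in> Hom C b c" for a k f b
    by (rule ScaleArr_Hom[OF iH[OF that]])
  have \<beta>H: "\<beta> b v f \<in> Hom C b T" if "f \<in> Hom C b c" for b v f
    unfolding \<beta>_def by (rule hsum_Hom[OF Hom_Obj(1)[OF that] T sH[OF _ that]])
  have \<beta>_comp: "\<beta> b v g \<cdot> f = \<beta> a v (g \<cdot> f)" if f: "f \<in> Hom C a b" and g: "g \<in> Hom C b c" for a b v f g
  proof -
    have "\<beta> b v g \<cdot> f = hsum a T (\<lambda>k. ScaleArr C (\<epsilon> k v) (i k \<cdot> g) \<cdot> f) n"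
      unfolding \<beta>_def by (rule hsum_Comp[OF f T]) (rule sH[OF _ g])
    also have "\<dots> = \<beta> a v (g \<cdot> f)"
      unfolding \<beta>_def
      by (rule vsum_cong) (simp add: ScaleArr_Comp[OF f iH[OF _ g]] Comp_assoc[OF f g ip(1)])
    finally show ?thesis .
  qed
  \<comment> \<open>Guarded by the implication so that one function \<open>\<theta>\<close> can be
    chosen for all \<open>b\<close> at once.\<close>
  have "\<exists>\<theta>. b \<in> Obj C \<longrightarrow> \<theta> \<in> linear_maps (tensor_space V (hom_space C b c)) (hom_space C b T) \<and>
      (\<forall>v\<in>carrier V. \<forall>f\<in>Hom C b c. \<theta> (pure_tensor V (hom_space C b c) v f) = \<beta> b v f)" for b
  proof (cases "b \<in> Obj C")
    case b: True
    note H = vectorspace_Hom[OF b c] and HT = vectorspace_Hom[OF b T]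
    show ?thesis
    proof (rule tensor_space_lift[OF V1 H fdvs_Hom[OF b T], where B = "\<beta> b"])
      fix f assume "f \<in> carrier (hom_space C b c)"
      then have f: "f \<in> Hom C b c"
        by simp
      show "(\<lambda>v. \<beta> b v f) \<in> linear_maps V (hom_space C b T)"
      proof (rule linear_mapsI; simp only: hom_space_simps)
        show "\<beta> b v f \<in> Hom C b T" for v
          by (rule \<beta>H[OF f])
        show "\<beta> b (v \<oplus>\<^bsub>V\<^esub> w) f = AddArr C (\<beta> b v f) (\<beta> b w f)" if "v \<in> carrier V" "w \<in> carrier V" for v w
        proof -
          have "\<beta> b (v \<oplus>\<^bsub>V\<^esub> w) f = hsum b T (\<lambda>k. ScaleArr C (\<epsilon> k v) (i k \<cdot> f) \<oplus>\<^bsub>hom_space C b T\<^esub> ScaleArr C (\<epsilon> k w) (i k \<cdot> f)) n"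
            unfolding \<beta>_def using vs_add_smult[OF HT] iH[OF _ f]
            by (intro vsum_cong) (simp add: dual_add[OF \<epsilon>] that)
          also have "\<dots> = AddArr C (\<beta> b v f) (\<beta> b w f)"
            unfolding \<beta>_def by (subst vsum_add[OF HT]) (simp_all add: sH[OF _ f])
          finally show ?thesis .
        qed
        show "\<beta> b (a \<odot>\<^bsub>V\<^esub> v) f = ScaleArr C a (\<beta> b v f)" if "v \<in> carrier V" for a v
        proof -
          have "\<beta> b (a \<odot>\<^bsub>V\<^esub> v) f = hsum b T (\<lambda>k. a \<odot>\<^bsub>hom_space C b T\<^esub> ScaleArr C (\<epsilon> k v) (i k \<cdot> f)) n"
            unfolding \<beta>_def using vs_smult_assoc[OF HT] iH[OF _ f]
            by (intro vsum_cong) (simp add: dual_smult[OF \<epsilon>] that)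
          also have "\<dots> = ScaleArr C a (\<beta> b v f)"
            unfolding \<beta>_def by (subst vsum_smult[OF HT]) (simp_all add: sH[OF _ f])
          finally show ?thesis .
        qed
      qed
    next
      fix v assume v: "v \<in> carrier V"
      show "(\<lambda>f. \<beta> b v f) \<in> linear_maps (hom_space C b c) (hom_space C b T)"
      proof (rule linear_mapsI; simp only: hom_space_simps)
        show "\<beta> b v f \<in> Hom C b T" if "f \<in> Hom C b c" for f
          by (rule \<beta>H[OF that])
        show "\<beta> b v (AddArr C f g) = AddArr C (\<beta> b v f) (\<beta> b v g)" if f: "f \<in> Hom C b c" and g: "g \<in> Hom C b c" for f g
        proof -
          have "\<beta> b v (AddArr C f g) = hsum b T (\<lambda>k. ScaleArr C (\<epsilon> k v) (i k \<cdot> f) \<oplus>\<^bsub>hom_space C b T\<^esub> ScaleArr C (\<epsilon> k v) (i k \<cdot> g)) n"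
            unfolding \<beta>_def using vs_smult_add[OF HT] iH[OF _ f] iH[OF _ g]
            by (intro vsum_cong) (simp add: Comp_AddArr[OF f ip(1) g])
          also have "\<dots> = AddArr C (\<beta> b v f) (\<beta> b v g)"
            unfolding \<beta>_def by (subst vsum_add[OF HT]) (simp_all add: sH[OF _ f] sH[OF _ g])
          finally show ?thesis .
        qed
        show "\<beta> b v (ScaleArr C a f) = ScaleArr C a (\<beta> b v f)" if f: "f \<in> Hom C b c" for a f
        proof -
          have "\<beta> b v (ScaleArr C a f) = hsum b T (\<lambda>k. a \<odot>\<^bsub>hom_space C b T\<^esub> ScaleArr C (\<epsilon> k v) (i k \<cdot> f)) n"
            unfolding \<beta>_def using vs_smult_assoc[OF HT, of _ a] vs_smult_assoc[OF HT, of _ _ a] iH[OF _ f]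
            by (intro vsum_cong) (simp add: Comp_ScaleArr[OF f ip(1)] mult.commute flip: vs_smult_assoc)
          also have "\<dots> = ScaleArr C a (\<beta> b v f)"
            unfolding \<beta>_def by (subst vsum_smult[OF HT]) (simp_all add: sH[OF _ f])
          finally show ?thesis .
        qed
      qed
    qed (use b in auto)
  qed auto
  then obtain \<theta> where \<theta>L: "\<And>b. b \<in> Obj C \<Longrightarrow> \<theta> b \<in> linear_maps (tensor_space V (hom_space C b c)) (hom_space C b T)"
    and \<theta>: "\<And>b v f. \<lbrakk>b \<in> Obj C; v \<in> carrier V; f \<in> Hom C b c\<rbrakk> \<Longrightarrow> \<theta> b (pure_tensor V (hom_space C b c) v f) = \<beta> b v f"
    by metis
  have \<beta>e: "\<beta> b (e k) f = i k \<cdot> f" if f: "f \<in> Hom C b c" and k: "k < n" for b f k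
  proof -
    note b = Hom_Obj(1)[OF f]
    have "\<beta> b (e k) f = hsum b T (\<lambda>l. if l = k then i k \<cdot> f else ZeroArr C b T) n"
      unfolding \<beta>_def
      by (rule vsum_cong) (use dual_basisD(3)[OF B _ k] ScaleArr_one[OF iH[OF _ f]] ScaleArr_zero[OF iH[OF _ f]] in auto)
    then show ?thesis
      using hsum_delta[OF iH[OF k f], of k n] k by simp
  qed
  have \<theta>sum: "\<theta> b (vsum (tensor_space V (hom_space C b c)) (\<lambda>k. pure_tensor V (hom_space C b c) (e k) (r k)) n) = hsum b T (\<lambda>k. i k \<cdot> r k) n"
    if b: "b \<in> Obj C" and r: "\<And>k. k < n \<Longrightarrow> r k \<in> Hom C b c" for b r
  proof -
    note H = vectorspace_Hom[OF b c] and HT = vectorspace_Hom[OF b T]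
    have "\<theta> b (vsum (tensor_space V (hom_space C b c)) (\<lambda>k. pure_tensor V (hom_space C b c) (e k) (r k)) n)
        = hsum b T (\<lambda>k. \<theta> b (pure_tensor V (hom_space C b c) (e k) (r k))) n"
      by (rule linear_maps_vsum[OF vectorspace_tensor[OF V1 H] HT \<theta>L[OF b]])
        (rule pure_tensor_closed[OF V1 H e], simp_all add: r)
    also have "\<dots> = hsum b T (\<lambda>k. i k \<cdot> r k) n"
      by (rule vsum_cong) (simp add: \<theta>[OF b e r] \<beta>e r)
    finally show ?thesis .
  qed
  have psum: "p l \<cdot> hsum b T (\<lambda>k. i k \<cdot> r k) n = r l"
    if b: "b \<in> Obj C" and r: "\<And>k. k < n \<Longrightarrow> r k \<in> Hom C b c" and l: "l < n" for b r l
  proof -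
    have "p l \<cdot> hsum b T (\<lambda>k. i k \<cdot> r k) n = hsum b c (\<lambda>k. p l \<cdot> (i k \<cdot> r k)) n"
      by (rule Comp_hsum[OF ip(2)[OF l] b]) (rule iH[OF _ r])
    also have "\<dots> = hsum b c (\<lambda>k. if k = l then r l else ZeroArr C b c) n"
    proof (rule vsum_cong)
      fix k assume k: "k < n"
      show "p l \<cdot> (i k \<cdot> r k) = (if k = l then r l else ZeroArr C b c)"
        using Comp_assoc[OF r[OF k] ip(1)[OF k] ip(2)[OF l]] Idt_Comp[OF r[OF k]] zero_Comp[OF r[OF k] c] pi[OF l k]
        by (cases "k = l") auto
    qed
    also have "\<dots> = r l"
      using hsum_delta[OF r[OF l], of l n] l by simp
    finally show ?thesis .
  qed
  have "is_tensor_obj C V c T \<theta>"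
    unfolding is_tensor_obj_def
  proof (intro conjI ballI allI)
    fix b assume b: "b \<in> Obj C"
    note H = vectorspace_Hom[OF b c]
    let ?TS = "tensor_space V (hom_space C b c)"
    show "\<theta> b \<in> linear_maps ?TS (hom_space C b T)"
      by (rule \<theta>L[OF b])
    show "bij_betw (\<theta> b) (carrier ?TS) (Hom C b T)"
    proof (rule bij_betw_imageI)
      show "inj_on (\<theta> b) (carrier ?TS)"
      proof (rule inj_onI)
        fix t t' assume t: "t \<in> carrier ?TS" and t': "t' \<in> carrier ?TS" and eq: "\<theta> b t = \<theta> b t'"
        obtain r where r: "\<And>k. k < n \<Longrightarrow> r k \<in> Hom C b c" "t = vsum ?TS (\<lambda>k. pure_tensor V (hom_space C b c) (e k) (r k)) n"
          using tensor_space_basis_expand[OF V1 H B t] by auto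
        obtain r' where r': "\<And>k. k < n \<Longrightarrow> r' k \<in> Hom C b c" "t' = vsum ?TS (\<lambda>k. pure_tensor V (hom_space C b c) (e k) (r' k)) n"
          using tensor_space_basis_expand[OF V1 H B t'] by auto
        have "hsum b T (\<lambda>k. i k \<cdot> r k) n = hsum b T (\<lambda>k. i k \<cdot> r' k) n"
          using eq \<theta>sum[OF b, of r] \<theta>sum[OF b, of r'] r(1) r'(1) r(2) r'(2) by simp
        then have "r k = r' k" if "k < n" for k
          using psum[of b r, OF b r(1) that] psum[of b r', OF b r'(1) that] by simp
        then show "t = t'"
          unfolding r(2) r'(2) by (intro vsum_cong) simp
      qed
      show "\<theta> b ` carrier ?TS = Hom C b T"
      proof
        show "\<theta> b ` carrier ?TS \<subseteq> Hom C b T"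
          using linear_maps_closed[OF \<theta>L[OF b]] by auto
        show "Hom C b T \<subseteq> \<theta> b ` carrier ?TS"
        proof
          fix h assume h: "h \<in> Hom C b T"
          have ph: "p k \<cdot> h \<in> Hom C b c" if "k < n" for k
            using Comp_in_Hom[OF h ip(2)[OF that]] .
          have ipH: "i k \<cdot> p k \<in> Hom C T T" if "k < n" for k
            using Comp_in_Hom[OF ip(2)[OF that] ip(1)[OF that]] .
          have "h = hsum b T (\<lambda>k. (i k \<cdot> p k) \<cdot> h) n"
            using hsum_Comp[where g = "\<lambda>k. i k \<cdot> p k" and n = n, OF h T ipH] sum Idt_Comp[OF h] by simp
          also have "\<dots> = hsum b T (\<lambda>k. i k \<cdot> (p k \<cdot> h)) n"
            by (rule vsum_cong) (rule Comp_assoc[OF h ip(2) ip(1)])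
          also have "\<dots> = \<theta> b (vsum ?TS (\<lambda>k. pure_tensor V (hom_space C b c) (e k) (p k \<cdot> h)) n)"
            by (rule \<theta>sum[OF b ph, symmetric])
          finally show "h \<in> \<theta> b ` carrier ?TS"
            by (rule image_eqI)
              (rule vsum_closed[OF vectorspace_tensor[OF V1 H]], rule pure_tensor_closed[OF V1 H e], simp_all add: ph)
        qed
      qed
    qed
  next
    fix a b f g v assume f: "f \<in> Hom C a b" and g: "g \<in> Hom C b c" and v: "v \<in> carrier V"
    have O: "a \<in> Obj C" "b \<in> Obj C"
      using Hom_Obj[OF f] by auto
    show "\<theta> a (pure_tensor V (hom_space C a c) v (g \<cdot> f)) = \<theta> b (pure_tensor V (hom_space C b c) v g) \<cdot> f"
      by (simp add: \<theta>[OF O(1) v Comp_in_Hom[OF f g]] \<theta>[OF O(2) v g] \<beta>_comp[OF f g])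
  qed (rule T)
  then show ?thesis
    by blast
qed

section \<open>Morphisms into and out of the chosen tensor objects\<close>

context
  fixes V :: "('k, 'v) module" and c
  assumes V: "fdvs V" and c: "c \<in> Obj C"
begin

lemma tensor_choice_is_tensor_obj: "is_tensor_obj C V c (tensor_obj C V c) (snd (tensor_choice C V c))"
proof -
  have "\<exists>x. case x of (T, \<theta>) \<Rightarrow> is_tensor_obj C V c T \<theta>"
    using tensor_obj_exists[OF V c] by auto
  then have "case tensor_choice C V c of (T, \<theta>) \<Rightarrow> is_tensor_obj C V c T \<theta>"
    unfolding tensor_choice_def by (rule someI_ex)
  then show ?thesis
    by (simp add: tensor_obj_def split_beta)
qed

lemma tensor_obj_Obj: "tensor_obj C V c \<in> Obj C"
  using tensor_choice_is_tensor_obj by (simp add: is_tensor_obj_def)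

lemma tensor_elt_Hom: "v \<in> carrier V \<Longrightarrow> f \<in> Hom C b c \<Longrightarrow> tensor_elt C V c v f \<in> Hom C b (tensor_obj C V c)"
  using tensor_choice_is_tensor_obj Hom_Obj(1)[of f b c]
    pure_tensor_closed[OF fdvs_vectorspace[OF V] vectorspace_Hom[OF _ c], of b v f]
    linear_maps_closed[of "snd (tensor_choice C V c) b" "tensor_space V (hom_space C b c)" "hom_space C b (tensor_obj C V c)"]
  by (simp add: is_tensor_obj_def tensor_elt_def HomD)

lemma tin_Hom: "v \<in> carrier V \<Longrightarrow> tin V c v \<in> Hom C c (tensor_obj C V c)"
  by (rule tensor_elt_Hom[OF _ Idt_in_Hom[OF c]])

text \<open>The Yoneda argument: naturality applied to the identity of \<open>c\<close>. Everything
  about the isomorphism \<open>\<theta>\<close> is thereby encoded in the morphisms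
  \<open>tin V c v\<close>.\<close>

lemma tensor_elt_tin: "v \<in> carrier V \<Longrightarrow> f \<in> Hom C b c \<Longrightarrow> tensor_elt C V c v f = tin V c v \<cdot> f"
  using tensor_choice_is_tensor_obj Idt_in_Hom[OF c] Idt_Comp[of f b c]
  unfolding is_tensor_obj_def tensor_elt_def by (metis HomD(2))

lemma tin_linear: "tin V c \<in> linear_maps V (hom_space C c (tensor_obj C V c))"
proof -
  note V1 = fdvs_vectorspace[OF V] and H = vectorspace_Hom[OF c c]
  have I: "Idt C c \<in> carrier (hom_space C c c)"
    using Idt_in_Hom[OF c] by simp
  have "(\<lambda>v. pure_tensor V (hom_space C c c) v (Idt C c)) \<in> linear_maps V (tensor_space V (hom_space C c c))"
    using I by (intro linear_mapsI)
      (simp_all add: pure_tensor_closed[OF V1 H] pure_tensor_add_left[OF V1 H] pure_tensor_smult_left[OF V1 H])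
  moreover have "snd (tensor_choice C V c) c \<in> linear_maps (tensor_space V (hom_space C c c)) (hom_space C c (tensor_obj C V c))"
    using tensor_choice_is_tensor_obj c by (simp add: is_tensor_obj_def)
  ultimately have "(\<lambda>v. snd (tensor_choice C V c) c (pure_tensor V (hom_space C c c) v (Idt C c))) \<in> linear_maps V (hom_space C c (tensor_obj C V c))"
    by (rule linear_maps_comp)
  then show ?thesis
    using HomD(2)[OF Idt_in_Hom[OF c]] by (simp add: tensor_elt_def)
qed

text \<open>
  The tensor corresponding to the identity of \<open>T = V \<otimes> c\<close> is \<open>\<Sum>\<^sub>k e\<^sub>k \<otimes> r\<^sub>k\<close> with \<open>r\<^sub>k : T \<rightarrow> c\<close>, and these
  are the projections dual to the inclusions.
\<close>

lemma tensor_obj_decomposition: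
  assumes B: "dual_basis V n e \<epsilon>"
  obtains r where "\<And>k. k < n \<Longrightarrow> r k \<in> Hom C (tensor_obj C V c) c"
    "hsum (tensor_obj C V c) (tensor_obj C V c) (\<lambda>k. tin V c (e k) \<cdot> r k) n = Idt C (tensor_obj C V c)"
    "\<And>k v. k < n \<Longrightarrow> v \<in> carrier V \<Longrightarrow> r k \<cdot> tin V c v = ScaleArr C (\<epsilon> k v) (Idt C c)"
proof -
  define T where "T = tensor_obj C V c"
  define \<theta> where "\<theta> = snd (tensor_choice C V c)"
  note V1 = fdvs_vectorspace[OF V] and e = dual_basisD(1)[OF B] and \<epsilon> = dual_basisD(2)[OF B]
  have T: "T \<in> Obj C"
    using tensor_obj_Obj by (simp add: T_def)
  have \<theta>L: "\<theta> b \<in> linear_maps (tensor_space V (hom_space C b c)) (hom_space C b T)"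
    and \<theta>B: "bij_betw (\<theta> b) (carrier (tensor_space V (hom_space C b c))) (Hom C b T)" if "b \<in> Obj C" for b
    using tensor_choice_is_tensor_obj that by (auto simp: is_tensor_obj_def \<theta>_def T_def)
  have \<theta>p: "\<theta> b (pure_tensor V (hom_space C b c) v f) = tin V c v \<cdot> f" if "v \<in> carrier V" "f \<in> Hom C b c" for b v f
    using tensor_elt_tin[OF that] HomD(2)[OF that(2)] by (simp add: \<theta>_def tensor_elt_def)
  have tinH: "tin V c v \<in> Hom C c T" if "v \<in> carrier V" for v
    using tin_Hom[OF that] by (simp add: T_def)
  have \<theta>sum: "\<theta> b (vsum (tensor_space V (hom_space C b c)) (\<lambda>k. pure_tensor V (hom_space C b c) (e k) (r k)) n)
      = hsum b T (\<lambda>k. tin V c (e k) \<cdot> r k) n"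
    if b: "b \<in> Obj C" and r: "\<And>k. k < n \<Longrightarrow> r k \<in> Hom C b c" for b r
  proof -
    note H = vectorspace_Hom[OF b c] and HT = vectorspace_Hom[OF b T]
    have "\<theta> b (vsum (tensor_space V (hom_space C b c)) (\<lambda>k. pure_tensor V (hom_space C b c) (e k) (r k)) n)
        = hsum b T (\<lambda>k. \<theta> b (pure_tensor V (hom_space C b c) (e k) (r k))) n"
      by (rule linear_maps_vsum[OF vectorspace_tensor[OF V1 H] HT \<theta>L[OF b]])
        (rule pure_tensor_closed[OF V1 H e], simp_all add: r)
    also have "\<dots> = hsum b T (\<lambda>k. tin V c (e k) \<cdot> r k) n"
      by (rule vsum_cong) (simp add: \<theta>p[OF e r])
    finally show ?thesis .
  qed
  have "Idt C T \<in> \<theta> T ` carrier (tensor_space V (hom_space C T c))"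
    using \<theta>B[OF T] Idt_in_Hom[OF T] by (simp add: bij_betw_def)
  then obtain t where t: "t \<in> carrier (tensor_space V (hom_space C T c))" "\<theta> T t = Idt C T"
    by auto
  obtain r where r: "\<And>k. k < n \<Longrightarrow> r k \<in> Hom C T c"
    and tr: "t = vsum (tensor_space V (hom_space C T c)) (\<lambda>k. pure_tensor V (hom_space C T c) (e k) (r k)) n"
    using tensor_space_basis_expand[OF V1 vectorspace_Hom[OF T c] B t(1)] by auto
  have sum: "hsum T T (\<lambda>k. tin V c (e k) \<cdot> r k) n = Idt C T"
    using \<theta>sum[OF T, of r] r t(2) tr by simp
  note H = vectorspace_Hom[OF c c] and I = Idt_in_Hom[OF c]
  let ?TS = "tensor_space V (hom_space C c c)"
  have "r k \<cdot> tin V c v = ScaleArr C (\<epsilon> k v) (Idt C c)" if k: "k < n" and v: "v \<in> carrier V" for k v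
  proof -
    have rt: "r l \<cdot> tin V c v \<in> Hom C c c" if "l < n" for l
      using Comp_in_Hom[OF tinH[OF v] r[OF that]] .
    have tr: "tin V c (e l) \<cdot> r l \<in> Hom C T T" if "l < n" for l
      using Comp_in_Hom[OF r[OF that] tinH[OF e[OF that]]] .
    have "\<theta> c (vsum ?TS (\<lambda>l. pure_tensor V (hom_space C c c) (e l) (r l \<cdot> tin V c v)) n)
        = hsum c T (\<lambda>l. tin V c (e l) \<cdot> (r l \<cdot> tin V c v)) n"
      by (rule \<theta>sum[OF c rt])
    also have "\<dots> = hsum c T (\<lambda>l. (tin V c (e l) \<cdot> r l) \<cdot> tin V c v) n"
      by (rule vsum_cong) (rule Comp_assoc[OF tinH[OF v] r tinH[OF e], symmetric])
    also have "\<dots> = tin V c v"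
      using hsum_Comp[where g = "\<lambda>l. tin V c (e l) \<cdot> r l" and n = n, OF tinH[OF v] T tr] sum Idt_Comp[OF tinH[OF v]] by simp
    also have "\<dots> = \<theta> c (pure_tensor V (hom_space C c c) v (Idt C c))"
      using \<theta>p[OF v I] Comp_Idt[OF tinH[OF v]] by simp
    finally have "vsum ?TS (\<lambda>l. pure_tensor V (hom_space C c c) (e l) (r l \<cdot> tin V c v)) n = pure_tensor V (hom_space C c c) v (Idt C c)"
    proof (rule inj_onD[OF bij_betw_imp_inj_on[OF \<theta>B[OF c]]])
      show "vsum ?TS (\<lambda>l. pure_tensor V (hom_space C c c) (e l) (r l \<cdot> tin V c v)) n \<in> carrier ?TS"
        by (rule vsum_closed[OF vectorspace_tensor[OF V1 H]], rule pure_tensor_closed[OF V1 H e]) (simp_all add: rt)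
      show "pure_tensor V (hom_space C c c) v (Idt C c) \<in> carrier ?TS"
        by (rule pure_tensor_closed[OF V1 H v]) (simp add: I)
    qed
    \<comment> \<open>This is \<open>\<epsilon> k\<close> tensored with the identity. Applied to the
      two expressions for the tensor that belongs to \<open>tin V c v\<close>, it yields a multiple
      of the identity on one side and \<open>r k \<cdot> tin V c v\<close> on the other.\<close>
    moreover obtain \<mu> where L: "\<mu> \<in> linear_maps ?TS (hom_space C c c)"
      "\<And>v f. \<lbrakk>v \<in> carrier V; f \<in> carrier (hom_space C c c)\<rbrakk> \<Longrightarrow> \<mu> (pure_tensor V (hom_space C c c) v f) = ScaleArr C (\<epsilon> k v) f"
    proof (rule tensor_space_lift[OF V1 H fdvs_Hom[OF c c], where B = "\<lambda>v f. ScaleArr C (\<epsilon> k v) f"])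
      show "(\<lambda>v. ScaleArr C (\<epsilon> k v) f) \<in> linear_maps V (hom_space C c c)" if "f \<in> carrier (hom_space C c c)" for f
        using that ScaleArr_Hom[of f c c] vs_add_smult[OF H, of f] vs_smult_assoc[OF H, of f]
        by (intro linear_mapsI) (simp_all add: dual_add[OF \<epsilon>[OF k]] dual_smult[OF \<epsilon>[OF k]])
      show "(\<lambda>f. ScaleArr C (\<epsilon> k v) f) \<in> linear_maps (hom_space C c c) (hom_space C c c)" if "v \<in> carrier V" for v
      proof (rule linear_mapsI; simp only: hom_space_simps)
        show "ScaleArr C (\<epsilon> k v) f \<in> Hom C c c" if "f \<in> Hom C c c" for f
          by (rule ScaleArr_Hom[OF that])
        show "ScaleArr C (\<epsilon> k v) (AddArr C f g) = AddArr C (ScaleArr C (\<epsilon> k v) f) (ScaleArr C (\<epsilon> k v) g)"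
          if "f \<in> Hom C c c" "g \<in> Hom C c c" for f g
          using vs_smult_add[OF H, of f g] that by simp
        show "ScaleArr C (\<epsilon> k v) (ScaleArr C a f) = ScaleArr C a (ScaleArr C (\<epsilon> k v) f)" if "f \<in> Hom C c c" for a f
          using vs_smult_assoc[OF H, of f "\<epsilon> k v" a] vs_smult_assoc[OF H, of f a "\<epsilon> k v"] that by (simp add: mult.commute)
      qed
    qed (rule that)
    ultimately have "ScaleArr C (\<epsilon> k v) (Idt C c) = \<mu> (vsum ?TS (\<lambda>l. pure_tensor V (hom_space C c c) (e l) (r l \<cdot> tin V c v)) n)"
      using v I by simp
    also have "\<dots> = hsum c c (\<lambda>l. \<mu> (pure_tensor V (hom_space C c c) (e l) (r l \<cdot> tin V c v))) n"
      by (rule linear_maps_vsum[OF vectorspace_tensor[OF V1 H] H L(1)])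
        (rule pure_tensor_closed[OF V1 H e], simp_all add: rt)
    also have "\<dots> = hsum c c (\<lambda>l. if l = k then r k \<cdot> tin V c v else ZeroArr C c c) n"
    proof (rule vsum_cong)
      fix l assume l: "l < n"
      show "\<mu> (pure_tensor V (hom_space C c c) (e l) (r l \<cdot> tin V c v)) = (if l = k then r k \<cdot> tin V c v else ZeroArr C c c)"
        using L(2)[OF e[OF l]] rt[OF l] dual_basisD(3)[OF B k l] ScaleArr_one[OF rt[OF l]] ScaleArr_zero[OF rt[OF l]] by auto
    qed
    also have "\<dots> = r k \<cdot> tin V c v"
      using hsum_delta[OF rt[OF k], of k n] k by simp
    finally show ?thesis
      by simp
  qed
  then show thesis
    using that[of r] r sum by (simp add: T_def)
qed

text \<open>The identity of the tensor object is a sum of composites beginning with projections and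
  ending with inclusions, so the inclusions are jointly epic.\<close>

lemma tensor_obj_eqI_out:
  assumes h: "h \<in> Hom C (tensor_obj C V c) x" "h' \<in> Hom C (tensor_obj C V c) x"
    and eq: "\<And>v. v \<in> carrier V \<Longrightarrow> h \<cdot> tin V c v = h' \<cdot> tin V c v"
  shows "h = h'"
proof -
  obtain n e \<epsilon> where B: "dual_basis V n e \<epsilon>"
    using V by (rule fdvsE)
  note e = dual_basisD(1)[OF B]
  let ?T = "tensor_obj C V c"
  obtain r where r: "\<And>k. k < n \<Longrightarrow> r k \<in> Hom C ?T c" and sum: "hsum ?T ?T (\<lambda>k. tin V c (e k) \<cdot> r k) n = Idt C ?T"
    and "\<And>k v. k < n \<Longrightarrow> v \<in> carrier V \<Longrightarrow> r k \<cdot> tin V c v = ScaleArr C (\<epsilon> k v) (Idt C c)"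
    by (rule tensor_obj_decomposition[OF B]) (rule that)
  have tr: "tin V c (e l) \<cdot> r l \<in> Hom C ?T ?T" if "l < n" for l
    using Comp_in_Hom[OF r[OF that] tin_Hom[OF e[OF that]]] .
  have "g = hsum ?T x (\<lambda>k. (g \<cdot> tin V c (e k)) \<cdot> r k) n" if g: "g \<in> Hom C ?T x" for g
  proof -
    have "g = hsum ?T x (\<lambda>k. g \<cdot> (tin V c (e k) \<cdot> r k)) n"
      using Comp_hsum[where f = "\<lambda>k. tin V c (e k) \<cdot> r k" and n = n, OF g tensor_obj_Obj tr] sum Comp_Idt[OF g] by simp
    also have "\<dots> = hsum ?T x (\<lambda>k. (g \<cdot> tin V c (e k)) \<cdot> r k) n"
      by (rule vsum_cong) (rule Comp_assoc[OF r tin_Hom[OF e] g, symmetric])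
    finally show ?thesis .
  qed
  from this[OF h(1)] this[OF h(2)] show ?thesis
    by (simp add: eq e cong: vsum_cong)
qed

text \<open>Together with \<open>tensor_obj_eqI_out\<close> this presents
  \<open>V \<otimes> c\<close> as a copower: morphisms out of it are linear maps from
  \<open>V\<close> to a space of morphisms. It is the form suited to coends.\<close>

lemma tensor_obj_map_out:
  assumes x: "x \<in> Obj C" and u: "u \<in> linear_maps V (hom_space C c x)"
  obtains h where "h \<in> Hom C (tensor_obj C V c) x" "\<And>v. v \<in> carrier V \<Longrightarrow> h \<cdot> tin V c v = u v"
proof -
  note V1 = fdvs_vectorspace[OF V]
  obtain n e \<epsilon> where B: "dual_basis V n e \<epsilon>"
    using V by (rule fdvsE)
  note e = dual_basisD(1)[OF B]
  let ?T = "tensor_obj C V c"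
  obtain r where r: "\<And>k. k < n \<Longrightarrow> r k \<in> Hom C ?T c"
    and "hsum ?T ?T (\<lambda>k. tin V c (e k) \<cdot> r k) n = Idt C ?T"
    and rt: "\<And>k v. k < n \<Longrightarrow> v \<in> carrier V \<Longrightarrow> r k \<cdot> tin V c v = ScaleArr C (\<epsilon> k v) (Idt C c)"
    by (rule tensor_obj_decomposition[OF B]) (rule that)
  have uH: "u v \<in> Hom C c x" if "v \<in> carrier V" for v
    using linear_maps_closed[OF u that] by simp
  have ur: "u (e k) \<cdot> r k \<in> Hom C ?T x" if "k < n" for k
    using Comp_in_Hom[OF r[OF that] uH[OF e[OF that]]] .
  let ?h = "hsum ?T x (\<lambda>k. u (e k) \<cdot> r k) n"
  have "?h \<cdot> tin V c v = u v" if v: "v \<in> carrier V" for v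
  proof -
    have "?h \<cdot> tin V c v = hsum c x (\<lambda>k. (u (e k) \<cdot> r k) \<cdot> tin V c v) n"
      by (rule hsum_Comp[OF tin_Hom[OF v] x ur])
    also have "\<dots> = hsum c x (\<lambda>k. u (\<epsilon> k v \<odot>\<^bsub>V\<^esub> e k)) n"
    proof (rule vsum_cong)
      fix k assume k: "k < n"
      show "(u (e k) \<cdot> r k) \<cdot> tin V c v = u (\<epsilon> k v \<odot>\<^bsub>V\<^esub> e k)"
        using Comp_assoc[OF tin_Hom[OF v] r[OF k] uH[OF e[OF k]]] rt[OF k v] linear_maps_smult[OF u e[OF k], of "\<epsilon> k v"]
          Comp_ScaleArr[OF Idt_in_Hom[OF c] uH[OF e[OF k]], of "\<epsilon> k v"] Comp_Idt[OF uH[OF e[OF k]]] by simp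
    qed
    also have "\<dots> = u (vsum V (\<lambda>k. \<epsilon> k v \<odot>\<^bsub>V\<^esub> e k) n)"
      by (rule linear_maps_vsum[OF V1 vectorspace_Hom[OF c x] u, symmetric]) (rule vs_smult_closed[OF V1 e])
    finally show ?thesis
      using dual_basisD(4)[OF B v] by simp
  qed
  moreover have "?h \<in> Hom C ?T x"
    by (rule hsum_Hom[OF tensor_obj_Obj x ur])
  ultimately show thesis
    using that by blast
qed

lemma tensor_proj:
  assumes \<xi>: "\<xi> \<in> carrier (dual_space V)"
  shows "tensor_proj C V c \<xi> \<in> Hom C (tensor_obj C V c) c"
    and "v \<in> carrier V \<Longrightarrow> tensor_proj C V c \<xi> \<cdot> tin V c v = ScaleArr C (\<xi> v) (Idt C c)"
proof -
  note H = vectorspace_Hom[OF c c] and I = Idt_in_Hom[OF c]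
  have "(\<lambda>v. ScaleArr C (\<xi> v) (Idt C c)) \<in> linear_maps V (hom_space C c c)"
    using ScaleArr_Hom[OF I] vs_add_smult[OF H, of "Idt C c"] vs_smult_assoc[OF H, of "Idt C c"] I
    by (intro linear_mapsI) (simp_all add: dual_add[OF \<xi>] dual_smult[OF \<xi>])
  then obtain h where h: "h \<in> Hom C (tensor_obj C V c) c" "\<And>v. v \<in> carrier V \<Longrightarrow> h \<cdot> tin V c v = ScaleArr C (\<xi> v) (Idt C c)"
    using tensor_obj_map_out[OF c] by metis
  have "tensor_proj C V c \<xi> = h"
    unfolding tensor_proj_def
  proof (rule the_equality)
    fix h' assume h': "h' \<in> Hom C (tensor_obj C V c) c \<and> (\<forall>v\<in>carrier V. h' \<cdot> tin V c v = ScaleArr C (\<xi> v) (Idt C c))"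
    show "h' = h"
      by (rule tensor_obj_eqI_out[OF _ h(1)]) (use h' h(2) in auto)
  qed (use h in auto)
  then show "tensor_proj C V c \<xi> \<in> Hom C (tensor_obj C V c) c"
    "v \<in> carrier V \<Longrightarrow> tensor_proj C V c \<xi> \<cdot> tin V c v = ScaleArr C (\<xi> v) (Idt C c)"
    using h by auto
qed

lemma tensor_proj_linear: "tensor_proj C V c \<in> linear_maps (dual_space V) (hom_space C (tensor_obj C V c) c)"
proof (rule linear_mapsI; simp only: hom_space_simps)
  note V' = vectorspace_dual[OF fdvs_vectorspace[OF V]] and H = vectorspace_Hom[OF c c] and I = Idt_in_Hom[OF c]
  show "tensor_proj C V c \<xi> \<in> Hom C (tensor_obj C V c) c" if "\<xi> \<in> carrier (dual_space V)" for \<xi>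
    by (rule tensor_proj(1)[OF that])
  show "tensor_proj C V c (\<xi> \<oplus>\<^bsub>dual_space V\<^esub> \<eta>) = AddArr C (tensor_proj C V c \<xi>) (tensor_proj C V c \<eta>)"
    if \<xi>: "\<xi> \<in> carrier (dual_space V)" and \<eta>: "\<eta> \<in> carrier (dual_space V)" for \<xi> \<eta>
  proof (rule tensor_obj_eqI_out[OF tensor_proj(1)[OF vs_add_closed[OF V' \<xi> \<eta>]] AddArr_Hom[OF tensor_proj(1)[OF \<xi>] tensor_proj(1)[OF \<eta>]]])
    fix v assume v: "v \<in> carrier V"
    show "tensor_proj C V c (\<xi> \<oplus>\<^bsub>dual_space V\<^esub> \<eta>) \<cdot> tin V c v = AddArr C (tensor_proj C V c \<xi>) (tensor_proj C V c \<eta>) \<cdot> tin V c v"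
      using vs_add_smult[OF H, of "Idt C c"] I
      by (simp add: AddArr_Comp[OF tin_Hom[OF v] tensor_proj(1)[OF \<xi>] tensor_proj(1)[OF \<eta>]] tensor_proj(2)[OF \<xi> v] tensor_proj(2)[OF \<eta> v]
          tensor_proj(2)[OF vs_add_closed[OF V' \<xi> \<eta>] v] dual_add_apply[OF v])
  qed
  show "tensor_proj C V c (k \<odot>\<^bsub>dual_space V\<^esub> \<xi>) = ScaleArr C k (tensor_proj C V c \<xi>)"
    if \<xi>: "\<xi> \<in> carrier (dual_space V)" for k \<xi>
  proof (rule tensor_obj_eqI_out[OF tensor_proj(1)[OF vs_smult_closed[OF V' \<xi>]] ScaleArr_Hom[OF tensor_proj(1)[OF \<xi>]]])
    fix v assume v: "v \<in> carrier V"
    show "tensor_proj C V c (k \<odot>\<^bsub>dual_space V\<^esub> \<xi>) \<cdot> tin V c v = ScaleArr C k (tensor_proj C V c \<xi>) \<cdot> tin V c v"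
      using vs_smult_assoc[OF H, of "Idt C c"] I
      by (simp add: ScaleArr_Comp[OF tin_Hom[OF v] tensor_proj(1)[OF \<xi>]] tensor_proj(2)[OF \<xi> v]
          tensor_proj(2)[OF vs_smult_closed[OF V' \<xi>] v] dual_smult_apply[OF v])
  qed
qed

text \<open>The projections of the decomposition have the same composites with the inclusions as
  \<open>tensor_proj C V c (\<epsilon> k)\<close>, hence equal them.\<close>

lemma tensor_obj_sum:
  assumes B: "dual_basis V n e \<epsilon>"
  shows "hsum (tensor_obj C V c) (tensor_obj C V c) (\<lambda>k. tin V c (e k) \<cdot> tensor_proj C V c (\<epsilon> k)) n = Idt C (tensor_obj C V c)"
proof -
  obtain r where r: "\<And>k. k < n \<Longrightarrow> r k \<in> Hom C (tensor_obj C V c) c"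
    "hsum (tensor_obj C V c) (tensor_obj C V c) (\<lambda>k. tin V c (e k) \<cdot> r k) n = Idt C (tensor_obj C V c)"
    "\<And>k v. k < n \<Longrightarrow> v \<in> carrier V \<Longrightarrow> r k \<cdot> tin V c v = ScaleArr C (\<epsilon> k v) (Idt C c)"
    by (rule tensor_obj_decomposition[OF B]) (rule that)
  have "tensor_proj C V c (\<epsilon> k) = r k" if k: "k < n" for k
    by (rule tensor_obj_eqI_out[OF tensor_proj(1)[OF dual_basisD(2)[OF B k]] r(1)[OF k]])
      (simp add: tensor_proj(2)[OF dual_basisD(2)[OF B k]] r(3)[OF k])
  then show ?thesis
    using r(2) by (simp cong: vsum_cong)
qed

lemma tensor_obj_eqI_in:
  assumes g: "g \<in> Hom C w (tensor_obj C V c)" "g' \<in> Hom C w (tensor_obj C V c)"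
    and eq: "\<And>\<xi>. \<xi> \<in> carrier (dual_space V) \<Longrightarrow> tensor_proj C V c \<xi> \<cdot> g = tensor_proj C V c \<xi> \<cdot> g'"
  shows "g = g'"
proof -
  obtain n e \<epsilon> where B: "dual_basis V n e \<epsilon>"
    using V by (rule fdvsE)
  note e = dual_basisD(1)[OF B] and \<epsilon> = dual_basisD(2)[OF B]
  let ?T = "tensor_obj C V c"
  have tr: "tin V c (e l) \<cdot> tensor_proj C V c (\<epsilon> l) \<in> Hom C ?T ?T" if "l < n" for l
    using Comp_in_Hom[OF tensor_proj(1)[OF \<epsilon>[OF that]] tin_Hom[OF e[OF that]]] .
  have "h = hsum w ?T (\<lambda>k. tin V c (e k) \<cdot> (tensor_proj C V c (\<epsilon> k) \<cdot> h)) n" if h: "h \<in> Hom C w ?T" for h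
  proof -
    have "h = hsum w ?T (\<lambda>k. (tin V c (e k) \<cdot> tensor_proj C V c (\<epsilon> k)) \<cdot> h) n"
      using hsum_Comp[where g = "\<lambda>k. tin V c (e k) \<cdot> tensor_proj C V c (\<epsilon> k)" and n = n, OF h tensor_obj_Obj tr] tensor_obj_sum[OF B] Idt_Comp[OF h] by simp
    also have "\<dots> = hsum w ?T (\<lambda>k. tin V c (e k) \<cdot> (tensor_proj C V c (\<epsilon> k) \<cdot> h)) n"
      by (rule vsum_cong) (rule Comp_assoc[OF h tensor_proj(1)[OF \<epsilon>] tin_Hom[OF e]])
    finally show ?thesis .
  qed
  from this[OF g(1)] this[OF g(2)] show ?thesis
    by (simp add: eq \<epsilon> cong: vsum_cong)
qed

text \<open>The mirror image of \<open>tensor_obj_map_out\<close>, with projections indexed by the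
  dual of \<open>V\<close>. Through it a family of morphisms into
  \<open>Hom(x, y) \<otimes> H(x)\<close> becomes a family of linear maps on dual spaces.\<close>

lemma tensor_obj_map_in:
  assumes w: "w \<in> Obj C" and u: "u \<in> linear_maps (dual_space V) (hom_space C w c)"
  obtains g where "g \<in> Hom C w (tensor_obj C V c)" "\<And>\<xi>. \<xi> \<in> carrier (dual_space V) \<Longrightarrow> tensor_proj C V c \<xi> \<cdot> g = u \<xi>"
proof -
  note V1 = fdvs_vectorspace[OF V] and V' = vectorspace_dual[OF fdvs_vectorspace[OF V]]
  obtain n e \<epsilon> where B: "dual_basis V n e \<epsilon>"
    using V by (rule fdvsE)
  note e = dual_basisD(1)[OF B] and \<epsilon> = dual_basisD(2)[OF B]
  let ?T = "tensor_obj C V c"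
  have uH: "u \<xi> \<in> Hom C w c" if "\<xi> \<in> carrier (dual_space V)" for \<xi>
    using linear_maps_closed[OF u that] by simp
  have tu: "tin V c (e k) \<cdot> u (\<epsilon> k) \<in> Hom C w ?T" if "k < n" for k
    using Comp_in_Hom[OF uH[OF \<epsilon>[OF that]] tin_Hom[OF e[OF that]]] .
  let ?g = "hsum w ?T (\<lambda>k. tin V c (e k) \<cdot> u (\<epsilon> k)) n"
  have "tensor_proj C V c \<xi> \<cdot> ?g = u \<xi>" if \<xi>: "\<xi> \<in> carrier (dual_space V)" for \<xi>
  proof -
    have "tensor_proj C V c \<xi> \<cdot> ?g = hsum w c (\<lambda>k. tensor_proj C V c \<xi> \<cdot> (tin V c (e k) \<cdot> u (\<epsilon> k))) n"
      by (rule Comp_hsum[OF tensor_proj(1)[OF \<xi>] w tu])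
    also have "\<dots> = hsum w c (\<lambda>k. u (\<xi> (e k) \<odot>\<^bsub>dual_space V\<^esub> \<epsilon> k)) n"
    proof (rule vsum_cong)
      fix k assume k: "k < n"
      show "tensor_proj C V c \<xi> \<cdot> (tin V c (e k) \<cdot> u (\<epsilon> k)) = u (\<xi> (e k) \<odot>\<^bsub>dual_space V\<^esub> \<epsilon> k)"
        using Comp_assoc[OF uH[OF \<epsilon>[OF k]] tin_Hom[OF e[OF k]] tensor_proj(1)[OF \<xi>]] tensor_proj(2)[OF \<xi> e[OF k]]
          linear_maps_smult[OF u \<epsilon>[OF k], of "\<xi> (e k)"] ScaleArr_Comp[OF uH[OF \<epsilon>[OF k]] Idt_in_Hom[OF c], of "\<xi> (e k)"]
          Idt_Comp[OF uH[OF \<epsilon>[OF k]]] by simp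
    qed
    also have "\<dots> = u (vsum (dual_space V) (\<lambda>k. \<xi> (e k) \<odot>\<^bsub>dual_space V\<^esub> \<epsilon> k) n)"
      by (rule linear_maps_vsum[OF V' vectorspace_Hom[OF w c] u, symmetric]) (rule vs_smult_closed[OF V' \<epsilon>])
    also have "vsum (dual_space V) (\<lambda>k. \<xi> (e k) \<odot>\<^bsub>dual_space V\<^esub> \<epsilon> k) n = \<xi>"
      using dual_basisD(4)[OF dual_basis_dual[OF V1 B] \<xi>] \<xi> by simp
    finally show ?thesis .
  qed
  moreover have "?g \<in> Hom C w ?T"
    by (rule hsum_Hom[OF w tensor_obj_Obj tu])
  ultimately show thesis
    using that by blast
qed

end

text \<open>The second claim describes the morphism through inclusions, for use with coends, and the
  third through projections, for use with ends, where the linear map appears transposed.\<close>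

lemma tensor_mor:
  fixes V :: "('k, 'v) module" and V' :: "('k, 'w) module"
  assumes V: "fdvs V" and V': "fdvs V'" and t: "t \<in> linear_maps V V'" and g: "g \<in> Hom C c c'"
  shows "tensor_mor C V V' t g \<in> Hom C (tensor_obj C V c) (tensor_obj C V' c')"
    and "v \<in> carrier V \<Longrightarrow> tensor_mor C V V' t g \<cdot> tin V c v = tin V' c' (t v) \<cdot> g"
    and "\<xi> \<in> carrier (dual_space V') \<Longrightarrow>
      tensor_proj C V' c' \<xi> \<cdot> tensor_mor C V V' t g = g \<cdot> tensor_proj C V c (transpose_map V t \<xi>)"
proof -
  have c: "c \<in> Obj C" and c': "c' \<in> Obj C"
    using Hom_Obj[OF g] by auto
  let ?T = "tensor_obj C V c" and ?T' = "tensor_obj C V' c'"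
  note T' = tensor_obj_Obj[OF V' c']
  note tv = linear_maps_closed[OF t]
  have "(\<lambda>v. tin V' c' (t v) \<cdot> g) \<in> linear_maps V (hom_space C c ?T')"
    using linear_maps_comp[OF linear_maps_comp[OF t tin_linear[OF V' c']] precomp_linear[OF g T']] .
  then obtain h where h: "h \<in> Hom C ?T ?T'" "\<And>v. v \<in> carrier V \<Longrightarrow> h \<cdot> tin V c v = tin V' c' (t v) \<cdot> g"
    using tensor_obj_map_out[OF V c T'] by metis
  have he: "h \<cdot> tensor_elt C V c v f = tensor_elt C V' c' (t v) (g \<cdot> f)" if f: "f \<in> Hom C b c" and v: "v \<in> carrier V" for b f v
    using tensor_elt_tin[OF V c v f] tensor_elt_tin[OF V' c' tv[OF v] Comp_in_Hom[OF f g]] h(2)[OF v]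
      Comp_assoc[OF f tin_Hom[OF V c v] h(1)] Comp_assoc[OF f g tin_Hom[OF V' c' tv[OF v]]] by simp
  \<comment> \<open>The condition under \<open>THE\<close>, taken at the identity of
    \<open>c\<close>, already prescribes the composites with all inclusions, so at most one morphism
    satisfies it.\<close>
  have m: "tensor_mor C V V' t g = h"
    unfolding tensor_mor_def HomD(2)[OF g] HomD(3)[OF g]
  proof (rule the_equality)
    show "h \<in> Hom C ?T ?T' \<and> (\<forall>b. \<forall>f\<in>Hom C b c. \<forall>v\<in>carrier V. h \<cdot> tensor_elt C V c v f = tensor_elt C V' c' (t v) (g \<cdot> f))"
      using h(1) he by blast
    fix h' assume h': "h' \<in> Hom C ?T ?T' \<and> (\<forall>b. \<forall>f\<in>Hom C b c. \<forall>v\<in>carrier V. h' \<cdot> tensor_elt C V c v f = tensor_elt C V' c' (t v) (g \<cdot> f))"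
    show "h' = h"
    proof (rule tensor_obj_eqI_out[OF V c _ h(1)])
      show "h' \<in> Hom C ?T ?T'"
        using h' by blast
      show "h' \<cdot> tin V c v = h \<cdot> tin V c v" if v: "v \<in> carrier V" for v
        using h' he[OF Idt_in_Hom[OF c] v] Idt_in_Hom[OF c] v by simp
    qed
  qed
  show "tensor_mor C V V' t g \<in> Hom C ?T ?T'"
    using h(1) m by simp
  show "v \<in> carrier V \<Longrightarrow> tensor_mor C V V' t g \<cdot> tin V c v = tin V' c' (t v) \<cdot> g"
    using h(2) m by simp
  assume \<xi>: "\<xi> \<in> carrier (dual_space V')"
  note \<xi>t = transpose_map_dual[OF fdvs_vectorspace[OF V] t \<xi>]
  have "tensor_proj C V' c' \<xi> \<cdot> h = g \<cdot> tensor_proj C V c (transpose_map V t \<xi>)"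
  proof (rule tensor_obj_eqI_out[OF V c Comp_in_Hom[OF h(1) tensor_proj(1)[OF V' c' \<xi>]] Comp_in_Hom[OF tensor_proj(1)[OF V c \<xi>t] g]])
    fix v assume v: "v \<in> carrier V"
    have "(tensor_proj C V' c' \<xi> \<cdot> h) \<cdot> tin V c v = (tensor_proj C V' c' \<xi> \<cdot> tin V' c' (t v)) \<cdot> g"
      using Comp_assoc[OF tin_Hom[OF V c v] h(1) tensor_proj(1)[OF V' c' \<xi>]]
        Comp_assoc[OF g tin_Hom[OF V' c' tv[OF v]] tensor_proj(1)[OF V' c' \<xi>]] h(2)[OF v] by simp
    also have "\<dots> = ScaleArr C (\<xi> (t v)) g"
      using ScaleArr_Comp[OF g Idt_in_Hom[OF c']] Idt_Comp[OF g] by (simp add: tensor_proj(2)[OF V' c' \<xi> tv[OF v]])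
    also have "\<dots> = (g \<cdot> tensor_proj C V c (transpose_map V t \<xi>)) \<cdot> tin V c v"
      using Comp_assoc[OF tin_Hom[OF V c v] tensor_proj(1)[OF V c \<xi>t] g] tensor_proj(2)[OF V c \<xi>t v]
        Comp_ScaleArr[OF Idt_in_Hom[OF c] g] Comp_Idt[OF g] by (simp add: transpose_map_apply[OF v])
    finally show "(tensor_proj C V' c' \<xi> \<cdot> h) \<cdot> tin V c v = (g \<cdot> tensor_proj C V c (transpose_map V t \<xi>)) \<cdot> tin V c v" .
  qed
  then show "tensor_proj C V' c' \<xi> \<cdot> tensor_mor C V V' t g = g \<cdot> tensor_proj C V c (transpose_map V t \<xi>)"
    using m by simp
qed

end


section \<open>Ends and coends as universal data\<close>

lemma precomp_dual_op: "precomp_dual (op_cat C) y f \<xi> = postcomp_dual C y f \<xi>"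
  by (simp add: precomp_dual_def postcomp_dual_def)

lemma postcomp_dual_op: "postcomp_dual (op_cat C) x u \<xi> = precomp_dual C x u \<xi>"
  by (simp add: precomp_dual_def postcomp_dual_def)

context linear_category
begin

lemma is_datum_cong:
  assumes H: "linear_endofunctor C H" and y: "y \<in> Obj C" and p: "is_datum C H y w p"
    and eq: "\<And>x \<xi>. x \<in> Obj C \<Longrightarrow> \<xi> \<in> hdual C x y \<Longrightarrow> q x \<xi> = p x \<xi>"
  shows "is_datum C H y w q"
  by (rule is_datum_comp[OF H p Idt_in_Hom[OF is_datumD(1)[OF p]] _ y])
    (simp add: eq Comp_Idt[OF is_datum_Hom[OF p]])

lemma is_universal_cong:
  assumes H: "linear_endofunctor C H" and y: "y \<in> Obj C" and p: "is_universal C H y w p"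
    and eq: "\<And>x \<xi>. x \<in> Obj C \<Longrightarrow> \<xi> \<in> hdual C x y \<Longrightarrow> q x \<xi> = p x \<xi>"
  shows "is_universal C H y w q"
  using p is_datum_cong[OF H y is_universalD[OF p] eq] unfolding is_universal_def by (simp add: eq)

text \<open>Precomposition with \<open>f\<close> and postcomposition with \<open>u\<close> commute,
  by associativity. This produces the action of \<Gamma> on morphisms.\<close>

lemma is_datum_postcomp:
  assumes H: "linear_endofunctor C H" and p: "is_datum C H y z p" and u: "u \<in> Hom C y y'"
  shows "is_datum C H y' z (\<lambda>x \<xi>. p x (postcomp_dual C x u \<xi>))"
  unfolding is_datum_def
proof (intro conjI ballI allI)
  show "z \<in> Obj C"
    by (rule is_datumD(1)[OF p])
  show "(\<lambda>\<xi>. p x (postcomp_dual C x u \<xi>)) \<in> linear_maps (dual_space (hom_space C x y')) (hom_space C z (OMap H x))"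
    if x: "x \<in> Obj C" for x
    by (rule linear_maps_comp[OF postcomp_dual_linear[OF u x] is_datumD(2)[OF p x]])
  fix a b f \<xi> assume f: "f \<in> Hom C a b" and \<xi>: "\<xi> \<in> hdual C a y'"
  have a: "a \<in> Obj C" and b: "b \<in> Obj C" and y: "y \<in> Obj C" and y': "y' \<in> Obj C"
    using Hom_Obj[OF f] Hom_Obj[OF u] by auto
  note c = postcomp_dual_closed[OF u a \<xi>] and d = precomp_dual_closed[OF f y' \<xi>]
  have "precomp_dual C y f (postcomp_dual C a u \<xi>) = postcomp_dual C b u (precomp_dual C y' f \<xi>)"
  proof (rule hdual_eqI[OF precomp_dual_closed[OF f y c] postcomp_dual_closed[OF u b d]])
    fix g assume g: "g \<in> Hom C b y"
    show "precomp_dual C y f (postcomp_dual C a u \<xi>) g = postcomp_dual C b u (precomp_dual C y' f \<xi>) g"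
      using Comp_assoc[OF f g u]
      by (simp add: precomp_dual_apply[OF f g] postcomp_dual_apply[OF u Comp_in_Hom[OF f g]] postcomp_dual_apply[OF u g]
          precomp_dual_apply[OF f Comp_in_Hom[OF g u]])
  qed
  then show "AMap H f \<cdot> p a (postcomp_dual C a u \<xi>) = p b (postcomp_dual C b u (precomp_dual C y' f \<xi>))"
    using is_datumD(3)[OF p f c] by simp
qed

end

section \<open>Wedges and ends of \<open>lr_bifunctor\<close>\<close>

context category_with_generator
begin

context
  fixes H y
  assumes H: "linear_endofunctor C H" and y: "y \<in> Obj C"
begin

abbreviation (input) lr_obj :: "'o \<Rightarrow> 'o" where
  "lr_obj x \<equiv> tensor_obj C (hom_space C x y) (OMap H x)"

abbreviation (input) lr_proj :: "'o \<Rightarrow> ('m \<Rightarrow> 'k) \<Rightarrow> 'm" where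
  "lr_proj x \<equiv> tensor_proj C (hom_space C x y) (OMap H x)"

abbreviation (input) rl_obj :: "'o \<Rightarrow> 'o" where
  "rl_obj x \<equiv> tensor_obj C (dual_space (hom_space C y x)) (OMap H x)"

abbreviation (input) rl_incl :: "'o \<Rightarrow> ('m \<Rightarrow> 'k) \<Rightarrow> 'm" where
  "rl_incl x \<xi> \<equiv> tensor_elt C (dual_space (hom_space C y x)) (OMap H x) \<xi> (Idt C (OMap H x))"

lemma lr_proj_Hom: "x \<in> Obj C \<Longrightarrow> \<xi> \<in> hdual C x y \<Longrightarrow> lr_proj x \<xi> \<in> Hom C (lr_obj x) (OMap H x)"
  by (rule tensor_proj(1)[OF fdvs_Hom[OF _ y] linear_endofunctorD(1)[OF H]])

lemma rl_incl_Hom: "x \<in> Obj C \<Longrightarrow> \<xi> \<in> hdual C y x \<Longrightarrow> rl_incl x \<xi> \<in> Hom C (OMap H x) (rl_obj x)"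
  by (rule tin_Hom[OF fdvs_dual[OF fdvs_Hom[OF y]] linear_endofunctorD(1)[OF H]])

text \<open>Seen through the projections, the two sides of the wedge condition turn into the two
  sides of the naturality of a datum: this lemma treats the side with \<open>H f\<close>, the next
  one the side with \<open>precomp_dual\<close>.\<close>

lemma lr_bifunctor_left:
  assumes f: "f \<in> Hom C a b" and k: "k \<in> Hom C w (lr_obj a)" and \<xi>: "\<xi> \<in> hdual C a y"
  shows "BMap (lr_bifunctor C H y) (Idt C a) f \<cdot> k \<in> Hom C w (tensor_obj C (hom_space C a y) (OMap H b))"
    and "tensor_proj C (hom_space C a y) (OMap H b) \<xi> \<cdot> (BMap (lr_bifunctor C H y) (Idt C a) f \<cdot> k) = AMap H f \<cdot> (lr_proj a \<xi> \<cdot> k)"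
proof -
  have a: "a \<in> Obj C" and b: "b \<in> Obj C"
    using Hom_Obj[OF f] by auto
  note V = fdvs_Hom[OF a y] and I = Idt_in_Hom[OF a] and Hf = linear_endofunctor_Hom[OF H f]
  note Hb = linear_endofunctorD(1)[OF H b]
  note M = tensor_mor[OF V V precomp_linear[OF I y] Hf]
  have B: "BMap (lr_bifunctor C H y) (Idt C a) f = tensor_mor C (hom_space C a y) (hom_space C a y) (\<lambda>h. h \<cdot> Idt C a) (AMap H f)"
    using HomD[OF I] by (simp add: lr_bifunctor_def)
  show "BMap (lr_bifunctor C H y) (Idt C a) f \<cdot> k \<in> Hom C w (tensor_obj C (hom_space C a y) (OMap H b))"
    unfolding B by (rule Comp_in_Hom[OF k M(1)])
  have "transpose_map (hom_space C a y) (\<lambda>h. h \<cdot> Idt C a) \<xi> = \<xi>"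
    by (rule hdual_eqI[OF transpose_map_dual[OF fdvs_vectorspace[OF V] precomp_linear[OF I y] \<xi>] \<xi>])
      (simp add: transpose_map_apply Comp_Idt)
  then show "tensor_proj C (hom_space C a y) (OMap H b) \<xi> \<cdot> (BMap (lr_bifunctor C H y) (Idt C a) f \<cdot> k) = AMap H f \<cdot> (lr_proj a \<xi> \<cdot> k)"
    using Comp_assoc[OF k M(1) tensor_proj(1)[OF V Hb \<xi>]] M(3)[OF \<xi>] Comp_assoc[OF k lr_proj_Hom[OF a \<xi>] Hf] by (simp add: B)
qed

lemma lr_bifunctor_right:
  assumes f: "f \<in> Hom C a b" and k: "k \<in> Hom C w (lr_obj b)" and \<xi>: "\<xi> \<in> hdual C a y"
  shows "BMap (lr_bifunctor C H y) f (Idt C b) \<cdot> k \<in> Hom C w (tensor_obj C (hom_space C a y) (OMap H b))"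
    and "tensor_proj C (hom_space C a y) (OMap H b) \<xi> \<cdot> (BMap (lr_bifunctor C H y) f (Idt C b) \<cdot> k) = lr_proj b (precomp_dual C y f \<xi>) \<cdot> k"
proof -
  have a: "a \<in> Obj C" and b: "b \<in> Obj C"
    using Hom_Obj[OF f] by auto
  note Va = fdvs_Hom[OF a y] and Vb = fdvs_Hom[OF b y]
  note Hb = linear_endofunctorD(1)[OF H b] and I = Idt_in_Hom[OF linear_endofunctorD(1)[OF H b]]
  note M = tensor_mor[OF Vb Va precomp_linear[OF f y] I]
  have B: "BMap (lr_bifunctor C H y) f (Idt C b) = tensor_mor C (hom_space C b y) (hom_space C a y) (\<lambda>h. h \<cdot> f) (Idt C (OMap H b))"
    using HomD[OF f] by (simp add: lr_bifunctor_def linear_endofunctorD(2)[OF H b])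
  show "BMap (lr_bifunctor C H y) f (Idt C b) \<cdot> k \<in> Hom C w (tensor_obj C (hom_space C a y) (OMap H b))"
    unfolding B by (rule Comp_in_Hom[OF k M(1)])
  have e: "transpose_map (hom_space C b y) (\<lambda>h. h \<cdot> f) \<xi> = precomp_dual C y f \<xi>"
    by (simp add: precomp_dual_def HomD[OF f])
  show "tensor_proj C (hom_space C a y) (OMap H b) \<xi> \<cdot> (BMap (lr_bifunctor C H y) f (Idt C b) \<cdot> k) = lr_proj b (precomp_dual C y f \<xi>) \<cdot> k"
    using Comp_assoc[OF k M(1) tensor_proj(1)[OF Va Hb \<xi>]] M(3)[OF \<xi>] Idt_Comp[OF lr_proj_Hom[OF b precomp_dual_closed[OF f y \<xi>]]]
    by (simp add: B e)
qed

lemma lr_wedge_iff_datum: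
  assumes w: "w \<in> Obj C" and k: "\<And>x. x \<in> Obj C \<Longrightarrow> \<kappa> x \<in> Hom C w (lr_obj x)"
  shows "is_wedge C (lr_bifunctor C H y) w \<kappa> \<longleftrightarrow> is_datum C H y w (\<lambda>x \<xi>. lr_proj x \<xi> \<cdot> \<kappa> x)"
proof -
  let ?S = "lr_bifunctor C H y"
  have "BMap ?S (Idt C a) f \<cdot> \<kappa> a = BMap ?S f (Idt C b) \<cdot> \<kappa> b \<longleftrightarrow>
      (\<forall>\<xi>\<in>hdual C a y. AMap H f \<cdot> (lr_proj a \<xi> \<cdot> \<kappa> a) = lr_proj b (precomp_dual C y f \<xi>) \<cdot> \<kappa> b)" (is "?l = ?r \<longleftrightarrow> ?R")
    if f: "f \<in> Hom C a b" for a b f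
  proof -
    have a: "a \<in> Obj C" and b: "b \<in> Obj C"
      using Hom_Obj[OF f] by auto
    \<comment> \<open>Some functional to instantiate \<open>\<xi>\<close> when the membership
      statements \<open>L(1)\<close> and \<open>R(1)\<close> are used.\<close>
    note z = vs_zero_closed[OF vectorspace_dual[OF vectorspace_Hom[OF a y]]]
    note L = lr_bifunctor_left[OF f k[OF a]] and R = lr_bifunctor_right[OF f k[OF b]]
    show ?thesis
    proof
      assume "?l = ?r"
      then show ?R
        using L(2) R(2) by fastforce
    next
      assume R': ?R
      show "?l = ?r"
        by (rule tensor_obj_eqI_in[OF fdvs_Hom[OF a y] linear_endofunctorD(1)[OF H b] L(1)[OF z] R(1)[OF z]])
          (use L(2) R(2) R' in simp)
    qed
  qed
  moreover have "(\<lambda>\<xi>. lr_proj x \<xi> \<cdot> \<kappa> x) \<in> linear_maps (dual_space (hom_space C x y)) (hom_space C w (OMap H x))" if x: "x \<in> Obj C" for x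
    by (rule linear_maps_comp[OF tensor_proj_linear[OF fdvs_Hom[OF x y] linear_endofunctorD(1)[OF H x]]
          precomp_linear[OF k[OF x] linear_endofunctorD(1)[OF H x]]])
  ultimately show ?thesis
    using w k unfolding is_wedge_def is_datum_def by (simp add: lr_bifunctor_def)
qed

lemma lr_wedge_Hom: "is_wedge C (lr_bifunctor C H y) w \<kappa> \<Longrightarrow> x \<in> Obj C \<Longrightarrow> \<kappa> x \<in> Hom C w (lr_obj x)"
  by (simp add: is_wedge_def lr_bifunctor_def)

lemma lr_wedge_datum: "is_wedge C (lr_bifunctor C H y) w \<kappa> \<Longrightarrow> is_datum C H y w (\<lambda>x \<xi>. lr_proj x \<xi> \<cdot> \<kappa> x)"
  using lr_wedge_iff_datum[of w \<kappa>] lr_wedge_Hom[of w \<kappa>] by (auto simp: is_wedge_def)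

lemma lr_datum_wedge:
  assumes q: "is_datum C H y w q"
  obtains \<kappa> where "is_wedge C (lr_bifunctor C H y) w \<kappa>" "\<And>x \<xi>. x \<in> Obj C \<Longrightarrow> \<xi> \<in> hdual C x y \<Longrightarrow> lr_proj x \<xi> \<cdot> \<kappa> x = q x \<xi>"
proof -
  have w: "w \<in> Obj C"
    by (rule is_datumD(1)[OF q])
  have "\<exists>k. x \<in> Obj C \<longrightarrow> k \<in> Hom C w (lr_obj x) \<and> (\<forall>\<xi>\<in>hdual C x y. lr_proj x \<xi> \<cdot> k = q x \<xi>)" for x
    using tensor_obj_map_in[OF fdvs_Hom[OF _ y] linear_endofunctorD(1)[OF H] w is_datumD(2)[OF q]] by metis
  then obtain \<kappa> where k: "\<And>x. x \<in> Obj C \<Longrightarrow> \<kappa> x \<in> Hom C w (lr_obj x)"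
    and kq: "\<And>x \<xi>. x \<in> Obj C \<Longrightarrow> \<xi> \<in> hdual C x y \<Longrightarrow> lr_proj x \<xi> \<cdot> \<kappa> x = q x \<xi>"
    by metis
  have "is_datum C H y w (\<lambda>x \<xi>. lr_proj x \<xi> \<cdot> \<kappa> x)"
    by (rule is_datum_cong[OF H y q kq])
  then have "is_wedge C (lr_bifunctor C H y) w \<kappa>"
    by (rule iffD2[OF lr_wedge_iff_datum[of w \<kappa>], rotated 2]) (simp_all add: w k)
  then show thesis
    using that kq by blast
qed

text \<open>Wedges and data correspond, and since the projections are jointly monic the conditions
  on a mediating morphism are equivalent as well.\<close>

lemma lr_end_iff_universal:
  assumes \<pi>: "is_wedge C (lr_bifunctor C H y) z \<pi>"
  shows "is_end C (lr_bifunctor C H y) z \<pi> \<longleftrightarrow> is_universal C H y z (\<lambda>x \<xi>. lr_proj x \<xi> \<cdot> \<pi> x)"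
proof -
  note \<pi>H = lr_wedge_Hom[OF \<pi>]
  have eq: "(\<forall>x\<in>Obj C. \<pi> x \<cdot> h = \<kappa> x) \<longleftrightarrow> (\<forall>x\<in>Obj C. \<forall>\<xi>\<in>hdual C x y. (lr_proj x \<xi> \<cdot> \<pi> x) \<cdot> h = q x \<xi>)"
    if h: "h \<in> Hom C w z" and k: "\<And>x. x \<in> Obj C \<Longrightarrow> \<kappa> x \<in> Hom C w (lr_obj x)"
      and kq: "\<And>x \<xi>. x \<in> Obj C \<Longrightarrow> \<xi> \<in> hdual C x y \<Longrightarrow> lr_proj x \<xi> \<cdot> \<kappa> x = q x \<xi>" for h w \<kappa> q
  proof -
    have "\<pi> x \<cdot> h = \<kappa> x \<longleftrightarrow> (\<forall>\<xi>\<in>hdual C x y. (lr_proj x \<xi> \<cdot> \<pi> x) \<cdot> h = q x \<xi>)" if x: "x \<in> Obj C" for x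
    proof
      assume *: "\<pi> x \<cdot> h = \<kappa> x"
      show "\<forall>\<xi>\<in>hdual C x y. (lr_proj x \<xi> \<cdot> \<pi> x) \<cdot> h = q x \<xi>"
        using Comp_assoc[OF h \<pi>H[OF x] lr_proj_Hom[OF x]] by (simp add: * kq[OF x])
    next
      assume *: "\<forall>\<xi>\<in>hdual C x y. (lr_proj x \<xi> \<cdot> \<pi> x) \<cdot> h = q x \<xi>"
      show "\<pi> x \<cdot> h = \<kappa> x"
        by (rule tensor_obj_eqI_in[OF fdvs_Hom[OF x y] linear_endofunctorD(1)[OF H x] Comp_in_Hom[OF h \<pi>H[OF x]] k[OF x]])
          (use * Comp_assoc[OF h \<pi>H[OF x] lr_proj_Hom[OF x]] kq[OF x] in simp)
    qed
    then show ?thesis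
      by blast
  qed
  show ?thesis
  proof
    assume E: "is_end C (lr_bifunctor C H y) z \<pi>"
    show "is_universal C H y z (\<lambda>x \<xi>. lr_proj x \<xi> \<cdot> \<pi> x)"
      unfolding is_universal_def
    proof (intro conjI allI impI)
      fix w q assume "is_datum C H y w q"
      then obtain \<kappa> where k: "is_wedge C (lr_bifunctor C H y) w \<kappa>" "\<And>x \<xi>. x \<in> Obj C \<Longrightarrow> \<xi> \<in> hdual C x y \<Longrightarrow> lr_proj x \<xi> \<cdot> \<kappa> x = q x \<xi>"
        using lr_datum_wedge by metis
      have "\<exists>!h. h \<in> Hom C w z \<and> (\<forall>x\<in>Obj C. \<pi> x \<cdot> h = \<kappa> x)"
        using E k(1) unfolding is_end_def by blast
      moreover have "(h \<in> Hom C w z \<and> (\<forall>x\<in>Obj C. \<pi> x \<cdot> h = \<kappa> x)) \<longleftrightarrow>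
          (h \<in> Hom C w z \<and> (\<forall>x\<in>Obj C. \<forall>\<xi>\<in>hdual C x y. (lr_proj x \<xi> \<cdot> \<pi> x) \<cdot> h = q x \<xi>))" for h
        using eq[OF _ lr_wedge_Hom[OF k(1)] k(2)] by (rule conj_cong[OF refl])
      ultimately show "\<exists>!h. h \<in> Hom C w z \<and> (\<forall>x\<in>Obj C. \<forall>\<xi>\<in>hdual C x y. (lr_proj x \<xi> \<cdot> \<pi> x) \<cdot> h = q x \<xi>)"
        by simp
    qed (rule lr_wedge_datum[OF \<pi>])
  next
    assume U: "is_universal C H y z (\<lambda>x \<xi>. lr_proj x \<xi> \<cdot> \<pi> x)"
    show "is_end C (lr_bifunctor C H y) z \<pi>"
      unfolding is_end_def
    proof (intro conjI allI impI)
      fix w \<kappa> assume k: "is_wedge C (lr_bifunctor C H y) w \<kappa>"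
      have "\<exists>!h. h \<in> Hom C w z \<and> (\<forall>x\<in>Obj C. \<forall>\<xi>\<in>hdual C x y. (lr_proj x \<xi> \<cdot> \<pi> x) \<cdot> h = lr_proj x \<xi> \<cdot> \<kappa> x)"
        using U lr_wedge_datum[OF k] unfolding is_universal_def by blast
      moreover have "(h \<in> Hom C w z \<and> (\<forall>x\<in>Obj C. \<pi> x \<cdot> h = \<kappa> x)) \<longleftrightarrow>
          (h \<in> Hom C w z \<and> (\<forall>x\<in>Obj C. \<forall>\<xi>\<in>hdual C x y. (lr_proj x \<xi> \<cdot> \<pi> x) \<cdot> h = lr_proj x \<xi> \<cdot> \<kappa> x))" for h
        using eq[OF _ lr_wedge_Hom[OF k] refl] by (rule conj_cong[OF refl])
      ultimately show "\<exists>!h. h \<in> Hom C w z \<and> (\<forall>x\<in>Obj C. \<pi> x \<cdot> h = \<kappa> x)"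
        by simp
    qed (rule \<pi>)
  qed
qed

text \<open>The universal datum provides an end, so the choice operator does pick one.\<close>

lemma lr_end_choice:
  "is_end C (lr_bifunctor C H y) (fst (end_choice C (lr_bifunctor C H y))) (snd (end_choice C (lr_bifunctor C H y)))"
proof -
  obtain z p where zp: "is_universal C H y z p"
    using universal_datum_exists[OF H y] by blast
  obtain \<pi> where \<pi>: "is_wedge C (lr_bifunctor C H y) z \<pi>" "\<And>x \<xi>. x \<in> Obj C \<Longrightarrow> \<xi> \<in> hdual C x y \<Longrightarrow> lr_proj x \<xi> \<cdot> \<pi> x = p x \<xi>"
    using lr_datum_wedge[OF is_universalD[OF zp]] by metis
  have "is_end C (lr_bifunctor C H y) z \<pi>"
    unfolding lr_end_iff_universal[OF \<pi>(1)] by (rule is_universal_cong[OF H y zp \<pi>(2)])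
  then have "\<exists>x. case x of (z, \<pi>) \<Rightarrow> is_end C (lr_bifunctor C H y) z \<pi>"
    by auto
  then have "case end_choice C (lr_bifunctor C H y) of (z, \<pi>) \<Rightarrow> is_end C (lr_bifunctor C H y) z \<pi>"
    unfolding end_choice_def by (rule someI_ex)
  then show ?thesis
    by (simp add: split_beta)
qed

section \<open>Cowedges and coends of \<open>rl_bifunctor\<close>\<close>

lemma rl_bifunctor_left:
  assumes f: "f \<in> Hom C a b" and k: "k \<in> Hom C (rl_obj a) w" and \<xi>: "\<xi> \<in> hdual C y b"
  shows "k \<cdot> BMap (rl_bifunctor C H y) f (Idt C a) \<in> Hom C (tensor_obj C (dual_space (hom_space C y b)) (OMap H a)) w"
    and "(k \<cdot> BMap (rl_bifunctor C H y) f (Idt C a)) \<cdot> tin (dual_space (hom_space C y b)) (OMap H a) \<xi> = k \<cdot> rl_incl a (postcomp_dual C y f \<xi>)"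
proof -
  have a: "a \<in> Obj C" and b: "b \<in> Obj C"
    using Hom_Obj[OF f] by auto
  note Va = fdvs_dual[OF fdvs_Hom[OF y a]] and Vb = fdvs_dual[OF fdvs_Hom[OF y b]]
  note Ha = linear_endofunctorD(1)[OF H a] and I = Idt_in_Hom[OF linear_endofunctorD(1)[OF H a]]
  note t = transpose_map_linear[OF vectorspace_Hom[OF y a] postcomp_linear[OF f y]]
  note M = tensor_mor[OF Vb Va t I]
  have B: "BMap (rl_bifunctor C H y) f (Idt C a) = tensor_mor C (dual_space (hom_space C y b)) (dual_space (hom_space C y a))
      (transpose_map (hom_space C y a) (\<lambda>h. f \<cdot> h)) (Idt C (OMap H a))"
    using HomD[OF f] by (simp add: rl_bifunctor_def linear_endofunctorD(2)[OF H a])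
  show "k \<cdot> BMap (rl_bifunctor C H y) f (Idt C a) \<in> Hom C (tensor_obj C (dual_space (hom_space C y b)) (OMap H a)) w"
    unfolding B by (rule Comp_in_Hom[OF M(1) k])
  have e: "transpose_map (hom_space C y a) (\<lambda>h. f \<cdot> h) \<xi> = postcomp_dual C y f \<xi>"
    by (simp add: postcomp_dual_def HomD[OF f])
  show "(k \<cdot> BMap (rl_bifunctor C H y) f (Idt C a)) \<cdot> tin (dual_space (hom_space C y b)) (OMap H a) \<xi> = k \<cdot> rl_incl a (postcomp_dual C y f \<xi>)"
    using Comp_assoc[OF tin_Hom[OF Vb Ha \<xi>] M(1) k] M(2)[OF \<xi>] Comp_Idt[OF rl_incl_Hom[OF a postcomp_dual_closed[OF f y \<xi>]]]
    by (simp add: B e)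
qed

lemma rl_bifunctor_right:
  assumes f: "f \<in> Hom C a b" and k: "k \<in> Hom C (rl_obj b) w" and \<xi>: "\<xi> \<in> hdual C y b"
  shows "k \<cdot> BMap (rl_bifunctor C H y) (Idt C b) f \<in> Hom C (tensor_obj C (dual_space (hom_space C y b)) (OMap H a)) w"
    and "(k \<cdot> BMap (rl_bifunctor C H y) (Idt C b) f) \<cdot> tin (dual_space (hom_space C y b)) (OMap H a) \<xi> = (k \<cdot> rl_incl b \<xi>) \<cdot> AMap H f"
proof -
  have a: "a \<in> Obj C" and b: "b \<in> Obj C"
    using Hom_Obj[OF f] by auto
  note V = fdvs_dual[OF fdvs_Hom[OF y b]] and I = Idt_in_Hom[OF b] and Hf = linear_endofunctor_Hom[OF H f]
  note Ha = linear_endofunctorD(1)[OF H a]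
  note t = transpose_map_linear[OF vectorspace_Hom[OF y b] postcomp_linear[OF I y]]
  note M = tensor_mor[OF V V t Hf]
  have B: "BMap (rl_bifunctor C H y) (Idt C b) f = tensor_mor C (dual_space (hom_space C y b)) (dual_space (hom_space C y b))
      (transpose_map (hom_space C y b) (\<lambda>h. Idt C b \<cdot> h)) (AMap H f)"
    using HomD[OF I] by (simp add: rl_bifunctor_def)
  show "k \<cdot> BMap (rl_bifunctor C H y) (Idt C b) f \<in> Hom C (tensor_obj C (dual_space (hom_space C y b)) (OMap H a)) w"
    unfolding B by (rule Comp_in_Hom[OF M(1) k])
  have e: "transpose_map (hom_space C y b) (\<lambda>h. Idt C b \<cdot> h) \<xi> = \<xi>"
    by (rule hdual_eqI[OF linear_maps_closed[OF t \<xi>] \<xi>]) (simp add: transpose_map_apply Idt_Comp)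
  show "(k \<cdot> BMap (rl_bifunctor C H y) (Idt C b) f) \<cdot> tin (dual_space (hom_space C y b)) (OMap H a) \<xi> = (k \<cdot> rl_incl b \<xi>) \<cdot> AMap H f"
    using Comp_assoc[OF tin_Hom[OF V Ha \<xi>] M(1) k] M(2)[OF \<xi>] Comp_assoc[OF Hf rl_incl_Hom[OF b \<xi>] k] by (simp add: B e)
qed

text \<open>Here the tensor factor is itself the dual of a space of morphisms, so the inclusions are
  indexed by the functionals that indexed the projections in the case of ends. Reversing arrows
  turns a cowedge into the same kind of family.\<close>

lemma rl_cowedge_iff_datum:
  assumes w: "w \<in> Obj C" and k: "\<And>x. x \<in> Obj C \<Longrightarrow> \<kappa> x \<in> Hom C (rl_obj x) w"
  shows "is_cowedge C (rl_bifunctor C H y) w \<kappa> \<longleftrightarrow> is_datum (op_cat C) H y w (\<lambda>x \<xi>. \<kappa> x \<cdot> rl_incl x \<xi>)"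
proof -
  let ?S = "rl_bifunctor C H y"
  have *: "\<kappa> a \<cdot> BMap ?S f (Idt C a) = \<kappa> b \<cdot> BMap ?S (Idt C b) f \<longleftrightarrow>
      (\<forall>\<xi>\<in>hdual C y b. (\<kappa> b \<cdot> rl_incl b \<xi>) \<cdot> AMap H f = \<kappa> a \<cdot> rl_incl a (postcomp_dual C y f \<xi>))" (is "?l = ?r \<longleftrightarrow> ?R")
    if f: "f \<in> Hom C a b" for a b f
  proof -
    have a: "a \<in> Obj C" and b: "b \<in> Obj C"
      using Hom_Obj[OF f] by auto
    note z = vs_zero_closed[OF vectorspace_dual[OF vectorspace_Hom[OF y b]]]
    note L = rl_bifunctor_left[OF f k[OF a]] and R = rl_bifunctor_right[OF f k[OF b]]
    show ?thesis
    proof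
      assume "?l = ?r"
      then show ?R
        using L(2) R(2) by fastforce
    next
      assume R': ?R
      show "?l = ?r"
        by (rule tensor_obj_eqI_out[OF fdvs_dual[OF fdvs_Hom[OF y b]] linear_endofunctorD(1)[OF H a] L(1)[OF z] R(1)[OF z]])
          (use L(2) R(2) R' in simp)
    qed
  qed
  have lin: "(\<lambda>\<xi>. \<kappa> x \<cdot> rl_incl x \<xi>) \<in> linear_maps (dual_space (hom_space C y x)) (hom_space C (OMap H x) w)" if x: "x \<in> Obj C" for x
    by (rule linear_maps_comp[OF tin_linear[OF fdvs_dual[OF fdvs_Hom[OF y x]] linear_endofunctorD(1)[OF H x]]
          postcomp_linear[OF k[OF x] linear_endofunctorD(1)[OF H x]]])
  have c: "is_cowedge C ?S w \<kappa> \<longleftrightarrow> (\<forall>a b. \<forall>f\<in>Hom C a b. \<kappa> a \<cdot> BMap ?S f (Idt C a) = \<kappa> b \<cdot> BMap ?S (Idt C b) f)"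
    using w k unfolding is_cowedge_def by (simp add: rl_bifunctor_def)
  have d: "is_datum (op_cat C) H y w (\<lambda>x \<xi>. \<kappa> x \<cdot> rl_incl x \<xi>) \<longleftrightarrow>
      (\<forall>b a. \<forall>f\<in>Hom C a b. \<forall>\<xi>\<in>hdual C y b. (\<kappa> b \<cdot> rl_incl b \<xi>) \<cdot> AMap H f = \<kappa> a \<cdot> rl_incl a (postcomp_dual C y f \<xi>))"
    using w lin unfolding is_datum_def by (simp add: precomp_dual_op)
  show ?thesis
    unfolding c d using * by blast
qed

lemma rl_cowedge_Hom: "is_cowedge C (rl_bifunctor C H y) w \<kappa> \<Longrightarrow> x \<in> Obj C \<Longrightarrow> \<kappa> x \<in> Hom C (rl_obj x) w"
  by (simp add: is_cowedge_def rl_bifunctor_def)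

lemma rl_cowedge_datum: "is_cowedge C (rl_bifunctor C H y) w \<kappa> \<Longrightarrow> is_datum (op_cat C) H y w (\<lambda>x \<xi>. \<kappa> x \<cdot> rl_incl x \<xi>)"
  using rl_cowedge_iff_datum[of w \<kappa>] rl_cowedge_Hom[of w \<kappa>] by (auto simp: is_cowedge_def)

lemma rl_datum_cowedge:
  assumes q: "is_datum (op_cat C) H y w q"
  obtains \<kappa> where "is_cowedge C (rl_bifunctor C H y) w \<kappa>" "\<And>x \<xi>. x \<in> Obj C \<Longrightarrow> \<xi> \<in> hdual C y x \<Longrightarrow> \<kappa> x \<cdot> rl_incl x \<xi> = q x \<xi>"
proof -
  have w: "w \<in> Obj C"
    using is_datumD(1)[OF q] by simp
  have qL: "q x \<in> linear_maps (dual_space (hom_space C y x)) (hom_space C (OMap H x) w)" if "x \<in> Obj C" for x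
    using is_datumD(2)[OF q, of x] that by simp
  have "\<exists>k. x \<in> Obj C \<longrightarrow> k \<in> Hom C (rl_obj x) w \<and> (\<forall>\<xi>\<in>hdual C y x. k \<cdot> rl_incl x \<xi> = q x \<xi>)" for x
    using tensor_obj_map_out[OF fdvs_dual[OF fdvs_Hom[OF y]] linear_endofunctorD(1)[OF H] w qL] by metis
  then obtain \<kappa> where k: "\<And>x. x \<in> Obj C \<Longrightarrow> \<kappa> x \<in> Hom C (rl_obj x) w"
    and kq: "\<And>x \<xi>. x \<in> Obj C \<Longrightarrow> \<xi> \<in> hdual C y x \<Longrightarrow> \<kappa> x \<cdot> rl_incl x \<xi> = q x \<xi>"
    by metis
  have "is_datum (op_cat C) H y w (\<lambda>x \<xi>. \<kappa> x \<cdot> rl_incl x \<xi>)"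
    by (rule linear_category.is_datum_cong[OF linear_category_op _ _ q]) (simp_all add: linear_endofunctor_op H y kq)
  then have "is_cowedge C (rl_bifunctor C H y) w \<kappa>"
    by (rule iffD2[OF rl_cowedge_iff_datum[of w \<kappa>], rotated 2]) (simp_all add: w k)
  then show thesis
    using that kq by blast
qed

lemma rl_coend_iff_universal:
  assumes \<iota>: "is_cowedge C (rl_bifunctor C H y) z \<iota>"
  shows "is_coend C (rl_bifunctor C H y) z \<iota> \<longleftrightarrow> is_universal (op_cat C) H y z (\<lambda>x \<xi>. \<iota> x \<cdot> rl_incl x \<xi>)"
proof -
  note \<iota>H = rl_cowedge_Hom[OF \<iota>]
  have eq: "(\<forall>x\<in>Obj C. h \<cdot> \<iota> x = \<kappa> x) \<longleftrightarrow> (\<forall>x\<in>Obj C. \<forall>\<xi>\<in>hdual C y x. h \<cdot> (\<iota> x \<cdot> rl_incl x \<xi>) = q x \<xi>)"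
    if h: "h \<in> Hom C z w" and k: "\<And>x. x \<in> Obj C \<Longrightarrow> \<kappa> x \<in> Hom C (rl_obj x) w"
      and kq: "\<And>x \<xi>. x \<in> Obj C \<Longrightarrow> \<xi> \<in> hdual C y x \<Longrightarrow> \<kappa> x \<cdot> rl_incl x \<xi> = q x \<xi>" for h w \<kappa> q
  proof -
    have "h \<cdot> \<iota> x = \<kappa> x \<longleftrightarrow> (\<forall>\<xi>\<in>hdual C y x. h \<cdot> (\<iota> x \<cdot> rl_incl x \<xi>) = q x \<xi>)" if x: "x \<in> Obj C" for x
    proof
      assume *: "h \<cdot> \<iota> x = \<kappa> x"
      show "\<forall>\<xi>\<in>hdual C y x. h \<cdot> (\<iota> x \<cdot> rl_incl x \<xi>) = q x \<xi>"
        using Comp_assoc[OF rl_incl_Hom[OF x] \<iota>H[OF x] h] by (simp add: * flip: kq[OF x])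
    next
      assume *: "\<forall>\<xi>\<in>hdual C y x. h \<cdot> (\<iota> x \<cdot> rl_incl x \<xi>) = q x \<xi>"
      show "h \<cdot> \<iota> x = \<kappa> x"
        by (rule tensor_obj_eqI_out[OF fdvs_dual[OF fdvs_Hom[OF y x]] linear_endofunctorD(1)[OF H x] Comp_in_Hom[OF \<iota>H[OF x] h] k[OF x]])
          (use * Comp_assoc[OF rl_incl_Hom[OF x] \<iota>H[OF x] h] kq[OF x] in simp)
    qed
    then show ?thesis
      by blast
  qed
  show ?thesis
  proof
    assume E: "is_coend C (rl_bifunctor C H y) z \<iota>"
    show "is_universal (op_cat C) H y z (\<lambda>x \<xi>. \<iota> x \<cdot> rl_incl x \<xi>)"
      unfolding is_universal_def
    proof (intro conjI allI impI)
      fix w q assume "is_datum (op_cat C) H y w q"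
      then obtain \<kappa> where k: "is_cowedge C (rl_bifunctor C H y) w \<kappa>" "\<And>x \<xi>. x \<in> Obj C \<Longrightarrow> \<xi> \<in> hdual C y x \<Longrightarrow> \<kappa> x \<cdot> rl_incl x \<xi> = q x \<xi>"
        using rl_datum_cowedge by metis
      have "\<exists>!h. h \<in> Hom C z w \<and> (\<forall>x\<in>Obj C. h \<cdot> \<iota> x = \<kappa> x)"
        using E k(1) unfolding is_coend_def by blast
      moreover have "(h \<in> Hom C z w \<and> (\<forall>x\<in>Obj C. h \<cdot> \<iota> x = \<kappa> x)) \<longleftrightarrow>
          (h \<in> Hom C z w \<and> (\<forall>x\<in>Obj C. \<forall>\<xi>\<in>hdual C y x. h \<cdot> (\<iota> x \<cdot> rl_incl x \<xi>) = q x \<xi>))" for h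
        using eq[OF _ rl_cowedge_Hom[OF k(1)] k(2)] by (rule conj_cong[OF refl])
      ultimately show "\<exists>!h. h \<in> Hom (op_cat C) w z \<and> (\<forall>x\<in>Obj (op_cat C). \<forall>\<xi>\<in>hdual (op_cat C) x y. (\<iota> x \<cdot> rl_incl x \<xi>) \<cdot>\<^bsub>op_cat C\<^esub> h = q x \<xi>)"
        by simp
    qed (rule rl_cowedge_datum[OF \<iota>])
  next
    assume U: "is_universal (op_cat C) H y z (\<lambda>x \<xi>. \<iota> x \<cdot> rl_incl x \<xi>)"
    show "is_coend C (rl_bifunctor C H y) z \<iota>"
      unfolding is_coend_def
    proof (intro conjI allI impI)
      fix w \<kappa> assume k: "is_cowedge C (rl_bifunctor C H y) w \<kappa>"
      have "\<exists>!h. h \<in> Hom (op_cat C) w z \<and> (\<forall>x\<in>Obj (op_cat C). \<forall>\<xi>\<in>hdual (op_cat C) x y. (\<iota> x \<cdot> rl_incl x \<xi>) \<cdot>\<^bsub>op_cat C\<^esub> h = \<kappa> x \<cdot> rl_incl x \<xi>)"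
        using U rl_cowedge_datum[OF k] unfolding is_universal_def by blast
      moreover have "(h \<in> Hom C z w \<and> (\<forall>x\<in>Obj C. h \<cdot> \<iota> x = \<kappa> x)) \<longleftrightarrow>
          (h \<in> Hom C z w \<and> (\<forall>x\<in>Obj C. \<forall>\<xi>\<in>hdual C y x. h \<cdot> (\<iota> x \<cdot> rl_incl x \<xi>) = \<kappa> x \<cdot> rl_incl x \<xi>))" for h
        using eq[OF _ rl_cowedge_Hom[OF k] refl] by (rule conj_cong[OF refl])
      ultimately show "\<exists>!h. h \<in> Hom C z w \<and> (\<forall>x\<in>Obj C. h \<cdot> \<iota> x = \<kappa> x)"
        by simp
    qed (rule \<iota>)
  qed
qed

text \<open>Coends come from universal data of the opposite category, whose generator
  \<open>I\<close> is an injective cogenerator of \<open>C\<close>.\<close>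

lemma rl_coend_choice:
  assumes "category_with_generator (op_cat C) I"
  shows "is_coend C (rl_bifunctor C H y) (fst (coend_choice C (rl_bifunctor C H y))) (snd (coend_choice C (rl_bifunctor C H y)))"
proof -
  interpret op: category_with_generator "op_cat C" I
    by (rule assms)
  have H': "linear_endofunctor (op_cat C) H" and y': "y \<in> Obj (op_cat C)"
    using H y by (simp_all add: linear_endofunctor_op)
  obtain z p where zp: "is_universal (op_cat C) H y z p"
    using op.universal_datum_exists[OF H' y'] by blast
  obtain \<iota> where \<iota>: "is_cowedge C (rl_bifunctor C H y) z \<iota>" "\<And>x \<xi>. x \<in> Obj C \<Longrightarrow> \<xi> \<in> hdual C y x \<Longrightarrow> \<iota> x \<cdot> rl_incl x \<xi> = p x \<xi>"
    using rl_datum_cowedge[OF is_universalD[OF zp]] by metis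
  have "is_coend C (rl_bifunctor C H y) z \<iota>"
    unfolding rl_coend_iff_universal[OF \<iota>(1)] by (rule op.is_universal_cong[OF H' y' zp]) (simp add: \<iota>(2))
  then have "\<exists>x. case x of (z, \<iota>) \<Rightarrow> is_coend C (rl_bifunctor C H y) z \<iota>"
    by auto
  then have "case coend_choice C (rl_bifunctor C H y) of (z, \<iota>) \<Rightarrow> is_coend C (rl_bifunctor C H y) z \<iota>"
    unfolding coend_choice_def by (rule someI_ex)
  then show ?thesis
    by (simp add: split_beta)
qed

end

section \<open>The functors of the theorem are of the form \<Gamma>\<close>

lemma is_Gamma_lr:
  assumes H: "linear_endofunctor C H"
  shows "is_Gamma C H (Gamma_lr C H)
    (\<lambda>y x \<xi>. tensor_proj C (hom_space C x y) (OMap H x) \<xi> \<cdot> snd (end_choice C (lr_bifunctor C H y)) x)"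
proof -
  define z \<pi> where "z y = fst (end_choice C (lr_bifunctor C H y))" and "\<pi> y = snd (end_choice C (lr_bifunctor C H y))" for y
  define P where "P y x \<xi> = tensor_proj C (hom_space C x y) (OMap H x) \<xi> \<cdot> \<pi> y x" for y x \<xi>
  have E: "is_end C (lr_bifunctor C H y) (z y) (\<pi> y)" if "y \<in> Obj C" for y
    unfolding z_def \<pi>_def by (rule lr_end_choice[OF H that])
  have W: "is_wedge C (lr_bifunctor C H y) (z y) (\<pi> y)" if "y \<in> Obj C" for y
    using E[OF that] by (simp add: is_end_def)
  note \<pi>H = lr_wedge_Hom[OF H _ W]
  have U: "is_universal C H y (z y) (P y)" if "y \<in> Obj C" for y
    using E[OF that] unfolding P_def[abs_def] lr_end_iff_universal[OF H that W[OF that]] .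
  have obj: "OMap (Gamma_lr C H) y = z y" for y
    by (simp add: Gamma_lr_def z_def)
  let ?m = "\<lambda>u x. tensor_mor C (hom_space C x (Dom C u)) (hom_space C x (Cod C u)) (\<lambda>h. u \<cdot> h) (Idt C (OMap H x))"
  have arr: "AMap (Gamma_lr C H) u = (THE h. h \<in> Hom C (z (Dom C u)) (z (Cod C u)) \<and>
      (\<forall>x\<in>Obj C. \<pi> (Cod C u) x \<cdot> h = ?m u x \<cdot> \<pi> (Dom C u) x))" for u
    by (simp add: Gamma_lr_def z_def \<pi>_def)
  have "is_Gamma C H (Gamma_lr C H) P"
    unfolding is_Gamma_def obj
  proof (intro conjI ballI allI)
    show "is_universal C H y (z y) (P y)" if "y \<in> Obj C" for y
      by (rule U[OF that])
  next
    fix y y' u assume u: "u \<in> Hom C y y'"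
    have y: "y \<in> Obj C" and y': "y' \<in> Obj C"
      using Hom_Obj[OF u] by auto
    have m: "?m u x \<cdot> \<pi> y x \<in> Hom C (z y) (tensor_obj C (hom_space C x y') (OMap H x))"
      and mP: "\<And>\<xi>. \<xi> \<in> hdual C x y' \<Longrightarrow> tensor_proj C (hom_space C x y') (OMap H x) \<xi> \<cdot> (?m u x \<cdot> \<pi> y x) = P y x (postcomp_dual C x u \<xi>)"
      if x: "x \<in> Obj C" for x
    proof -
      note Hx = linear_endofunctorD(1)[OF H x] and V = fdvs_Hom[OF x y] and V' = fdvs_Hom[OF x y']
      note M = tensor_mor[OF V V' postcomp_linear[OF u x] Idt_in_Hom[OF Hx]]
      show "?m u x \<cdot> \<pi> y x \<in> Hom C (z y) (tensor_obj C (hom_space C x y') (OMap H x))"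
        using Comp_in_Hom[OF \<pi>H[OF y y x] M(1)] by (simp add: HomD[OF u])
      fix \<xi> assume \<xi>: "\<xi> \<in> hdual C x y'"
      note c = postcomp_dual_closed[OF u x \<xi>]
      have "transpose_map (hom_space C x y) (\<lambda>h. u \<cdot> h) \<xi> = postcomp_dual C x u \<xi>"
        by (simp add: postcomp_dual_def HomD[OF u])
      then show "tensor_proj C (hom_space C x y') (OMap H x) \<xi> \<cdot> (?m u x \<cdot> \<pi> y x) = P y x (postcomp_dual C x u \<xi>)"
        using Comp_assoc[OF \<pi>H[OF y y x] M(1) tensor_proj(1)[OF V' Hx \<xi>]] M(3)[OF \<xi>] Idt_Comp[OF tensor_proj(1)[OF V Hx c]]
        by (simp add: P_def HomD[OF u])
    qed
    have d: "is_datum C H y' (z y) (\<lambda>x \<xi>. P y x (postcomp_dual C x u \<xi>))"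
      by (rule is_datum_postcomp[OF H is_universalD[OF U[OF y]] u])
    obtain h where h: "h \<in> Hom C (z y) (z y')" "\<And>x \<xi>. x \<in> Obj C \<Longrightarrow> \<xi> \<in> hdual C x y' \<Longrightarrow> P y' x \<xi> \<cdot> h = P y x (postcomp_dual C x u \<xi>)"
      by (rule is_universalE[OF U[OF y'] d]) (rule that)
    \<comment> \<open>The condition that defines the functor on \<open>u\<close>, an equation of
      morphisms into tensor objects, is tested by the projections and becomes the condition in
      \<open>is_Gamma\<close>. Hence \<open>THE\<close> denotes the mediating morphism
      \<open>h\<close>.\<close>
    have iff: "\<pi> y' x \<cdot> k = ?m u x \<cdot> \<pi> y x \<longleftrightarrow> (\<forall>\<xi>\<in>hdual C x y'. P y' x \<xi> \<cdot> k = P y x (postcomp_dual C x u \<xi>))"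
      if k: "k \<in> Hom C (z y) (z y')" and x: "x \<in> Obj C" for k x
    proof -
      note Hx = linear_endofunctorD(1)[OF H x] and V' = fdvs_Hom[OF x y']
      have as: "P y' x \<xi> \<cdot> k = tensor_proj C (hom_space C x y') (OMap H x) \<xi> \<cdot> (\<pi> y' x \<cdot> k)" if "\<xi> \<in> hdual C x y'" for \<xi>
        unfolding P_def by (rule Comp_assoc[OF k \<pi>H[OF y' y' x] tensor_proj(1)[OF V' Hx that]])
      show ?thesis
      proof
        assume "\<pi> y' x \<cdot> k = ?m u x \<cdot> \<pi> y x"
        then show "\<forall>\<xi>\<in>hdual C x y'. P y' x \<xi> \<cdot> k = P y x (postcomp_dual C x u \<xi>)"
          by (simp add: as mP[OF x])
      next
        assume *: "\<forall>\<xi>\<in>hdual C x y'. P y' x \<xi> \<cdot> k = P y x (postcomp_dual C x u \<xi>)"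
        show "\<pi> y' x \<cdot> k = ?m u x \<cdot> \<pi> y x"
          by (rule tensor_obj_eqI_in[OF V' Hx Comp_in_Hom[OF k \<pi>H[OF y' y' x]] m[OF x]])
            (use * as mP[OF x] in simp)
      qed
    qed
    have "AMap (Gamma_lr C H) u = h"
      unfolding arr HomD(2)[OF u] HomD(3)[OF u]
    proof (rule the_equality)
      have "\<forall>x\<in>Obj C. \<pi> y' x \<cdot> h = ?m u x \<cdot> \<pi> y x"
        using iff[OF h(1)] h(2) by blast
      then show "h \<in> Hom C (z y) (z y') \<and> (\<forall>x\<in>Obj C. \<pi> y' x \<cdot> h =
          tensor_mor C (hom_space C x y) (hom_space C x y') (\<lambda>h. u \<cdot> h) (Idt C (OMap H x)) \<cdot> \<pi> y x)"
        using h(1) by (simp add: HomD[OF u])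
      fix k assume k: "k \<in> Hom C (z y) (z y') \<and> (\<forall>x\<in>Obj C. \<pi> y' x \<cdot> k =
          tensor_mor C (hom_space C x y) (hom_space C x y') (\<lambda>h. u \<cdot> h) (Idt C (OMap H x)) \<cdot> \<pi> y x)"
      then have k': "k \<in> Hom C (z y) (z y')" and ks: "\<And>x. x \<in> Obj C \<Longrightarrow> \<pi> y' x \<cdot> k = ?m u x \<cdot> \<pi> y x"
        by (auto simp: HomD[OF u])
      show "k = h"
        by (rule is_universal_eqI[OF H y' U[OF y'] k' h(1)]) (use iff[OF k'] ks h(2) in simp)
    qed
    then show "AMap (Gamma_lr C H) u \<in> Hom C (z y) (z y')"
      "\<And>x \<xi>. x \<in> Obj C \<Longrightarrow> \<xi> \<in> hdual C x y' \<Longrightarrow> P y' x \<xi> \<cdot> AMap (Gamma_lr C H) u = P y x (postcomp_dual C x u \<xi>)"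
      using h by auto
  qed
  then show ?thesis
    unfolding P_def \<pi>_def .
qed

lemma is_Gamma_rl:
  assumes op: "category_with_generator (op_cat C) I" and H: "linear_endofunctor C H"
  shows "is_Gamma (op_cat C) H (Gamma_rl C H)
    (\<lambda>y x \<xi>. snd (coend_choice C (rl_bifunctor C H y)) x \<cdot> tensor_elt C (dual_space (hom_space C y x)) (OMap H x) \<xi> (Idt C (OMap H x)))"
proof -
  interpret op: category_with_generator "op_cat C" I
    by (rule op)
  have H': "linear_endofunctor (op_cat C) H"
    using H by (simp add: linear_endofunctor_op)
  define z \<iota> where "z y = fst (coend_choice C (rl_bifunctor C H y))" and "\<iota> y = snd (coend_choice C (rl_bifunctor C H y))" for y
  let ?i = "\<lambda>y x \<xi>. tensor_elt C (dual_space (hom_space C y x)) (OMap H x) \<xi> (Idt C (OMap H x))"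
  define P where "P y x \<xi> = \<iota> y x \<cdot> ?i y x \<xi>" for y x \<xi>
  have E: "is_coend C (rl_bifunctor C H y) (z y) (\<iota> y)" if "y \<in> Obj C" for y
    unfolding z_def \<iota>_def by (rule rl_coend_choice[OF H that op])
  have W: "is_cowedge C (rl_bifunctor C H y) (z y) (\<iota> y)" if "y \<in> Obj C" for y
    using E[OF that] by (simp add: is_coend_def)
  note \<iota>H = rl_cowedge_Hom[OF H _ W]
  have U: "is_universal (op_cat C) H y (z y) (P y)" if "y \<in> Obj C" for y
    using E[OF that] unfolding P_def[abs_def] rl_coend_iff_universal[OF H that W[OF that]] .
  have obj: "OMap (Gamma_rl C H) y = z y" for y
    by (simp add: Gamma_rl_def z_def)
  let ?m = "\<lambda>u x. tensor_mor C (dual_space (hom_space C (Dom C u) x)) (dual_space (hom_space C (Cod C u) x))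
    (transpose_map (hom_space C (Cod C u) x) (\<lambda>h. h \<cdot> u)) (Idt C (OMap H x))"
  have arr: "AMap (Gamma_rl C H) u = (THE h. h \<in> Hom C (z (Dom C u)) (z (Cod C u)) \<and>
      (\<forall>x\<in>Obj C. h \<cdot> \<iota> (Dom C u) x = \<iota> (Cod C u) x \<cdot> ?m u x))" for u
    by (simp add: Gamma_rl_def z_def \<iota>_def)
  have main: "AMap (Gamma_rl C H) u \<in> Hom C (z y) (z y') \<and>
      (\<forall>x\<in>Obj C. \<forall>\<xi>\<in>hdual C y x. AMap (Gamma_rl C H) u \<cdot> P y x \<xi> = P y' x (precomp_dual C x u \<xi>))"
    if u: "u \<in> Hom C y y'" for u y y'
  proof -
    have y: "y \<in> Obj C" and y': "y' \<in> Obj C"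
      using Hom_Obj[OF u] by auto
    have m: "\<iota> y' x \<cdot> ?m u x \<in> Hom C (tensor_obj C (dual_space (hom_space C y x)) (OMap H x)) (z y')"
      and mP: "\<And>\<xi>. \<xi> \<in> hdual C y x \<Longrightarrow> (\<iota> y' x \<cdot> ?m u x) \<cdot> ?i y x \<xi> = P y' x (precomp_dual C x u \<xi>)"
      if x: "x \<in> Obj C" for x
    proof -
      note Hx = linear_endofunctorD(1)[OF H x] and V = fdvs_dual[OF fdvs_Hom[OF y x]] and V' = fdvs_dual[OF fdvs_Hom[OF y' x]]
      note t = transpose_map_linear[OF vectorspace_Hom[OF y' x] precomp_linear[OF u x]]
      note M = tensor_mor[OF V V' t Idt_in_Hom[OF Hx]]
      show "\<iota> y' x \<cdot> ?m u x \<in> Hom C (tensor_obj C (dual_space (hom_space C y x)) (OMap H x)) (z y')"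
        using Comp_in_Hom[OF M(1) \<iota>H[OF y' y' x]] by (simp add: HomD[OF u])
      fix \<xi> assume \<xi>: "\<xi> \<in> hdual C y x"
      note c = precomp_dual_closed[OF u x \<xi>]
      have "transpose_map (hom_space C y' x) (\<lambda>h. h \<cdot> u) \<xi> = precomp_dual C x u \<xi>"
        by (simp add: precomp_dual_def HomD[OF u])
      then show "(\<iota> y' x \<cdot> ?m u x) \<cdot> ?i y x \<xi> = P y' x (precomp_dual C x u \<xi>)"
        using Comp_assoc[OF tin_Hom[OF V Hx \<xi>] M(1) \<iota>H[OF y' y' x]] M(2)[OF \<xi>] Comp_Idt[OF tin_Hom[OF V' Hx c]]
        by (simp add: P_def HomD[OF u])
    qed
    \<comment> \<open>In the opposite category \<open>u\<close> leads from \<open>y'\<close> to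
      \<open>y\<close>. It carries the datum at \<open>y'\<close> to one at \<open>y\<close>, and
      universality of \<open>P y\<close> answers with a morphism of \<open>C\<close> from
      \<open>z y\<close> to \<open>z y'\<close>.\<close>
    have u': "u \<in> Hom (op_cat C) y' y"
      using u by simp
    have d: "is_datum (op_cat C) H y (z y') (\<lambda>x \<xi>. P y' x (precomp_dual C x u \<xi>))"
      using op.is_datum_postcomp[OF H' is_universalD[OF U[OF y']] u'] by (simp add: postcomp_dual_op)
    obtain h where "h \<in> Hom (op_cat C) (z y') (z y)"
      "\<And>x \<xi>. x \<in> Obj (op_cat C) \<Longrightarrow> \<xi> \<in> hdual (op_cat C) x y \<Longrightarrow> P y x \<xi> \<cdot>\<^bsub>op_cat C\<^esub> h = P y' x (precomp_dual C x u \<xi>)"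
      by (rule is_universalE[OF U[OF y] d]) (rule that)
    then have h: "h \<in> Hom C (z y) (z y')" "\<And>x \<xi>. x \<in> Obj C \<Longrightarrow> \<xi> \<in> hdual C y x \<Longrightarrow> h \<cdot> P y x \<xi> = P y' x (precomp_dual C x u \<xi>)"
      by simp_all
    have iff: "k \<cdot> \<iota> y x = \<iota> y' x \<cdot> ?m u x \<longleftrightarrow> (\<forall>\<xi>\<in>hdual C y x. k \<cdot> P y x \<xi> = P y' x (precomp_dual C x u \<xi>))"
      if k: "k \<in> Hom C (z y) (z y')" and x: "x \<in> Obj C" for k x
    proof -
      note Hx = linear_endofunctorD(1)[OF H x] and V = fdvs_dual[OF fdvs_Hom[OF y x]]
      have as: "k \<cdot> P y x \<xi> = (k \<cdot> \<iota> y x) \<cdot> ?i y x \<xi>" if "\<xi> \<in> hdual C y x" for \<xi>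
        unfolding P_def by (rule Comp_assoc[OF tin_Hom[OF V Hx that] \<iota>H[OF y y x] k, symmetric])
      show ?thesis
      proof
        assume "k \<cdot> \<iota> y x = \<iota> y' x \<cdot> ?m u x"
        then show "\<forall>\<xi>\<in>hdual C y x. k \<cdot> P y x \<xi> = P y' x (precomp_dual C x u \<xi>)"
          by (simp add: as mP[OF x])
      next
        assume *: "\<forall>\<xi>\<in>hdual C y x. k \<cdot> P y x \<xi> = P y' x (precomp_dual C x u \<xi>)"
        show "k \<cdot> \<iota> y x = \<iota> y' x \<cdot> ?m u x"
          by (rule tensor_obj_eqI_out[OF V Hx Comp_in_Hom[OF \<iota>H[OF y y x] k] m[OF x]])
            (use * as mP[OF x] in simp)
      qed
    qed
    have "AMap (Gamma_rl C H) u = h"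
      unfolding arr HomD(2)[OF u] HomD(3)[OF u]
    proof (rule the_equality)
      have "\<forall>x\<in>Obj C. h \<cdot> \<iota> y x = \<iota> y' x \<cdot> ?m u x"
        using iff[OF h(1)] h(2) by blast
      then show "h \<in> Hom C (z y) (z y') \<and> (\<forall>x\<in>Obj C. h \<cdot> \<iota> y x = \<iota> y' x \<cdot>
          tensor_mor C (dual_space (hom_space C y x)) (dual_space (hom_space C y' x))
            (transpose_map (hom_space C y' x) (\<lambda>h. h \<cdot> u)) (Idt C (OMap H x)))"
        using h(1) by (simp add: HomD[OF u])
      fix k assume k: "k \<in> Hom C (z y) (z y') \<and> (\<forall>x\<in>Obj C. k \<cdot> \<iota> y x = \<iota> y' x \<cdot>
          tensor_mor C (dual_space (hom_space C y x)) (dual_space (hom_space C y' x))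
            (transpose_map (hom_space C y' x) (\<lambda>h. h \<cdot> u)) (Idt C (OMap H x)))"
      then have k': "k \<in> Hom C (z y) (z y')" and ks: "\<And>x. x \<in> Obj C \<Longrightarrow> k \<cdot> \<iota> y x = \<iota> y' x \<cdot> ?m u x"
        by (auto simp: HomD[OF u])
      show "k = h"
        by (rule op.is_universal_eqI[OF H' _ U[OF y]]) (use k' h(1) iff[OF k'] ks h(2) y in simp_all)
    qed
    then show ?thesis
      using h by auto
  qed
  have "is_Gamma (op_cat C) H (Gamma_rl C H) P"
    unfolding is_Gamma_def obj
  proof (intro conjI ballI allI)
    show "is_universal (op_cat C) H y (z y) (P y)" if "y \<in> Obj (op_cat C)" for y
      using U[of y] that by simp
  qed (use main in \<open>auto simp: postcomp_dual_op\<close>)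
  then show ?thesis
    unfolding P_def \<iota>_def .
qed

end

text \<open>Both functors carry a universal family for \<open>functor_comp F' G\<close>, so
  \<open>is_Gamma_unique\<close> applies. Both directions are recorded because an isomorphism found
  in the opposite category has to be turned around.\<close>

lemma (in category_with_generator) is_Gamma_comp_isomorphic:
  assumes F: "linear_endofunctor C F" and G: "linear_endofunctor C G"
    and F': "is_Gamma C F F' P" and G': "is_Gamma C G G' P2" and E: "is_Gamma C (functor_comp F' G) E P3"
  shows "isomorphic_functors C (functor_comp F' G') E" "isomorphic_functors C E (functor_comp F' G')"
proof -
  have FG: "linear_endofunctor C (functor_comp F' G)"
    by (rule linear_endofunctor_comp[OF is_Gamma_linear_endofunctor[OF F F'] G])
  note c = is_Gamma_comp[OF F G F' G']
  show "isomorphic_functors C (functor_comp F' G') E" "isomorphic_functors C E (functor_comp F' G')"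
    by (rule is_Gamma_unique[OF FG c E], rule is_Gamma_unique[OF FG E c])
qed


theorem lemma4p1p5:
  fixes X :: "('o, 'm, 'k::alg_closed_field) linear_cat"
  assumes "finite_linear_category X"
  shows "(\<forall>F G. left_exact X F \<and> left_exact X G \<longrightarrow>
            isomorphic_functors X
              (functor_comp (Gamma_rl X F) (Gamma_rl X G))
              (Gamma_rl X (functor_comp (Gamma_rl X F) G)))
       \<and> (\<forall>F G. right_exact X F \<and> right_exact X G \<longrightarrow>
            isomorphic_functors X
              (functor_comp (Gamma_lr X F) (Gamma_lr X G))
              (Gamma_lr X (functor_comp (Gamma_lr X F) G)))"
proof -
  interpret X: finite_linear_category X
    by (rule assms)
  \<comment> \<open>The projective generator \<open>Q\<close> serves the ends, the generator
    \<open>I\<close> of the opposite category the coends.\<close>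
  obtain Q where Q: "category_with_generator X Q"
    using X.generator_exists by blast
  obtain I where I: "category_with_generator (op_cat X) I"
    using X.generator_op[OF Q] by blast
  interpret Q: category_with_generator X Q
    by (rule Q)
  interpret op: category_with_generator "op_cat X" I
    by (rule I)
  show ?thesis
  proof (intro conjI allI impI; elim conjE)
    fix F G assume "left_exact X F" "left_exact X G"
    then have F: "linear_endofunctor X F" and G: "linear_endofunctor X G"
      by (simp_all add: left_exact_def)
    have lin: "linear_endofunctor (op_cat X) H \<longleftrightarrow> linear_endofunctor X H" for H
      by (rule linear_endofunctor_op)
    \<comment> \<open>These statements live in the opposite category, so the composition result is
      used there and brought back by \<open>isomorphic_functors_op\<close>; this reverses the
      direction, hence the second variant below.\<close>
    note rl = Q.is_Gamma_rl[OF I]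
    have FG: "linear_endofunctor X (functor_comp (Gamma_rl X F) G)"
      using op.is_Gamma_linear_endofunctor[OF _ rl[OF F]] F G Q.linear_endofunctor_comp by (simp add: lin)
    show "isomorphic_functors X (functor_comp (Gamma_rl X F) (Gamma_rl X G)) (Gamma_rl X (functor_comp (Gamma_rl X F) G))"
      using op.is_Gamma_comp_isomorphic(2)[OF _ _ rl[OF F] rl[OF G] rl[OF FG]] F G
      by (simp add: lin isomorphic_functors_op)
  next
    fix F G assume "right_exact X F" "right_exact X G"
    then have F: "linear_endofunctor X F" and G: "linear_endofunctor X G"
      by (simp_all add: right_exact_def)
    note lr = Q.is_Gamma_lr
    have FG: "linear_endofunctor X (functor_comp (Gamma_lr X F) G)"
      by (rule Q.linear_endofunctor_comp[OF X.is_Gamma_linear_endofunctor[OF F lr[OF F]] G])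
    show "isomorphic_functors X (functor_comp (Gamma_lr X F) (Gamma_lr X G)) (Gamma_lr X (functor_comp (Gamma_lr X F) G))"
      by (rule Q.is_Gamma_comp_isomorphic(1)[OF F G lr[OF F] lr[OF G] lr[OF FG]])
  qed
qed

end
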